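(* There are absolute (numeric) constants $c_1,c_2>0$ such that the following holds. Let $\mu$ be a probability measure on $\mathbb{R}^n$ with a bounded density $f$. Then for each integer $1\le k\le n-1$ and each $s>1$ there exists $\mathcal{A}_s\subseteq G_{n,k}$ with $\mu_{n,k}(\mathcal{A}_s)\ge 1-2s^{-kn}$ such that: (i) for every $E\in\mathcal{A}_s$ and $t>1$ there exists a set $\mathcal{B}_t\subseteq E$ such that $\pi_E(\mu)(\mathcal{B}_t)\le t^{-kn}$ and $$ f_{\pi_E(\mu)}(x)^{1/k}\le c_1\,s\,t\,\|f\|_\infty^{1/n}\qquad\text{for all } x\in(E\setminus\mathcal{B}_t)\cup\{0\}; $$ (ii) for every $E\in\mathcal{A}_s$, every $\varepsilon>0$ and every $z\in E$, $$ \pi_E(\mu)\left(\{x\in E:|x-z|\le\varepsilon\sqrt{k}\}\right)\le\left(c_2\,s\,\varepsilon\,\|f\|_\infty^{1/n}\right)^{kn/(n+1)}. $$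
   Context: $G_{n,k}$ is the Grassmannian of $k$-dimensional linear subspaces of $\mathbb{R}^n$ with its Haar probability measure $\mu_{n,k}$. For $E\in G_{n,k}$, $\pi_E(\mu)$ is the marginal of $\mu$ on $E$, i.e. the push-forward of $\mu$ under the orthogonal projection onto $E$; its density on $E$ is $f_{\pi_E(\mu)}(x)=\int_{E^\perp+x}f(y)\,dy$ for $x\in E$. $|\cdot|$ is the Euclidean norm and $\|\cdot\|_\infty$ the $L^\infty$-norm. The constants do not depend on $n,k,\mu,s,t,\varepsilon$. *)

theory Defs
  imports "HOL-Probability.Probability"
begin

text \<open>
  Absolute constants have to be chosen before the dimension \<open>n\<close>, so \<open>n\<close> cannot be a type parameter.
  All the spaces \<open>\<real>\<^sup>n\<close> are therefore realised inside one inner product space, the finitely supported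
  real sequences; \<open>\<real>\<^sup>n\<close> is the subspace of sequences whose coordinates with index \<open>\<ge> n\<close> vanish.
  Subspaces, dimensions, norms and so on are then those of the library.
\<close>

typedef fin_seq = "{x :: nat \<Rightarrow> real. finite {i. x i \<noteq> 0}}"
  morphisms coord Fin_Seq
  by (intro exI[of _ "\<lambda>_. 0"]) auto

setup_lifting type_definition_fin_seq

instantiation fin_seq :: real_inner
begin

lift_definition zero_fin_seq :: fin_seq is "\<lambda>_. 0" by simp

lift_definition plus_fin_seq :: "fin_seq \<Rightarrow> fin_seq \<Rightarrow> fin_seq" is "\<lambda>x y i. x i + y i"
proof -
  fix x y :: "nat \<Rightarrow> real"
  assume "finite {i. x i \<noteq> 0}" "finite {i. y i \<noteq> 0}"
  then have "finite ({i. x i \<noteq> 0} \<union> {i. y i \<noteq> 0})" by simp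
  then show "finite {i. x i + y i \<noteq> 0}" by (rule rev_finite_subset) auto
qed

lift_definition uminus_fin_seq :: "fin_seq \<Rightarrow> fin_seq" is "\<lambda>x i. - x i" by simp

lift_definition scaleR_fin_seq :: "real \<Rightarrow> fin_seq \<Rightarrow> fin_seq" is "\<lambda>c x i. c * x i"
  by (erule rev_finite_subset) auto

definition minus_fin_seq :: "fin_seq \<Rightarrow> fin_seq \<Rightarrow> fin_seq" where
  "minus_fin_seq x y = x + - y"

definition inner_fin_seq :: "fin_seq \<Rightarrow> fin_seq \<Rightarrow> real" where
  "inner_fin_seq x y = (\<Sum>i | coord x i \<noteq> 0. coord x i * coord y i)"

definition norm_fin_seq :: "fin_seq \<Rightarrow> real" where
  "norm_fin_seq x = sqrt (inner x x)"

definition dist_fin_seq :: "fin_seq \<Rightarrow> fin_seq \<Rightarrow> real" where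
  "dist_fin_seq x y = norm (x - y)"

definition sgn_fin_seq :: "fin_seq \<Rightarrow> fin_seq" where
  "sgn_fin_seq x = inverse (norm x) *\<^sub>R x"

definition uniformity_fin_seq :: "(fin_seq \<times> fin_seq) filter" where
  "uniformity_fin_seq = (INF e\<in>{0<..}. principal {(x, y). dist x y < e})"

definition open_fin_seq :: "fin_seq set \<Rightarrow> bool" where
  "open_fin_seq U \<longleftrightarrow> (\<forall>x\<in>U. eventually (\<lambda>(x', y). x' = x \<longrightarrow> y \<in> U) uniformity)"

instance
proof
  have fin: "finite {i. coord x i \<noteq> 0}" for x using coord[of x] by simp
  have inner_alt: "inner x y = (\<Sum>i\<in>A. coord x i * coord y i)"
    if "finite A" "{i. coord x i \<noteq> 0} \<subseteq> A" for A and x y :: fin_seq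
    unfolding inner_fin_seq_def using that by (intro sum.mono_neutral_left) auto
  fix x y z :: fin_seq and a b r :: real
  show "x + y + z = x + (y + z)" by transfer (simp add: add.assoc)
  show "x + y = y + x" by transfer (simp add: add.commute)
  show "0 + x = x" by transfer simp
  show "- x + x = 0" by transfer simp
  show "x - y = x + - y" by (rule minus_fin_seq_def)
  show "a *\<^sub>R (x + y) = a *\<^sub>R x + a *\<^sub>R y" by transfer (simp add: distrib_left)
  show "(a + b) *\<^sub>R x = a *\<^sub>R x + b *\<^sub>R x" by transfer (simp add: distrib_right)
  show "a *\<^sub>R b *\<^sub>R x = (a * b) *\<^sub>R x" by transfer (simp add: mult.assoc)
  show "1 *\<^sub>R x = x" by transfer simp
  show "dist x y = norm (x - y)" by (rule dist_fin_seq_def)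
  show "sgn x = inverse (norm x) *\<^sub>R x" by (rule sgn_fin_seq_def)
  show "(uniformity :: (fin_seq \<times> fin_seq) filter)
      = (INF e\<in>{0<..}. principal {(x, y). dist x y < e})" by (rule uniformity_fin_seq_def)
  show "open U \<longleftrightarrow> (\<forall>x\<in>U. eventually (\<lambda>(x', y). x' = x \<longrightarrow> y \<in> U) uniformity)"
    for U :: "fin_seq set" by (rule open_fin_seq_def)
  show "inner x y = inner y x"
    using inner_alt[of "{i. coord x i \<noteq> 0} \<union> {i. coord y i \<noteq> 0}" x y]
      inner_alt[of "{i. coord x i \<noteq> 0} \<union> {i. coord y i \<noteq> 0}" y x] fin
    by (simp add: mult.commute)
  show "inner (x + y) z = inner x z + inner y z"
  proof -
    let ?A = "{i. coord x i \<noteq> 0} \<union> {i. coord y i \<noteq> 0}"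
    have "{i. coord (x + y) i \<noteq> 0} \<subseteq> ?A" by (auto simp: plus_fin_seq.rep_eq)
    then have "inner (x + y) z = (\<Sum>i\<in>?A. coord (x + y) i * coord z i)"
      by (intro inner_alt) (use fin in auto)
    also have "\<dots> = (\<Sum>i\<in>?A. coord x i * coord z i) + (\<Sum>i\<in>?A. coord y i * coord z i)"
      by (simp add: plus_fin_seq.rep_eq distrib_right sum.distrib)
    also have "\<dots> = inner x z + inner y z"
      using fin by (simp add: inner_alt[of ?A])
    finally show ?thesis .
  qed
  show "inner (r *\<^sub>R x) y = r * inner x y"
  proof -
    have "{i. coord (r *\<^sub>R x) i \<noteq> 0} \<subseteq> {i. coord x i \<noteq> 0}" by (auto simp: scaleR_fin_seq.rep_eq)
    then have "inner (r *\<^sub>R x) y = (\<Sum>i | coord x i \<noteq> 0. coord (r *\<^sub>R x) i * coord y i)"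
      by (intro inner_alt) (use fin in auto)
    then show ?thesis by (simp add: inner_fin_seq_def scaleR_fin_seq.rep_eq sum_distrib_left mult.assoc)
  qed
  show "0 \<le> inner x x" unfolding inner_fin_seq_def by (intro sum_nonneg) auto
  show "inner x x = 0 \<longleftrightarrow> x = 0"
  proof
    assume "inner x x = 0"
    then have "\<forall>i\<in>{i. coord x i \<noteq> 0}. coord x i * coord x i = 0"
      unfolding inner_fin_seq_def by (subst (asm) sum_nonneg_eq_0_iff) (use fin in auto)
    then show "x = 0" by (auto simp: coord_inject[symmetric] zero_fin_seq.rep_eq)
  qed (simp add: inner_fin_seq_def zero_fin_seq.rep_eq)
  show "norm x = sqrt (inner x x)" by (rule norm_fin_seq_def)
qed

end

definition Rn :: "nat \<Rightarrow> fin_seq set" where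
  "Rn n = {x. \<forall>i\<ge>n. coord x i = 0}"

lift_definition unit_vec :: "nat \<Rightarrow> fin_seq" is "\<lambda>i j. if j = i then 1 else 0" by simp

definition orthonormal_basis :: "(nat \<Rightarrow> fin_seq) \<Rightarrow> fin_seq set \<Rightarrow> bool" where
  "orthonormal_basis b F \<longleftrightarrow>
     (\<forall>i<dim F. \<forall>j<dim F. b i \<bullet> b j = (if i = j then 1 else 0)) \<and> span (b ` {..<dim F}) = F"

text \<open>
  Lebesgue measure on a finite-dimensional subspace, on its Borel sets: \<open>F\<close> is identified with
  \<open>\<real>\<^bsup>dim F\<^esup>\<close> through an orthonormal basis. The result does not depend on the basis, since Lebesgue
  measure is invariant under orthogonal maps.
\<close>

definition lebesgue_on_subspace :: "fin_seq set \<Rightarrow> fin_seq measure" where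
  "lebesgue_on_subspace F =
     distr (\<Pi>\<^sub>M i\<in>{..<dim F}. lborel) (restrict_space borel F)
       (\<lambda>c. \<Sum>i<dim F. c i *\<^sub>R (SOME b. orthonormal_basis b F) i)"

definition orth_proj :: "fin_seq set \<Rightarrow> fin_seq \<Rightarrow> fin_seq" where
  "orth_proj E x = (THE y. y \<in> E \<and> (\<forall>v\<in>E. orthogonal (x - y) v))"

definition grassmannian :: "nat \<Rightarrow> nat \<Rightarrow> fin_seq set set" where
  "grassmannian n k = {E. subspace E \<and> E \<subseteq> Rn n \<and> dim E = k}"

text \<open>
  The usual topology of the Grassmannian is the one induced by \<open>E \<mapsto> P\<^sub>E\<close>, where the orthogonal
  projection \<open>P\<^sub>E\<close> is identified with its matrix of entries. Its Borel sets are the preimages of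
  the Borel sets of matrices.
\<close>

definition grassmannian_borel :: "nat \<Rightarrow> nat \<Rightarrow> fin_seq set measure" where
  "grassmannian_borel n k =
     vimage_algebra (grassmannian n k) (\<lambda>E i j. coord (orth_proj E (unit_vec j)) i)
       (borel :: (nat \<Rightarrow> nat \<Rightarrow> real) measure)"

text \<open>
  The Haar probability measure is the unique Borel probability measure on the Grassmannian that is
  invariant under \<open>O(n)\<close>. The orthogonal transformations of the ambient space that preserve \<open>\<real>\<^sup>n\<close>
  restrict to exactly the elements of \<open>O(n)\<close>.
\<close>

definition grassmannian_haar :: "nat \<Rightarrow> nat \<Rightarrow> fin_seq set measure" where
  "grassmannian_haar n k =
     (THE M. prob_space M \<and> sets M = sets (grassmannian_borel n k) \<and>
        (\<forall>T. orthogonal_transformation T \<and> T ` Rn n = Rn n \<longrightarrow> distr M M (\<lambda>E. T ` E) = M))"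

definition marginal :: "fin_seq measure \<Rightarrow> fin_seq set \<Rightarrow> fin_seq measure" where
  "marginal \<mu> E = distr \<mu> (restrict_space borel E) (orth_proj E)"

text \<open>
  The integral of \<open>f\<close> over \<open>E\<^sup>\<bottom> + x\<close>, where \<open>E\<^sup>\<bottom>\<close> is the complement inside \<open>\<real>\<^sup>n\<close>. For some points \<open>x\<close>
  its value may be infinite.
\<close>

definition marginal_density ::
    "nat \<Rightarrow> (fin_seq \<Rightarrow> real) \<Rightarrow> fin_seq set \<Rightarrow> fin_seq \<Rightarrow> ennreal" where
  "marginal_density n f E x = (\<integral>\<^sup>+ y. ennreal (f (y + x)) \<partial>lebesgue_on_subspace (E\<^sup>\<bottom> \<inter> Rn n))"

definition ess_bounded :: "'a measure \<Rightarrow> ('a \<Rightarrow> real) \<Rightarrow> bool" where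
  "ess_bounded M f \<longleftrightarrow> f \<in> borel_measurable M \<and> esssup M (\<lambda>x. ereal \<bar>f x\<bar>) < \<infinity>"

definition Linf_norm :: "'a measure \<Rightarrow> ('a \<Rightarrow> real) \<Rightarrow> real" where
  "Linf_norm M f = real_of_ereal (esssup M (\<lambda>x. ereal \<bar>f x\<bar>))"

end

theory Submission
  imports Defs
begin

text \<open>
  Write \<open>n = m + k\<close>. A random \<open>m\<close>-dimensional subspace is the span of \<open>m\<close> independent Gaussian vectors
  of \<open>\<real>\<^sup>n\<close>, and its orthogonal complement is distributed according to the Haar measure on the
  Grassmannian of \<open>k\<close>-dimensional subspaces. The core is the dual affine quermassintegral inequality: the
  \<open>n\<close>-th moment of the integral of \<open>f\<close> over the random subspace is at most \<open>\<parallel>f\<parallel>\<^sub>\<infinity>\<^sup>k C\<^bsup>kn\<^esup>\<close>.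
  Almost every subspace is the graph of a linear map from \<open>\<real>\<^sup>m\<close> to \<open>\<real>\<^sup>k\<close>; in this chart a formula
  of Blaschke--Petkantschin type writes the \<open>m\<close>-th power of the integral of \<open>f\<close> over \<open>\<real>\<^sup>n\<close> as an
  integral over the maps of \<open>\<integral> |det Y|\<^sup>k \<Prod>\<^sub>j g (y\<^sub>j) dY\<close>, where \<open>g \<le> \<parallel>f\<parallel>\<^sub>\<infinity>\<close> is the restriction
  of \<open>f\<close> to the graph. That determinant moment is bounded below by the \<open>n\<close>-th power of the integral of
  \<open>g\<close>: among \<open>2m + 1\<close> points of \<open>\<real>\<^sup>m\<close> one always lies in a dilated cross-polytope spanned by
  \<open>m\<close> others, so that the determinants cannot all be small.

  The inequality for \<open>f\<close> and, after integration against \<open>f\<close>, for its translates bounds the averages over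
  \<open>E\<close> of the \<open>n\<close>-th power of the marginal density at \<open>0\<close> and of its integral against the marginal.
  The rest is Markov's inequality, on the Grassmannian and on \<open>E\<close>.
\<close>

text \<open>The exponent n = m + k is dictated by the chart. For the graph of a map let D be the
  volume factor of its parametrisation over R^m. Integrating the Gaussian weights of the m random
  vectors against |det|^k gives a multiple of D^(-n), while the integral of f over the subspace is D
  times an integral over R^m; so its n-th power, and no other, becomes free of D. The dimension may
  enter only through C^(kn). The determinant bound contributes m^(-mk/2), the Gaussian moment of
  |det|^k contributes n^(mk/2), and the quotient (n/m)^(mk/2) is at most e^(k^2/2). Changes of
  variables are reduced to Gram-Schmidt residuals and integrals of Gaussians; volumes of m vectors
  in R^n and determinants are then one notion, \<open>gs_vol\<close>. Averaging the moment at y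
  against f gives the (n + 1)-st moment of the density on E, so cutting a ball at a level of the
  density and balancing the two parts produces the exponent kn/(n + 1).\<close>

section \<open>Coordinates and the subspaces R^n of the sequence space\<close>

lemma finite_coord: "finite {i. coord x i \<noteq> 0}"
  using coord[of x] by simp

lemma fin_seq_eq_iff: "x = y \<longleftrightarrow> (\<forall>i. coord x i = coord y i)"
  by (simp add: coord_inject[of x y, symmetric] fun_eq_iff)

lemma coord_simps [simp]:
  "coord 0 i = 0" "coord (x + y) i = coord x i + coord y i" "coord (- x) i = - coord x i"
  "coord (x - y) i = coord x i - coord y i" "coord (r *\<^sub>R x) i = r * coord x i"
proof -
  have "coord (x + - y) i = coord x i - coord y i"
    unfolding plus_fin_seq.rep_eq uminus_fin_seq.rep_eq by simp
  then show "coord (x - y) i = coord x i - coord y i" by simp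
qed (simp_all add: zero_fin_seq.rep_eq plus_fin_seq.rep_eq uminus_fin_seq.rep_eq scaleR_fin_seq.rep_eq)

lemma coord_sum [simp]: "coord (sum f A) i = (\<Sum>a\<in>A. coord (f a) i)"
  by (induction A rule: infinite_finite_induct) auto

lemma coord_unit_vec: "coord (unit_vec i) j = (if j = i then 1 else 0)"
  by (simp add: unit_vec.rep_eq)

lemma inner_fin_seq_alt:
  assumes "finite A" "{i. coord x i \<noteq> 0} \<subseteq> A"
  shows "x \<bullet> y = (\<Sum>i\<in>A. coord x i * coord y i)"
  unfolding inner_fin_seq_def using assms by (intro sum.mono_neutral_left) auto

lemma inner_unit_vec [simp]: "unit_vec i \<bullet> x = coord x i" "x \<bullet> unit_vec i = coord x i"
proof -
  have "unit_vec i \<bullet> x = (\<Sum>j\<in>{i}. coord (unit_vec i) j * coord x j)"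
    by (rule inner_fin_seq_alt) (auto simp: coord_unit_vec split: if_splits)
  then show "unit_vec i \<bullet> x = coord x i" by (simp add: coord_unit_vec)
  then show "x \<bullet> unit_vec i = coord x i" by (simp add: inner_commute)
qed

lemma unit_vec_in_Rn: "i < n \<Longrightarrow> unit_vec i \<in> Rn n"
  by (auto simp: Rn_def coord_unit_vec)

lemma subspace_Rn [simp]: "subspace (Rn n)"
  by (auto simp: subspace_def Rn_def)

lemma Rn_expand:
  assumes "x \<in> Rn n"
  shows "x = (\<Sum>i<n. coord x i *\<^sub>R unit_vec i)"
  unfolding fin_seq_eq_iff
proof
  fix j
  have "coord (\<Sum>i<n. coord x i *\<^sub>R unit_vec i) j = (\<Sum>i<n. if i = j then coord x j else 0)"
    unfolding coord_sum by (intro sum.cong) (auto simp: coord_unit_vec)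
  also have "\<dots> = coord x j" using assms by (cases "j < n") (auto simp: Rn_def)
  finally show "coord x j = coord (\<Sum>i<n. coord x i *\<^sub>R unit_vec i) j" by simp
qed

lemma inner_Rn:
  assumes "x \<in> Rn n"
  shows "x \<bullet> y = (\<Sum>i<n. coord x i * coord y i)"
proof (rule inner_fin_seq_alt)
  show "{i. coord x i \<noteq> 0} \<subseteq> {..<n}"
    using assms by (auto simp: Rn_def not_less[symmetric])
qed simp

lemma ex_Rn: "\<exists>n. x \<in> Rn n"
proof -
  obtain N where "\<forall>i\<in>{i. coord x i \<noteq> 0}. i < N"
    using finite_coord[of x] finite_nat_set_iff_bounded by blast
  then have "coord x i = 0" if "N \<le> i" for i
    using that by (metis (mono_tags, lifting) leD mem_Collect_eq)
  then have "x \<in> Rn N" by (simp add: Rn_def)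
  then show ?thesis ..
qed

lemma span_unit_vec: "span (unit_vec ` {..<n}) = Rn n"
proof (rule span_unique)
  show "unit_vec ` {..<n} \<subseteq> Rn n" by (auto simp: unit_vec_in_Rn)
  fix T assume T: "unit_vec ` {..<n} \<subseteq> T" "subspace T"
  show "Rn n \<subseteq> T"
  proof
    fix x assume "x \<in> Rn n"
    then have "x = (\<Sum>i<n. coord x i *\<^sub>R unit_vec i)" by (rule Rn_expand)
    also have "\<dots> \<in> T" using T by (intro subspace_sum subspace_scale) auto
    finally show "x \<in> T" .
  qed
qed simp

text \<open>Second countability makes the Borel sets of a product space the product of the Borel
  sets, on which measurability of sums and inner products of vector-valued functions rests. Balls of
  radius \<open>1 / Suc N\<close> around finitely supported rational vectors form a countable
  basis.\<close>

instance fin_seq :: second_countable_topology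
proof
  define d :: "rat list \<Rightarrow> fin_seq" where
    "d l = (\<Sum>i<length l. of_rat (l ! i) *\<^sub>R unit_vec i)" for l
  define B where "B = (\<lambda>(l, N). ball (d l) (1 / real (Suc N))) ` (UNIV :: (rat list \<times> nat) set)"
  have dense: "\<exists>l. dist (d l) x < e" if "e > 0" for x e
  proof -
    obtain n where n: "x \<in> Rn n" using ex_Rn by blast
    \<comment> \<open>Dividing by \<open>Suc n\<close> instead of n keeps the sum of n coordinate
      errors strictly below e and also covers n = 0.\<close>
    have "\<exists>q. \<bar>of_rat q - coord x i\<bar> < e / real (Suc n)" for i
    proof -
      have "e / real (Suc n) > 0" using \<open>e > 0\<close> by simp
      then obtain q where "coord x i - e / real (Suc n) < of_rat q" "of_rat q < coord x i + e / real (Suc n)"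
        using of_rat_dense[of "coord x i - e / real (Suc n)" "coord x i + e / real (Suc n)"] by auto
      then show ?thesis by (intro exI[of _ q]) auto
    qed
    then obtain q where q: "\<And>i. \<bar>of_rat (q i) - coord x i\<bar> < e / real (Suc n)" by metis
    have "dist (d (map q [0..<n])) x = norm ((\<Sum>i<n. of_rat (q i) *\<^sub>R unit_vec i) - (\<Sum>i<n. coord x i *\<^sub>R unit_vec i))"
      using Rn_expand[OF n] by (simp add: dist_norm d_def)
    also have "\<dots> = norm (\<Sum>i<n. (of_rat (q i) - coord x i) *\<^sub>R unit_vec i)"
      by (simp add: sum_subtractf scaleR_diff_left)
    also have "\<dots> \<le> (\<Sum>i<n. norm ((of_rat (q i) - coord x i) *\<^sub>R unit_vec i))" by (rule norm_sum)
    also have "\<dots> \<le> (\<Sum>i<n. e / real (Suc n))"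
      using q by (intro sum_mono) (auto simp: norm_eq_sqrt_inner[of "unit_vec _"] coord_unit_vec intro: less_imp_le)
    also have "\<dots> < e" using \<open>e > 0\<close> by (simp add: field_simps)
    finally show ?thesis by blast
  qed
  have "topological_basis B"
  proof (rule topological_basisI)
    fix U :: "fin_seq set" and x assume U: "open U" "x \<in> U"
    then obtain e where e: "e > 0" "ball x e \<subseteq> U" by (meson open_contains_ball)
    obtain N where N: "1 / real (Suc N) < e / 2" using nat_approx_posE[of "e/2"] e by auto
    obtain l where l: "dist (d l) x < 1 / real (Suc N)" using dense[of "1 / real (Suc N)" x] by auto
    have "ball (d l) (1 / real (Suc N)) \<subseteq> ball x e"
    proof
      fix y assume "y \<in> ball (d l) (1 / real (Suc N))"
      then have "dist x y < e" using l N dist_triangle2[of x y "d l"] by (simp add: dist_commute)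
      then show "y \<in> ball x e" by simp
    qed
    then show "\<exists>B'\<in>B. x \<in> B' \<and> B' \<subseteq> U"
      using l e(2) unfolding B_def
      by (intro bexI[of _ "ball (d l) (1 / real (Suc N))"])
         (auto intro!: image_eqI[of _ _ "(l, N)"] simp del: of_nat_Suc)
  qed (auto simp: B_def simp del: of_nat_Suc)
  moreover have "countable B" by (auto simp: B_def)
  ultimately show "\<exists>B::fin_seq set set. countable B \<and> open = generate_topology B"
    using topological_basis_imp_subbasis by blast
qed

lemma borel_measurable_coord [measurable]: "(\<lambda>x. coord x i) \<in> borel_measurable borel"
proof -
  have "(\<lambda>x. x \<bullet> unit_vec i) \<in> borel_measurable borel" by measurable
  then show ?thesis by simp
qed

lemma Rn_borel [measurable]: "Rn n \<in> sets borel"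
proof -
  have "Rn n = {x. \<forall>i\<in>{n..}. coord x i = 0}" by (auto simp: Rn_def)
  also have "\<dots> = {x \<in> space borel. \<forall>i\<in>{n..}. coord x i = 0}" by simp
  also have "\<dots> \<in> sets borel" by measurable
  finally show ?thesis .
qed

subsection \<open>Gram--Schmidt orthogonalisation\<close>

text \<open>This is the component of x orthogonal to \<open>w 0\<close>, ...,
  \<open>w (j - 1)\<close>. Division by zero returns zero, so the recursion passes over a vector
  that depends on its predecessors and is meaningful for every family.\<close>

primrec res :: "(nat \<Rightarrow> 'a::real_inner) \<Rightarrow> nat \<Rightarrow> 'a \<Rightarrow> 'a" where
  "res w 0 x = x"
| "res w (Suc j) x = res w j x - (x \<bullet> res w j (w j) / (res w j (w j) \<bullet> res w j (w j))) *\<^sub>R res w j (w j)"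

text \<open>The volume of the parallelepiped spanned by the first m vectors; for vectors of R^m it
  is the absolute value of the determinant. Expressed through residuals it makes sense in any inner
  product space, and it vanishes exactly for dependent families.\<close>

definition gs_vol :: "(nat \<Rightarrow> 'a::real_inner) \<Rightarrow> nat \<Rightarrow> real" where
  "gs_vol w m = (\<Prod>i<m. norm (res w i (w i)))"

definition gs :: "(nat \<Rightarrow> 'a::real_inner) \<Rightarrow> nat \<Rightarrow> 'a" where
  "gs w i = res w i (w i) /\<^sub>R norm (res w i (w i))"

definition orthonormal :: "(nat \<Rightarrow> 'a::real_inner) \<Rightarrow> nat \<Rightarrow> bool" where
  "orthonormal b d \<longleftrightarrow> (\<forall>i<d. \<forall>j<d. b i \<bullet> b j = (if i = j then 1 else 0))"

lemma res_add: "res w j (x + y) = res w j x + res w j y"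
  by (induction j) (auto simp: inner_add_left add_divide_distrib scaleR_add_left)

lemma res_scaleR: "res w j (r *\<^sub>R x) = r *\<^sub>R res w j x"
  by (induction j) (auto simp: scaleR_diff_right)

lemma linear_res: "linear (res w j)"
  by (rule linearI) (simp_all add: res_add res_scaleR)

lemma res_sum: "res w j (sum f A) = (\<Sum>a\<in>A. res w j (f a))"
  using linear_res by (rule linear_sum)

lemma res_cong: "(\<And>i. i < j \<Longrightarrow> w i = w' i) \<Longrightarrow> res w j x = res w' j x"
  by (induction j arbitrary: x) auto

lemma gs_vol_cong: "(\<And>i. i < m \<Longrightarrow> w i = w' i) \<Longrightarrow> gs_vol w m = gs_vol w' m"
  unfolding gs_vol_def
  by (intro prod.cong refl) (metis lessThan_iff order.strict_trans res_cong)

lemma diff_res_in_span: "x - res w j x \<in> span (w ` {..<j})"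
proof (induction j arbitrary: x)
  case (Suc j)
  have *: "span (w ` {..<j}) \<subseteq> span (w ` {..<Suc j})" by (intro span_mono) auto
  have "w j \<in> span (w ` {..<Suc j})" "w j - res w j (w j) \<in> span (w ` {..<Suc j})"
    using Suc[of "w j"] * by (auto intro: span_base)
  then have "w j - (w j - res w j (w j)) \<in> span (w ` {..<Suc j})" by (rule span_diff)
  then have "res w j (w j) \<in> span (w ` {..<Suc j})" by simp
  then have "(x - res w j x) + c *\<^sub>R res w j (w j) \<in> span (w ` {..<Suc j})" for c
    using Suc[of x] * by (intro span_add span_scale) auto
  then show ?case by (simp add: algebra_simps)
qed (simp add: span_zero)

lemma span_orth:
  assumes "\<And>i. i \<in> A \<Longrightarrow> x \<bullet> w i = 0" "y \<in> span (w ` A)"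
  shows "x \<bullet> y = (0::real)"
proof -
  have "span (w ` A) \<subseteq> {y. x \<bullet> y = 0}"
    using assms(1) by (intro span_minimal) (auto simp: subspace_def inner_add_right)
  then show ?thesis using assms(2) by auto
qed

lemma res_orth: "i < j \<Longrightarrow> res w j x \<bullet> w i = 0"
proof (induction j arbitrary: x i)
  case (Suc j)
  let ?u = "res w j (w j)"
  have IH: "res w j y \<bullet> v = 0" if "v \<in> span (w ` {..<j})" for y v
    using that by (rule span_orth[rotated, where A="{..<j}" and w=w]) (simp add: Suc.IH)
  show ?case
  proof (cases "i = j")
    case False
    then have "i < j" using Suc.prems by simp
    then show ?thesis by (simp add: inner_diff_left Suc.IH)
  next
    case True
    have 1: "res w j y \<bullet> w j = res w j y \<bullet> ?u" for y
      using IH[OF diff_res_in_span[of "w j" w j], of y] by (simp add: inner_diff_right)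
    have 2: "res w j x \<bullet> ?u = x \<bullet> ?u"
      using IH[OF diff_res_in_span[of x w j], of "w j"] by (simp add: inner_diff_right inner_commute)
    show ?thesis using True by (simp add: inner_diff_left 1 2)
  qed
qed simp

lemma res_orth_span: "y \<in> span (w ` {..<j}) \<Longrightarrow> res w j x \<bullet> y = 0"
  by (rule span_orth[where A="{..<j}" and w=w]) (auto simp: res_orth)

text \<open>The difference of the residual and y lies in the span and is orthogonal to it, hence is
  zero. This lets residuals be identified by two linear conditions instead of by the
  recursion.\<close>

lemma res_unique:
  assumes "x - y \<in> span (w ` {..<j})" "\<And>i. i < j \<Longrightarrow> y \<bullet> w i = 0"
  shows "res w j x = y"
proof -
  have "res w j x - y = (x - y) - (x - res w j x)" by simp
  then have *: "res w j x - y \<in> span (w ` {..<j})"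
    using assms(1) diff_res_in_span by (metis span_diff)
  then have "res w j x \<bullet> (res w j x - y) = 0" by (rule res_orth_span)
  moreover have "y \<bullet> (res w j x - y) = 0"
    using * by (rule span_orth[rotated, where A="{..<j}" and w=w]) (simp add: assms)
  ultimately have "(res w j x - y) \<bullet> (res w j x - y) = 0"
    by (simp add: inner_diff_left)
  then show ?thesis by simp
qed

lemma res_eq_0_iff: "res w j x = 0 \<longleftrightarrow> x \<in> span (w ` {..<j})"
  using diff_res_in_span[of x w j] res_unique[of x 0 w j] by auto

lemma inner_res_self: "res w j x \<bullet> res w j x = x \<bullet> res w j x"
  using res_orth_span[OF diff_res_in_span[of x w j], of x]
  by (simp add: inner_diff_right inner_commute)

lemma norm_res_le: "norm (res w j x) \<le> norm x"
proof (cases "res w j x = 0")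
  case False
  have "(norm (res w j x))\<^sup>2 \<le> norm x * norm (res w j x)"
    using norm_cauchy_schwarz[of x "res w j x"] by (simp add: power2_norm_eq_inner inner_res_self)
  then show ?thesis using False by (simp add: power2_eq_square)
qed simp

lemma gs_vol_nonneg [simp]: "0 \<le> gs_vol w m"
  by (simp add: gs_vol_def prod_nonneg)

lemma gs_vol_le: "gs_vol w m \<le> (\<Prod>i<m. norm (w i))"
  unfolding gs_vol_def by (intro prod_mono) (auto simp: norm_res_le)

lemma gs_vol_0 [simp]: "gs_vol w 0 = 1" by (simp add: gs_vol_def)

lemma gs_vol_Suc: "gs_vol w (Suc m) = gs_vol w m * norm (res w m (w m))"
  by (simp add: gs_vol_def)

lemma gs_vol_neq_0_iff: "gs_vol w m \<noteq> 0 \<longleftrightarrow> (\<forall>i<m. w i \<notin> span (w ` {..<i}))"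
  by (auto simp: gs_vol_def res_eq_0_iff)

lemma res_isometry:
  assumes "linear T" "\<And>x y. T x \<bullet> T y = x \<bullet> y"
  shows "res (\<lambda>i. T (w i)) j (T x) = T (res w j x)"
  by (induction j arbitrary: x) (auto simp: assms linear_diff linear_scale)

lemma gs_vol_isometry:
  assumes "linear T" "\<And>x y. T x \<bullet> T y = x \<bullet> y"
  shows "gs_vol (\<lambda>i. T (w i)) m = gs_vol w m"
  unfolding gs_vol_def by (simp add: res_isometry assms norm_eq_sqrt_inner)

lemma res_in_subspace:
  assumes "subspace S" "\<And>i. i < j \<Longrightarrow> w i \<in> S" "x \<in> S"
  shows "res w j x \<in> S"
proof -
  have "span (w ` {..<j}) \<subseteq> S" using assms by (intro span_minimal) auto
  then have "x - res w j x \<in> S" using diff_res_in_span by blast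
  with assms(1,3) have "x - (x - res w j x) \<in> S" by (rule subspace_diff)
  then show ?thesis by simp
qed

text \<open>The left side is the trace of the projection P onto the orthogonal complement of the
  span, because |P e|^2 is the inner product of e and P e. Each nonzero residual lowers the trace by
  one, by Parseval in R^n, and a zero residual leaves it unchanged. Dimension counts below are read
  off from this trace.\<close>

lemma sum_norm_res_unit_vec:
  assumes "\<And>i. i < j \<Longrightarrow> w i \<in> Rn n"
  shows "(\<Sum>l<n. (norm (res w j (unit_vec l)))\<^sup>2) = real n - real (card {i. i < j \<and> res w i (w i) \<noteq> 0})"
  using assms
proof (induction j)
  case (Suc j)
  let ?u = "res w j (w j)"
  have u: "?u \<in> Rn n" using Suc.prems by (intro res_in_subspace) auto
  have eq: "(norm (res w (Suc j) x))\<^sup>2 = (norm (res w j x))\<^sup>2 - (x \<bullet> ?u)\<^sup>2 / (?u \<bullet> ?u)" for x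
  proof -
    have "(norm (res w (Suc j) x))\<^sup>2 = x \<bullet> res w (Suc j) x"
      by (simp add: power2_norm_eq_inner inner_res_self del: res.simps)
    also have "\<dots> = x \<bullet> res w j x - (x \<bullet> ?u)\<^sup>2 / (?u \<bullet> ?u)"
      by (simp add: inner_diff_right power2_eq_square)
    finally show ?thesis by (simp add: power2_norm_eq_inner inner_res_self)
  qed
  have "(\<Sum>l<n. (norm (res w (Suc j) (unit_vec l)))\<^sup>2)
      = (\<Sum>l<n. (norm (res w j (unit_vec l)))\<^sup>2) - (\<Sum>l<n. (unit_vec l \<bullet> ?u)\<^sup>2) / (?u \<bullet> ?u)"
    by (simp add: eq sum_subtractf sum_divide_distrib del: res.simps)
  also have "(\<Sum>l<n. (unit_vec l \<bullet> ?u)\<^sup>2) = ?u \<bullet> ?u"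
    using inner_Rn[OF u, of ?u] by (simp add: power2_eq_square)
  also have "?u \<bullet> ?u / (?u \<bullet> ?u) = (if ?u \<noteq> 0 then 1 else 0)" by simp
  also have "(\<Sum>l<n. (norm (res w j (unit_vec l)))\<^sup>2) = real n - real (card {i. i < j \<and> res w i (w i) \<noteq> 0})"
    using Suc by simp
  also have "{i. i < Suc j \<and> res w i (w i) \<noteq> 0}
      = (if ?u \<noteq> 0 then insert j {i. i < j \<and> res w i (w i) \<noteq> 0} else {i. i < j \<and> res w i (w i) \<noteq> 0})"
    by (auto simp: less_Suc_eq)
  ultimately show ?case by (auto simp: less_Suc_eq)
qed (simp add: norm_eq_sqrt_inner coord_unit_vec)

lemma sum_norm_res_ge:
  assumes "\<And>i. i < j \<Longrightarrow> w i \<in> Rn n"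
  shows "(\<Sum>l<n. (norm (res w j (unit_vec l)))\<^sup>2) \<ge> real n - real j"
proof -
  have "card {i. i < j \<and> res w i (w i) \<noteq> 0} \<le> card {..<j}" by (intro card_mono) auto
  then show ?thesis using sum_norm_res_unit_vec[of j w n] assms by simp
qed

text \<open>With n nonzero residuals the trace is zero, so every unit vector has residual zero and
  lies in the span.\<close>

lemma gs_vol_neq_0_imp_span:
  assumes "gs_vol w n \<noteq> 0" "\<And>i. i < n \<Longrightarrow> w i \<in> Rn n"
  shows "span (w ` {..<n}) = Rn n"
proof
  show "span (w ` {..<n}) \<subseteq> Rn n" using assms by (intro span_minimal) auto
  have "{i. i < n \<and> res w i (w i) \<noteq> 0} = {..<n}" using assms(1) by (auto simp: gs_vol_def)
  then have "(\<Sum>l<n. (norm (res w n (unit_vec l)))\<^sup>2) = 0"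
    using sum_norm_res_unit_vec[of n w n] assms(2) by simp
  then have "\<forall>l<n. res w n (unit_vec l) = 0"
    by (subst (asm) sum_nonneg_eq_0_iff) auto
  then have "unit_vec ` {..<n} \<subseteq> span (w ` {..<n})" by (auto simp: res_eq_0_iff)
  then have "span (unit_vec ` {..<n}) \<subseteq> span (w ` {..<n})" by (intro span_minimal) auto
  then show "Rn n \<subseteq> span (w ` {..<n})" by (simp add: span_unit_vec)
qed

text \<open>The trace n - j of the remaining projection is a sum of squares.\<close>

lemma gs_vol_neq_0_le:
  assumes "gs_vol w j \<noteq> 0" "\<And>i. i < j \<Longrightarrow> w i \<in> Rn n"
  shows "j \<le> n"
proof -
  have "{i. i < j \<and> res w i (w i) \<noteq> 0} = {..<j}" using assms(1) by (auto simp: gs_vol_def)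
  then have "real n - real j = (\<Sum>l<n. (norm (res w j (unit_vec l)))\<^sup>2)"
    using sum_norm_res_unit_vec[of j w n] assms(2) by simp
  also have "\<dots> \<ge> 0" by (intro sum_nonneg) auto
  finally show ?thesis by simp
qed

text \<open>The trace of the projection onto the complement is at least n - j > 0, so some
  \<open>unit_vec l\<close> has a nonzero residual; normalising it gives u.\<close>

lemma ex_unit_orth:
  assumes "\<And>i. i < j \<Longrightarrow> w i \<in> Rn n" "j < n"
  obtains u where "u \<in> Rn n" "norm u = 1" "\<And>i. i < j \<Longrightarrow> u \<bullet> w i = 0"
proof -
  have "\<exists>l<n. res w j (unit_vec l) \<noteq> 0"
  proof (rule ccontr)
    assume "\<not> ?thesis"
    then have "(\<Sum>l<n. (norm (res w j (unit_vec l)))\<^sup>2) = 0" by simp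
    then show False using sum_norm_res_ge[of j w n] assms by simp
  qed
  then obtain l where l: "l < n" "res w j (unit_vec l) \<noteq> 0" by blast
  have "res w j (unit_vec l) \<in> Rn n" using assms l by (intro res_in_subspace) (auto simp: unit_vec_in_Rn)
  then have "res w j (unit_vec l) /\<^sub>R norm (res w j (unit_vec l)) \<in> Rn n" by (intro subspace_scale) auto
  then show ?thesis using l by (intro that[of "res w j (unit_vec l) /\<^sub>R norm (res w j (unit_vec l))"]) (auto simp: res_orth)
qed

lemma orthonormal_cong: "(\<And>i. i < d \<Longrightarrow> b i = b' i) \<Longrightarrow> orthonormal b d = orthonormal b' d"
  by (simp add: orthonormal_def)

lemma orthonormal_Suc:
  "orthonormal b (Suc d) \<longleftrightarrow> orthonormal b d \<and> norm (b d) = 1 \<and> (\<forall>i<d. b d \<bullet> b i = 0)"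
  unfolding orthonormal_def
  by (auto simp: less_Suc_eq norm_eq_1 inner_commute)

lemma orthonormal_unit_vec: "orthonormal unit_vec d"
  by (simp add: orthonormal_def coord_unit_vec)

lemma orthonormal_inner_sum:
  assumes "orthonormal b d" "i < d"
  shows "(\<Sum>j<d. c j *\<^sub>R b j) \<bullet> b i = c i"
proof -
  have "(\<Sum>j<d. c j *\<^sub>R b j) \<bullet> b i = (\<Sum>j<d. if j = i then c j else 0)"
    unfolding inner_sum_left using assms by (intro sum.cong) (auto simp: orthonormal_def)
  then show ?thesis using assms by simp
qed

lemma orthonormal_expand:
  assumes "orthonormal b d" "x \<in> span (b ` {..<d})"
  shows "x = (\<Sum>i<d. (x \<bullet> b i) *\<^sub>R b i)"
proof -
  have "x - (\<Sum>i<d. (x \<bullet> b i) *\<^sub>R b i) \<in> span (b ` {..<d})"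
    using assms(2) by (rule span_diff) (intro span_sum span_scale span_base, auto)
  moreover have "(x - (\<Sum>i<d. (x \<bullet> b i) *\<^sub>R b i)) \<bullet> b i = 0" if "i < d" for i
    using orthonormal_inner_sum[OF assms(1) that] by (simp add: inner_diff_left)
  ultimately have "(x - (\<Sum>i<d. (x \<bullet> b i) *\<^sub>R b i)) \<bullet> (x - (\<Sum>i<d. (x \<bullet> b i) *\<^sub>R b i)) = 0"
    by (rule span_orth[rotated, where A="{..<d}" and w=b]) auto
  then show ?thesis by simp
qed

lemma in_span_orthonormal_iff:
  assumes "orthonormal b d"
  shows "x \<in> span (b ` {..<d}) \<longleftrightarrow> x = (\<Sum>i<d. (x \<bullet> b i) *\<^sub>R b i)"
proof
  assume "x = (\<Sum>i<d. (x \<bullet> b i) *\<^sub>R b i)"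
  moreover have "(\<Sum>i<d. (x \<bullet> b i) *\<^sub>R b i) \<in> span (b ` {..<d})"
    by (intro span_sum span_scale span_base) auto
  ultimately show "x \<in> span (b ` {..<d})" by simp
qed (rule orthonormal_expand[OF assms])

lemma sum_in_span: "(\<Sum>i<d. c i *\<^sub>R b i) \<in> span (b ` {..<d})"
  by (intro span_sum span_scale span_base) auto

lemma in_span_family:
  assumes "x \<in> span (b ` {..<d::nat})"
  obtains c where "x = (\<Sum>i<d. c i *\<^sub>R b i)"
proof -
  have "\<exists>c. x = (\<Sum>i<d. c i *\<^sub>R b i)"
    using assms
  proof (induct d arbitrary: x)
    case (Suc d)
    then have "x \<in> span (insert (b d) (b ` {..<d}))" by (simp add: lessThan_Suc)
    then obtain k where "x - k *\<^sub>R b d \<in> span (b ` {..<d})" by (auto simp: span_breakdown_eq)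
    then obtain c where "x - k *\<^sub>R b d = (\<Sum>i<d. c i *\<^sub>R b i)" using Suc.hyps by blast
    then have "x = (\<Sum>i<Suc d. (c(d := k)) i *\<^sub>R b i)" by (simp add: algebra_simps)
    then show ?case by blast
  qed simp
  then show ?thesis using that by blast
qed

lemma norm_orthonormal_sum:
  assumes "orthonormal b d"
  shows "(norm (\<Sum>i<d. c i *\<^sub>R b i))\<^sup>2 = (\<Sum>i<d. (c i)\<^sup>2)"
proof -
  have "(norm (\<Sum>i<d. c i *\<^sub>R b i))\<^sup>2 = (\<Sum>j<d. c j * ((\<Sum>i<d. c i *\<^sub>R b i) \<bullet> b j))"
    unfolding power2_norm_eq_inner inner_sum_right by simp
  also have "\<dots> = (\<Sum>j<d. (c j)\<^sup>2)"
    using orthonormal_inner_sum[OF assms] by (intro sum.cong) (auto simp: power2_eq_square)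
  finally show ?thesis .
qed

lemma orthonormal_gs:
  assumes "gs_vol w m \<noteq> 0"
  shows "orthonormal (gs w) m" "span (gs w ` {..<m}) = span (w ` {..<m})"
proof -
  have "orthonormal (gs w) m \<and> span (gs w ` {..<m}) = span (w ` {..<m})"
    using assms
  proof (induction m)
    case (Suc m)
    let ?u = "res w m (w m)"
    from Suc have IH: "orthonormal (gs w) m" "span (gs w ` {..<m}) = span (w ` {..<m})" and u: "?u \<noteq> 0"
      by (auto simp: gs_vol_Suc)
    have "?u \<bullet> gs w i = 0" if "i < m" for i
      using IH(2) that by (intro res_orth_span) (metis imageI lessThan_iff span_base)
    then have "orthonormal (gs w) (Suc m)"
      using IH u by (simp add: orthonormal_Suc gs_def)
    moreover have "span (gs w ` {..<Suc m}) = span (w ` {..<Suc m})"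
    proof -
      have w: "w m - ?u \<in> span (w ` {..<m})" by (rule diff_res_in_span)
      have "x \<in> span (insert (gs w m) (gs w ` {..<m})) \<longleftrightarrow> x \<in> span (insert (w m) (w ` {..<m}))" for x
      proof
        assume "x \<in> span (insert (gs w m) (gs w ` {..<m}))"
        then obtain k where k: "x - k *\<^sub>R gs w m \<in> span (w ` {..<m})" by (auto simp: span_breakdown_eq IH)
        define r where "r = k / norm ?u"
        have "x - r *\<^sub>R w m = (x - k *\<^sub>R gs w m) - r *\<^sub>R (w m - ?u)"
          by (simp add: r_def gs_def algebra_simps divide_inverse)
        then have "x - r *\<^sub>R w m \<in> span (w ` {..<m})" using k w by (metis span_diff span_scale)
        then show "x \<in> span (insert (w m) (w ` {..<m}))" by (auto simp: span_breakdown_eq)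
      next
        assume "x \<in> span (insert (w m) (w ` {..<m}))"
        then obtain k where k: "x - k *\<^sub>R w m \<in> span (w ` {..<m})" by (auto simp: span_breakdown_eq)
        have "x - (k * norm ?u) *\<^sub>R gs w m = (x - k *\<^sub>R w m) + k *\<^sub>R (w m - ?u)"
          using u by (simp add: gs_def algebra_simps)
        then have "x - (k * norm ?u) *\<^sub>R gs w m \<in> span (w ` {..<m})" using k w by (metis span_add span_scale)
        then show "x \<in> span (insert (gs w m) (gs w ` {..<m}))" by (auto simp: span_breakdown_eq IH)
      qed
      then show ?thesis by (auto simp: lessThan_Suc)
    qed
    ultimately show ?case by simp
  qed (auto simp: orthonormal_def)
  then show "orthonormal (gs w) m" "span (gs w ` {..<m}) = span (w ` {..<m})" by auto
qed

lemma orthonormal_gs_vol: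
  assumes "orthonormal b d"
  shows "gs_vol b d = 1"
proof -
  have "res b i (b i) = b i" if "i < d" for i
    using assms that by (intro res_unique) (auto simp: span_zero orthonormal_def)
  then have "norm (res b i (b i)) = 1" if "i < d" for i
    using assms that by (auto simp: orthonormal_def norm_eq_1)
  then show ?thesis by (simp add: gs_vol_def)
qed

text \<open>Taking the residual of the relation with respect to all vectors but the last leaves only
  the last term, so coefficients can be removed from the end.\<close>

lemma independent_gs_vol:
  assumes "gs_vol w m \<noteq> 0" "(\<Sum>i<m. r i *\<^sub>R w i) = 0" "i < m"
  shows "r i = 0"
  using assms
proof (induction m arbitrary: i)
  case (Suc m)
  have *: "gs_vol w m \<noteq> 0" "res w m (w m) \<noteq> 0" using Suc.prems by (auto simp: gs_vol_Suc)
  have "res w m (\<Sum>i<Suc m. r i *\<^sub>R w i) = r m *\<^sub>R res w m (w m)"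
  proof -
    have "res w m (w i) = 0" if "i < m" for i
      using that by (subst res_eq_0_iff) (auto intro: span_base)
    then show ?thesis by (simp add: res_add res_sum res_scaleR)
  qed
  moreover have "res w m 0 = 0" using linear_res by (rule linear_0)
  ultimately have "r m = 0" using Suc.prems * by simp
  then show ?case using Suc * by (cases "i = m") (auto simp: less_Suc_eq)
qed simp

lemma inj_on_orthonormal: "orthonormal b d \<Longrightarrow> inj_on b {..<d}"
  unfolding inj_on_def orthonormal_def by (metis lessThan_iff zero_neq_one)

lemma dim_orthonormal:
  assumes "orthonormal b d"
  shows "dim (span (b ` {..<d})) = d"
proof -
  have "independent (b ` {..<d})"
    using assms
    by (intro pairwise_orthogonal_independent)
       (fastforce simp: pairwise_def orthogonal_def orthonormal_def)+
  then have "dim (b ` {..<d}) = card (b ` {..<d})" by (rule dim_eq_card_independent)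
  then show ?thesis using card_image[OF inj_on_orthonormal[OF assms]] by simp
qed

lemma borel_measurable_res [measurable (raw)]:
  fixes w :: "'z \<Rightarrow> nat \<Rightarrow> fin_seq"
  assumes "\<And>i. i < j \<Longrightarrow> (\<lambda>z. w z i) \<in> borel_measurable M" "x \<in> borel_measurable M"
  shows "(\<lambda>z. res (w z) j (x z)) \<in> borel_measurable M"
  using assms
proof (induction j arbitrary: x)
  case (Suc j)
  have [measurable]: "(\<lambda>z. res (w z) j (w z j)) \<in> borel_measurable M" "(\<lambda>z. res (w z) j (x z)) \<in> borel_measurable M"
    "x \<in> borel_measurable M"
    using Suc by auto
  show ?case by simp
qed simp

lemma borel_measurable_gs_vol [measurable (raw)]:
  fixes w :: "'z \<Rightarrow> nat \<Rightarrow> fin_seq"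
  assumes "\<And>i. i < m \<Longrightarrow> (\<lambda>z. w z i) \<in> borel_measurable M"
  shows "(\<lambda>z. gs_vol (w z) m) \<in> borel_measurable M"
  unfolding gs_vol_def using assms
  by (intro borel_measurable_prod borel_measurable_norm borel_measurable_res measurable_compose[OF _ borel_measurable_norm]) auto

lemma borel_measurable_gs [measurable (raw)]:
  fixes w :: "'z \<Rightarrow> nat \<Rightarrow> fin_seq"
  assumes "\<And>j. j \<le> i \<Longrightarrow> (\<lambda>z. w z j) \<in> borel_measurable M"
  shows "(\<lambda>z. gs (w z) i) \<in> borel_measurable M"
proof -
  have [measurable]: "(\<lambda>z. res (w z) i (w z i)) \<in> borel_measurable M"
    using assms by (intro borel_measurable_res) auto
  show ?thesis unfolding gs_def by measurable
qed

lemma ex_orthonormal_extend: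
  assumes "orthonormal b k" "\<And>i. i < k \<Longrightarrow> b i \<in> Rn n" "k \<le> n"
  obtains b' where "orthonormal b' n" "\<And>i. i < k \<Longrightarrow> b' i = b i" "span (b' ` {..<n}) = Rn n"
proof -
  have "\<exists>b'. orthonormal b' j \<and> (\<forall>i<k. b' i = b i) \<and> (\<forall>i<j. b' i \<in> Rn n)" if "k \<le> j" "j \<le> n" for j
    using that
  proof (induction j rule: dec_induct)
    case base
    then show ?case using assms by auto
  next
    case (step j)
    then obtain b' where b': "orthonormal b' j" "\<forall>i<k. b' i = b i" "\<forall>i<j. b' i \<in> Rn n" by auto
    obtain u where u: "u \<in> Rn n" "norm u = 1" "\<And>i. i < j \<Longrightarrow> u \<bullet> b' i = 0"
      using ex_unit_orth[of j b' n] b' step by auto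
    have "orthonormal (b'(j := u)) j" using b'(1) by (subst orthonormal_cong[of _ _ b']) auto
    then have "orthonormal (b'(j := u)) (Suc j)" using u by (simp add: orthonormal_Suc)
    moreover have "\<forall>i<k. (b'(j := u)) i = b i" "\<forall>i<Suc j. (b'(j := u)) i \<in> Rn n"
      using b' u step by (auto simp: less_Suc_eq)
    ultimately show ?case by blast
  qed
  then obtain b' where b': "orthonormal b' n" "\<forall>i<k. b' i = b i" "\<forall>i<n. b' i \<in> Rn n" using assms by blast
  moreover have "span (b' ` {..<n}) = Rn n"
    using b' orthonormal_gs_vol[OF b'(1)] by (intro gs_vol_neq_0_imp_span) auto
  ultimately show ?thesis by (intro that) auto
qed

text \<open>A maximal orthonormal system in E exists because such systems have at most n members;
  the normalised residual of a vector outside its span would extend it.\<close>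

lemma ex_orthonormal_subspace:
  assumes "subspace E" "E \<subseteq> Rn n"
  obtains b where "orthonormal b (dim E)" "span (b ` {..<dim E}) = E" "dim E \<le> n"
proof -
  define P where "P j \<longleftrightarrow> (\<exists>b. orthonormal b j \<and> b ` {..<j} \<subseteq> E)" for j
  have P0: "P 0" by (auto simp: P_def orthonormal_def)
  have bound: "j \<le> n" if "P j" for j
  proof -
    from that obtain b where "orthonormal b j" "b ` {..<j} \<subseteq> E" by (auto simp: P_def)
    then show ?thesis using orthonormal_gs_vol[of b j] assms by (intro gs_vol_neq_0_le[of b j n]) auto
  qed
  define d where "d = (GREATEST j. P j)"
  have d: "P d" "\<And>j. P j \<Longrightarrow> j \<le> d"
    unfolding d_def using GreatestI_nat[of P 0 n] Greatest_le_nat[of P _ n] P0 bound by blast+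
  then obtain b where b: "orthonormal b d" "b ` {..<d} \<subseteq> E" by (auto simp: P_def)
  have "E \<subseteq> span (b ` {..<d})"
  proof
    fix x assume x: "x \<in> E"
    show "x \<in> span (b ` {..<d})"
    proof (rule ccontr)
      assume "x \<notin> span (b ` {..<d})"
      then have r: "res b d x \<noteq> 0" by (simp add: res_eq_0_iff)
      have "res b d x \<in> E" using b x assms by (intro res_in_subspace) auto
      then have e: "res b d x /\<^sub>R norm (res b d x) \<in> E" using assms by (intro subspace_scale) auto
      let ?b = "b(d := res b d x /\<^sub>R norm (res b d x))"
      have "orthonormal ?b d" using b(1) by (subst orthonormal_cong[of _ _ b]) auto
      then have "orthonormal ?b (Suc d)" using r by (auto simp: orthonormal_Suc res_orth)
      moreover have "?b ` {..<Suc d} \<subseteq> E" using b e by auto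
      ultimately have "P (Suc d)" unfolding P_def by blast
      then show False using d(2) by fastforce
    qed
  qed
  moreover have "span (b ` {..<d}) \<subseteq> E" using b assms by (intro span_minimal) auto
  ultimately have s: "span (b ` {..<d}) = E" by auto
  then have "dim E = d" using dim_orthonormal[OF b(1)] by simp
  then show ?thesis using b s bound[OF d(1)] by (intro that[of b]) auto
qed

subsection \<open>Lebesgue measure on subspaces\<close>

interpretation lborel_prod: product_sigma_finite "\<lambda>_::nat. lborel :: real measure"
  by unfold_locales

text \<open>The measure lives on the Borel sets of the whole ambient space, so all subspaces share
  one measurable space. The family b may be arbitrary: for independent b this is Lebesgue measure on
  the span divided by \<open>gs_vol b d\<close>.\<close>

definition Lb :: "(nat \<Rightarrow> fin_seq) \<Rightarrow> nat \<Rightarrow> fin_seq measure" where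
  "Lb b d = distr (\<Pi>\<^sub>M i\<in>{..<d}. lborel) borel (\<lambda>c. \<Sum>i<d. c i *\<^sub>R b i)"

lemma sets_Lb [simp, measurable_cong]: "sets (Lb b d) = sets borel"
  by (simp add: Lb_def)

lemma space_Lb [simp]: "space (Lb b d) = UNIV"
  by (simp add: Lb_def)

lemma measurable_lin_comb [measurable]:
  "(\<lambda>c. \<Sum>i<d. c i *\<^sub>R b i) \<in> borel_measurable (\<Pi>\<^sub>M i\<in>{..<d}. (lborel :: real measure))"
  for b :: "nat \<Rightarrow> fin_seq"
  by measurable

lemma nn_integral_Lb:
  assumes [measurable]: "g \<in> borel_measurable borel"
  shows "(\<integral>\<^sup>+x. g x \<partial>Lb b d) = (\<integral>\<^sup>+c. g (\<Sum>i<d. c i *\<^sub>R b i) \<partial>(\<Pi>\<^sub>M i\<in>{..<d}. lborel))"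
  unfolding Lb_def by (subst nn_integral_distr) auto

lemma nn_swap:
  assumes "sigma_finite_measure M" "sigma_finite_measure N"
    "case_prod f \<in> borel_measurable (M \<Otimes>\<^sub>M N)"
  shows "(\<integral>\<^sup>+x. \<integral>\<^sup>+y. f x y \<partial>N \<partial>M) = (\<integral>\<^sup>+y. \<integral>\<^sup>+x. f x y \<partial>M \<partial>N)"
  using pair_sigma_finite.Fubini'[OF pair_sigma_finite.intro[OF assms(1,2)] assms(3)] by simp

lemma nn_integral_Lb_Suc:
  assumes [measurable]: "g \<in> borel_measurable borel"
  shows "(\<integral>\<^sup>+x. g x \<partial>Lb b (Suc d)) = (\<integral>\<^sup>+x. \<integral>\<^sup>+s. g (x + s *\<^sub>R b d) \<partial>lborel \<partial>Lb b d)"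
proof -
  have "(\<integral>\<^sup>+x. g x \<partial>Lb b (Suc d))
      = (\<integral>\<^sup>+c. g (\<Sum>i<Suc d. c i *\<^sub>R b i) \<partial>(\<Pi>\<^sub>M i\<in>insert d {..<d}. lborel))"
    by (subst nn_integral_Lb) (auto simp: lessThan_Suc)
  also have "\<dots> = (\<integral>\<^sup>+c. \<integral>\<^sup>+s. g (\<Sum>i<Suc d. (c(d := s)) i *\<^sub>R b i) \<partial>lborel \<partial>(\<Pi>\<^sub>M i\<in>{..<d}. lborel))"
  proof (rule lborel_prod.product_nn_integral_insert)
    show "(\<lambda>c. g (\<Sum>i<Suc d. c i *\<^sub>R b i)) \<in> borel_measurable (Pi\<^sub>M (insert d {..<d}) (\<lambda>_. lborel))"
      using measurable_lin_comb[of b "Suc d"] by (simp only: lessThan_Suc) measurable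
  qed auto
  also have "\<dots> = (\<integral>\<^sup>+c. \<integral>\<^sup>+s. g ((\<Sum>i<d. c i *\<^sub>R b i) + s *\<^sub>R b d) \<partial>lborel \<partial>(\<Pi>\<^sub>M i\<in>{..<d}. lborel))"
    by (intro nn_integral_cong arg_cong[of _ _ g]) simp
  also have "\<dots> = (\<integral>\<^sup>+x. \<integral>\<^sup>+s. g (x + s *\<^sub>R b d) \<partial>lborel \<partial>Lb b d)"
    by (subst nn_integral_Lb) auto
  finally show ?thesis .
qed

lemma nn_integral_Lb_0:
  assumes [measurable]: "g \<in> borel_measurable borel"
  shows "(\<integral>\<^sup>+x. g x \<partial>Lb b 0) = g 0"
  by (subst nn_integral_Lb) (simp_all add: PiM_empty nn_integral_count_space_finite)

lemma nn_integral_exp_square: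
  assumes "\<theta> > 0"
  shows "(\<integral>\<^sup>+s. ennreal (exp (- (\<theta> / 2) * s\<^sup>2)) \<partial>lborel) = ennreal (sqrt (2 * pi / \<theta>))"
proof -
  define \<sigma> where "\<sigma> = 1 / sqrt \<theta>"
  have \<sigma>: "\<sigma> > 0" "\<sigma>\<^sup>2 = 1 / \<theta>" using assms by (auto simp: \<sigma>_def power_divide)
  have *: "exp (- (\<theta> / 2) * s\<^sup>2) = sqrt (2 * pi / \<theta>) * normal_density 0 \<sigma> s" for s
    using assms unfolding normal_density_def \<sigma> by (simp add: real_sqrt_mult real_sqrt_divide field_simps)
  have "(\<integral>\<^sup>+s. ennreal (exp (- (\<theta> / 2) * s\<^sup>2)) \<partial>lborel)
      = (\<integral>\<^sup>+s. ennreal (sqrt (2 * pi / \<theta>)) * ennreal (normal_density 0 \<sigma> s) \<partial>lborel)"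
    unfolding * using assms by (intro nn_integral_cong ennreal_mult) auto
  also have "\<dots> = ennreal (sqrt (2 * pi / \<theta>)) * (\<integral>\<^sup>+s. ennreal (normal_density 0 \<sigma> s) \<partial>lborel)"
    by (rule nn_integral_cmult) simp
  also have "(\<integral>\<^sup>+s. ennreal (normal_density 0 \<sigma> s) \<partial>lborel) = 1"
    using \<sigma> by (subst nn_integral_eq_integral) auto
  finally show ?thesis by simp
qed

lemma nn_integral_Lb_gaussian:
  assumes b: "orthonormal b d" and \<theta>: "\<theta> > 0"
  shows "(\<integral>\<^sup>+x. ennreal (exp (- (\<theta> / 2) * (norm x)\<^sup>2)) \<partial>Lb b d) = ennreal (sqrt (2 * pi / \<theta>) ^ d)"
proof -
  have "(\<integral>\<^sup>+x. ennreal (exp (- (\<theta> / 2) * (norm x)\<^sup>2)) \<partial>Lb b d)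
      = (\<integral>\<^sup>+c. (\<Prod>i<d. ennreal (exp (- (\<theta> / 2) * (c i)\<^sup>2))) \<partial>(\<Pi>\<^sub>M i\<in>{..<d}. lborel))"
    by (subst nn_integral_Lb)
       (auto intro!: nn_integral_cong simp: norm_orthonormal_sum[OF b] prod_ennreal exp_sum[symmetric] sum_distrib_left)
  also have "\<dots> = (\<Prod>i<d. ennreal (sqrt (2 * pi / \<theta>)))"
    using nn_integral_exp_square[OF \<theta>] by (subst lborel_prod.product_nn_integral_prod) auto
  also have "\<dots> = ennreal (sqrt (2 * pi / \<theta>) ^ d)"
    using \<theta> by (simp add: ennreal_power)
  finally show ?thesis .
qed

text \<open>Balls have finite measure: the indicator of the ball of radius r is at most exp(r^2 / 2)
  times the Gaussian exp(-|x|^2 / 2), whose integral is known.\<close>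

lemma sigma_finite_Lb:
  assumes b: "orthonormal b d"
  shows "sigma_finite_measure (Lb b d)"
proof
  let ?B = "\<lambda>n::nat. {x::fin_seq. norm x \<le> real n}"
  have fin: "emeasure (Lb b d) (?B n) \<noteq> \<infinity>" for n
  proof -
    have "emeasure (Lb b d) (?B n) = (\<integral>\<^sup>+x. indicator (?B n) x \<partial>Lb b d)"
      by (subst nn_integral_indicator) auto
    also have "\<dots> \<le> (\<integral>\<^sup>+x. ennreal (exp ((real n)\<^sup>2 / 2)) * ennreal (exp (- (1 / 2) * (norm x)\<^sup>2)) \<partial>Lb b d)"
    proof (rule nn_integral_mono)
      fix x :: fin_seq
      have "(norm x)\<^sup>2 \<le> (real n)\<^sup>2" if "norm x \<le> real n" using that by (intro power_mono) auto
      then have "1 \<le> exp ((real n)\<^sup>2 / 2) * exp (- (1 / 2) * (norm x)\<^sup>2)" if "norm x \<le> real n"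
        using that by (simp flip: exp_add)
      then show "indicator (?B n) x \<le> ennreal (exp ((real n)\<^sup>2 / 2)) * ennreal (exp (- (1 / 2) * (norm x)\<^sup>2))"
        by (auto simp: indicator_def ennreal_mult[symmetric] ennreal_1[symmetric] simp del: ennreal_1)
    qed
    also have "\<dots> = ennreal (exp ((real n)\<^sup>2 / 2)) * ennreal (sqrt (2 * pi / 1) ^ d)"
      using nn_integral_Lb_gaussian[OF b, of 1] by (subst nn_integral_cmult) auto
    also have "\<dots> < \<infinity>" by (simp add: ennreal_mult_less_top)
    finally show ?thesis by simp
  qed
  have "(\<Union>n. ?B n) = UNIV" using real_arch_simple by auto
  then show "\<exists>A. countable A \<and> A \<subseteq> sets (Lb b d) \<and> \<Union> A = space (Lb b d) \<and> (\<forall>a\<in>A. emeasure (Lb b d) a \<noteq> \<infinity>)"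
    using fin by (intro exI[of _ "range ?B"]) auto
qed

lemma span_orthonormal_borel:
  assumes "orthonormal b d"
  shows "span (b ` {..<d}) \<in> sets (borel :: fin_seq measure)"
proof -
  have "span (b ` {..<d}) = {x \<in> space borel. x = (\<Sum>i<d. (x \<bullet> b i) *\<^sub>R b i)}"
    using in_span_orthonormal_iff[OF assms] by auto
  also have "\<dots> = {x \<in> space borel. norm (x - (\<Sum>i<d. (x \<bullet> b i) *\<^sub>R b i)) = 0}" by auto
  also have "\<dots> \<in> sets borel" by measurable
  finally show ?thesis .
qed

lemma AE_Lb_span:
  assumes "orthonormal b d"
  shows "AE x in Lb b d. x \<in> span (b ` {..<d})"
  unfolding Lb_def using span_orthonormal_borel[OF assms]
  by (subst AE_distr_iff) (auto simp: sum_in_span)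

lemma nn_integral_Lb_cong:
  assumes "orthonormal b d" "\<And>x. x \<in> span (b ` {..<d}) \<Longrightarrow> f x = g x"
  shows "(\<integral>\<^sup>+x. f x \<partial>Lb b d) = (\<integral>\<^sup>+x. g x \<partial>Lb b d)"
  using AE_Lb_span[OF assms(1)] by (intro nn_integral_cong_AE) (auto simp: assms(2))

lemma nn_integral_lborel_shift:
  assumes [measurable]: "f \<in> borel_measurable borel"
  shows "(\<integral>\<^sup>+s. f (s + a) \<partial>lborel) = (\<integral>\<^sup>+s. f (s::real) \<partial>lborel)"
  using nn_integral_real_affine[of f 1 a] by (simp add: add.commute)

lemma nn_integral_Lb_translate_aux:
  assumes [measurable]: "g \<in> borel_measurable borel"
  shows "(\<integral>\<^sup>+x. g (x + (\<Sum>i<d. a i *\<^sub>R b i)) \<partial>Lb b d) = (\<integral>\<^sup>+x. g x \<partial>Lb b d)"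
  using assms
proof (induction d arbitrary: g)
  case (Suc d)
  note [measurable] = Suc.prems
  let ?v = "\<Sum>i<d. a i *\<^sub>R b i"
  have "(\<integral>\<^sup>+x. g (x + (\<Sum>i<Suc d. a i *\<^sub>R b i)) \<partial>Lb b (Suc d))
      = (\<integral>\<^sup>+x. \<integral>\<^sup>+s. g (x + s *\<^sub>R b d + (?v + a d *\<^sub>R b d)) \<partial>lborel \<partial>Lb b d)"
    by (subst nn_integral_Lb_Suc) auto
  also have "\<dots> = (\<integral>\<^sup>+x. \<integral>\<^sup>+s. g ((x + ?v) + (s + a d) *\<^sub>R b d) \<partial>lborel \<partial>Lb b d)"
    by (simp add: algebra_simps)
  also have "\<dots> = (\<integral>\<^sup>+x. \<integral>\<^sup>+s. g ((x + ?v) + s *\<^sub>R b d) \<partial>lborel \<partial>Lb b d)"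
    by (intro nn_integral_cong nn_integral_lborel_shift[where f="\<lambda>s. g (_ + s *\<^sub>R b d)"]) measurable
  also have "\<dots> = (\<integral>\<^sup>+x. \<integral>\<^sup>+s. g (x + s *\<^sub>R b d) \<partial>lborel \<partial>Lb b d)"
    by (rule Suc.IH[where g="\<lambda>x. \<integral>\<^sup>+s. g (x + s *\<^sub>R b d) \<partial>lborel"]) measurable
  also have "\<dots> = (\<integral>\<^sup>+x. g x \<partial>Lb b (Suc d))"
    by (subst nn_integral_Lb_Suc) auto
  finally show ?case .
qed simp

lemma nn_integral_Lb_translate:
  assumes "g \<in> borel_measurable borel" "v \<in> span (b ` {..<d})"
  shows "(\<integral>\<^sup>+x. g (x + v) \<partial>Lb b d) = (\<integral>\<^sup>+x. g x \<partial>Lb b d)"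
proof -
  obtain a where "v = (\<Sum>i<d. a i *\<^sub>R b i)" using in_span_family[OF assms(2)] by blast
  then show ?thesis using nn_integral_Lb_translate_aux[OF assms(1)] by simp
qed

text \<open>Two translation invariant measures are proportional; the factor is found by integrating a Gaussian.\<close>

lemma Lb_unique:
  assumes b: "orthonormal b d" and b': "orthonormal b' d"
    and span: "span (b ` {..<d}) = span (b' ` {..<d})"
  shows "Lb b d = Lb b' d"
proof (rule measure_eqI)
  fix A assume "A \<in> sets (Lb b d)"
  then have [measurable]: "A \<in> sets borel" by simp
  define f :: "fin_seq \<Rightarrow> ennreal" where "f = indicator A"
  have [measurable]: "f \<in> borel_measurable borel" by (simp add: f_def)
  define G :: "fin_seq \<Rightarrow> ennreal" where "G x = ennreal (exp (- (1 / 2) * (norm x)\<^sup>2))" for x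
  have [measurable]: "G \<in> borel_measurable borel" unfolding G_def by measurable
  \<comment> \<open>Evenness closes the argument: translating y by -x and then x by y turns f(x)
    G(y) into f(x + y) G(-x), and after exchanging the integrals another translation leaves f(y)
    G(x).\<close>
  have even: "G (- x) = G x" for x by (simp add: G_def)
  let ?N = "Lb b d" and ?L = "Lb b' d"
  interpret N: sigma_finite_measure ?N by (rule sigma_finite_Lb[OF b])
  interpret L: sigma_finite_measure ?L by (rule sigma_finite_Lb[OF b'])
  define c where "c = sqrt (2 * pi / 1) ^ d"
  have c: "c > 0" by (simp add: c_def)
  have G: "(\<integral>\<^sup>+x. G x \<partial>?N) = ennreal c" "(\<integral>\<^sup>+x. G x \<partial>?L) = ennreal c"
    unfolding G_def c_def using nn_integral_Lb_gaussian[OF b, of 1] nn_integral_Lb_gaussian[OF b', of 1] by simp_all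
  have "(\<integral>\<^sup>+x. f x \<partial>?N) * ennreal c = (\<integral>\<^sup>+x. \<integral>\<^sup>+y. f x * G y \<partial>?L \<partial>?N)"
    by (simp add: nn_integral_cmult nn_integral_multc G)
  also have "\<dots> = (\<integral>\<^sup>+x. \<integral>\<^sup>+y. f x * G (y + (- x)) \<partial>?L \<partial>?N)"
  proof (rule nn_integral_Lb_cong[OF b])
    fix x assume "x \<in> span (b ` {..<d})"
    then have "- x \<in> span (b' ` {..<d})" using span by (simp add: span_neg)
    then show "(\<integral>\<^sup>+y. f x * G y \<partial>?L) = (\<integral>\<^sup>+y. f x * G (y + (- x)) \<partial>?L)"
      by (intro nn_integral_Lb_translate[symmetric, where g="\<lambda>y. f x * G y"]) measurable
  qed
  also have "\<dots> = (\<integral>\<^sup>+y. \<integral>\<^sup>+x. f x * G (y - x) \<partial>?N \<partial>?L)"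
    by (subst nn_swap[OF N.sigma_finite_measure_axioms L.sigma_finite_measure_axioms]) auto
  also have "\<dots> = (\<integral>\<^sup>+y. \<integral>\<^sup>+x. f (x + y) * G (- x) \<partial>?N \<partial>?L)"
  proof (rule nn_integral_Lb_cong[OF b'])
    fix y assume "y \<in> span (b' ` {..<d})"
    then have "(\<integral>\<^sup>+x. f (x + y) * G (y - (x + y)) \<partial>?N) = (\<integral>\<^sup>+x. f x * G (y - x) \<partial>?N)"
      using span by (intro nn_integral_Lb_translate[where g="\<lambda>x. f x * G (y - x)"]) auto
    then show "(\<integral>\<^sup>+x. f x * G (y - x) \<partial>?N) = (\<integral>\<^sup>+x. f (x + y) * G (- x) \<partial>?N)" by simp
  qed
  also have "\<dots> = (\<integral>\<^sup>+x. \<integral>\<^sup>+y. f (y + x) * G x \<partial>?L \<partial>?N)"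
    unfolding even
    by (subst nn_swap[OF L.sigma_finite_measure_axioms N.sigma_finite_measure_axioms]) (auto simp: add.commute)
  also have "\<dots> = (\<integral>\<^sup>+x. \<integral>\<^sup>+y. f y * G x \<partial>?L \<partial>?N)"
  proof (rule nn_integral_Lb_cong[OF b])
    fix x assume "x \<in> span (b ` {..<d})"
    then show "(\<integral>\<^sup>+y. f (y + x) * G x \<partial>?L) = (\<integral>\<^sup>+y. f y * G x \<partial>?L)"
      using span by (intro nn_integral_Lb_translate[where g="\<lambda>y. f y * G x"]) auto
  qed
  also have "\<dots> = (\<integral>\<^sup>+x. f x \<partial>?L) * ennreal c"
    by (simp add: nn_integral_cmult nn_integral_multc G)
  finally have "(\<integral>\<^sup>+x. f x \<partial>?N) = (\<integral>\<^sup>+x. f x \<partial>?L)"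
    using c by (simp add: ennreal_mult_cancel_left mult.commute[of _ "ennreal c"])
  then show "emeasure ?N A = emeasure ?L A" by (simp add: f_def)
qed simp

lemma nn_integral_lborel_scale:
  assumes [measurable]: "f \<in> borel_measurable borel" and "r > 0"
  shows "ennreal r * (\<integral>\<^sup>+s. f (s * r) \<partial>lborel) = (\<integral>\<^sup>+s. f (s::real) \<partial>lborel)"
  using nn_integral_real_affine[of f r 0] assms by (simp add: mult.commute)

text \<open>In the orthonormalised basis the change of variables is triangular: \<open>w m\<close>
  is a vector of the earlier span plus r times the new basis vector. The former is absorbed by
  translation invariance, the latter contributes its length r, and these lengths multiply to
  \<open>gs_vol\<close>.\<close>

lemma nn_integral_Lb_gs:
  assumes "gs_vol w m \<noteq> 0" and "g \<in> borel_measurable borel"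
  shows "ennreal (gs_vol w m) * (\<integral>\<^sup>+x. g x \<partial>Lb w m) = (\<integral>\<^sup>+x. g x \<partial>Lb (gs w) m)"
  using assms
proof (induction m arbitrary: g)
  case (Suc m)
  note [measurable] = Suc.prems(2)
  let ?u = "res w m (w m)" and ?e = "gs w m"
  define r where "r = norm ?u"
  from Suc.prems have w: "gs_vol w m \<noteq> 0" and r: "r > 0" by (auto simp: gs_vol_Suc r_def)
  define p where "p = w m - ?u"
  have p: "p \<in> span (gs w ` {..<m})" using diff_res_in_span[of "w m" w m] orthonormal_gs(2)[OF w] by (simp add: p_def)
  have wm: "w m = p + r *\<^sub>R ?e" using r by (simp add: p_def r_def gs_def)
  have on: "orthonormal (gs w) m" by (rule orthonormal_gs(1)[OF w])
  have "ennreal (gs_vol w (Suc m)) * (\<integral>\<^sup>+x. g x \<partial>Lb w (Suc m))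
      = ennreal r * (ennreal (gs_vol w m) * (\<integral>\<^sup>+x. \<integral>\<^sup>+s. g (x + s *\<^sub>R w m) \<partial>lborel \<partial>Lb w m))"
    by (subst nn_integral_Lb_Suc) (auto simp: gs_vol_Suc r_def ennreal_mult mult_ac)
  also have "ennreal (gs_vol w m) * (\<integral>\<^sup>+x. \<integral>\<^sup>+s. g (x + s *\<^sub>R w m) \<partial>lborel \<partial>Lb w m)
      = (\<integral>\<^sup>+x. \<integral>\<^sup>+s. g (x + s *\<^sub>R w m) \<partial>lborel \<partial>Lb (gs w) m)"
    by (rule Suc.IH[OF w]) measurable
  also have "\<dots> = (\<integral>\<^sup>+s. \<integral>\<^sup>+x. g (x + s *\<^sub>R w m) \<partial>Lb (gs w) m \<partial>lborel)"
    by (rule nn_swap[OF sigma_finite_Lb[OF on] sigma_finite_lborel]) measurable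
  also have "\<dots> = (\<integral>\<^sup>+s. \<integral>\<^sup>+x. g (x + (s * r) *\<^sub>R ?e) \<partial>Lb (gs w) m \<partial>lborel)"
  proof (rule nn_integral_cong)
    fix s :: real
    have "(\<integral>\<^sup>+x. g (x + s *\<^sub>R w m) \<partial>Lb (gs w) m) = (\<integral>\<^sup>+x. g ((x + s *\<^sub>R p) + (s * r) *\<^sub>R ?e) \<partial>Lb (gs w) m)"
      by (simp add: wm scaleR_add_right add.assoc)
    also have "\<dots> = (\<integral>\<^sup>+x. g (x + (s * r) *\<^sub>R ?e) \<partial>Lb (gs w) m)"
      using p by (intro nn_integral_Lb_translate[where g="\<lambda>x. g (x + (s * r) *\<^sub>R ?e)"] span_scale) auto
    finally show "(\<integral>\<^sup>+x. g (x + s *\<^sub>R w m) \<partial>Lb (gs w) m) = (\<integral>\<^sup>+x. g (x + (s * r) *\<^sub>R ?e) \<partial>Lb (gs w) m)" .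
  qed
  also have "ennreal r * \<dots> = (\<integral>\<^sup>+s. \<integral>\<^sup>+x. g (x + s *\<^sub>R ?e) \<partial>Lb (gs w) m \<partial>lborel)"
  proof -
    interpret sigma_finite_measure "Lb (gs w) m" by (rule sigma_finite_Lb[OF on])
    show ?thesis
      using r by (intro nn_integral_lborel_scale[where f="\<lambda>s. \<integral>\<^sup>+x. g (x + s *\<^sub>R ?e) \<partial>Lb (gs w) m"]) measurable
  qed
  also have "\<dots> = (\<integral>\<^sup>+x. \<integral>\<^sup>+s. g (x + s *\<^sub>R ?e) \<partial>lborel \<partial>Lb (gs w) m)"
    by (rule nn_swap[symmetric, OF sigma_finite_Lb[OF on] sigma_finite_lborel]) measurable
  also have "\<dots> = (\<integral>\<^sup>+x. g x \<partial>Lb (gs w) (Suc m))"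
    by (subst nn_integral_Lb_Suc) auto
  finally show ?case .
qed (simp add: nn_integral_Lb_0)

text \<open>The transposed substitution, mapping c to its inner products with the
  \<open>w j\<close>. In the basis \<open>gs w\<close> its matrix is triangular, because each basis
  vector is orthogonal to all earlier \<open>w j\<close>, and its diagonal consists of the residual
  norms.\<close>

lemma nn_integral_Lb_inner:
  assumes "gs_vol w m \<noteq> 0" and "g \<in> borel_measurable (\<Pi>\<^sub>M i\<in>{..<m}. lborel)"
  shows "ennreal (gs_vol w m) * (\<integral>\<^sup>+c. g (\<lambda>j\<in>{..<m}. c \<bullet> w j) \<partial>Lb (gs w) m) = (\<integral>\<^sup>+c. g c \<partial>(\<Pi>\<^sub>M i\<in>{..<m}. lborel))"
  using assms
proof (induction m arbitrary: g)
  case 0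
  then show ?case
    by (subst nn_integral_Lb_0) (auto simp: lborel_prod.nn_integral_empty space_PiM restrict_def)
next
  case (Suc m)
  note g [measurable] = Suc.prems(2)
  let ?u = "res w m (w m)" and ?e = "gs w m"
  define r where "r = norm ?u"
  from Suc.prems have w: "gs_vol w m \<noteq> 0" and r: "r > 0" by (auto simp: gs_vol_Suc r_def)
  have on: "orthonormal (gs w) m" by (rule orthonormal_gs(1)[OF w])
  have e1: "?e \<bullet> w j = 0" if "j < m" for j using res_orth[OF that, of w "w m"] by (simp add: gs_def)
  have "?u \<bullet> w m = r\<^sup>2" using inner_res_self[of w m "w m"] by (simp add: r_def power2_norm_eq_inner inner_commute)
  then have e2: "?e \<bullet> w m = r" using r by (simp add: gs_def r_def[symmetric] power2_eq_square)
  have g' [measurable]: "g \<in> borel_measurable (Pi\<^sub>M (insert m {..<m}) (\<lambda>_. lborel))"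
    using g by (simp only: lessThan_Suc)
  have upd: "(\<lambda>(c, s). c(m := s)) \<in> Pi\<^sub>M {..<m} (\<lambda>_. lborel) \<Otimes>\<^sub>M lborel \<rightarrow>\<^sub>M Pi\<^sub>M (insert m {..<m}) (\<lambda>_. lborel :: real measure)"
    using measurable_add_dim[of m "{..<m}" "\<lambda>_. lborel :: real measure"] by simp
  have gm: "(\<lambda>(c, s). g (c(m := s))) \<in> borel_measurable (Pi\<^sub>M {..<m} (\<lambda>_. lborel) \<Otimes>\<^sub>M lborel)"
    using measurable_compose[OF upd g'] by (simp add: case_prod_beta)
  have rs [measurable]: "(\<lambda>c. \<lambda>j\<in>{..<k}. c \<bullet> w j) \<in> borel \<rightarrow>\<^sub>M Pi\<^sub>M {..<k} (\<lambda>_. lborel)" for k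
    by (intro measurable_restrict) auto
  have "(\<integral>\<^sup>+c. g (\<lambda>j\<in>{..<Suc m}. c \<bullet> w j) \<partial>Lb (gs w) (Suc m))
      = (\<integral>\<^sup>+x. \<integral>\<^sup>+s. g (\<lambda>j\<in>{..<Suc m}. (x + s *\<^sub>R ?e) \<bullet> w j) \<partial>lborel \<partial>Lb (gs w) m)"
    by (subst nn_integral_Lb_Suc) auto
  also have "\<dots> = (\<integral>\<^sup>+x. \<integral>\<^sup>+s. g ((\<lambda>j\<in>{..<m}. x \<bullet> w j)(m := s * r + x \<bullet> w m)) \<partial>lborel \<partial>Lb (gs w) m)"
    by (intro nn_integral_cong arg_cong[of _ _ g] ext)
       (auto simp: inner_add_left e1 e2 less_Suc_eq restrict_def)
  finally have *: "(\<integral>\<^sup>+c. g (\<lambda>j\<in>{..<Suc m}. c \<bullet> w j) \<partial>Lb (gs w) (Suc m))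
      = (\<integral>\<^sup>+x. \<integral>\<^sup>+s. g ((\<lambda>j\<in>{..<m}. x \<bullet> w j)(m := s * r + x \<bullet> w m)) \<partial>lborel \<partial>Lb (gs w) m)" .
  have inner: "ennreal r * (\<integral>\<^sup>+s. g ((\<lambda>j\<in>{..<m}. x \<bullet> w j)(m := s * r + x \<bullet> w m)) \<partial>lborel)
      = (\<integral>\<^sup>+s. g ((\<lambda>j\<in>{..<m}. x \<bullet> w j)(m := s)) \<partial>lborel)" for x
  proof -
    have "(\<lambda>j\<in>{..<m}. x \<bullet> w j) \<in> space (Pi\<^sub>M {..<m} (\<lambda>_. lborel :: real measure))" by (simp add: space_PiM)
    then have m1: "(\<lambda>s. g ((\<lambda>j\<in>{..<m}. x \<bullet> w j)(m := s))) \<in> borel_measurable borel"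
      using measurable_compose[OF measurable_Pair1' gm] by (simp only: prod.case measurable_lborel2)
    have "ennreal r * (\<integral>\<^sup>+s. g ((\<lambda>j\<in>{..<m}. x \<bullet> w j)(m := s * r + x \<bullet> w m)) \<partial>lborel)
      = (\<integral>\<^sup>+s. g ((\<lambda>j\<in>{..<m}. x \<bullet> w j)(m := s + x \<bullet> w m)) \<partial>lborel)"
      using r m1 measurable_compose[OF _ m1, of "\<lambda>s. s + x \<bullet> w m" borel]
      by (intro nn_integral_lborel_scale[where f="\<lambda>s. g ((\<lambda>j\<in>{..<m}. x \<bullet> w j)(m := s + x \<bullet> w m))"]) auto
    also have "\<dots> = (\<integral>\<^sup>+s. g ((\<lambda>j\<in>{..<m}. x \<bullet> w j)(m := s)) \<partial>lborel)"
      by (intro nn_integral_lborel_shift[where f="\<lambda>s. g ((\<lambda>j\<in>{..<m}. x \<bullet> w j)(m := s))"] m1)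
    finally show ?thesis .
  qed
  have m2: "(\<lambda>c. \<integral>\<^sup>+s. g (c(m := s)) \<partial>lborel) \<in> borel_measurable (Pi\<^sub>M {..<m} (\<lambda>_. lborel))"
    using gm by (intro lborel.borel_measurable_nn_integral) simp
  have m3: "(\<lambda>x. \<integral>\<^sup>+s. g ((\<lambda>j\<in>{..<m}. x \<bullet> w j)(m := s * r + x \<bullet> w m)) \<partial>lborel) \<in> borel_measurable (Lb (gs w) m)"
  proof (rule lborel.borel_measurable_nn_integral)
    have "(\<lambda>z. (\<lambda>j\<in>{..<m}. fst z \<bullet> w j, snd z * r + fst z \<bullet> w m)) \<in> Lb (gs w) m \<Otimes>\<^sub>M lborel \<rightarrow>\<^sub>M Pi\<^sub>M {..<m} (\<lambda>_. lborel) \<Otimes>\<^sub>M lborel"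
      by measurable
    from measurable_compose[OF this gm]
    show "(\<lambda>(x, s). g ((\<lambda>j\<in>{..<m}. x \<bullet> w j)(m := s * r + x \<bullet> w m))) \<in> borel_measurable (Lb (gs w) m \<Otimes>\<^sub>M lborel)"
      by (simp add: case_prod_beta)
  qed
  have "ennreal (gs_vol w (Suc m)) * (\<integral>\<^sup>+c. g (\<lambda>j\<in>{..<Suc m}. c \<bullet> w j) \<partial>Lb (gs w) (Suc m))
      = ennreal (gs_vol w m) * (\<integral>\<^sup>+x. \<integral>\<^sup>+s. g ((\<lambda>j\<in>{..<m}. x \<bullet> w j)(m := s)) \<partial>lborel \<partial>Lb (gs w) m)"
    unfolding * inner[symmetric] using m3 by (subst nn_integral_cmult) (auto simp: gs_vol_Suc r_def ennreal_mult mult_ac)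
  also have "\<dots> = (\<integral>\<^sup>+c. \<integral>\<^sup>+s. g (c(m := s)) \<partial>lborel \<partial>(\<Pi>\<^sub>M i\<in>{..<m}. lborel))"
    by (rule Suc.IH[OF w m2])
  also have "\<dots> = (\<integral>\<^sup>+c. g c \<partial>(\<Pi>\<^sub>M i\<in>insert m {..<m}. lborel))"
    using g' by (intro lborel_prod.product_nn_integral_insert[symmetric]) auto
  finally show ?case by (simp only: lessThan_Suc)
qed

lemma nn_integral_Lb_append:
  assumes "g \<in> borel_measurable borel" "orthonormal (\<lambda>i. b (k + i)) m"
  shows "(\<integral>\<^sup>+x. g x \<partial>Lb b (k + m)) = (\<integral>\<^sup>+x. \<integral>\<^sup>+y. g (x + y) \<partial>Lb (\<lambda>i. b (k + i)) m \<partial>Lb b k)"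
  using assms
proof (induction m arbitrary: g)
  case (Suc m)
  note [measurable] = Suc.prems(1)
  have "orthonormal (\<lambda>i. b (k + i)) m" using Suc.prems by (simp add: orthonormal_Suc)
  then have "(\<integral>\<^sup>+x. g x \<partial>Lb b (k + Suc m))
    = (\<integral>\<^sup>+x. \<integral>\<^sup>+y. \<integral>\<^sup>+s. g (x + y + s *\<^sub>R b (k + m)) \<partial>lborel \<partial>Lb (\<lambda>i. b (k + i)) m \<partial>Lb b k)"
    by (simp add: nn_integral_Lb_Suc Suc.IH)
  then show ?case by (simp add: nn_integral_Lb_Suc add.assoc)
qed (simp add: nn_integral_Lb_0)

lemma orthonormal_basis_eq:
  assumes "dim F = d"
  shows "orthonormal_basis b F \<longleftrightarrow> orthonormal b d \<and> span (b ` {..<d}) = F"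
  using assms by (simp add: orthonormal_basis_def orthonormal_def)

lemma sets_lebesgue_on_subspace [simp, measurable_cong]:
  "sets (lebesgue_on_subspace F) = sets (restrict_space borel F)"
  by (simp add: lebesgue_on_subspace_def)

lemma space_lebesgue_on_subspace [simp]: "space (lebesgue_on_subspace F) = F"
  by (simp add: lebesgue_on_subspace_def space_restrict_space)

text \<open>The basis chosen by \<open>SOME\<close> may be exchanged for any orthonormal basis,
  since the span alone determines the measure.\<close>

lemma nn_integral_lebesgue_on_subspace:
  assumes b: "orthonormal b d" "span (b ` {..<d}) = F" and g[measurable]: "g \<in> borel_measurable borel"
  shows "(\<integral>\<^sup>+x. g x \<partial>lebesgue_on_subspace F) = (\<integral>\<^sup>+x. g x \<partial>Lb b d)"
proof -
  have d: "dim F = d" using dim_orthonormal[OF b(1)] b(2) by simp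
  define b0 where "b0 = (SOME b. orthonormal_basis b F)"
  have "orthonormal_basis b0 F"
    unfolding b0_def by (rule someI[of _ b]) (use b d in \<open>simp add: orthonormal_basis_eq\<close>)
  then have b0: "orthonormal b0 d" "span (b0 ` {..<d}) = F" using d by (simp_all add: orthonormal_basis_eq)
  have "(\<lambda>c. \<Sum>i<d. c i *\<^sub>R b0 i) \<in> (\<Pi>\<^sub>M i\<in>{..<d}. lborel) \<rightarrow>\<^sub>M restrict_space borel F"
    using b0 sum_in_span[of _ b0 d] by (intro measurable_restrict_space2 measurable_lin_comb) auto
  then have "(\<integral>\<^sup>+x. g x \<partial>lebesgue_on_subspace F)
      = (\<integral>\<^sup>+c. g (\<Sum>i<d. c i *\<^sub>R b0 i) \<partial>(\<Pi>\<^sub>M i\<in>{..<d}. lborel))"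
    unfolding lebesgue_on_subspace_def d b0_def[symmetric]
    by (intro nn_integral_distr) (simp_all add: measurable_restrict_space1)
  also have "\<dots> = (\<integral>\<^sup>+x. g x \<partial>Lb b0 d)" by (simp add: nn_integral_Lb)
  also have "Lb b0 d = Lb b d" using b b0 by (intro Lb_unique) auto
  finally show ?thesis .
qed

abbreviation Leb :: "nat \<Rightarrow> fin_seq measure" where
  "Leb n \<equiv> Lb unit_vec n"

lemma sigma_finite_Leb: "sigma_finite_measure (Leb n)"
  by (rule sigma_finite_Lb[OF orthonormal_unit_vec])

lemma Lb_eq_Leb:
  assumes "orthonormal b n" "span (b ` {..<n}) = Rn n"
  shows "Lb b n = Leb n"
  using assms by (intro Lb_unique) (auto simp: orthonormal_unit_vec span_unit_vec)

lemma AE_Leb_Rn: "AE x in Leb n. x \<in> Rn n"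
  using AE_Lb_span[OF orthonormal_unit_vec, of n] by (simp add: span_unit_vec)

lemma nn_integral_lebesgue_Rn:
  assumes "g \<in> borel_measurable borel"
  shows "(\<integral>\<^sup>+x. g x \<partial>lebesgue_on_subspace (Rn n)) = (\<integral>\<^sup>+x. g x \<partial>Leb n)"
  using nn_integral_lebesgue_on_subspace[OF orthonormal_unit_vec span_unit_vec assms] .

subsection \<open>Finite products of \<open>\<sigma>\<close>-finite measures\<close>

lemma product_sigma_finite_const: "sigma_finite_measure M \<Longrightarrow> product_sigma_finite (\<lambda>_::nat. M)"
  by (simp add: product_sigma_finite_def)

lemma distr_PiM_map:
  assumes "sigma_finite_measure M" "sigma_finite_measure (distr M N L)" and [measurable]: "L \<in> M \<rightarrow>\<^sub>M N" and "finite I"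
  shows "distr (PiM I (\<lambda>_. M)) (PiM I (\<lambda>_. N)) (\<lambda>x. \<lambda>i\<in>I. L (x i)) = PiM (I :: nat set) (\<lambda>_. distr M N L)"
proof (rule product_sigma_finite.PiM_eqI[OF product_sigma_finite_const[OF assms(2)] \<open>finite I\<close>])
  have [measurable]: "(\<lambda>x. \<lambda>i\<in>I. L (x i)) \<in> PiM I (\<lambda>_. M) \<rightarrow>\<^sub>M PiM I (\<lambda>_. N)"
    by (intro measurable_restrict) measurable
  fix A assume A: "\<And>i. i \<in> I \<Longrightarrow> A i \<in> sets (distr M N L)"
  have "emeasure (distr (PiM I (\<lambda>_. M)) (PiM I (\<lambda>_. N)) (\<lambda>x. \<lambda>i\<in>I. L (x i))) (Pi\<^sub>E I A)
      = emeasure (PiM I (\<lambda>_. M)) (Pi\<^sub>E I (\<lambda>i. L -` A i \<inter> space M))"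
    using A \<open>finite I\<close>
    by (subst emeasure_distr) (auto intro!: arg_cong2[of _ _ _ _ emeasure] sets_PiM_I_finite simp: space_PiM PiE_iff)
  also have "\<dots> = (\<Prod>i\<in>I. emeasure M (L -` A i \<inter> space M))"
    using A by (intro product_sigma_finite.emeasure_PiM product_sigma_finite_const assms) auto
  also have "\<dots> = (\<Prod>i\<in>I. emeasure (distr M N L) (A i))"
    using A by (intro prod.cong refl) (auto simp: emeasure_distr)
  finally show "emeasure (distr (PiM I (\<lambda>_. M)) (PiM I (\<lambda>_. N)) (\<lambda>x. \<lambda>i\<in>I. L (x i))) (Pi\<^sub>E I A)
      = (\<Prod>i\<in>I. emeasure (distr M N L) (A i))" .
qed (auto intro!: sets_PiM_cong)

lemma PiM_density:
  assumes N: "sigma_finite_measure N" and h [measurable]: "h \<in> borel_measurable N" "\<And>x. h x < \<infinity>" and "finite I"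
  shows "PiM (I :: nat set) (\<lambda>_. density N h) = density (PiM I (\<lambda>_. N)) (\<lambda>x. \<Prod>i\<in>I. h (x i))"
proof -
  have sf: "sigma_finite_measure (density N h)"
    using h by (subst sigma_finite_measure.sigma_finite_iff_density_finite[OF N]) (auto simp: less_top[symmetric])
  have "density (PiM I (\<lambda>_. N)) (\<lambda>x. \<Prod>i\<in>I. h (x i)) = PiM (I :: nat set) (\<lambda>_. density N h)"
  proof (rule product_sigma_finite.PiM_eqI[OF product_sigma_finite_const[OF sf] \<open>finite I\<close>])
    fix A assume A: "\<And>i. i \<in> I \<Longrightarrow> A i \<in> sets (density N h)"
    then have A' [measurable]: "\<And>i. i \<in> I \<Longrightarrow> A i \<in> sets N" by simp
    have "emeasure (density (PiM I (\<lambda>_. N)) (\<lambda>x. \<Prod>i\<in>I. h (x i))) (Pi\<^sub>E I A)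
        = (\<integral>\<^sup>+x. (\<Prod>i\<in>I. h (x i)) * indicator (Pi\<^sub>E I A) x \<partial>PiM I (\<lambda>_. N))"
      using A \<open>finite I\<close> by (subst emeasure_density) (auto intro!: sets_PiM_I_finite)
    also have "\<dots> = (\<integral>\<^sup>+x. (\<Prod>i\<in>I. h (x i) * indicator (A i) (x i)) \<partial>PiM I (\<lambda>_. N))"
    proof (rule nn_integral_cong)
      fix x assume "x \<in> space (PiM I (\<lambda>_. N))"
      then have "(indicator (Pi\<^sub>E I A) x :: ennreal) = (\<Prod>i\<in>I. indicator (A i) (x i))"
        using \<open>finite I\<close> by (auto simp: indicator_def space_PiM PiE_iff)
      then show "(\<Prod>i\<in>I. h (x i)) * indicator (Pi\<^sub>E I A) x = (\<Prod>i\<in>I. h (x i) * indicator (A i) (x i))"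
        by (simp add: prod.distrib)
    qed
    also have "\<dots> = (\<Prod>i\<in>I. \<integral>\<^sup>+x. h x * indicator (A i) x \<partial>N)"
      using \<open>finite I\<close> by (intro product_sigma_finite.product_nn_integral_prod product_sigma_finite_const N) auto
    also have "\<dots> = (\<Prod>i\<in>I. emeasure (density N h) (A i))"
      by (intro prod.cong refl) (auto simp: emeasure_density)
    finally show "emeasure (density (PiM I (\<lambda>_. N)) (\<lambda>x. \<Prod>i\<in>I. h (x i))) (Pi\<^sub>E I A)
        = (\<Prod>i\<in>I. emeasure (density N h) (A i))" .
  qed (auto intro!: sets_PiM_cong)
  then show ?thesis by simp
qed

text \<open>Hypothesis \<open>eq\<close> says that the image of M under L is N with constant density
  c; the product of such measures has density c to the power \<open>card I\<close>.\<close>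

lemma nn_integral_PiM_map:
  assumes M: "sigma_finite_measure M" and N: "sigma_finite_measure N"
    and L [measurable]: "L \<in> M \<rightarrow>\<^sub>M N" and c: "c < (\<infinity>::ennreal)"
    and eq: "\<And>g. g \<in> borel_measurable N \<Longrightarrow> (\<integral>\<^sup>+x. g (L x) \<partial>M) = c * (\<integral>\<^sup>+y. g y \<partial>N)"
    and I: "finite (I :: nat set)" and G [measurable]: "G \<in> borel_measurable (PiM I (\<lambda>_. N))"
  shows "(\<integral>\<^sup>+x. G (\<lambda>i\<in>I. L (x i)) \<partial>PiM I (\<lambda>_. M)) = c ^ card I * (\<integral>\<^sup>+y. G y \<partial>PiM I (\<lambda>_. N))"
proof -
  have D: "distr M N L = density N (\<lambda>_. c)"
  proof (rule measure_eqI)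
    fix A assume "A \<in> sets (distr M N L)"
    then have [measurable]: "A \<in> sets N" by simp
    have "emeasure (distr M N L) A = (\<integral>\<^sup>+x. indicator A x \<partial>distr M N L)" by simp
    also have "\<dots> = (\<integral>\<^sup>+x. indicator A (L x) \<partial>M)" by (rule nn_integral_distr) auto
    also have "\<dots> = emeasure (density N (\<lambda>_. c)) A"
      by (subst eq) (auto simp: emeasure_density nn_integral_cmult)
    finally show "emeasure (distr M N L) A = emeasure (density N (\<lambda>_. c)) A" .
  qed simp
  have sf: "sigma_finite_measure (distr M N L)"
    unfolding D using c by (subst sigma_finite_measure.sigma_finite_iff_density_finite[OF N]) auto
  have "(\<integral>\<^sup>+x. G (\<lambda>i\<in>I. L (x i)) \<partial>PiM I (\<lambda>_. M))
      = (\<integral>\<^sup>+y. G y \<partial>distr (PiM I (\<lambda>_. M)) (PiM I (\<lambda>_. N)) (\<lambda>x. \<lambda>i\<in>I. L (x i)))"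
    by (subst nn_integral_distr) (auto intro!: measurable_restrict)
  also have "\<dots> = (\<integral>\<^sup>+y. G y \<partial>density (PiM I (\<lambda>_. N)) (\<lambda>x. \<Prod>i\<in>I. c))"
    unfolding distr_PiM_map[OF M sf L I] unfolding D using PiM_density[OF N _ _ I, of "\<lambda>_. c"] c by simp
  also have "\<dots> = c ^ card I * (\<integral>\<^sup>+y. G y \<partial>PiM I (\<lambda>_. N))"
    by (subst nn_integral_density) (auto simp: nn_integral_cmult)
  finally show ?thesis .
qed

text \<open>Serves to split the last coordinate off all vectors of a family at once. Equality is
  checked on boxes, where the integral factors over the index set.\<close>

lemma distr_PiM_pair:
  assumes M: "sigma_finite_measure M" and N: "sigma_finite_measure N" and "finite (I :: nat set)"
  shows "distr (PiM I (\<lambda>_. M) \<Otimes>\<^sub>M PiM I (\<lambda>_. N)) (PiM I (\<lambda>_. M \<Otimes>\<^sub>M N)) (\<lambda>(x, y). \<lambda>i\<in>I. (x i, y i))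
    = PiM I (\<lambda>_. M \<Otimes>\<^sub>M N)"
proof -
  interpret pair_sigma_finite M N using M N by (rule pair_sigma_finite.intro)
  interpret MN: product_sigma_finite "\<lambda>_::nat. M \<Otimes>\<^sub>M N"
    by (rule product_sigma_finite_const) unfold_locales
  interpret PM: product_sigma_finite "\<lambda>_::nat. M" by (rule product_sigma_finite_const[OF M])
  interpret PN: product_sigma_finite "\<lambda>_::nat. N" by (rule product_sigma_finite_const[OF N])
  interpret FN: finite_product_sigma_finite "\<lambda>_::nat. N" I by standard fact
  have [measurable]: "(\<lambda>(x, y). \<lambda>i\<in>I. (x i, y i)) \<in> PiM I (\<lambda>_. M) \<Otimes>\<^sub>M PiM I (\<lambda>_. N) \<rightarrow>\<^sub>M PiM I (\<lambda>_. M \<Otimes>\<^sub>M N)"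
    unfolding case_prod_beta by (intro measurable_restrict) measurable
  show ?thesis
  proof (rule MN.PiM_eqI[OF \<open>finite I\<close>])
    fix A assume A: "\<And>i. i \<in> I \<Longrightarrow> A i \<in> sets (M \<Otimes>\<^sub>M N)"
    then have A' [measurable]: "\<And>i. i \<in> I \<Longrightarrow> A i \<in> sets (M \<Otimes>\<^sub>M N)" by simp
    have [measurable]: "Pi\<^sub>E I A \<in> sets (PiM I (\<lambda>_. M \<Otimes>\<^sub>M N))" using A \<open>finite I\<close> by (intro sets_PiM_I_finite) auto
    let ?D = "distr (PiM I (\<lambda>_. M) \<Otimes>\<^sub>M PiM I (\<lambda>_. N)) (PiM I (\<lambda>_. M \<Otimes>\<^sub>M N)) (\<lambda>(x, y). \<lambda>i\<in>I. (x i, y i))"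
    have "emeasure ?D (Pi\<^sub>E I A) = (\<integral>\<^sup>+z. indicator (Pi\<^sub>E I A) z \<partial>?D)" by simp
    also have "\<dots> = (\<integral>\<^sup>+z. indicator (Pi\<^sub>E I A) ((\<lambda>(x, y). \<lambda>i\<in>I. (x i, y i)) z) \<partial>(PiM I (\<lambda>_. M) \<Otimes>\<^sub>M PiM I (\<lambda>_. N)))"
      by (rule nn_integral_distr) measurable
    also have "\<dots> = (\<integral>\<^sup>+x. \<integral>\<^sup>+y. indicator (Pi\<^sub>E I A) (\<lambda>i\<in>I. (x i, y i)) \<partial>PiM I (\<lambda>_. N) \<partial>PiM I (\<lambda>_. M))"
      by (subst FN.nn_integral_fst[symmetric]) auto
    also have "\<dots> = (\<integral>\<^sup>+x. \<integral>\<^sup>+y. (\<Prod>i\<in>I. indicator (A i) (x i, y i)) \<partial>PiM I (\<lambda>_. N) \<partial>PiM I (\<lambda>_. M))"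
      using \<open>finite I\<close> by (intro nn_integral_cong) (auto simp: indicator_def PiE_iff)
    also have "\<dots> = (\<integral>\<^sup>+x. (\<Prod>i\<in>I. \<integral>\<^sup>+y. indicator (A i) (x i, y) \<partial>N) \<partial>PiM I (\<lambda>_. M))"
    proof (rule nn_integral_cong)
      fix x assume x: "x \<in> space (PiM I (\<lambda>_. M))"
      then have "x i \<in> space M" if "i \<in> I" for i using that by (auto simp: space_PiM)
      then show "(\<integral>\<^sup>+y. (\<Prod>i\<in>I. indicator (A i) (x i, y i)) \<partial>PiM I (\<lambda>_. N)) = (\<Prod>i\<in>I. \<integral>\<^sup>+y. indicator (A i) (x i, y) \<partial>N)"
        using \<open>finite I\<close> by (intro PN.product_nn_integral_prod[where f="\<lambda>i y. indicator (A i) (x i, y)"]) auto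
    qed
    also have "\<dots> = (\<Prod>i\<in>I. \<integral>\<^sup>+x. \<integral>\<^sup>+y. indicator (A i) (x, y) \<partial>N \<partial>M)"
      using \<open>finite I\<close> by (intro PM.product_nn_integral_prod) auto
    also have "\<dots> = (\<Prod>i\<in>I. emeasure (M \<Otimes>\<^sub>M N) (A i))"
      by (intro prod.cong refl) (subst M2.emeasure_pair_measure, auto)
    finally show "emeasure ?D (Pi\<^sub>E I A) = (\<Prod>i\<in>I. emeasure (M \<Otimes>\<^sub>M N) (A i))" .
  qed simp
qed

text \<open>Gives all terms of a union bound the same integral once their indices have been permuted
  into standard position.\<close>

lemma nn_integral_PiM_reindex:
  assumes M: "sigma_finite_measure M" and "finite (I :: nat set)" "bij_betw \<sigma> I J"
    and G [measurable]: "G \<in> borel_measurable (PiM I (\<lambda>_. M))"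
  shows "(\<integral>\<^sup>+x. G (\<lambda>i\<in>I. x (\<sigma> i)) \<partial>PiM (J :: nat set) (\<lambda>_. M)) = (\<integral>\<^sup>+x. G x \<partial>PiM I (\<lambda>_. M))"
proof -
  have fJ: "finite J" using assms bij_betw_finite by blast
  have \<sigma>: "\<sigma> i \<in> J" if "i \<in> I" for i using assms(3) that by (auto simp: bij_betw_def)
  have [measurable]: "(\<lambda>x. \<lambda>i\<in>I. x (\<sigma> i)) \<in> PiM J (\<lambda>_. M) \<rightarrow>\<^sub>M PiM I (\<lambda>_. M)"
    using \<sigma> by (intro measurable_restrict) auto
  have "distr (PiM J (\<lambda>_. M)) (PiM I (\<lambda>_. M)) (\<lambda>x. \<lambda>i\<in>I. x (\<sigma> i)) = PiM I (\<lambda>_. M)"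
  proof (rule product_sigma_finite.PiM_eqI[OF product_sigma_finite_const[OF M] \<open>finite I\<close>])
    fix A assume A: "\<And>i. i \<in> I \<Longrightarrow> A i \<in> sets M"
    let ?\<tau> = "the_inv_into I \<sigma>"
    have \<tau>: "?\<tau> (\<sigma> i) = i" if "i \<in> I" for i using assms(3) that by (auto simp: bij_betw_def the_inv_into_f_f)
    have sp: "\<forall>i\<in>I. A i \<subseteq> space M" using A sets.sets_into_space by blast
    have J: "J = \<sigma> ` I" using assms(3) by (auto simp: bij_betw_def)
    have "emeasure (distr (PiM J (\<lambda>_. M)) (PiM I (\<lambda>_. M)) (\<lambda>x. \<lambda>i\<in>I. x (\<sigma> i))) (Pi\<^sub>E I A)
        = emeasure (PiM J (\<lambda>_. M)) (Pi\<^sub>E J (\<lambda>j. A (?\<tau> j)))"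
    proof (subst emeasure_distr)
      have "(\<lambda>x. \<lambda>i\<in>I. x (\<sigma> i)) -` Pi\<^sub>E I A \<inter> space (PiM J (\<lambda>_. M)) = Pi\<^sub>E J (\<lambda>j. A (?\<tau> j))"
      proof (rule set_eqI)
        fix x
        have "(\<forall>j\<in>J. x j \<in> A (?\<tau> j)) \<longleftrightarrow> (\<forall>i\<in>I. x (\<sigma> i) \<in> A i)" by (simp add: J \<tau>)
        moreover have "\<forall>j\<in>J. x j \<in> space M" if "\<forall>i\<in>I. x (\<sigma> i) \<in> A i"
          using that sp by (auto simp: J)
        ultimately show "x \<in> (\<lambda>x. \<lambda>i\<in>I. x (\<sigma> i)) -` Pi\<^sub>E I A \<inter> space (PiM J (\<lambda>_. M))
            \<longleftrightarrow> x \<in> Pi\<^sub>E J (\<lambda>j. A (?\<tau> j))"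
          unfolding space_PiM by (auto simp: PiE_iff)
      qed
      then show "emeasure (PiM J (\<lambda>_. M)) ((\<lambda>x. \<lambda>i\<in>I. x (\<sigma> i)) -` Pi\<^sub>E I A \<inter> space (PiM J (\<lambda>_. M)))
        = emeasure (PiM J (\<lambda>_. M)) (Pi\<^sub>E J (\<lambda>j. A (?\<tau> j)))" by simp
    qed (use A \<open>finite I\<close> in \<open>auto intro!: sets_PiM_I_finite\<close>)
    also have "\<dots> = (\<Prod>j\<in>J. emeasure M (A (?\<tau> j)))"
      using A \<tau> fJ by (intro product_sigma_finite.emeasure_PiM product_sigma_finite_const M) (auto simp: J)
    also have "\<dots> = (\<Prod>i\<in>I. emeasure M (A i))"
      using prod.reindex_bij_betw[OF assms(3), of "\<lambda>j. emeasure M (A (?\<tau> j))"] \<tau> by simp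
    finally show "emeasure (distr (PiM J (\<lambda>_. M)) (PiM I (\<lambda>_. M)) (\<lambda>x. \<lambda>i\<in>I. x (\<sigma> i))) (Pi\<^sub>E I A)
        = (\<Prod>i\<in>I. emeasure M (A i))" .
  qed simp
  then have "(\<integral>\<^sup>+x. G x \<partial>PiM I (\<lambda>_. M))
      = (\<integral>\<^sup>+x. G x \<partial>distr (PiM J (\<lambda>_. M)) (PiM I (\<lambda>_. M)) (\<lambda>x. \<lambda>i\<in>I. x (\<sigma> i)))" by simp
  also have "\<dots> = (\<integral>\<^sup>+x. G (\<lambda>i\<in>I. x (\<sigma> i)) \<partial>PiM J (\<lambda>_. M))"
    by (rule nn_integral_distr) measurable
  finally show ?thesis by simp
qed

lemma AE_PiM_insert:
  assumes M: "sigma_finite_measure M" and I: "finite (I :: nat set)" "i \<notin> I"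
    and [measurable]: "Measurable.pred (PiM (insert i I) (\<lambda>_. M)) P"
    and AE: "AE x in PiM I (\<lambda>_. M). AE y in M. P (x(i := y))"
  shows "AE x in PiM (insert i I) (\<lambda>_. M). P x"
proof -
  interpret product_sigma_finite "\<lambda>_::nat. M" by (rule product_sigma_finite_const[OF M])
  let ?f = "\<lambda>x. indicator {x. \<not> P x} x :: ennreal"
  have m: "?f \<in> borel_measurable (PiM (insert i I) (\<lambda>_. M))"
    unfolding indicator_def by measurable
  have "(\<integral>\<^sup>+x. ?f x \<partial>PiM (insert i I) (\<lambda>_. M)) = (\<integral>\<^sup>+x. \<integral>\<^sup>+y. ?f (x(i := y)) \<partial>M \<partial>PiM I (\<lambda>_. M))"
    by (rule product_nn_integral_insert[OF I m])
  also have "\<dots> = (\<integral>\<^sup>+x. 0 \<partial>PiM I (\<lambda>_. M))"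
  proof (rule nn_integral_cong_AE, use AE in eventually_elim)
    case (elim x)
    then have "(\<integral>\<^sup>+y. ?f (x(i := y)) \<partial>M) = (\<integral>\<^sup>+y. 0 \<partial>M)"
      by (intro nn_integral_cong_AE) (auto elim!: eventually_mono)
    then show ?case by simp
  qed
  finally have "AE x in PiM (insert i I) (\<lambda>_. M). ?f x = 0"
    using nn_integral_0_iff_AE[OF m] by simp
  then show ?thesis by (auto elim!: eventually_mono split: split_indicator_asm)
qed

section \<open>Families of vectors under product Lebesgue measure\<close>

interpretation Leb_prod: product_sigma_finite "\<lambda>_::nat. Leb n" for n
  by (rule product_sigma_finite_const[OF sigma_finite_Leb])

abbreviation PLeb :: "nat set \<Rightarrow> nat \<Rightarrow> (nat \<Rightarrow> fin_seq) measure" where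
  "PLeb I n \<equiv> PiM I (\<lambda>_. Leb n)"

lemma borel_measurable_PLeb_component [measurable]:
  "i \<in> I \<Longrightarrow> (\<lambda>X. X i) \<in> borel_measurable (PLeb I n)"
  using measurable_component_singleton[of i I "\<lambda>_. Leb n"] by (simp cong: measurable_cong_sets)

lemma borel_measurable_gs_vol_PLeb [measurable]: "(\<lambda>X. gs_vol X m) \<in> borel_measurable (PLeb {..<m} n)"
  by (rule borel_measurable_gs_vol) simp

text \<open>Complete u to an orthonormal basis with u in front; in these coordinates the hyperplane
  is the set where coordinate 0 vanishes, a box with one null factor.\<close>

lemma emeasure_Leb_hyperplane:
  assumes "u \<in> Rn n" "norm u = 1"
  shows "AE x in Leb n. x \<bullet> u \<noteq> 0"
proof -
  have n: "n \<ge> 1"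
  proof (rule ccontr)
    assume "\<not> n \<ge> 1"
    then have "u = 0" using assms(1) by (simp add: Rn_def fin_seq_eq_iff)
    then show False using assms(2) by simp
  qed
  obtain b where b: "orthonormal b n" "b 0 = u" "span (b ` {..<n}) = Rn n"
    using ex_orthonormal_extend[of "\<lambda>_. u" 1 n] assms n by (auto simp: orthonormal_def norm_eq_1)
  have m: "{x \<in> space borel. x \<bullet> u \<noteq> 0} \<in> sets borel" by measurable
  have "AE c in (\<Pi>\<^sub>M i\<in>{..<n}. (lborel :: real measure)). c 0 \<noteq> 0"
  proof (rule AE_I)
    let ?N = "\<Pi>\<^sub>E i\<in>{..<n}. if i = 0 then {0::real} else UNIV"
    show "{c \<in> space (\<Pi>\<^sub>M i\<in>{..<n}. lborel). \<not> c 0 \<noteq> 0} \<subseteq> ?N"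
      by (auto simp: space_PiM PiE_iff extensional_def)
    have "emeasure (\<Pi>\<^sub>M i\<in>{..<n}. lborel) ?N = (\<Prod>i<n. emeasure lborel (if i = 0 then {0::real} else UNIV))"
      by (intro lborel_prod.emeasure_PiM) auto
    also have "\<dots> = 0" using n by (intro prod_zero) auto
    finally show "emeasure (\<Pi>\<^sub>M i\<in>{..<n}. lborel) ?N = 0" .
    show "?N \<in> sets (\<Pi>\<^sub>M i\<in>{..<n}. lborel)" by (intro sets_PiM_I_finite) auto
  qed
  then have "AE x in Lb b n. x \<bullet> u \<noteq> 0"
    unfolding Lb_def using m orthonormal_inner_sum[OF b(1), of 0] n b(2)
    by (subst AE_distr_iff) auto
  then show ?thesis unfolding Lb_eq_Leb[OF b(1,3)] .
qed

text \<open>The span of fewer than n vectors lies in a hyperplane, which is a null set.\<close>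

lemma AE_Leb_res:
  assumes "\<And>i. i < j \<Longrightarrow> w i \<in> Rn n" "j < n"
  shows "AE x in Leb n. res w j x \<noteq> 0"
proof -
  obtain u where u: "u \<in> Rn n" "norm u = 1" "\<And>i. i < j \<Longrightarrow> u \<bullet> w i = 0"
    using ex_unit_orth[of j w n] assms by blast
  show ?thesis
    using emeasure_Leb_hyperplane[OF u(1,2)]
  proof eventually_elim
    case (elim x)
    show ?case
    proof
      assume "res w j x = 0"
      then have "x \<in> span (w ` {..<j})" by (simp add: res_eq_0_iff)
      then have "u \<bullet> x = 0" using u(3) by (rule span_orth[rotated, where A="{..<j}" and w=w]) auto
      then show False using elim by (simp add: inner_commute)
    qed
  qed
qed

lemma AE_PLeb_Rn:
  assumes "finite I"
  shows "AE X in PLeb I n. \<forall>i\<in>I. X i \<in> Rn n"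
  using assms
proof (induction I rule: finite_induct)
  case (insert i I)
  have [measurable]: "Measurable.pred (PLeb (insert i I) n) (\<lambda>X. \<forall>j\<in>insert i I. X j \<in> Rn n)"
    using insert.hyps by measurable
  show ?case
  proof (rule AE_PiM_insert[OF sigma_finite_Leb insert.hyps])
    show "AE x in PLeb I n. AE y in Leb n. \<forall>j\<in>insert i I. (x(i := y)) j \<in> Rn n"
      using insert.IH
    proof eventually_elim
      case (elim x)
      show ?case using AE_Leb_Rn[of n] by eventually_elim (use elim in auto)
    qed
  qed measurable
qed simp

text \<open>Given independent predecessors, almost every choice of the next vector avoids their
  span.\<close>

lemma AE_PLeb_gs_vol:
  assumes "j \<le> n"
  shows "AE X in PLeb {..<j} n. gs_vol X j \<noteq> 0"
  using assms
proof (induction j)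
  case (Suc j)
  have meas: "Measurable.pred (PLeb (insert j {..<j}) n) (\<lambda>X. gs_vol X (Suc j) \<noteq> 0)"
    unfolding lessThan_Suc[symmetric] by measurable
  have "AE X in PLeb (insert j {..<j}) n. gs_vol X (Suc j) \<noteq> 0"
  proof (rule AE_PiM_insert[OF sigma_finite_Leb _ _ meas])
    have "AE X in PLeb {..<j} n. gs_vol X j \<noteq> 0" using Suc by simp
    then show "AE X in PLeb {..<j} n. AE y in Leb n. gs_vol (X(j := y)) (Suc j) \<noteq> 0"
      using AE_PLeb_Rn[of "{..<j}" n, simplified]
    proof eventually_elim
      case (elim X)
      have "AE y in Leb n. res X j y \<noteq> 0" using elim Suc.prems by (intro AE_Leb_res) auto
      then show ?case
      proof eventually_elim
        case (elim y)
        have "gs_vol (X(j := y)) (Suc j) = gs_vol X j * norm (res X j y)"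
          unfolding gs_vol_Suc by (intro arg_cong2[of _ _ _ _ "(*)"] gs_vol_cong arg_cong[of _ _ norm]) (auto intro: res_cong)
        then show ?case using elim \<open>gs_vol X j \<noteq> 0\<close> by simp
      qed
    qed
  qed auto
  then show ?case by (simp only: lessThan_Suc)
qed simp

subsection \<open>Random determinants of points with a bounded density\<close>

text \<open>
  The kernel vector is the projection of a coordinate vector \<open>e\<^sub>j\<close> onto the kernel; the trace of that
  projection is at least \<open>card S - m\<close>, so some \<open>j\<close> has a large diagonal entry.
\<close>

lemma ex_kernel_vector:
  fixes S :: "nat set"
  assumes S: "finite S" "S \<noteq> {}" and x: "\<And>i. i \<in> S \<Longrightarrow> x i \<in> Rn m"
  obtains t j where "j \<in> S" "(\<Sum>i\<in>S. t i *\<^sub>R x i) = 0" "(\<Sum>i\<in>S. (t i)\<^sup>2) = t j"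
    "real (card S) * t j \<ge> real (card S) - real m"
proof -
  obtain N where N: "\<forall>i\<in>S. i < N" using S(1) finite_nat_set_iff_bounded by blast
  then have SN: "S \<subseteq> {..<N}" by auto
  \<comment> \<open>\<open>r i\<close> is row i of the matrix with columns \<open>x l\<close>, l in
    S; a vector orthogonal to the m rows is a relation between the columns.\<close>
  define r where "r i = (\<Sum>l\<in>S. coord (x l) i *\<^sub>R unit_vec l)" for i
  define V where "V = {y. \<forall>i. i \<notin> S \<longrightarrow> coord y i = 0}"
  have V: "subspace V" by (auto simp: V_def subspace_def)
  have unitV: "unit_vec l \<in> V" if "l \<in> S" for l using that by (auto simp: V_def coord_unit_vec)
  have rV: "r i \<in> V" for i unfolding r_def using V unitV by (intro subspace_sum subspace_scale) auto
  have VN: "V \<subseteq> Rn N" using N unfolding V_def Rn_def by (auto simp: not_less[symmetric])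
  define q where "q l = res r m (unit_vec l)" for l
  have "real N - real m \<le> (\<Sum>l<N. (norm (q l))\<^sup>2)"
    unfolding q_def using rV VN by (intro sum_norm_res_ge) auto
  also have "\<dots> = (\<Sum>l\<in>{..<N} - S. (norm (q l))\<^sup>2) + (\<Sum>l\<in>S. (norm (q l))\<^sup>2)"
    using SN by (subst sum.subset_diff[of S]) auto
  \<comment> \<open>Indices outside S contribute at most 1 each to the trace, so S keeps at least
    \<open>card S - m\<close> of it.\<close>
  also have "(\<Sum>l\<in>{..<N} - S. (norm (q l))\<^sup>2) \<le> (\<Sum>l\<in>{..<N} - S. 1)"
  proof (rule sum_mono)
    fix l
    have "norm (q l) \<le> norm (unit_vec l)" unfolding q_def by (rule norm_res_le)
    then have "norm (q l) \<le> 1" by (simp add: norm_eq_sqrt_inner coord_unit_vec)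
    then show "(norm (q l))\<^sup>2 \<le> 1" by (simp add: power_le_one)
  qed
  also have "(\<Sum>l\<in>{..<N} - S. 1) = real N - real (card S)"
    using SN S card_mono[OF _ SN] by (simp add: card_Diff_subset of_nat_diff)
  finally have tr: "real (card S) - real m \<le> (\<Sum>l\<in>S. (norm (q l))\<^sup>2)" by simp
  obtain j where j: "j \<in> S" "real (card S) - real m \<le> real (card S) * (norm (q j))\<^sup>2"
  proof (rule ccontr)
    assume "\<not> thesis"
    then have "\<forall>l\<in>S. real (card S) * (norm (q l))\<^sup>2 < real (card S) - real m" using that by force
    then have "(\<Sum>l\<in>S. real (card S) * (norm (q l))\<^sup>2) < (\<Sum>l\<in>S. real (card S) - real m)"
      using S by (intro sum_strict_mono) auto
    then show False using tr S by (simp add: sum_distrib_left[symmetric] mult_less_cancel_left)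
  qed
  have qV: "q j \<in> V" unfolding q_def using V rV unitV j by (intro res_in_subspace) auto
  have inn: "q j \<bullet> y = (\<Sum>l\<in>S. coord (q j) l * coord y l)" for y
    using qV S by (intro inner_fin_seq_alt) (auto simp: V_def)
  define t where "t = coord (q j)"
  show thesis
  proof (rule that)
    show "j \<in> S" by fact
    show "(\<Sum>i\<in>S. t i *\<^sub>R x i) = 0"
      unfolding fin_seq_eq_iff
    proof
      fix i
      show "coord (\<Sum>i\<in>S. t i *\<^sub>R x i) i = coord 0 i"
      proof (cases "i < m")
        case True
        have "coord (r i) l = coord (x l) i" if "l \<in> S" for l
        proof -
          have "coord (r i) l = (\<Sum>l'\<in>S. if l' = l then coord (x l) i else 0)"
            unfolding r_def coord_sum by (intro sum.cong) (auto simp: coord_unit_vec)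
          then show ?thesis using that S by simp
        qed
        then have "coord (\<Sum>i\<in>S. t i *\<^sub>R x i) i = q j \<bullet> r i"
          unfolding inn t_def coord_sum by (intro sum.cong) auto
        also have "\<dots> = 0" using res_orth[OF True, of r "unit_vec j"] by (simp add: q_def)
        finally show ?thesis by simp
      next
        case False
        then have "coord (x l) i = 0" if "l \<in> S" for l using x[OF that] by (simp add: Rn_def)
        then show ?thesis by simp
      qed
    qed
    have sq1: "(\<Sum>i\<in>S. (t i)\<^sup>2) = q j \<bullet> q j" by (simp add: inn t_def power2_eq_square)
    have "q j \<bullet> q j = unit_vec j \<bullet> q j" unfolding q_def by (rule inner_res_self)
    then have sq2: "q j \<bullet> q j = t j" by (simp add: t_def)
    note sq = sq1 sq2
    from sq1 sq2 show "(\<Sum>i\<in>S. (t i)\<^sup>2) = t j" by simp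
    show "real (card S) * t j \<ge> real (card S) - real m" using j sq by (simp add: power2_norm_eq_inner)
  qed
qed

text \<open>As long as more than m points remain, there is a nontrivial relation among them. Adding
  a multiple of it, with the sign for which the l1 norm does not grow, until the first coefficient
  vanishes shortens the combination; the number of points decreases.\<close>

lemma caratheodory_l1:
  fixes S :: "nat set"
  assumes "finite S" "\<And>i. i \<in> S \<Longrightarrow> x i \<in> Rn m"
  shows "\<exists>I s'. I \<subseteq> S \<and> card I \<le> m \<and> (\<Sum>i\<in>S. s i *\<^sub>R x i) = (\<Sum>i\<in>I. s' i *\<^sub>R x i)
    \<and> (\<Sum>i\<in>I. \<bar>s' i\<bar>) \<le> (\<Sum>i\<in>S. \<bar>s i :: real\<bar>)"
  using assms
proof (induction "card S" arbitrary: S s rule: less_induct)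
  case less
  have rec: ?case if i0: "i0 \<in> S" "s' i0 = 0" and eq: "(\<Sum>i\<in>S. s i *\<^sub>R x i) = (\<Sum>i\<in>S. s' i *\<^sub>R x i)"
    and le: "(\<Sum>i\<in>S. \<bar>s' i\<bar>) \<le> (\<Sum>i\<in>S. \<bar>s i\<bar>)" for i0 s'
  proof -
    have "\<exists>I s''. I \<subseteq> S - {i0} \<and> card I \<le> m \<and> (\<Sum>i\<in>S - {i0}. s' i *\<^sub>R x i) = (\<Sum>i\<in>I. s'' i *\<^sub>R x i)
        \<and> (\<Sum>i\<in>I. \<bar>s'' i\<bar>) \<le> (\<Sum>i\<in>S - {i0}. \<bar>s' i\<bar>)"
      using less.prems i0 by (intro less.hyps card_Diff1_less) auto
    moreover have "(\<Sum>i\<in>S - {i0}. s' i *\<^sub>R x i) = (\<Sum>i\<in>S. s' i *\<^sub>R x i)"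
      "(\<Sum>i\<in>S - {i0}. \<bar>s' i\<bar>) = (\<Sum>i\<in>S. \<bar>s' i\<bar>)"
      using i0 less.prems by (simp_all add: sum_diff1)
    ultimately show ?thesis using eq le by (smt (verit) Diff_subset order_trans)
  qed
  show ?case
  proof (cases "card S \<le> m")
    case True
    then show ?thesis by (intro exI[of _ S] exI[of _ s]) auto
  next
    case False
    show ?thesis
    proof (cases "\<exists>i0\<in>S. s i0 = 0")
      case True
      then show ?thesis using rec by blast
    next
      case nz: False
      from False have "S \<noteq> {}" by auto
      obtain t j where t: "j \<in> S" "(\<Sum>i\<in>S. t i *\<^sub>R x i) = 0" "real (card S) * t j \<ge> real (card S) - real m"
        by (rule ex_kernel_vector[OF less.prems(1) \<open>S \<noteq> {}\<close> less.prems(2)]) (assumption | rule that)+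
      have "real (card S) * t j > 0" using t(3) False by simp
      then have tj: "t j \<noteq> 0" by auto
      \<comment> \<open>The sign makes the derivative of the l1 norm of s in the direction r
        nonpositive.\<close>
      define c :: real where "c = (if (\<Sum>i\<in>S. sgn (s i) * t i) \<le> 0 then 1 else - 1)"
      define r where "r i = c * t i" for i
      have r0: "(\<Sum>i\<in>S. r i *\<^sub>R x i) = 0"
        using t(2) by (simp add: r_def scaleR_scaleR[symmetric] scaleR_sum_right[symmetric] del: scaleR_scaleR)
      have "(\<Sum>i\<in>S. sgn (s i) * r i) = c * (\<Sum>i\<in>S. sgn (s i) * t i)"
        by (simp add: r_def sum_distrib_left mult_ac)
      then have rle: "(\<Sum>i\<in>S. sgn (s i) * r i) \<le> 0" by (auto simp: c_def)
      have rj: "r j \<noteq> 0" using tj by (simp add: r_def c_def)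
      define T where "T = {i\<in>S. sgn (s i) * r i < 0}"
      have "T \<noteq> {}"
      proof
        assume "T = {}"
        then have nn: "\<forall>i\<in>S. 0 \<le> sgn (s i) * r i" by (auto simp: T_def not_less)
        then have "(\<Sum>i\<in>S. sgn (s i) * r i) = 0" using rle sum_nonneg[of S "\<lambda>i. sgn (s i) * r i"] by simp
        then have "sgn (s j) * r j = 0" using nn t(1) less.prems(1) by (subst (asm) sum_nonneg_eq_0_iff) auto
        then show False using rj nz t(1) by (auto simp: sgn_eq_0_iff)
      qed
      have fT: "finite T" using less.prems(1) by (simp add: T_def)
      \<comment> \<open>The first time at which a coefficient moving towards zero reaches it. Up to
        then no sign changes, so the l1 norm is affine in the step length.\<close>
      define \<tau> where "\<tau> = Min ((\<lambda>i. \<bar>s i\<bar> / \<bar>r i\<bar>) ` T)"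
      have "\<tau> \<in> (\<lambda>i. \<bar>s i\<bar> / \<bar>r i\<bar>) ` T"
        unfolding \<tau>_def using fT \<open>T \<noteq> {}\<close> by (intro Min_in) auto
      then obtain i0 where i0: "i0 \<in> T" "\<tau> = \<bar>s i0\<bar> / \<bar>r i0\<bar>" by blast
      have \<tau>0: "\<tau> \<ge> 0" using i0 by simp
      define s' where "s' i = s i + \<tau> * r i" for i
      have "s' i0 = 0"
        using i0 unfolding s'_def T_def by (auto simp: sgn_if field_simps split: if_splits)
      have abs: "\<bar>s' i\<bar> = \<bar>s i\<bar> + \<tau> * (sgn (s i) * r i)" if "i \<in> S" for i
      proof -
        have s: "s i \<noteq> 0" using nz that by auto
        have "\<bar>s i\<bar> + \<tau> * (sgn (s i) * r i) \<ge> 0"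
        proof (cases "i \<in> T")
          case True
          then have ri: "sgn (s i) * r i < 0" by (simp add: T_def)
          have "\<tau> \<le> \<bar>s i\<bar> / \<bar>r i\<bar>" unfolding \<tau>_def using fT True by (intro Min_le) auto
          moreover have "\<bar>r i\<bar> > 0" using ri by auto
          ultimately have "\<tau> * \<bar>r i\<bar> \<le> \<bar>s i\<bar>" by (simp add: field_simps)
          moreover have "sgn (s i) * r i = - \<bar>r i\<bar>" using ri s by (auto simp: sgn_if abs_if split: if_splits)
          ultimately show ?thesis by simp
        next
          case False
          then have "0 \<le> sgn (s i) * r i" using that by (auto simp: T_def)
          then show ?thesis using \<tau>0 by simp
        qed
        moreover have "s' i = sgn (s i) * (\<bar>s i\<bar> + \<tau> * (sgn (s i) * r i))"
          using s by (auto simp: s'_def sgn_if)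
        ultimately show ?thesis using s by (auto simp: abs_mult)
      qed
      show ?thesis
      proof (rule rec[of i0 s'])
        show "i0 \<in> S" using i0 by (simp add: T_def)
        show "s' i0 = 0" by fact
        have "(\<Sum>i\<in>S. s' i *\<^sub>R x i) = (\<Sum>i\<in>S. s i *\<^sub>R x i) + \<tau> *\<^sub>R (\<Sum>i\<in>S. r i *\<^sub>R x i)"
          by (simp add: s'_def scaleR_add_left sum.distrib scaleR_sum_right)
        then show "(\<Sum>i\<in>S. s i *\<^sub>R x i) = (\<Sum>i\<in>S. s' i *\<^sub>R x i)" by (simp add: r0)
        have "(\<Sum>i\<in>S. \<bar>s' i\<bar>) = (\<Sum>i\<in>S. \<bar>s i\<bar>) + \<tau> * (\<Sum>i\<in>S. sgn (s i) * r i)"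
          by (simp add: abs sum.distrib sum_distrib_left)
        also have "\<dots> \<le> (\<Sum>i\<in>S. \<bar>s i\<bar>)" using \<tau>0 rle by (simp add: mult_nonneg_nonpos)
        finally show "(\<Sum>i\<in>S. \<bar>s' i\<bar>) \<le> (\<Sum>i\<in>S. \<bar>s i\<bar>)" .
      qed
    qed
  qed
qed

text \<open>The trace bound gives a relation t with \<open>t j\<close> at least (m + 1)/(2m + 1) >
  1/2 and sum of squares equal to \<open>t j\<close>. Dividing by \<open>t j\<close> leaves
  coefficients with square sum at most 2 on 2m points, hence l1 norm at most 2 sqrt m by
  Cauchy-Schwarz. Then the combination is reduced to at most m points and padded with zero
  coefficients.\<close>

lemma ex_short_combination:
  assumes m: "m \<ge> 1" and x: "\<And>i. i < 2 * m + 1 \<Longrightarrow> x i \<in> Rn m"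
  obtains j I s where "j < 2 * m + 1" "I \<subseteq> {..<2 * m + 1} - {j}" "card I = m"
    "x j = (\<Sum>i\<in>I. s i *\<^sub>R x i)" "(\<Sum>i\<in>I. \<bar>s i :: real\<bar>) \<le> 2 * sqrt m"
proof -
  let ?S = "{..<2 * m + 1}"
  obtain t j where t: "j \<in> ?S" "(\<Sum>i\<in>?S. t i *\<^sub>R x i) = 0" "(\<Sum>i\<in>?S. (t i)\<^sup>2) = t j"
    "real (card ?S) * t j \<ge> real (card ?S) - real m"
  proof (rule ex_kernel_vector[of ?S x m])
    show "x i \<in> Rn m" if "i \<in> ?S" for i using that x by simp
  qed (use that lessThan_empty_iff in auto)
  have "real m + 1 \<le> (2 * real m + 1) * t j" using t(4) by (simp add: algebra_simps)
  have tj: "t j \<ge> 1 / 2"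
  proof (rule ccontr)
    assume "\<not> t j \<ge> 1 / 2"
    then have "(2 * real m + 1) * t j \<le> (2 * real m + 1) * (1 / 2)" by (intro mult_left_mono) auto
    moreover have "(2 * real m + 1) * (1 / 2) = real m + 1 / 2" by (simp add: field_simps)
    ultimately show False using \<open>real m + 1 \<le> (2 * real m + 1) * t j\<close> by linarith
  qed
  define s where "s i = - t i / t j" for i
  let ?S' = "?S - {j}"
  have "0 = t j *\<^sub>R x j + (\<Sum>i\<in>?S'. t i *\<^sub>R x i)" 
    using t(2) sum.remove[of ?S j "\<lambda>i. t i *\<^sub>R x i"] t(1) by (simp del: sum.lessThan_Suc)
  then have eq: "t j *\<^sub>R x j = (\<Sum>i\<in>?S'. (- t i) *\<^sub>R x i)" by (simp add: sum_negf eq_neg_iff_add_eq_0)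
  have xj: "x j = (\<Sum>i\<in>?S'. s i *\<^sub>R x i)"
  proof -
    have "x j = (1 / t j) *\<^sub>R (t j *\<^sub>R x j)" using tj by simp
    also have "\<dots> = (\<Sum>i\<in>?S'. (1 / t j) *\<^sub>R ((- t i) *\<^sub>R x i))" by (simp only: eq scaleR_sum_right)
    also have "\<dots> = (\<Sum>i\<in>?S'. s i *\<^sub>R x i)" by (intro sum.cong) (simp_all add: s_def)
    finally show ?thesis .
  qed
  have c: "card ?S' = 2 * m" using t(1) by simp
  have "(\<Sum>i\<in>?S'. \<bar>s i\<bar>)\<^sup>2 \<le> (\<Sum>i\<in>?S'. \<bar>s i\<bar>\<^sup>2) * real (card ?S')"
    by (rule sum_squared_le_sum_of_squares)
  also have "(\<Sum>i\<in>?S'. \<bar>s i\<bar>\<^sup>2) = (\<Sum>i\<in>?S'. (t i)\<^sup>2) / (t j)\<^sup>2"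
    by (simp add: s_def power_divide sum_divide_distrib)
  also have "\<dots> \<le> t j / (t j)\<^sup>2"
    unfolding t(3)[symmetric] by (intro divide_right_mono sum_mono2) auto
  also have "\<dots> \<le> 2" using tj by (simp add: power2_eq_square field_simps)
  finally have "(\<Sum>i\<in>?S'. \<bar>s i\<bar>)\<^sup>2 \<le> 4 * real m" using c by (simp add: mult_right_mono)
  then have "(\<Sum>i\<in>?S'. \<bar>s i\<bar>) \<le> sqrt (4 * real m)" by (rule real_le_rsqrt)
  then have l1: "(\<Sum>i\<in>?S'. \<bar>s i\<bar>) \<le> 2 * sqrt m" by (simp add: real_sqrt_mult)
  obtain I s' where I: "I \<subseteq> ?S'" "card I \<le> m" "(\<Sum>i\<in>?S'. s i *\<^sub>R x i) = (\<Sum>i\<in>I. s' i *\<^sub>R x i)"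
    "(\<Sum>i\<in>I. \<bar>s' i\<bar>) \<le> (\<Sum>i\<in>?S'. \<bar>s i\<bar>)"
    using caratheodory_l1[of ?S' x m s] x by auto
  obtain J where J: "I \<subseteq> J" "J \<subseteq> ?S'" "card J = m"
    using exists_subset_between[of I m ?S'] I c by auto
  have fJ: "finite J" using J finite_subset by blast
  define s'' where "s'' i = (if i \<in> I then s' i else 0)" for i
  have "x j = (\<Sum>i\<in>J. s'' i *\<^sub>R x i)"
    unfolding xj I(3) using J fJ by (intro sum.mono_neutral_cong_left) (auto simp: s''_def)
  moreover have "(\<Sum>i\<in>J. \<bar>s'' i\<bar>) = (\<Sum>i\<in>I. \<bar>s' i\<bar>)"
    using J fJ by (intro sum.mono_neutral_cong_right) (auto simp: s''_def)
  ultimately show thesis using J I l1 t(1) by (intro that[of j J s'']) auto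
qed

section \<open>Cross-polytopes spanned by m points\<close>

lemma diff_res_combination: "\<exists>a. x - res w j x = (\<Sum>i<j. a i *\<^sub>R w i)"
  using in_span_family[OF diff_res_in_span] by metis

text \<open>
  The \<open>i\<close>-th coordinate in the basis \<open>X\<^sub>0, \<dots>, X\<^bsub>m-1\<^esub>\<close>. The vector \<open>u\<close> is the component of \<open>X\<^sub>i\<close>
  orthogonal to the other basis vectors.
\<close>

definition dual_coord :: "(nat \<Rightarrow> fin_seq) \<Rightarrow> nat \<Rightarrow> nat \<Rightarrow> fin_seq \<Rightarrow> real" where
  "dual_coord X m i x =
    (let u = res (\<lambda>j. X (if j < i then j else Suc j)) (m - 1) (X i) in (x \<bullet> u) / (X i \<bullet> u))"

text \<open>Inner products with u single out the term of \<open>X i\<close>. The denominator is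
  |u|^2, and u is nonzero since otherwise \<open>X i\<close> would be a combination of the other
  vectors.\<close>

lemma dual_coord_sum:
  assumes D: "gs_vol X m \<noteq> 0" and i: "i < m"
  shows "dual_coord X m i (\<Sum>j<m. c j *\<^sub>R X j) = c i"
proof -
  define sk where "sk j = (if j < i then j else Suc j)" for j
  define u where "u = res (\<lambda>j. X (sk j)) (m - 1) (X i)"
  have inj: "inj_on sk {..<m - 1}" by (auto simp: sk_def inj_on_def split: if_splits)
  have im: "sk ` {..<m - 1} = {..<m} - {i}"
  proof
    show "{..<m} - {i} \<subseteq> sk ` {..<m - 1}"
    proof
      fix j assume j: "j \<in> {..<m} - {i}"
      show "j \<in> sk ` {..<m - 1}"
        using j i by (intro image_eqI[of _ _ "if j < i then j else j - 1"]) (auto simp: sk_def)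
    qed
  qed (use i in \<open>auto simp: sk_def\<close>)
  have orth: "u \<bullet> X j = 0" if "j < m" "j \<noteq> i" for j
  proof -
    have "j \<in> sk ` {..<m - 1}" unfolding im using that by simp
    then obtain j' where "j' < m - 1" "j = sk j'" by auto
    then show ?thesis using res_orth[of j' "m - 1" "\<lambda>j. X (sk j)" "X i"] by (simp add: u_def)
  qed
  have "u \<noteq> 0"
  proof
    assume "u = 0"
    then obtain a where a: "X i = (\<Sum>j<m - 1. a j *\<^sub>R X (sk j))"
      using diff_res_combination[of "X i" "\<lambda>j. X (sk j)" "m - 1"] by (auto simp: u_def)
    define r where "r j = (if j = i then - 1 else a (the_inv_into {..<m - 1} sk j))" for j
    have "(\<Sum>j<m. r j *\<^sub>R X j) = - X i + (\<Sum>j\<in>sk ` {..<m - 1}. r j *\<^sub>R X j)"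
      unfolding im using i by (subst sum.remove[of _ i]) (auto simp: r_def)
    also have "(\<Sum>j\<in>sk ` {..<m - 1}. r j *\<^sub>R X j) = (\<Sum>j<m - 1. r (sk j) *\<^sub>R X (sk j))"
      by (subst sum.reindex[OF inj]) simp
    also have "\<dots> = (\<Sum>j<m - 1. a j *\<^sub>R X (sk j))"
    proof (rule sum.cong)
      fix j assume "j \<in> {..<m - 1}"
      then have "sk j \<noteq> i" "the_inv_into {..<m - 1} sk (sk j) = j"
        using the_inv_into_f_f[OF inj] by (auto simp: sk_def)
      then show "r (sk j) *\<^sub>R X (sk j) = a j *\<^sub>R X (sk j)" by (simp add: r_def)
    qed simp
    finally have "(\<Sum>j<m. r j *\<^sub>R X j) = 0" using a by simp
    then have "r i = 0" by (rule independent_gs_vol[OF D _ i])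
    then show False by (simp add: r_def)
  qed
  then have nz: "X i \<bullet> u \<noteq> 0" unfolding u_def inner_res_self[symmetric] by simp
  have "(\<Sum>j<m. c j *\<^sub>R X j) \<bullet> u = (\<Sum>j<m. if j = i then c i * (X i \<bullet> u) else 0)"
    unfolding inner_sum_left using orth by (intro sum.cong) (auto simp: inner_commute)
  also have "\<dots> = c i * (X i \<bullet> u)" using i by simp
  finally show ?thesis using nz unfolding dual_coord_def u_def sk_def Let_def by simp
qed

text \<open>
  An exponential majorant of the indicator of the cross-polytope with vertices \<open>\<plusminus> 2\<surd>m X\<^sub>i\<close>; its integral,
  unlike the volume, is a product over the coordinates.
\<close>

definition simplex_weight :: "nat \<Rightarrow> (nat \<Rightarrow> fin_seq) \<Rightarrow> fin_seq \<Rightarrow> ennreal" where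
  "simplex_weight m X x = (if gs_vol X m = 0 then \<infinity>
     else ennreal (exp (real m - sqrt m / 2 * (\<Sum>i<m. \<bar>dual_coord X m i x\<bar>))))"

text \<open>For l1 norm at most 2 sqrt m the exponent is nonnegative, as sqrt m / 2 times 2 sqrt m
  is m. The value infinity for dependent families, which form a null set, makes the bound
  unconditional.\<close>

lemma simplex_weight_ge_1:
  assumes "x = (\<Sum>i<m. s i *\<^sub>R X i)" "(\<Sum>i<m. \<bar>s i\<bar>) \<le> 2 * sqrt m"
  shows "simplex_weight m X x \<ge> 1"
proof (cases "gs_vol X m = 0")
  case False
  then have "(\<Sum>i<m. \<bar>dual_coord X m i x\<bar>) = (\<Sum>i<m. \<bar>s i\<bar>)"
    by (intro sum.cong) (auto simp: assms(1) dual_coord_sum)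
  then have "sqrt m / 2 * (\<Sum>i<m. \<bar>dual_coord X m i x\<bar>) \<le> sqrt m / 2 * (2 * sqrt m)"
    using assms(2) by (intro mult_left_mono) auto
  also have "\<dots> = real m" by simp
  finally show ?thesis using False by (simp add: simplex_weight_def flip: ennreal_1)
qed (simp add: simplex_weight_def)

lemma borel_measurable_dual_coord:
  assumes "\<And>j. j < m \<Longrightarrow> (\<lambda>z. X z j) \<in> borel_measurable M" "x \<in> borel_measurable M" "i < m"
  shows "(\<lambda>z. dual_coord (X z) m i (x z)) \<in> borel_measurable M"
proof -
  have [measurable]: "(\<lambda>z. res (\<lambda>j. X z (if j < i then j else Suc j)) (m - 1) (X z i)) \<in> borel_measurable M"
    using assms by (intro borel_measurable_res) auto
  have [measurable]: "(\<lambda>z. X z i) \<in> borel_measurable M" "x \<in> borel_measurable M" using assms by auto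
  show ?thesis unfolding dual_coord_def Let_def by measurable
qed

lemma borel_measurable_simplex_weight [measurable (raw)]:
  assumes "\<And>j. j < m \<Longrightarrow> (\<lambda>z. X z j) \<in> borel_measurable M" "x \<in> borel_measurable M"
  shows "(\<lambda>z. simplex_weight m (X z) (x z)) \<in> borel_measurable M"
proof -
  have [measurable]: "(\<lambda>z. gs_vol (X z) m) \<in> borel_measurable M"
    using assms by (intro borel_measurable_gs_vol) auto
  have [measurable]: "(\<lambda>z. \<Sum>i<m. \<bar>dual_coord (X z) m i (x z)\<bar>) \<in> borel_measurable M"
    using assms by (intro borel_measurable_sum borel_measurable_abs borel_measurable_dual_coord) auto
  show ?thesis unfolding simplex_weight_def by measurable
qed

lemma nn_integral_exp_abs:
  assumes "a > 0"
  shows "(\<integral>\<^sup>+s. ennreal (exp (- a * \<bar>s\<bar>)) \<partial>lborel) \<le> ennreal (2 / a)"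
proof -
  have half: "(\<integral>\<^sup>+s. ennreal (exp (- a * s)) * indicator {0..} s \<partial>lborel) = ennreal (1 / a)"
  proof -
    have "LIM s at_top. (- a) * s :> at_bot"
      using assms by (intro filterlim_tendsto_neg_mult_at_bot[OF tendsto_const _ filterlim_ident]) simp
    then have "((\<lambda>s. exp (- a * s)) \<longlongrightarrow> 0) at_top" by (rule filterlim_compose[OF exp_at_bot])
    then have "((\<lambda>s. - (exp (- a * s) / a)) \<longlongrightarrow> - (0 / a)) at_top"
      using assms by (intro tendsto_minus tendsto_divide tendsto_const) auto
    then have "((\<lambda>s. - (exp (- a * s) / a)) \<longlongrightarrow> 0) at_top" by simp
    then have "(\<integral>\<^sup>+s. ennreal (exp (- a * s)) * indicator {0..} s \<partial>lborel) = ennreal (0 - (- (exp (- a * 0) / a)))"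
      using assms
      by (intro nn_integral_FTC_atLeast[where F="\<lambda>s. - (exp (- a * s) / a)"])
         (auto intro!: derivative_eq_intros)
    then show ?thesis by simp
  qed
  have "(\<integral>\<^sup>+s. ennreal (exp (- a * \<bar>s\<bar>)) \<partial>lborel)
      \<le> (\<integral>\<^sup>+s. ennreal (exp (- a * s)) * indicator {0..} s + ennreal (exp (- a * (- s))) * indicator {0..} (- s) \<partial>lborel)"
    by (intro nn_integral_mono) (auto simp: indicator_def abs_if)
  also have "\<dots> = (\<integral>\<^sup>+s. ennreal (exp (- a * s)) * indicator {0..} s \<partial>lborel)
      + (\<integral>\<^sup>+s. ennreal (exp (- a * (- s))) * indicator {0..} (- s) \<partial>lborel)"
    by (rule nn_integral_add) measurable
  also have "(\<integral>\<^sup>+s. ennreal (exp (- a * (- s))) * indicator {0..} (- s) \<partial>lborel)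
      = (\<integral>\<^sup>+s. ennreal (exp (- a * s)) * indicator {0..} s \<partial>lborel)"
    using nn_integral_real_affine[of "\<lambda>s. ennreal (exp (- a * s)) * indicator {0..} s" "-1" 0] by simp
  also have "(\<integral>\<^sup>+s. ennreal (exp (- a * s)) * indicator {0..} s \<partial>lborel)
      + (\<integral>\<^sup>+s. ennreal (exp (- a * s)) * indicator {0..} s \<partial>lborel) = ennreal (2 / a)"
    unfolding half using assms by (simp flip: ennreal_plus)
  finally show ?thesis .
qed

text \<open>In the coordinates of X the weight is a product. With exp(m) distributed evenly, each
  coordinate contributes at most e times 4 / sqrt m, and e <= 3 gives 12 / sqrt m. The factor
  \<open>gs_vol X m\<close> is the Jacobian.\<close>

lemma nn_integral_simplex_weight:
  assumes D: "gs_vol X m \<noteq> 0" and X: "\<And>i. i < m \<Longrightarrow> X i \<in> Rn m" and m: "m \<ge> 1"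
  shows "(\<integral>\<^sup>+x. simplex_weight m X x \<partial>Leb m) \<le> ennreal (gs_vol X m * (12 / sqrt m) ^ m)"
proof -
  have F [measurable]: "simplex_weight m X \<in> borel_measurable borel" by measurable
  have "Lb (gs X) m = Leb m"
    using orthonormal_gs[OF D] gs_vol_neq_0_imp_span[OF D X] by (intro Lb_eq_Leb) auto
  then have "(\<integral>\<^sup>+x. simplex_weight m X x \<partial>Leb m) = ennreal (gs_vol X m) * (\<integral>\<^sup>+x. simplex_weight m X x \<partial>Lb X m)"
    using nn_integral_Lb_gs[OF D F] by simp
  also have "(\<integral>\<^sup>+x. simplex_weight m X x \<partial>Lb X m)
      = (\<integral>\<^sup>+c. (\<Prod>i<m. ennreal (exp 1 * exp (- (sqrt m / 2) * \<bar>c i\<bar>))) \<partial>(\<Pi>\<^sub>M i\<in>{..<m}. lborel))"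
  proof (subst nn_integral_Lb[OF F], intro nn_integral_cong)
    fix c :: "nat \<Rightarrow> real"
    have "simplex_weight m X (\<Sum>i<m. c i *\<^sub>R X i) = ennreal (exp (real m - sqrt m / 2 * (\<Sum>i<m. \<bar>c i\<bar>)))"
      using D by (simp add: simplex_weight_def dual_coord_sum)
    also have "exp (real m - sqrt m / 2 * (\<Sum>i<m. \<bar>c i\<bar>)) = exp (\<Sum>i<m. 1 + - (sqrt m / 2) * \<bar>c i\<bar>)"
      by (simp add: sum_subtractf sum_distrib_left)
    also have "\<dots> = (\<Prod>i<m. exp 1 * exp (- (sqrt m / 2) * \<bar>c i\<bar>))"
      by (simp add: exp_sum exp_add[symmetric])
    finally show "simplex_weight m X (\<Sum>i<m. c i *\<^sub>R X i) = (\<Prod>i<m. ennreal (exp 1 * exp (- (sqrt m / 2) * \<bar>c i\<bar>)))"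
      by (simp add: prod_ennreal)
  qed
  also have "\<dots> = (\<Prod>i<m. \<integral>\<^sup>+s. ennreal (exp 1 * exp (- (sqrt m / 2) * \<bar>s\<bar>)) \<partial>lborel)"
    by (rule lborel_prod.product_nn_integral_prod) auto
  also have "\<dots> = (ennreal (exp 1) * (\<integral>\<^sup>+s. ennreal (exp (- (sqrt m / 2) * \<bar>s\<bar>)) \<partial>lborel)) ^ m"
    by (simp add: ennreal_mult nn_integral_cmult)
  also have "\<dots> \<le> (ennreal (3::real) * ennreal (2 / (sqrt m / 2))) ^ m"
    using m exp_le by (intro power_mono mult_mono nn_integral_exp_abs ennreal_leI) auto
  also have "\<dots> = ennreal ((12 / sqrt m) ^ m)"
  proof -
    have "ennreal (3::real) * ennreal (2 / (sqrt m / 2)) = ennreal (12 / sqrt m)"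
      by (subst ennreal_mult[symmetric]) auto
    then show ?thesis by (simp only: ennreal_power zero_le_divide_iff real_sqrt_ge_zero of_nat_0_le_iff zero_le_numeral simp_thms)
  qed
  finally show ?thesis by (simp add: ennreal_mult mult_left_mono)
qed

lemma measurable_Lb_eq: "measurable (Lb b d) N = measurable borel N" "measurable N (Lb b d) = measurable N borel"
  by (auto intro!: measurable_cong_sets)

text \<open>\<open>\<Phi>\<close> sees only the first p vectors, so each of the q further ones
  splits off as one factor. Measurability is asked for on every longer product because the same
  function is used on all of them.\<close>

lemma nn_integral_PLeb_extra:
  assumes \<Phi>: "\<Phi> \<in> borel_measurable (PLeb {..<p} n)" and g [measurable]: "g \<in> borel_measurable borel"
    and dep: "\<And>x y. (\<And>i. i < p \<Longrightarrow> x i = y i) \<Longrightarrow> \<Phi> x = \<Phi> y"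
    and meas: "\<And>q. \<Phi> \<in> borel_measurable (PLeb {..<p + q} n)"
  shows "(\<integral>\<^sup>+x. \<Phi> x * (\<Prod>i\<in>{p..<p + q}. g (x i)) \<partial>PLeb {..<p + q} n)
    = (\<integral>\<^sup>+x. \<Phi> x \<partial>PLeb {..<p} n) * (\<integral>\<^sup>+y. g y \<partial>Leb n) ^ q"
proof (induction q)
  case (Suc q)
  have ins: "{..<p + Suc q} = insert (p + q) {..<p + q}" by auto
  have prod: "(\<Prod>i\<in>{p..<p + Suc q}. g (x i)) = (\<Prod>i\<in>{p..<p + q}. g (x i)) * g (x (p + q))" for x :: "nat \<Rightarrow> fin_seq"
    by simp
  have [measurable]: "\<Phi> \<in> borel_measurable (PLeb {..<p + q} n)" for q by (rule meas)
  have m1: "(\<lambda>x. \<Phi> x * (\<Prod>i\<in>{p..<p + q}. g (x i))) \<in> borel_measurable (PLeb {..<p + q} n)"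
    by measurable
  have m2: "(\<lambda>x. \<Phi> x * (\<Prod>i\<in>{p..<p + Suc q}. g (x i))) \<in> borel_measurable (PLeb (insert (p + q) {..<p + q}) n)"
    unfolding ins[symmetric] by measurable
  have "(\<integral>\<^sup>+x. \<Phi> x * (\<Prod>i\<in>{p..<p + Suc q}. g (x i)) \<partial>PLeb {..<p + Suc q} n)
      = (\<integral>\<^sup>+x. \<integral>\<^sup>+y. \<Phi> (x(p + q := y)) * (\<Prod>i\<in>{p..<p + Suc q}. g ((x(p + q := y)) i)) \<partial>Leb n \<partial>PLeb {..<p + q} n)"
    unfolding ins using m2 by (intro Leb_prod.product_nn_integral_insert) auto
  also have "\<dots> = (\<integral>\<^sup>+x. \<integral>\<^sup>+y. (\<Phi> x * (\<Prod>i\<in>{p..<p + q}. g (x i))) * g y \<partial>Leb n \<partial>PLeb {..<p + q} n)"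
  proof (intro nn_integral_cong)
    fix x :: "nat \<Rightarrow> fin_seq" and y
    have "\<Phi> (x(p + q := y)) = \<Phi> x" by (rule dep) auto
    moreover have "(\<Prod>i\<in>{p..<p + q}. g ((x(p + q := y)) i)) = (\<Prod>i\<in>{p..<p + q}. g (x i))" by (intro prod.cong) auto
    ultimately show "\<Phi> (x(p + q := y)) * (\<Prod>i\<in>{p..<p + Suc q}. g ((x(p + q := y)) i))
        = \<Phi> x * (\<Prod>i\<in>{p..<p + q}. g (x i)) * g y"
      by (simp add: mult_ac del: fun_upd_apply) (simp add: mult_ac)
  qed
  also have "\<dots> = (\<integral>\<^sup>+x. \<Phi> x * (\<Prod>i\<in>{p..<p + q}. g (x i)) \<partial>PLeb {..<p + q} n) * (\<integral>\<^sup>+y. g y \<partial>Leb n)"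
  proof -
    have "(\<integral>\<^sup>+y. (\<Phi> x * (\<Prod>i\<in>{p..<p + q}. g (x i))) * g y \<partial>Leb n)
        = (\<Phi> x * (\<Prod>i\<in>{p..<p + q}. g (x i))) * (\<integral>\<^sup>+y. g y \<partial>Leb n)" for x
      by (rule nn_integral_cmult) (simp add: measurable_Lb_eq)
    then show ?thesis using nn_integral_multc[OF m1] by simp
  qed
  finally show ?case by (simp add: Suc.IH mult_ac)
qed simp

lemma card_pairs_le: "card (SIGMA j:{..<N}. {I. I \<subseteq> {..<N} - {j} \<and> card I = m}) \<le> N * 2 ^ N"
proof -
  have "card (SIGMA j:{..<N}. {I. I \<subseteq> {..<N} - {j} \<and> card I = m}) \<le> card ({..<N} \<times> Pow {..<N})"
    by (intro card_mono) auto
  then show ?thesis by (simp add: card_cartesian_product card_Pow)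
qed

text \<open>Standard position for the union bound: the m spanning points first, the covered point at
  index m, the m remaining points last.\<close>

lemma ex_reindexing:
  assumes "j < 2 * m + 1" "I \<subseteq> {..<2 * m + 1} - {j}" "card I = m"
  shows "\<exists>\<sigma>. bij_betw \<sigma> {..<2 * m + 1} {..<2 * m + 1} \<and> \<sigma> ` {..<m} = I \<and> \<sigma> m = (j::nat)"
proof -
  have fI: "finite I" using assms finite_subset by blast
  obtain \<alpha> where \<alpha>: "bij_betw \<alpha> {..<m} I"
    using ex_bij_betw_nat_finite[OF fI] assms by (auto simp: atLeast0LessThan)
  let ?R = "{..<2 * m + 1} - insert j I"
  have "j \<notin> I" using assms by auto
  then have "card (insert j I) = m + 1" using fI assms by simp
  then have "card ?R = m" using assms fI by (subst card_Diff_subset) auto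
  then obtain \<beta> where \<beta>: "bij_betw \<beta> {m + 1..<2 * m + 1} ?R"
    using finite_same_card_bij[of "{m + 1..<2 * m + 1}" ?R] by auto
  define \<sigma> where "\<sigma> i = (if i < m then \<alpha> i else if i = m then j else \<beta> i)" for i
  have b1: "bij_betw \<sigma> {..<m} I" using \<alpha> by (subst bij_betw_cong[of _ _ \<alpha>]) (auto simp: \<sigma>_def)
  have b2: "bij_betw \<sigma> {m} {j}" by (simp add: bij_betw_def \<sigma>_def)
  have b3: "bij_betw \<sigma> {m + 1..<2 * m + 1} ?R" using \<beta> by (subst bij_betw_cong[of _ _ \<beta>]) (auto simp: \<sigma>_def)
  have "bij_betw \<sigma> (({..<m} \<union> {m}) \<union> {m + 1..<2 * m + 1}) ((I \<union> {j}) \<union> ?R)"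
    using b1 b2 b3 assms by (intro bij_betw_combine) auto
  moreover have "({..<m} \<union> {m}) \<union> {m + 1..<2 * m + 1} = {..<2 * m + 1}" by auto
  moreover have "(I \<union> {j}) \<union> ?R = {..<2 * m + 1}" using assms by auto
  ultimately have "bij_betw \<sigma> {..<2 * m + 1} {..<2 * m + 1}" by simp
  moreover have "\<sigma> ` {..<m} = I" using b1 by (simp add: bij_betw_def)
  moreover have "\<sigma> m = j" by (simp add: \<sigma>_def)
  ultimately show ?thesis by blast
qed

text \<open>Union bound over the choice of the point and of the \<open>m\<close> points that span the cross-polytope around it.\<close>

lemma random_det_first_moment_aux:
  assumes g [measurable]: "g \<in> borel_measurable borel" and gM: "\<And>x. g x \<le> ennreal M" and M: "M > 0" and m: "m \<ge> 1"
  shows "(\<integral>\<^sup>+x. g x \<partial>Leb m) ^ (2 * m + 1)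
    \<le> ennreal (real ((2 * m + 1) * 2 ^ (2 * m + 1)) * M * (12 / sqrt m) ^ m)
      * (\<integral>\<^sup>+X. ennreal (gs_vol X m) * (\<Prod>i<m. g (X i)) \<partial>PLeb {..<m} m) * (\<integral>\<^sup>+x. g x \<partial>Leb m) ^ m"
proof -
  let ?N = "2 * m + 1"
  define v where "v = (12 / sqrt m) ^ m"
  have v: "v \<ge> 0" by (simp add: v_def)
  define a where "a = (\<integral>\<^sup>+x. g x \<partial>Leb m)"
  define J where "J = (\<integral>\<^sup>+X. ennreal (gs_vol X m) * (\<Prod>i<m. g (X i)) \<partial>PLeb {..<m} m)"
  define Pairs where "Pairs = (SIGMA j:{..<?N}. {I. I \<subseteq> {..<?N} - {j} \<and> card I = m})"
  have fin: "finite Pairs" unfolding Pairs_def by (intro finite_SigmaI) auto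
  have "\<forall>p\<in>Pairs. \<exists>\<sigma>. bij_betw \<sigma> {..<?N} {..<?N} \<and> \<sigma> ` {..<m} = snd p \<and> \<sigma> m = fst p"
    unfolding Pairs_def using ex_reindexing by auto
  then obtain \<sigma> where \<sigma>: "\<And>p. p \<in> Pairs \<Longrightarrow> bij_betw (\<sigma> p) {..<?N} {..<?N}"
      "\<And>p. p \<in> Pairs \<Longrightarrow> \<sigma> p ` {..<m} = snd p" "\<And>p. p \<in> Pairs \<Longrightarrow> \<sigma> p m = fst p"
    by (metis (no_types, lifting))
  \<comment> \<open>The term of the union bound in standard position: vectors 0 to m - 1 span the
    cross-polytope, vector m is covered by it, and the last m vectors are free.\<close>
  define \<Phi> where "\<Phi> X = simplex_weight m X (X m) * (\<Prod>i<?N. g (X i))" for X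
  have mF: "(\<lambda>X. simplex_weight m X (X m)) \<in> borel_measurable (PLeb {..<q} m)" if "m < q" for q
    using that by (intro borel_measurable_simplex_weight borel_measurable_PLeb_component) auto
  have m\<Phi> [measurable]: "\<Phi> \<in> borel_measurable (PLeb {..<?N} m)"
  proof -
    have [measurable]: "(\<lambda>X. simplex_weight m X (X m)) \<in> borel_measurable (PLeb {..<?N} m)" by (rule mF) simp
    show ?thesis unfolding \<Phi>_def by measurable
  qed
  have eq\<Phi>: "\<Phi> (\<lambda>i\<in>{..<?N}. X (\<sigma> p i)) = simplex_weight m (\<lambda>i. X (\<sigma> p i)) (X (fst p)) * (\<Prod>i<?N. g (X i))"
    if p: "p \<in> Pairs" for p X
  proof -
    have "gs_vol (\<lambda>i\<in>{..<?N}. X (\<sigma> p i)) m = gs_vol (\<lambda>i. X (\<sigma> p i)) m" by (rule gs_vol_cong) auto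
    moreover have "dual_coord (\<lambda>i\<in>{..<?N}. X (\<sigma> p i)) m i x = dual_coord (\<lambda>i. X (\<sigma> p i)) m i x" if "i < m" for i x
    proof -
      have "res (\<lambda>j. (\<lambda>i\<in>{..<?N}. X (\<sigma> p i)) (if j < i then j else Suc j)) (m - 1) y
          = res (\<lambda>j. X (\<sigma> p (if j < i then j else Suc j))) (m - 1) y" for y
        using that by (intro res_cong) auto
      then show ?thesis using that unfolding dual_coord_def by (simp add: Let_def)
    qed
    ultimately have "simplex_weight m (\<lambda>i\<in>{..<?N}. X (\<sigma> p i)) (X (\<sigma> p m)) = simplex_weight m (\<lambda>i. X (\<sigma> p i)) (X (\<sigma> p m))"
      unfolding simplex_weight_def by (simp cong: sum.cong_simp)
    moreover have "(\<Prod>i<?N. g ((\<lambda>i\<in>{..<?N}. X (\<sigma> p i)) i)) = (\<Prod>i<?N. g (X i))"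
      using prod.reindex_bij_betw[OF \<sigma>(1)[OF p], of "\<lambda>i. g (X i)"] by simp
    ultimately show ?thesis unfolding \<Phi>_def using \<sigma>(3)[OF p] by simp
  qed
  have ge: "1 \<le> (\<Sum>p\<in>Pairs. simplex_weight m (\<lambda>i. X (\<sigma> p i)) (X (fst p)))"
    if X: "\<forall>i\<in>{..<?N}. X i \<in> Rn m" for X
  proof -
    obtain j I s where js: "j < ?N" "I \<subseteq> {..<?N} - {j}" "card I = m"
      "X j = (\<Sum>i\<in>I. s i *\<^sub>R X i)" "(\<Sum>i\<in>I. \<bar>s i :: real\<bar>) \<le> 2 * sqrt m"
      using ex_short_combination[OF m, of X] X by auto
    define p where "p = (j, I)"
    have p: "p \<in> Pairs" using js by (auto simp: p_def Pairs_def)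
    have im: "\<sigma> p ` {..<m} = I" using \<sigma>(2)[OF p] by (simp add: p_def)
    have inj: "inj_on (\<sigma> p) {..<m}" using \<sigma>(1)[OF p] by (auto simp: bij_betw_def intro: inj_on_subset)
    have "X (fst p) = (\<Sum>i<m. s (\<sigma> p i) *\<^sub>R X (\<sigma> p i))"
      using js(4) sum.reindex[OF inj, of "\<lambda>i. s i *\<^sub>R X i"] unfolding im by (simp add: p_def)
    moreover have "(\<Sum>i<m. \<bar>s (\<sigma> p i)\<bar>) \<le> 2 * sqrt m"
      using js(5) sum.reindex[OF inj, of "\<lambda>i. \<bar>s i\<bar>"] unfolding im by simp
    ultimately have "1 \<le> simplex_weight m (\<lambda>i. X (\<sigma> p i)) (X (fst p))" by (rule simplex_weight_ge_1)
    also have "\<dots> \<le> (\<Sum>p\<in>Pairs. simplex_weight m (\<lambda>i. X (\<sigma> p i)) (X (fst p)))"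
      using fin p by (intro member_le_sum) auto
    finally show ?thesis .
  qed
  have reidx: "(\<integral>\<^sup>+X. \<Phi> (\<lambda>i\<in>{..<?N}. X (\<sigma> p i)) \<partial>PLeb {..<?N} m) = (\<integral>\<^sup>+X. \<Phi> X \<partial>PLeb {..<?N} m)" if "p \<in> Pairs" for p
    using \<sigma>(1)[OF that] by (intro nn_integral_PiM_reindex[OF sigma_finite_Leb] m\<Phi>) auto
  have m\<Phi>2 [measurable]: "(\<lambda>X. \<Phi> (\<lambda>i\<in>{..<?N}. X (\<sigma> p i))) \<in> borel_measurable (PLeb {..<?N} m)" if "p \<in> Pairs" for p
  proof (rule measurable_compose[OF _ m\<Phi>])
    show "(\<lambda>X. \<lambda>i\<in>{..<?N}. X (\<sigma> p i)) \<in> PLeb {..<?N} m \<rightarrow>\<^sub>M PLeb {..<?N} m"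
      using \<sigma>(1)[OF that] by (intro measurable_restrict measurable_component_singleton) (auto simp: bij_betw_def)
  qed
  \<comment> \<open>Integrating the covered point first, with g bounded by M there, turns the weight
    into the volume \<open>gs_vol X m\<close> of the spanning points; this is where boundedness of g
    enters.\<close>
  have first: "(\<integral>\<^sup>+X. simplex_weight m X (X m) * (\<Prod>i<m + 1. g (X i)) \<partial>PLeb {..<m + 1} m) \<le> ennreal (M * v) * J"
  proof -
    have ins: "{..<m + 1} = insert m {..<m}" by auto
    have [measurable]: "(\<lambda>X. simplex_weight m X (X m)) \<in> borel_measurable (PLeb {..<m + 1} m)" by (rule mF) simp
    have m1: "(\<lambda>X. simplex_weight m X (X m) * (\<Prod>i<m + 1. g (X i))) \<in> borel_measurable (PLeb (insert m {..<m}) m)"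
      unfolding ins[symmetric] by measurable
    have "(\<integral>\<^sup>+X. simplex_weight m X (X m) * (\<Prod>i<m + 1. g (X i)) \<partial>PLeb {..<m + 1} m)
        = (\<integral>\<^sup>+X. \<integral>\<^sup>+y. simplex_weight m (X(m := y)) ((X(m := y)) m) * (\<Prod>i<m + 1. g ((X(m := y)) i)) \<partial>Leb m \<partial>PLeb {..<m} m)"
      unfolding ins using m1 by (intro Leb_prod.product_nn_integral_insert) (auto simp: ins)
    also have "\<dots> = (\<integral>\<^sup>+X. \<integral>\<^sup>+y. simplex_weight m X y * ((\<Prod>i<m. g (X i)) * g y) \<partial>Leb m \<partial>PLeb {..<m} m)"
    proof (intro nn_integral_cong arg_cong2[of _ _ _ _ "(*)"])
      fix X :: "nat \<Rightarrow> fin_seq" and y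
      have "gs_vol (X(m := y)) m = gs_vol X m" by (rule gs_vol_cong) auto
      moreover have "dual_coord (X(m := y)) m i z = dual_coord X m i z" if "i < m" for i z
      proof -
        have "res (\<lambda>j. (X(m := y)) (if j < i then j else Suc j)) (m - 1) x
            = res (\<lambda>j. X (if j < i then j else Suc j)) (m - 1) x" for x
          using that by (intro res_cong) auto
        then show ?thesis using that unfolding dual_coord_def by (simp add: Let_def)
      qed
      ultimately show "simplex_weight m (X(m := y)) ((X(m := y)) m) = simplex_weight m X y"
        unfolding simplex_weight_def by (simp cong: sum.cong_simp)
      show "(\<Prod>i<m + 1. g ((X(m := y)) i)) = (\<Prod>i<m. g (X i)) * g y"
        by (simp add: mult.commute)
    qed
    also have "\<dots> \<le> (\<integral>\<^sup>+X. ennreal (M * v) * (ennreal (gs_vol X m) * (\<Prod>i<m. g (X i))) \<partial>PLeb {..<m} m)"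
    proof (rule nn_integral_mono_AE)
      show "AE X in PLeb {..<m} m. (\<integral>\<^sup>+y. simplex_weight m X y * ((\<Prod>i<m. g (X i)) * g y) \<partial>Leb m)
          \<le> ennreal (M * v) * (ennreal (gs_vol X m) * (\<Prod>i<m. g (X i)))"
        using AE_PLeb_gs_vol[OF order_refl, of m] AE_PLeb_Rn[of "{..<m}" m, simplified]
      proof eventually_elim
        case (elim X)
        have "(\<integral>\<^sup>+y. simplex_weight m X y * ((\<Prod>i<m. g (X i)) * g y) \<partial>Leb m)
            \<le> (\<integral>\<^sup>+y. ((\<Prod>i<m. g (X i)) * ennreal M) * simplex_weight m X y \<partial>Leb m)"
        proof (rule nn_integral_mono)
          fix y
          have "simplex_weight m X y * ((\<Prod>i<m. g (X i)) * g y) \<le> simplex_weight m X y * ((\<Prod>i<m. g (X i)) * ennreal M)"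
            by (intro mult_left_mono gM) auto
          then show "simplex_weight m X y * ((\<Prod>i<m. g (X i)) * g y) \<le> ((\<Prod>i<m. g (X i)) * ennreal M) * simplex_weight m X y"
            by (simp add: mult_ac)
        qed
        also have "\<dots> = ((\<Prod>i<m. g (X i)) * ennreal M) * (\<integral>\<^sup>+y. simplex_weight m X y \<partial>Leb m)"
          by (rule nn_integral_cmult) (simp add: measurable_Lb_eq borel_measurable_simplex_weight)
        also have "\<dots> \<le> ((\<Prod>i<m. g (X i)) * ennreal M) * ennreal (gs_vol X m * v)"
          unfolding v_def using elim m by (intro mult_left_mono nn_integral_simplex_weight) auto
        also have "\<dots> = ennreal (M * v) * (ennreal (gs_vol X m) * (\<Prod>i<m. g (X i)))"
          using M v by (simp add: ennreal_mult mult_ac)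
        finally show ?case .
      qed
    qed
    also have "\<dots> = ennreal (M * v) * J"
      unfolding J_def by (rule nn_integral_cmult) measurable
    finally show ?thesis .
  qed
  \<comment> \<open>The m points that are neither spanning nor covered integrate to
    \<open>a ^ m\<close>.\<close>
  have int\<Phi>: "(\<integral>\<^sup>+X. \<Phi> X \<partial>PLeb {..<?N} m) \<le> ennreal (M * v) * J * a ^ m"
  proof -
    define \<Psi> where "\<Psi> X = simplex_weight m X (X m) * (\<Prod>i<m + 1. g (X i))" for X
    have dep: "\<Psi> X = \<Psi> Y" if eq: "\<And>i. i < m + 1 \<Longrightarrow> X i = Y i" for X Y
    proof -
      have "gs_vol X m = gs_vol Y m" using eq by (intro gs_vol_cong) auto
      moreover have "dual_coord X m i z = dual_coord Y m i z" if "i < m" for i z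
      proof -
        have "res (\<lambda>j. X (if j < i then j else Suc j)) (m - 1) x
            = res (\<lambda>j. Y (if j < i then j else Suc j)) (m - 1) x" for x
          using that eq by (intro res_cong) auto
        moreover have "X i = Y i" using eq that by simp
        ultimately show ?thesis unfolding dual_coord_def by simp
      qed
      moreover have "X m = Y m" using eq by simp
      ultimately have "simplex_weight m X (X m) = simplex_weight m Y (Y m)"
        unfolding simplex_weight_def by (simp cong: sum.cong_simp)
      moreover have "(\<Prod>i<m + 1. g (X i)) = (\<Prod>i<m + 1. g (Y i))" using eq by (intro prod.cong) auto
      ultimately show ?thesis by (simp only: \<Psi>_def)
    qed
    have m\<Psi>: "\<Psi> \<in> borel_measurable (PLeb {..<m + 1 + q} m)" for q
    proof -
      have [measurable]: "(\<lambda>X. simplex_weight m X (X m)) \<in> borel_measurable (PLeb {..<m + 1 + q} m)" by (rule mF) simp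
      show ?thesis unfolding \<Psi>_def by measurable
    qed
    have N: "?N = m + 1 + m" by simp
    have "\<Phi> X = \<Psi> X * (\<Prod>i\<in>{m + 1..<m + 1 + m}. g (X i))" for X
    proof -
      have un: "{..<m + 1} \<union> {m + 1..<m + 1 + m} = {..<?N}" by auto
      have "(\<Prod>i\<in>{..<m + 1} \<union> {m + 1..<m + 1 + m}. g (X i)) = (\<Prod>i<m + 1. g (X i)) * (\<Prod>i\<in>{m + 1..<m + 1 + m}. g (X i))"
        by (rule prod.union_disjoint) auto
      then have "(\<Prod>i<?N. g (X i)) = (\<Prod>i<m + 1. g (X i)) * (\<Prod>i\<in>{m + 1..<m + 1 + m}. g (X i))"
        unfolding un .
      then show ?thesis by (simp only: \<Phi>_def \<Psi>_def mult.assoc)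
    qed
    then have "(\<integral>\<^sup>+X. \<Phi> X \<partial>PLeb {..<?N} m)
        = (\<integral>\<^sup>+X. \<Psi> X * (\<Prod>i\<in>{m + 1..<m + 1 + m}. g (X i)) \<partial>PLeb {..<m + 1 + m} m)" by (simp only: N)
    also have "\<dots> = (\<integral>\<^sup>+X. \<Psi> X \<partial>PLeb {..<m + 1} m) * a ^ m"
      unfolding a_def
    proof (rule nn_integral_PLeb_extra)
      show "\<Psi> \<in> borel_measurable (PLeb {..<m + 1} m)" using m\<Psi>[of 0] by simp
    qed (fact g, rule dep, blast, rule m\<Psi>)
    also have "\<dots> \<le> ennreal (M * v) * J * a ^ m"
      using first unfolding \<Psi>_def by (intro mult_right_mono) auto
    finally show ?thesis .
  qed
  have "a ^ ?N = (\<integral>\<^sup>+X. (\<Prod>i<?N. g (X i)) \<partial>PLeb {..<?N} m)"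
    by (subst Leb_prod.product_nn_integral_prod) (auto simp: a_def measurable_Lb_eq)
  also have "\<dots> \<le> (\<integral>\<^sup>+X. (\<Sum>p\<in>Pairs. \<Phi> (\<lambda>i\<in>{..<?N}. X (\<sigma> p i))) \<partial>PLeb {..<?N} m)"
  proof (rule nn_integral_mono_AE)
    show "AE X in PLeb {..<?N} m. (\<Prod>i<?N. g (X i)) \<le> (\<Sum>p\<in>Pairs. \<Phi> (\<lambda>i\<in>{..<?N}. X (\<sigma> p i)))"
      using AE_PLeb_Rn[OF finite_lessThan, of ?N m]
    proof eventually_elim
      case (elim X)
      have "1 * (\<Prod>i<?N. g (X i)) \<le> (\<Sum>p\<in>Pairs. simplex_weight m (\<lambda>i. X (\<sigma> p i)) (X (fst p))) * (\<Prod>i<?N. g (X i))"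
        by (intro mult_right_mono ge elim) auto
      also have "\<dots> = (\<Sum>p\<in>Pairs. \<Phi> (\<lambda>i\<in>{..<?N}. X (\<sigma> p i)))"
        unfolding sum_distrib_right by (intro sum.cong refl) (simp only: eq\<Phi>)
      finally show ?case by simp
    qed
  qed
  also have "\<dots> = (\<Sum>p\<in>Pairs. \<integral>\<^sup>+X. \<Phi> (\<lambda>i\<in>{..<?N}. X (\<sigma> p i)) \<partial>PLeb {..<?N} m)"
    by (rule nn_integral_sum) (rule m\<Phi>2)
  also have "\<dots> = (\<Sum>p\<in>Pairs. \<integral>\<^sup>+X. \<Phi> X \<partial>PLeb {..<?N} m)"
    by (intro sum.cong refl reidx)
  also have "\<dots> = ennreal (real (card Pairs)) * (\<integral>\<^sup>+X. \<Phi> X \<partial>PLeb {..<?N} m)"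
    by (simp add: ennreal_of_nat_eq_real_of_nat)
  also have "\<dots> \<le> ennreal (real (?N * 2 ^ ?N)) * (ennreal (M * v) * J * a ^ m)"
  proof (intro mult_mono int\<Phi> ennreal_leI)
    have "card Pairs \<le> ?N * 2 ^ ?N" unfolding Pairs_def by (rule card_pairs_le)
    then show "real (card Pairs) \<le> real (?N * 2 ^ ?N)" by (simp only: of_nat_le_iff)
  qed auto
  also have "\<dots> = ennreal (real (?N * 2 ^ ?N) * M * v) * J * a ^ m"
    using M v by (simp add: ennreal_mult mult_ac)
  finally show ?thesis unfolding a_def J_def v_def .
qed

text \<open>The value at m = 1 is 24, and passing from m to m + 1 multiplies the left side by 4(2m +
  3)/(2m + 1), which stays below 48.\<close>

lemma det_constant_bound:
  assumes "m \<ge> 1"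
  shows "real ((2 * m + 1) * 2 ^ (2 * m + 1)) \<le> 48 ^ m"
  using assms
proof (induction m rule: dec_induct)
  case (step m)
  have e: "(2::real) ^ (2 * m) = 4 ^ m" by (simp add: power_mult)
  have "real ((2 * Suc m + 1) * 2 ^ (2 * Suc m + 1)) = (2 * real m + 3) * (8 * 2 ^ (2 * m))"
    by (simp add: algebra_simps)
  also have "\<dots> = (2 * real m + 3) * (8 * 4 ^ m)" by (simp only: e)
  also have "\<dots> \<le> 48 * ((2 * real m + 1) * (2 * 4 ^ m))"
    by (simp add: algebra_simps)
  also have "\<dots> = 48 * ((2 * real m + 1) * (2 * 2 ^ (2 * m)))" by (simp only: e)
  also have "\<dots> = 48 * real ((2 * m + 1) * 2 ^ (2 * m + 1))" by (simp add: algebra_simps)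
  also have "\<dots> \<le> 48 * 48 ^ m" using step.IH by (rule mult_left_mono) simp
  finally show ?case by simp
qed simp

text \<open>The union bound divided by \<open>a ^ m\<close>, which is possible because a is positive
  and finite; 576 is 48 times 12.\<close>

lemma random_det_first_moment:
  assumes g [measurable]: "g \<in> borel_measurable borel" and gM: "\<And>x. g x \<le> ennreal M" and M: "M > 0" and m: "m \<ge> 1"
    and a: "(\<integral>\<^sup>+x. g x \<partial>Leb m) = ennreal a" "a > 0"
  shows "ennreal (a ^ (m + 1)) \<le> ennreal (M * (576 / sqrt m) ^ m)
      * (\<integral>\<^sup>+X. ennreal (gs_vol X m) * (\<Prod>i<m. g (X i)) \<partial>PLeb {..<m} m)"
proof -
  define J where "J = (\<integral>\<^sup>+X. ennreal (gs_vol X m) * (\<Prod>i<m. g (X i)) \<partial>PLeb {..<m} m)"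
  have "ennreal (a ^ (2 * m + 1)) \<le> ennreal (real ((2 * m + 1) * 2 ^ (2 * m + 1)) * M * (12 / sqrt m) ^ m) * J * ennreal (a ^ m)"
    using random_det_first_moment_aux[OF g gM M m] a by (simp only: ennreal_power J_def less_imp_le)
  also have "\<dots> \<le> ennreal (48 ^ m * M * (12 / sqrt m) ^ m) * J * ennreal (a ^ m)"
    using M by (intro mult_right_mono ennreal_leI det_constant_bound m) auto
  also have "48 ^ m * M * (12 / sqrt m) ^ m = M * (576 / sqrt m) ^ m"
    by (simp add: power_mult_distrib[symmetric] mult_ac)
  finally have le: "ennreal (a ^ m) * ennreal (a ^ (m + 1)) \<le> ennreal (a ^ m) * (ennreal (M * (576 / sqrt m) ^ m) * J)"
    using a by (simp add: ennreal_mult[symmetric] power_add[symmetric] mult_ac mult_2 mult_2_right)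
  show ?thesis
    using le a(2) unfolding J_def[symmetric] by (subst (asm) ennreal_mult_le_mult_iff) auto
qed

text \<open>Tangent line of \<open>D \<mapsto> D\<^sup>k\<close> at \<open>\<tau>\<close>, which replaces Jensen's inequality for the measure with density \<open>\<Prod> g\<close>.\<close>

lemma bernoulli_tangent:
  fixes D \<tau> :: real
  assumes "D \<ge> 0" "\<tau> > 0"
  shows "real k * \<tau> ^ (k - 1) * D \<le> D ^ k + (real k - 1) * \<tau> ^ k"
proof (cases k)
  case (Suc j)
  have "1 + real k * (D / \<tau> - 1) \<le> (1 + (D / \<tau> - 1)) ^ k"
    using assms by (intro Bernoulli_inequality) auto
  then have "\<tau> ^ k * (1 + real k * (D / \<tau> - 1)) \<le> \<tau> ^ k * (D / \<tau>) ^ k"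
    using assms by (intro mult_left_mono) auto
  also have "\<dots> = D ^ k" using assms by (simp add: power_divide)
  also have "\<tau> ^ k * (1 + real k * (D / \<tau> - 1)) = real k * \<tau> ^ (k - 1) * D - (real k - 1) * \<tau> ^ k"
    using assms Suc by (simp add: field_simps)
  finally show ?thesis by simp
qed (use assms in simp)

text \<open>Put B = M (576 / sqrt m)^m and let a be the integral of g. By the first moment bound,
  the mean of \<open>gs_vol\<close> under the measure with density the product of the
  \<open>g (X i)\<close>, of total mass a^m, is at least a / B. The tangent of the k-th power at a /
  B then bounds the k-th moment below by (a / B)^k a^m. The tangent inequality involves a
  subtraction, so finite a is treated before the general case.\<close>

lemma random_det_moment:
  assumes g [measurable]: "g \<in> borel_measurable borel" and gM: "\<And>x. g x \<le> ennreal M" and M: "M > 0" and m: "m \<ge> 1" and k: "k \<ge> 1"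
  shows "(\<integral>\<^sup>+x. g x \<partial>Leb m) ^ (m + k) \<le> ennreal ((M * (576 / sqrt m) ^ m) ^ k)
      * (\<integral>\<^sup>+X. ennreal (gs_vol X m ^ k) * (\<Prod>i<m. g (X i)) \<partial>PLeb {..<m} m)"
proof -
  have finite_case: "(\<integral>\<^sup>+x. g x \<partial>Leb m) ^ (m + k) \<le> ennreal ((M * (576 / sqrt m) ^ m) ^ k)
      * (\<integral>\<^sup>+X. ennreal (gs_vol X m ^ k) * (\<Prod>i<m. g (X i)) \<partial>PLeb {..<m} m)"
    if g [measurable]: "g \<in> borel_measurable borel" and gM: "\<And>x. g x \<le> ennreal M" and fin: "(\<integral>\<^sup>+x. g x \<partial>Leb m) < \<infinity>"
    for g
  proof -
    obtain a where a: "(\<integral>\<^sup>+x. g x \<partial>Leb m) = ennreal a" "a \<ge> 0" using fin by (cases "\<integral>\<^sup>+x. g x \<partial>Leb m") auto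
    show ?thesis
    proof (cases "a = 0")
      case True
      then show ?thesis using a k by (simp add: power_0_left)
    next
      case False
      then have a0: "a > 0" using a by simp
      define B where "B = M * (576 / sqrt m) ^ m"
      have B: "B > 0" using M m by (simp add: B_def)
      define \<tau> where "\<tau> = a / B"
      have \<tau>: "\<tau> > 0" using a0 B by (simp add: \<tau>_def)
      let ?P = "\<lambda>X. \<Prod>i<m. g (X i)"
      define J where "J = (\<integral>\<^sup>+X. ennreal (gs_vol X m) * ?P X \<partial>PLeb {..<m} m)"
      define Jk where "Jk = (\<integral>\<^sup>+X. ennreal (gs_vol X m ^ k) * ?P X \<partial>PLeb {..<m} m)"
      have P: "(\<integral>\<^sup>+X. ?P X \<partial>PLeb {..<m} m) = ennreal (a ^ m)"
        using a by (subst Leb_prod.product_nn_integral_prod) (auto simp: ennreal_power measurable_Lb_eq)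
      have "ennreal (real k * \<tau> ^ (k - 1)) * J = (\<integral>\<^sup>+X. ennreal (real k * \<tau> ^ (k - 1)) * (ennreal (gs_vol X m) * ?P X) \<partial>PLeb {..<m} m)"
        unfolding J_def by (rule nn_integral_cmult[symmetric]) measurable
      also have "\<dots> \<le> (\<integral>\<^sup>+X. ennreal (gs_vol X m ^ k) * ?P X + ennreal ((real k - 1) * \<tau> ^ k) * ?P X \<partial>PLeb {..<m} m)"
      proof (rule nn_integral_mono)
        fix X :: "nat \<Rightarrow> fin_seq"
        have "ennreal (real k * \<tau> ^ (k - 1)) * ennreal (gs_vol X m) = ennreal (real k * \<tau> ^ (k - 1) * gs_vol X m)"
          using \<tau> by (simp add: ennreal_mult)
        also have "\<dots> \<le> ennreal (gs_vol X m ^ k + (real k - 1) * \<tau> ^ k)"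
          using \<tau> by (intro ennreal_leI bernoulli_tangent) auto
        also have "\<dots> = ennreal (gs_vol X m ^ k) + ennreal ((real k - 1) * \<tau> ^ k)"
          using \<tau> k by (intro ennreal_plus) auto
        finally have "(ennreal (real k * \<tau> ^ (k - 1)) * ennreal (gs_vol X m)) * ?P X
            \<le> (ennreal (gs_vol X m ^ k) + ennreal ((real k - 1) * \<tau> ^ k)) * ?P X" by (rule mult_right_mono) simp
        then show "ennreal (real k * \<tau> ^ (k - 1)) * (ennreal (gs_vol X m) * ?P X)
            \<le> ennreal (gs_vol X m ^ k) * ?P X + ennreal ((real k - 1) * \<tau> ^ k) * ?P X"
          by (simp add: distrib_right mult.assoc)
      qed
      also have "\<dots> = Jk + ennreal ((real k - 1) * \<tau> ^ k * a ^ m)"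
        unfolding Jk_def using \<tau> k a0 by (subst nn_integral_add) (auto simp: nn_integral_cmult P ennreal_mult)
      finally have up: "ennreal (real k * \<tau> ^ (k - 1)) * J \<le> Jk + ennreal ((real k - 1) * \<tau> ^ k * a ^ m)" .
      have main: "ennreal (a ^ (m + 1)) \<le> ennreal B * J"
        unfolding B_def J_def by (rule random_det_first_moment[OF g gM M m a(1) a0])
      show ?thesis
      proof (cases "Jk = \<infinity>")
        case True
        then show ?thesis unfolding Jk_def[symmetric] using M m by (simp add: ennreal_mult_top)
      next
        case False
        then obtain jk where jk: "Jk = ennreal jk" "jk \<ge> 0" by (cases Jk) auto
        have "ennreal (real k * \<tau> ^ (k - 1)) * J < \<infinity>"
          using up unfolding jk(1) by (simp add: le_less_trans flip: ennreal_plus)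
        then have "J \<noteq> \<infinity>" using k \<tau> by (auto simp: ennreal_mult_top)
        then obtain j where j: "J = ennreal j" "j \<ge> 0" by (cases J) auto
        have 1: "a ^ (m + 1) \<le> B * j"
          using main j B by (simp add: ennreal_mult[symmetric] ennreal_le_iff)
        have 2: "real k * \<tau> ^ (k - 1) * j \<le> jk + (real k - 1) * \<tau> ^ k * a ^ m"
          using up j jk \<tau> k a0 by (simp add: ennreal_mult[symmetric] ennreal_plus[symmetric] ennreal_le_iff del: ennreal_plus)
        have "\<tau> * a ^ m \<le> j" using 1 B by (simp add: \<tau>_def field_simps)
        then have "real k * \<tau> ^ (k - 1) * (\<tau> * a ^ m) \<le> real k * \<tau> ^ (k - 1) * j" using \<tau> by (intro mult_left_mono) auto
        moreover have "real k * \<tau> ^ (k - 1) * (\<tau> * a ^ m) = real k * \<tau> ^ k * a ^ m"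
          using k by (cases k) auto
        moreover have "(real k - 1) * \<tau> ^ k * a ^ m = real k * \<tau> ^ k * a ^ m - \<tau> ^ k * a ^ m"
          by (simp add: algebra_simps)
        ultimately have "\<tau> ^ k * a ^ m \<le> jk" using 2 by linarith
        then have "a ^ (m + k) \<le> B ^ k * jk"
          using B by (simp add: \<tau>_def power_divide power_add field_simps)
        then show ?thesis
          unfolding Jk_def[symmetric] B_def[symmetric] a(1) using jk B a
          by (simp add: ennreal_power ennreal_mult[symmetric] ennreal_leI)
      qed
    qed
  qed
  define R where "R = ennreal ((M * (576 / sqrt m) ^ m) ^ k)
      * (\<integral>\<^sup>+X. ennreal (gs_vol X m ^ k) * (\<Prod>i<m. g (X i)) \<partial>PLeb {..<m} m)"
  show ?thesis
  proof (cases "R = \<infinity>")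
    case True
    then show ?thesis by (simp add: R_def[symmetric])
  next
    case False
    \<comment> \<open>Truncation to balls makes the integrals finite. If the right side R is finite,
      every truncated integral is at most max 1 R, so the integral of g is finite too and the finite
      case applies to g itself.\<close>
    define h where "h r x = g x * indicator {x. norm x \<le> real r} x" for r :: nat and x
    have [measurable]: "h r \<in> borel_measurable borel" for r unfolding h_def by measurable
    have hg: "h r x \<le> g x" for r x by (simp add: h_def indicator_def)
    have fin: "(\<integral>\<^sup>+x. h r x \<partial>Leb m) < \<infinity>" for r
    proof -
      have "(\<integral>\<^sup>+x. h r x \<partial>Leb m) \<le> (\<integral>\<^sup>+x. ennreal (M * exp ((real r)\<^sup>2 / 2)) * ennreal (exp (- (1 / 2) * (norm x)\<^sup>2)) \<partial>Leb m)"
      proof (rule nn_integral_mono)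
        fix x :: fin_seq
        show "h r x \<le> ennreal (M * exp ((real r)\<^sup>2 / 2)) * ennreal (exp (- (1 / 2) * (norm x)\<^sup>2))"
        proof (cases "norm x \<le> real r")
          case True
          then have "(norm x)\<^sup>2 \<le> (real r)\<^sup>2" by (intro power_mono) auto
          then have "1 \<le> exp ((real r)\<^sup>2 / 2 + - (1 / 2) * (norm x)\<^sup>2)" by simp
          then have "M * 1 \<le> M * exp ((real r)\<^sup>2 / 2 + - (1 / 2) * (norm x)\<^sup>2)" using M by (intro mult_left_mono) auto
          then have "ennreal M \<le> ennreal (M * exp ((real r)\<^sup>2 / 2) * exp (- (1 / 2) * (norm x)\<^sup>2))"
            unfolding exp_add by (intro ennreal_leI) (simp add: mult.assoc)
          then show ?thesis using gM[of x] True M by (simp add: h_def ennreal_mult)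
        qed (simp add: h_def)
      qed
      also have "\<dots> = ennreal (M * exp ((real r)\<^sup>2 / 2)) * ennreal (sqrt (2 * pi / 1) ^ m)"
        using nn_integral_Lb_gaussian[OF orthonormal_unit_vec, of 1 m] by (subst nn_integral_cmult) (auto simp: measurable_Lb_eq)
      also have "\<dots> < \<infinity>" by (simp add: ennreal_mult_less_top)
      finally show ?thesis .
    qed
    have bound: "(\<integral>\<^sup>+x. h r x \<partial>Leb m) ^ (m + k) \<le> R" for r
    proof -
      have "(\<integral>\<^sup>+x. h r x \<partial>Leb m) ^ (m + k) \<le> ennreal ((M * (576 / sqrt m) ^ m) ^ k)
          * (\<integral>\<^sup>+X. ennreal (gs_vol X m ^ k) * (\<Prod>i<m. h r (X i)) \<partial>PLeb {..<m} m)"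
        using gM hg order_trans by (intro finite_case fin) (measurable, blast)
      also have "\<dots> \<le> R"
        unfolding R_def by (intro mult_left_mono nn_integral_mono prod_mono_ennreal hg) auto
      finally show ?thesis .
    qed
    have le1: "(\<integral>\<^sup>+x. h r x \<partial>Leb m) \<le> max 1 R" for r
    proof (rule ccontr)
      assume "\<not> ?thesis"
      then have gt: "(\<integral>\<^sup>+x. h r x \<partial>Leb m) > 1" "(\<integral>\<^sup>+x. h r x \<partial>Leb m) > R" by (simp_all add: not_le)
      then have "(\<integral>\<^sup>+x. h r x \<partial>Leb m) ^ 1 \<le> (\<integral>\<^sup>+x. h r x \<partial>Leb m) ^ (m + k)"
        using m by (intro power_increasing) auto
      then show False using bound[of r] gt by simp
    qed
    have sup: "(SUP r. h r x) = g x" for x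
    proof (rule antisym)
      show "(SUP r. h r x) \<le> g x" by (intro SUP_least hg)
      obtain r where "norm x \<le> real r" using real_arch_simple by blast
      then have "h r x = g x" by (simp add: h_def)
      then show "g x \<le> (SUP r. h r x)" by (metis SUP_upper UNIV_I)
    qed
    have "incseq h" unfolding incseq_def le_fun_def h_def by (auto simp: indicator_def)
    then have "(\<integral>\<^sup>+x. g x \<partial>Leb m) = (SUP r. \<integral>\<^sup>+x. h r x \<partial>Leb m)"
      by (subst nn_integral_monotone_convergence_SUP[symmetric]) (auto simp: sup measurable_Lb_eq)
    also have "\<dots> \<le> max 1 R" by (intro SUP_least le1)
    also have "\<dots> < \<infinity>" using False by (simp add: less_top)
    finally show ?thesis by (intro finite_case g gM)
  qed
qed

subsection \<open>An integral formula of Blaschke--Petkantschin type\<close>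

lemma sigma_finite_PLeb: "finite I \<Longrightarrow> sigma_finite_measure (PLeb I n)"
  by (rule Leb_prod.sigma_finite)

lemma sets_PLeb: "sets (PLeb I n) = sets (PiM I (\<lambda>_. borel))"
  by (rule sets_PiM_cong) simp_all

lemma space_PLeb: "space (PLeb I n) = extensional I"
  by (simp add: space_PiM PiE_def)

lemma measurable_PLeb_eq: "measurable (PLeb I n) N = measurable (PiM I (\<lambda>_. borel)) N"
  "measurable N (PLeb I n) = measurable N (PiM I (\<lambda>_. borel))"
  by (auto intro!: measurable_cong_sets sets_PLeb)

lemma Leb_Suc: "Leb (Suc n) = distr (Leb n \<Otimes>\<^sub>M lborel) borel (\<lambda>(x, s). x + s *\<^sub>R unit_vec n)"
proof (rule measure_eqI)
  fix A assume "A \<in> sets (Leb (Suc n))"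
  then have [measurable]: "A \<in> sets borel" by simp
  have "emeasure (Leb (Suc n)) A = (\<integral>\<^sup>+x. indicator A x \<partial>Leb (Suc n))" by simp
  also have "\<dots> = (\<integral>\<^sup>+x. \<integral>\<^sup>+s. indicator A (x + s *\<^sub>R unit_vec n) \<partial>lborel \<partial>Leb n)"
    by (rule nn_integral_Lb_Suc) measurable
  also have "\<dots> = (\<integral>\<^sup>+z. indicator A ((\<lambda>(x, s). x + s *\<^sub>R unit_vec n) z) \<partial>(Leb n \<Otimes>\<^sub>M lborel))"
    by (subst lborel.nn_integral_fst[symmetric]) auto
  also have "\<dots> = (\<integral>\<^sup>+x. indicator A x \<partial>distr (Leb n \<Otimes>\<^sub>M lborel) borel (\<lambda>(x, s). x + s *\<^sub>R unit_vec n))"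
    by (rule nn_integral_distr[symmetric]) auto
  also have "\<dots> = emeasure (distr (Leb n \<Otimes>\<^sub>M lborel) borel (\<lambda>(x, s). x + s *\<^sub>R unit_vec n)) A"
    by (rule nn_integral_indicator) simp
  finally show "emeasure (Leb (Suc n)) A = emeasure (distr (Leb n \<Otimes>\<^sub>M lborel) borel (\<lambda>(x, s). x + s *\<^sub>R unit_vec n)) A" .
qed simp

text \<open>Fubini for all vectors at once: the last coordinates of the whole family are collected
  into one product measure, so that they can be substituted jointly.\<close>

lemma nn_integral_PLeb_Suc:
  assumes I: "finite I" and g [measurable]: "g \<in> borel_measurable (PiM I (\<lambda>_. borel))"
  shows "(\<integral>\<^sup>+X. g X \<partial>PLeb I (Suc n))
    = (\<integral>\<^sup>+X. \<integral>\<^sup>+s. g (\<lambda>i\<in>I. X i + s i *\<^sub>R unit_vec n) \<partial>(\<Pi>\<^sub>M i\<in>I. lborel) \<partial>PLeb I n)"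
proof -
  interpret pair_sigma_finite "Leb n" lborel
    using sigma_finite_Leb sigma_finite_lborel by (rule pair_sigma_finite.intro)
  have sf: "sigma_finite_measure (Leb n \<Otimes>\<^sub>M (lborel :: real measure))" by unfold_locales
  interpret L: sigma_finite_measure "\<Pi>\<^sub>M i\<in>I. (lborel :: real measure)" using I by (rule lborel_prod.sigma_finite)
  have "PLeb I (Suc n) = distr (PiM I (\<lambda>_. Leb n \<Otimes>\<^sub>M lborel)) (PiM I (\<lambda>_. borel)) (\<lambda>z. \<lambda>i\<in>I. (\<lambda>(x, s). x + s *\<^sub>R unit_vec n) (z i))"
    unfolding Leb_Suc using sf sigma_finite_Leb[of "Suc n"] unfolding Leb_Suc
    by (intro distr_PiM_map[symmetric] I) auto
  also have "PiM I (\<lambda>_. Leb n \<Otimes>\<^sub>M (lborel :: real measure)) = distr (PLeb I n \<Otimes>\<^sub>M PiM I (\<lambda>_. lborel)) (PiM I (\<lambda>_. Leb n \<Otimes>\<^sub>M lborel)) (\<lambda>(x, y). \<lambda>i\<in>I. (x i, y i))"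
    by (rule distr_PiM_pair[OF sigma_finite_Leb sigma_finite_lborel I, symmetric])
  finally have eq: "PLeb I (Suc n) = distr (distr (PLeb I n \<Otimes>\<^sub>M PiM I (\<lambda>_. lborel)) (PiM I (\<lambda>_. Leb n \<Otimes>\<^sub>M lborel)) (\<lambda>(x, y). \<lambda>i\<in>I. (x i, y i)))
      (PiM I (\<lambda>_. borel)) (\<lambda>z. \<lambda>i\<in>I. (\<lambda>(x, s). x + s *\<^sub>R unit_vec n) (z i))" .
  have m1 [measurable]: "(\<lambda>(x, y). \<lambda>i\<in>I. (x i, y i)) \<in> PLeb I n \<Otimes>\<^sub>M PiM I (\<lambda>_. lborel :: real measure) \<rightarrow>\<^sub>M PiM I (\<lambda>_. Leb n \<Otimes>\<^sub>M lborel)"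
    unfolding case_prod_beta by (intro measurable_restrict) measurable
  have m2 [measurable]: "(\<lambda>z. \<lambda>i\<in>I. (\<lambda>(x, s). x + s *\<^sub>R unit_vec n) (z i)) \<in> PiM I (\<lambda>_. Leb n \<Otimes>\<^sub>M lborel) \<rightarrow>\<^sub>M PiM I (\<lambda>_. borel)"
  proof (intro measurable_restrict)
    fix i assume "i \<in> I"
    then have "(\<lambda>z. z i) \<in> PiM I (\<lambda>_. Leb n \<Otimes>\<^sub>M (lborel :: real measure)) \<rightarrow>\<^sub>M Leb n \<Otimes>\<^sub>M lborel" by (rule measurable_component_singleton)
    then show "(\<lambda>z. (\<lambda>(x, s). x + s *\<^sub>R unit_vec n) (z i)) \<in> borel_measurable (PiM I (\<lambda>_. Leb n \<Otimes>\<^sub>M (lborel :: real measure)))"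
      by (rule measurable_compose) measurable
  qed
  have "(\<integral>\<^sup>+X. g X \<partial>PLeb I (Suc n)) = (\<integral>\<^sup>+z. g (\<lambda>i\<in>I. (\<lambda>(x, s). x + s *\<^sub>R unit_vec n) ((\<lambda>(x, y). \<lambda>i\<in>I. (x i, y i)) z i)) \<partial>(PLeb I n \<Otimes>\<^sub>M PiM I (\<lambda>_. lborel)))"
    unfolding eq by (subst nn_integral_distr; measurable)+
  also have "\<dots> = (\<integral>\<^sup>+z. g (\<lambda>i\<in>I. fst z i + snd z i *\<^sub>R unit_vec n) \<partial>(PLeb I n \<Otimes>\<^sub>M PiM I (\<lambda>_. lborel)))"
    by (intro nn_integral_cong arg_cong[of _ _ g]) (auto simp: fun_eq_iff restrict_def)
  also have "\<dots> = (\<integral>\<^sup>+X. \<integral>\<^sup>+s. g (\<lambda>i\<in>I. X i + s i *\<^sub>R unit_vec n) \<partial>(\<Pi>\<^sub>M i\<in>I. lborel) \<partial>PLeb I n)"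
  proof (subst L.nn_integral_fst[symmetric])
    have "(\<lambda>z. \<lambda>i\<in>I. fst z i + snd z i *\<^sub>R unit_vec n) \<in> PLeb I n \<Otimes>\<^sub>M PiM I (\<lambda>_. lborel :: real measure) \<rightarrow>\<^sub>M PiM I (\<lambda>_. borel)"
      by (intro measurable_restrict) measurable
    then show "(\<lambda>z. g (\<lambda>i\<in>I. fst z i + snd z i *\<^sub>R unit_vec n)) \<in> borel_measurable (PLeb I n \<Otimes>\<^sub>M PiM I (\<lambda>_. lborel))"
      by (rule measurable_compose) measurable
  qed simp
  finally show ?thesis .
qed

text \<open>A linear map from R^m to R^k is given by its k rows \<open>C i\<close> in R^m, so the
  space of maps carries the product measure \<open>PLeb {..<k} m\<close>.\<close>

definition graph :: "nat \<Rightarrow> nat \<Rightarrow> (nat \<Rightarrow> fin_seq) \<Rightarrow> fin_seq \<Rightarrow> fin_seq" where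
  "graph m k C y = y + (\<Sum>i<k. (C i \<bullet> y) *\<^sub>R unit_vec (m + i))"

lemma linear_graph: "linear (graph m k C)"
  by (rule linearI)
     (simp_all add: graph_def inner_add_right scaleR_add_left scaleR_add_right sum.distrib scaleR_sum_right algebra_simps)

lemma coord_graph: "l < m \<Longrightarrow> coord (graph m k C y) l = coord y l"
  by (simp add: graph_def coord_unit_vec)

lemma graph_eq_0: "y \<in> Rn m \<Longrightarrow> graph m k C y = 0 \<Longrightarrow> y = 0"
  unfolding fin_seq_eq_iff using coord_graph[of _ m k C y] by (auto simp: Rn_def not_less[symmetric])

lemma borel_measurable_graph [measurable (raw)]:
  assumes "\<And>i. i < k \<Longrightarrow> (\<lambda>z. C z i) \<in> borel_measurable M" "y \<in> borel_measurable M"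
  shows "(\<lambda>z. graph m k (C z) (y z)) \<in> borel_measurable M"
  unfolding graph_def using assms
  by (intro borel_measurable_add borel_measurable_sum borel_measurable_scaleR borel_measurable_inner borel_measurable_const) auto

text \<open>The Jacobian of the chart. In each of k steps the m last coordinates of the vectors are
  written as inner products of one new row with the \<open>Y j\<close>; for independent Y this is an
  invertible linear substitution with factor \<open>gs_vol Y m\<close>.\<close>

lemma nn_integral_PLeb_graph:
  assumes "g \<in> borel_measurable (PiM {..<m} (\<lambda>_. borel))"
  shows "(\<integral>\<^sup>+X. g X \<partial>PLeb {..<m} (m + k))
    = (\<integral>\<^sup>+Y. ennreal (gs_vol Y m ^ k) * (\<integral>\<^sup>+C. g (\<lambda>j\<in>{..<m}. graph m k C (Y j)) \<partial>PLeb {..<k} m) \<partial>PLeb {..<m} m)"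
  using assms
proof (induction k arbitrary: g)
  case 0
  have "(\<integral>\<^sup>+Y. ennreal (gs_vol Y m ^ 0) * (\<integral>\<^sup>+C. g (\<lambda>j\<in>{..<m}. graph m 0 C (Y j)) \<partial>PLeb {..<0} m) \<partial>PLeb {..<m} m)
      = (\<integral>\<^sup>+Y. g Y \<partial>PLeb {..<m} m)"
  proof (rule nn_integral_cong)
    fix Y assume "Y \<in> space (PLeb {..<m} m)"
    then have "Y \<in> extensional {..<m}" by (simp only: space_PLeb)
    then have Y: "(\<lambda>j\<in>{..<m}. graph m 0 C (Y j)) = Y" for C
      by (auto simp: graph_def fun_eq_iff extensional_def restrict_def)
    show "ennreal (gs_vol Y m ^ 0) * (\<integral>\<^sup>+C. g (\<lambda>j\<in>{..<m}. graph m 0 C (Y j)) \<partial>PLeb {..<0} m) = g Y"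
      unfolding Y by (simp add: PiM_empty nn_integral_count_space_finite)
  qed
  then show ?case by (simp only: add_0_right)
next
  case (Suc k)
  note g [measurable] = Suc.prems
  let ?S = "PiM {..<m} (\<lambda>_. lborel :: real measure)"
  interpret L: sigma_finite_measure ?S by (rule lborel_prod.sigma_finite) simp
  interpret C: sigma_finite_measure "PLeb {..<k} m" by (rule sigma_finite_PLeb) simp
  define g' where "g' X = (\<integral>\<^sup>+s. g (\<lambda>i\<in>{..<m}. X i + s i *\<^sub>R unit_vec (m + k)) \<partial>?S)" for X
  have add: "(\<lambda>z. \<lambda>i\<in>{..<m}. fst z i + snd z i *\<^sub>R unit_vec (m + k)) \<in> PiM {..<m} (\<lambda>_. borel) \<Otimes>\<^sub>M ?S \<rightarrow>\<^sub>M PiM {..<m} (\<lambda>_. borel)"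
    by (intro measurable_restrict) measurable
  have g'm: "g' \<in> borel_measurable (PiM {..<m} (\<lambda>_. borel))"
    unfolding g'_def using measurable_compose[OF add g]
    by (intro L.borel_measurable_nn_integral) (simp add: case_prod_beta)
  have insk: "{..<Suc k} = insert k {..<k}" by auto
  have "(\<integral>\<^sup>+X. g X \<partial>PLeb {..<m} (m + Suc k)) = (\<integral>\<^sup>+X. g' X \<partial>PLeb {..<m} (m + k))"
    unfolding g'_def add_Suc_right by (rule nn_integral_PLeb_Suc[OF finite_lessThan g])
  also have "\<dots> = (\<integral>\<^sup>+Y. ennreal (gs_vol Y m ^ k) * (\<integral>\<^sup>+C. g' (\<lambda>j\<in>{..<m}. graph m k C (Y j)) \<partial>PLeb {..<k} m) \<partial>PLeb {..<m} m)"
    by (rule Suc.IH[OF g'm])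
  also have "\<dots> = (\<integral>\<^sup>+Y. ennreal (gs_vol Y m ^ Suc k) * (\<integral>\<^sup>+C. g (\<lambda>j\<in>{..<m}. graph m (Suc k) C (Y j)) \<partial>PLeb {..<Suc k} m) \<partial>PLeb {..<m} m)"
  proof (rule nn_integral_cong_AE)
    show "AE Y in PLeb {..<m} m. ennreal (gs_vol Y m ^ k) * (\<integral>\<^sup>+C. g' (\<lambda>j\<in>{..<m}. graph m k C (Y j)) \<partial>PLeb {..<k} m)
        = ennreal (gs_vol Y m ^ Suc k) * (\<integral>\<^sup>+C. g (\<lambda>j\<in>{..<m}. graph m (Suc k) C (Y j)) \<partial>PLeb {..<Suc k} m)"
      using AE_PLeb_gs_vol[OF order_refl, of m] AE_PLeb_Rn[of "{..<m}" m, simplified]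
    proof eventually_elim
      case (elim Y)
      have Lb: "Lb (gs Y) m = Leb m"
        using elim orthonormal_gs[OF elim(1)] gs_vol_neq_0_imp_span[OF elim(1)] by (intro Lb_eq_Leb) auto
      have inner: "g' (\<lambda>j\<in>{..<m}. graph m k C (Y j))
          = ennreal (gs_vol Y m) * (\<integral>\<^sup>+c. g (\<lambda>j\<in>{..<m}. graph m (Suc k) (C(k := c)) (Y j)) \<partial>Leb m)" for C
      proof -
        let ?\<psi> = "\<lambda>s. g (\<lambda>i\<in>{..<m}. (\<lambda>j\<in>{..<m}. graph m k C (Y j)) i + s i *\<^sub>R unit_vec (m + k))"
        have "(\<lambda>s. \<lambda>i\<in>{..<m}. (\<lambda>j\<in>{..<m}. graph m k C (Y j)) i + s i *\<^sub>R unit_vec (m + k)) \<in> ?S \<rightarrow>\<^sub>M PiM {..<m} (\<lambda>_. borel)"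
          by (intro measurable_restrict) measurable
        then have "?\<psi> \<in> borel_measurable ?S" by (rule measurable_compose[OF _ g])
        from nn_integral_Lb_inner[OF elim(1) this]
        have "g' (\<lambda>j\<in>{..<m}. graph m k C (Y j)) = ennreal (gs_vol Y m) * (\<integral>\<^sup>+c. ?\<psi> (\<lambda>j\<in>{..<m}. c \<bullet> Y j) \<partial>Leb m)"
          unfolding g'_def Lb by simp
        also have "(\<lambda>c. ?\<psi> (\<lambda>j\<in>{..<m}. c \<bullet> Y j)) = (\<lambda>c. g (\<lambda>j\<in>{..<m}. graph m (Suc k) (C(k := c)) (Y j)))"
          by (intro ext arg_cong[of _ _ g]) (auto simp: graph_def add.assoc)
        finally show ?thesis .
      qed
      have gY: "(\<lambda>C. \<lambda>j\<in>{..<m}. graph m (Suc k) C (Y j)) \<in> PLeb (insert k {..<k}) m \<rightarrow>\<^sub>M PiM {..<m} (\<lambda>_. borel)"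
        unfolding insk[symmetric]
        by (intro measurable_restrict borel_measurable_graph borel_measurable_PLeb_component) auto
      have gC: "(\<lambda>C. g (\<lambda>j\<in>{..<m}. graph m (Suc k) C (Y j))) \<in> borel_measurable (PLeb (insert k {..<k}) m)"
        by (rule measurable_compose[OF gY g])
      have upd: "(\<lambda>(C, c). C(k := c)) \<in> PLeb {..<k} m \<Otimes>\<^sub>M Leb m \<rightarrow>\<^sub>M PLeb (insert k {..<k}) m"
        using measurable_add_dim[of k "{..<k}" "\<lambda>_. Leb m"] by simp
      have mm: "(\<lambda>C. \<integral>\<^sup>+c. g (\<lambda>j\<in>{..<m}. graph m (Suc k) (C(k := c)) (Y j)) \<partial>Leb m) \<in> borel_measurable (PLeb {..<k} m)"
        using measurable_compose[OF upd gC] by (intro sigma_finite_measure.borel_measurable_nn_integral[OF sigma_finite_Leb]) (simp add: case_prod_beta)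
      have "(\<integral>\<^sup>+C. g' (\<lambda>j\<in>{..<m}. graph m k C (Y j)) \<partial>PLeb {..<k} m)
          = ennreal (gs_vol Y m) * (\<integral>\<^sup>+C. \<integral>\<^sup>+c. g (\<lambda>j\<in>{..<m}. graph m (Suc k) (C(k := c)) (Y j)) \<partial>Leb m \<partial>PLeb {..<k} m)"
        unfolding inner by (rule nn_integral_cmult[OF mm])
      also have "(\<integral>\<^sup>+C. \<integral>\<^sup>+c. g (\<lambda>j\<in>{..<m}. graph m (Suc k) (C(k := c)) (Y j)) \<partial>Leb m \<partial>PLeb {..<k} m)
          = (\<integral>\<^sup>+C. g (\<lambda>j\<in>{..<m}. graph m (Suc k) C (Y j)) \<partial>PLeb (insert k {..<k}) m)"
        by (rule Leb_prod.product_nn_integral_insert[symmetric, OF _ _ gC]) auto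
      finally have *: "(\<integral>\<^sup>+C. g' (\<lambda>j\<in>{..<m}. graph m k C (Y j)) \<partial>PLeb {..<k} m)
          = ennreal (gs_vol Y m) * (\<integral>\<^sup>+C. g (\<lambda>j\<in>{..<m}. graph m (Suc k) C (Y j)) \<partial>PLeb {..<Suc k} m)"
        unfolding insk .
      have "ennreal (gs_vol Y m ^ Suc k) = ennreal (gs_vol Y m ^ k) * ennreal (gs_vol Y m)"
        by (simp add: ennreal_mult mult.commute)
      then show ?case by (simp only: * mult.assoc)
    qed
  qed
  finally show ?case .
qed

section \<open>Behaviour of volumes under linear maps\<close>

lemma res_isometry_on:
  assumes T: "linear T" and S: "subspace S" "\<And>i. i < j \<Longrightarrow> w i \<in> S" "x \<in> S"
    and iso: "\<And>x y. x \<in> S \<Longrightarrow> y \<in> S \<Longrightarrow> T x \<bullet> T y = x \<bullet> y"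
  shows "res (\<lambda>i. T (w i)) j (T x) = T (res w j x)"
proof (rule res_unique)
  have "T x - T (res w j x) = T (x - res w j x)" using T by (simp add: linear_diff)
  also have "\<dots> \<in> T ` span (w ` {..<j})" using diff_res_in_span by blast
  also have "T ` span (w ` {..<j}) = span ((\<lambda>i. T (w i)) ` {..<j})"
    using linear_span_image[OF T, of "w ` {..<j}"] by (simp add: image_image)
  finally show "T x - T (res w j x) \<in> span ((\<lambda>i. T (w i)) ` {..<j})" .
  have "res w j x \<in> S" using S by (intro res_in_subspace) auto
  then show "T (res w j x) \<bullet> T (w i) = 0" if "i < j" for i
    using S that iso by (simp add: res_orth)
qed

lemma gs_vol_isometry_on:
  assumes T: "linear T" and S: "subspace S" "\<And>i. i < m \<Longrightarrow> w i \<in> S"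
    and iso: "\<And>x y. x \<in> S \<Longrightarrow> y \<in> S \<Longrightarrow> T x \<bullet> T y = x \<bullet> y"
  shows "gs_vol (\<lambda>i. T (w i)) m = gs_vol w m"
  unfolding gs_vol_def
proof (intro prod.cong refl)
  fix i assume i: "i \<in> {..<m}"
  have "res w i (w i) \<in> S" using S i by (intro res_in_subspace) auto
  then have "T (res w i (w i)) \<bullet> T (res w i (w i)) = res w i (w i) \<bullet> res w i (w i)" using iso by blast
  moreover have "res (\<lambda>i. T (w i)) i (T (w i)) = T (res w i (w i))" using i S iso by (intro res_isometry_on[OF T]) auto
  ultimately show "norm (res (\<lambda>i. T (w i)) i (T (w i))) = norm (res w i (w i))" by (simp add: norm_eq_sqrt_inner)
qed

lemma gs_vol_inj_image:
  fixes T :: "fin_seq \<Rightarrow> fin_seq"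
  assumes T: "linear T" and inj: "\<And>x. x \<in> Rn m \<Longrightarrow> T x = 0 \<Longrightarrow> x = 0"
    and B: "\<And>i. i < j \<Longrightarrow> B i \<in> Rn m" "gs_vol B j \<noteq> 0"
  shows "gs_vol (\<lambda>i. T (B i)) j \<noteq> 0"
  unfolding gs_vol_neq_0_iff
proof (intro allI impI notI)
  fix i assume i: "i < j" and "T (B i) \<in> span ((\<lambda>i. T (B i)) ` {..<i})"
  then have "T (B i) \<in> T ` span (B ` {..<i})"
    using linear_span_image[OF T, of "B ` {..<i}"] by (simp add: image_image)
  then obtain z where z: "z \<in> span (B ` {..<i})" "T (B i) = T z" by blast
  have "span (B ` {..<i}) \<subseteq> Rn m" using B i by (intro span_minimal) auto
  then have "B i - z \<in> Rn m" using z B i by (intro subspace_diff) auto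
  moreover have "T (B i - z) = 0" using z T by (simp add: linear_diff)
  ultimately have "B i = z" using inj by fastforce
  then show False using z B(2) i by (auto simp: gs_vol_neq_0_iff)
qed

lemma nn_integral_Lb_linear:
  fixes T :: "fin_seq \<Rightarrow> fin_seq"
  assumes T: "linear T" and Tm [measurable]: "T \<in> borel_measurable borel" and [measurable]: "g \<in> borel_measurable borel"
  shows "(\<integral>\<^sup>+x. g x \<partial>Lb (\<lambda>i. T (B i)) m) = (\<integral>\<^sup>+x. g (T x) \<partial>Lb B m)"
  by (simp add: nn_integral_Lb linear_sum[OF T] linear_scale[OF T])

text \<open>Multiplicativity of the determinant, obtained by integrating a Gaussian over the image
  of T in two frames, \<open>T (B i)\<close> and \<open>T (unit_vec l)\<close>. Both computations
  involve the integral X, which is finite and nonzero and therefore cancels.\<close>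

lemma gs_vol_mult:
  fixes T :: "fin_seq \<Rightarrow> fin_seq"
  assumes T: "linear T" and inj: "\<And>x. x \<in> Rn m \<Longrightarrow> T x = 0 \<Longrightarrow> x = 0" and Tm [measurable]: "T \<in> borel_measurable borel"
    and B: "\<And>i. i < m \<Longrightarrow> B i \<in> Rn m" "gs_vol B m \<noteq> 0"
  shows "gs_vol (\<lambda>i. T (B i)) m = gs_vol B m * gs_vol (\<lambda>l. T (unit_vec l)) m"
proof -
  define G :: "fin_seq \<Rightarrow> ennreal" where "G x = ennreal (exp (- (1 / 2) * (norm x)\<^sup>2))" for x
  have [measurable]: "G \<in> borel_measurable borel" unfolding G_def by measurable
  define c where "c = sqrt (2 * pi / 1) ^ m"
  have c: "c > 0" by (simp add: c_def)
  have G: "(\<integral>\<^sup>+x. G x \<partial>Lb b m) = ennreal c" if "orthonormal b m" for b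
    unfolding G_def c_def using nn_integral_Lb_gaussian[OF that, of 1] by simp
  have TB: "gs_vol (\<lambda>i. T (B i)) m \<noteq> 0" using inj B by (intro gs_vol_inj_image[OF T]) auto
  have TU: "gs_vol (\<lambda>i. T (unit_vec i)) m \<noteq> 0"
    using inj orthonormal_gs_vol[OF orthonormal_unit_vec, of m] by (intro gs_vol_inj_image[OF T]) (auto simp: unit_vec_in_Rn)
  define X where "X = (\<integral>\<^sup>+x. G (T x) \<partial>Lb B m)"
  have 1: "ennreal (gs_vol (\<lambda>i. T (B i)) m) * X = ennreal c"
    using nn_integral_Lb_gs[OF TB, of G] G[OF orthonormal_gs(1)[OF TB]] nn_integral_Lb_linear[OF T Tm, of G B m]
    by (simp add: X_def)
  have "Lb (gs B) m = Leb m"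
    using orthonormal_gs[OF B(2)] gs_vol_neq_0_imp_span[OF B(2,1)] by (intro Lb_eq_Leb) auto
  then have 2: "ennreal (gs_vol B m) * X = (\<integral>\<^sup>+x. G (T x) \<partial>Leb m)"
    using nn_integral_Lb_gs[OF B(2), of "\<lambda>x. G (T x)"] by (simp add: X_def)
  have 3: "ennreal (gs_vol (\<lambda>i. T (unit_vec i)) m) * (\<integral>\<^sup>+x. G (T x) \<partial>Leb m) = ennreal c"
    using nn_integral_Lb_gs[OF TU, of G] G[OF orthonormal_gs(1)[OF TU]] nn_integral_Lb_linear[OF T Tm, of G unit_vec m]
    by simp
  have "X \<noteq> \<infinity>" using 1 TB by (auto simp: ennreal_mult_top)
  then obtain x where x: "X = ennreal x" "x \<ge> 0" by (cases X) auto
  have "gs_vol (\<lambda>i. T (B i)) m * x = c" using 1 x c by (simp add: ennreal_mult[symmetric])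
  moreover have "gs_vol (\<lambda>i. T (unit_vec i)) m * (gs_vol B m * x) = c"
    using 3 x c unfolding 2[symmetric] by (simp add: ennreal_mult[symmetric])
  moreover have "x \<noteq> 0" using calculation c by auto
  ultimately have "gs_vol (\<lambda>i. T (B i)) m * x = (gs_vol B m * gs_vol (\<lambda>i. T (unit_vec i)) m) * x" by (simp add: mult_ac)
  then show ?thesis using \<open>x \<noteq> 0\<close> by simp
qed

text \<open>Substituting \<open>T (B j)\<close> in each of the m vectors gives m Jacobians 1 / D,
  and the k-th power of the volume gives k more. The new vectors range over the image of T, which
  the isometry \<open>O'\<close> identifies with R^m without changing norms or volumes.\<close>

lemma nn_integral_radial_matrix:
  fixes T :: "fin_seq \<Rightarrow> fin_seq" and \<rho> :: "real \<Rightarrow> ennreal"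
  assumes T: "linear T" and inj: "\<And>x. x \<in> Rn m \<Longrightarrow> T x = 0 \<Longrightarrow> x = 0" and Tm [measurable]: "T \<in> borel_measurable borel"
    and \<rho> [measurable]: "\<rho> \<in> borel_measurable borel"
  defines "D \<equiv> gs_vol (\<lambda>l. T (unit_vec l)) m"
  shows "(\<integral>\<^sup>+B. ennreal (gs_vol B m ^ k) * (\<Prod>j<m. \<rho> (norm (T (B j)))) \<partial>PLeb {..<m} m)
    = ennreal ((1 / D) ^ (m + k)) * (\<integral>\<^sup>+B. ennreal (gs_vol B m ^ k) * (\<Prod>j<m. \<rho> (norm (B j))) \<partial>PLeb {..<m} m)"
proof -
  let ?w = "\<lambda>l. T (unit_vec l)"
  have D: "D \<noteq> 0"
    unfolding D_def using inj orthonormal_gs_vol[OF orthonormal_unit_vec, of m]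
    by (intro gs_vol_inj_image[OF T]) (auto simp: unit_vec_in_Rn)
  then have D0: "D > 0" using gs_vol_nonneg[of ?w m] by (simp add: D_def less_le)
  define e where "e = gs ?w"
  have e: "orthonormal e m" unfolding e_def using D by (intro orthonormal_gs(1)) (simp add: D_def)
  define G where "G B = ennreal (gs_vol B m ^ k) * (\<Prod>j<m. \<rho> (norm (B j)))" for B :: "nat \<Rightarrow> fin_seq"
  have [measurable]: "(\<lambda>X. gs_vol X m) \<in> borel_measurable (PiM {..<m} (\<lambda>_. borel :: fin_seq measure))"
    by (rule borel_measurable_gs_vol) simp
  have [measurable]: "G \<in> borel_measurable (PiM {..<m} (\<lambda>_. borel))" unfolding G_def by measurable
  then have Gm [measurable]: "G \<in> borel_measurable (PLeb {..<m} n)" for n by (simp add: measurable_PLeb_eq)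
  have Gm' [measurable]: "G \<in> borel_measurable (PiM {..<m} (\<lambda>_. Lb e m))"
  proof -
    have "sets (PiM {..<m} (\<lambda>_. Lb e m)) = sets (PiM {..<m} (\<lambda>_. borel))" by (rule sets_PiM_cong) simp_all
    then show ?thesis using \<open>G \<in> borel_measurable (PiM {..<m} (\<lambda>_. borel))\<close> by (simp cong: measurable_cong_sets)
  qed
  have G_cong: "G B = G B'" if "\<And>j. j < m \<Longrightarrow> B j = B' j" for B B'
    unfolding G_def using that gs_vol_cong[of m B B'] by simp
  define O' where "O' y = (\<Sum>l<m. coord y l *\<^sub>R e l)" for y
  have linO: "linear O'" by (rule linearI) (simp_all add: O'_def scaleR_add_left sum.distrib scaleR_sum_right)
  have Om [measurable]: "O' \<in> borel_measurable borel" unfolding O'_def by measurable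
  have isoO: "O' x \<bullet> O' y = x \<bullet> y" if "x \<in> Rn m" "y \<in> Rn m" for x y
  proof -
    have "O' x \<bullet> O' y = (\<Sum>l<m. coord y l * (O' x \<bullet> e l))" by (simp add: O'_def inner_sum_right)
    also have "\<dots> = (\<Sum>l<m. coord y l * coord x l)"
      unfolding O'_def using orthonormal_inner_sum[OF e] by (intro sum.cong) auto
    also have "\<dots> = x \<bullet> y" by (simp add: inner_Rn[OF that(1)] mult.commute)
    finally show ?thesis .
  qed
  have unitO: "O' (unit_vec l) = e l" if "l < m" for l
  proof -
    have "O' (unit_vec l) = (\<Sum>i<m. if i = l then e l else 0)"
      unfolding O'_def by (intro sum.cong) (auto simp: coord_unit_vec)
    then show ?thesis using that by simp
  qed
  have eqT: "(\<integral>\<^sup>+x. g (T x) \<partial>Leb m) = ennreal (1 / D) * (\<integral>\<^sup>+y. g y \<partial>Lb e m)" if "g \<in> borel_measurable (Lb e m)" for g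
  proof -
    have g: "g \<in> borel_measurable borel" using that by (simp add: measurable_Lb_eq)
    have "ennreal (1 / D) * (\<integral>\<^sup>+y. g y \<partial>Lb e m) = ennreal (1 / D) * (ennreal D * (\<integral>\<^sup>+x. g x \<partial>Lb ?w m))"
      using nn_integral_Lb_gs[OF _ g, of ?w m] D by (simp add: D_def e_def)
    also have "\<dots> = (\<integral>\<^sup>+x. g x \<partial>Lb ?w m)"
      using D0 by (simp add: mult.assoc[symmetric] ennreal_mult[symmetric])
    finally show ?thesis using nn_integral_Lb_linear[OF T Tm g, of unit_vec m] by simp
  qed
  have eqO: "(\<integral>\<^sup>+x. g (O' x) \<partial>Leb m) = 1 * (\<integral>\<^sup>+y. g y \<partial>Lb e m)" if "g \<in> borel_measurable (Lb e m)" for g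
  proof -
    have g [measurable]: "g \<in> borel_measurable borel" using that by (simp add: measurable_Lb_eq)
    have "(\<integral>\<^sup>+x. g (O' x) \<partial>Leb m) = (\<integral>\<^sup>+x. g x \<partial>Lb (\<lambda>l. O' (unit_vec l)) m)"
      using nn_integral_Lb_linear[OF linO Om g] by simp
    also have "\<dots> = (\<integral>\<^sup>+y. g y \<partial>Lb e m)" by (simp add: nn_integral_Lb unitO)
    finally show ?thesis by simp
  qed
  have "(\<integral>\<^sup>+B. ennreal (gs_vol B m ^ k) * (\<Prod>j<m. \<rho> (norm (T (B j)))) \<partial>PLeb {..<m} m)
      = (\<integral>\<^sup>+B. ennreal ((1 / D) ^ k) * G (\<lambda>j\<in>{..<m}. T (B j)) \<partial>PLeb {..<m} m)"
  proof (rule nn_integral_cong_AE)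
    show "AE B in PLeb {..<m} m. ennreal (gs_vol B m ^ k) * (\<Prod>j<m. \<rho> (norm (T (B j)))) = ennreal ((1 / D) ^ k) * G (\<lambda>j\<in>{..<m}. T (B j))"
      using AE_PLeb_gs_vol[OF order_refl, of m] AE_PLeb_Rn[of "{..<m}" m, simplified]
    proof eventually_elim
      case (elim B)
      have "gs_vol (\<lambda>j\<in>{..<m}. T (B j)) m = gs_vol (\<lambda>j. T (B j)) m" by (rule gs_vol_cong) simp
      also have "\<dots> = gs_vol B m * D"
        unfolding D_def using elim by (intro gs_vol_mult[OF T inj Tm]) auto
      finally have "gs_vol B m ^ k = (1 / D) ^ k * gs_vol (\<lambda>j\<in>{..<m}. T (B j)) m ^ k"
        using D0 by (simp add: power_mult_distrib[symmetric])
      moreover have "ennreal ((1 / D) ^ k * gs_vol (\<lambda>j\<in>{..<m}. T (B j)) m ^ k) = ennreal ((1 / D) ^ k) * ennreal (gs_vol (\<lambda>j\<in>{..<m}. T (B j)) m ^ k)"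
        using D0 by (intro ennreal_mult) auto
      ultimately show ?case by (simp add: G_def mult.assoc)
    qed
  qed
  also have "\<dots> = ennreal ((1 / D) ^ k) * (\<integral>\<^sup>+B. G (\<lambda>j\<in>{..<m}. T (B j)) \<partial>PLeb {..<m} m)"
  proof (rule nn_integral_cmult)
    have "(\<lambda>B. \<lambda>j\<in>{..<m}. T (B j)) \<in> PLeb {..<m} m \<rightarrow>\<^sub>M PLeb {..<m} m"
      unfolding measurable_PLeb_eq
      by (intro measurable_restrict measurable_compose[OF _ Tm] measurable_component_singleton) auto
    then show "(\<lambda>B. G (\<lambda>j\<in>{..<m}. T (B j))) \<in> borel_measurable (PLeb {..<m} m)"
      by (rule measurable_compose[OF _ Gm])
  qed
  also have "(\<integral>\<^sup>+B. G (\<lambda>j\<in>{..<m}. T (B j)) \<partial>PLeb {..<m} m) = ennreal (1 / D) ^ card {..<m} * (\<integral>\<^sup>+y. G y \<partial>PiM {..<m} (\<lambda>_. Lb e m))"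
    using Tm by (intro nn_integral_PiM_map[OF sigma_finite_Leb sigma_finite_Lb[OF e] _ _ eqT _ Gm']) (auto simp: measurable_Lb_eq)
  also have "(\<integral>\<^sup>+y. G y \<partial>PiM {..<m} (\<lambda>_. Lb e m)) = 1 ^ card {..<m} * (\<integral>\<^sup>+y. G y \<partial>PiM {..<m} (\<lambda>_. Lb e m))" by simp
  also have "\<dots> = (\<integral>\<^sup>+B. G (\<lambda>j\<in>{..<m}. O' (B j)) \<partial>PLeb {..<m} m)"
    using Om by (intro nn_integral_PiM_map[symmetric, OF sigma_finite_Leb sigma_finite_Lb[OF e] _ _ eqO _ Gm']) (auto simp: measurable_Lb_eq)
  also have "\<dots> = (\<integral>\<^sup>+B. G B \<partial>PLeb {..<m} m)"
  proof (rule nn_integral_cong_AE)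
    show "AE B in PLeb {..<m} m. G (\<lambda>j\<in>{..<m}. O' (B j)) = G B"
      using AE_PLeb_Rn[of "{..<m}" m, simplified]
    proof eventually_elim
      case (elim B)
      have "gs_vol (\<lambda>j\<in>{..<m}. O' (B j)) m = gs_vol (\<lambda>j. O' (B j)) m" by (rule gs_vol_cong) simp
      also have "\<dots> = gs_vol B m"
        using elim isoO by (intro gs_vol_isometry_on[OF linO subspace_Rn[of m]]) auto
      finally have 1: "gs_vol (\<lambda>j\<in>{..<m}. O' (B j)) m = gs_vol B m" .
      have "norm (O' (B j)) = norm (B j)" if "j < m" for j
        using isoO[of "B j" "B j"] elim that by (simp add: norm_eq_sqrt_inner)
      then show ?case unfolding G_def 1 by simp
    qed
  qed
  also have "ennreal ((1 / D) ^ k) * (ennreal (1 / D) ^ card {..<m} * (\<integral>\<^sup>+B. G B \<partial>PLeb {..<m} m))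
      = ennreal ((1 / D) ^ (m + k)) * (\<integral>\<^sup>+B. G B \<partial>PLeb {..<m} m)"
    using D0 by (simp add: ennreal_power ennreal_mult[symmetric] mult.assoc[symmetric] power_add mult.commute)
  finally show ?thesis by (simp add: G_def)
qed

section \<open>Gaussian vectors and integrals over their span\<close>

text \<open>A function of the radius, because it is also evaluated on vectors of R^m with index m +
  k. The index only fixes the normalising factor; the total mass is one in dimension n.\<close>

definition gauss_density :: "nat \<Rightarrow> real \<Rightarrow> ennreal" where
  "gauss_density n r = ennreal ((1 / sqrt (2 * pi)) ^ n * exp (- (1 / 2) * r\<^sup>2))"

definition gauss_measure :: "nat \<Rightarrow> fin_seq measure" where
  "gauss_measure n = density (Leb n) (\<lambda>x. gauss_density n (norm x))"

lemma borel_measurable_gauss_density [measurable]: "gauss_density n \<in> borel_measurable borel"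
  unfolding gauss_density_def by measurable

lemma sets_gauss_measure [simp, measurable_cong]: "sets (gauss_measure n) = sets borel"
  by (simp add: gauss_measure_def)

lemma space_gauss_measure [simp]: "space (gauss_measure n) = UNIV"
  by (simp add: gauss_measure_def)

lemma nn_integral_gauss_density:
  assumes "orthonormal b d"
  shows "(\<integral>\<^sup>+x. gauss_density d (norm x) \<partial>Lb b d) = 1"
proof -
  have "(\<integral>\<^sup>+x. gauss_density d (norm x) \<partial>Lb b d)
      = (\<integral>\<^sup>+x. ennreal ((1 / sqrt (2 * pi)) ^ d) * ennreal (exp (- (1 / 2) * (norm x)\<^sup>2)) \<partial>Lb b d)"
    unfolding gauss_density_def by (intro nn_integral_cong ennreal_mult) auto
  also have "\<dots> = ennreal ((1 / sqrt (2 * pi)) ^ d) * (\<integral>\<^sup>+x. ennreal (exp (- (1 / 2) * (norm x)\<^sup>2)) \<partial>Lb b d)"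
    by (rule nn_integral_cmult) (simp add: measurable_Lb_eq)
  also have "\<dots> = ennreal ((1 / sqrt (2 * pi)) ^ d) * ennreal (sqrt (2 * pi / 1) ^ d)"
    by (subst nn_integral_Lb_gaussian[OF assms]) auto
  also have "\<dots> = ennreal (((1 / sqrt (2 * pi)) * sqrt (2 * pi)) ^ d)"
    by (subst ennreal_mult[symmetric]) (simp_all only: power_mult_distrib div_by_1, simp_all)
  also have "(1 / sqrt (2 * pi)) * sqrt (2 * pi) = 1" by simp
  also have "ennreal (1 ^ d) = 1" by simp
  finally show ?thesis .
qed

lemma prob_space_gauss_measure: "prob_space (gauss_measure n)"
proof
  have "(\<integral>\<^sup>+x. gauss_density n (norm x) * indicator UNIV x \<partial>Leb n) = 1"
    using nn_integral_gauss_density[OF orthonormal_unit_vec] by simp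
  then show "emeasure (gauss_measure n) (space (gauss_measure n)) = 1"
    unfolding gauss_measure_def by (subst emeasure_density) (auto simp: measurable_Lb_eq)
qed

abbreviation PGauss :: "nat \<Rightarrow> nat \<Rightarrow> (nat \<Rightarrow> fin_seq) measure" where
  "PGauss m n \<equiv> PiM {..<m} (\<lambda>_. gauss_measure n)"

lemma PGauss_density: "PGauss m n = density (PLeb {..<m} n) (\<lambda>X. \<Prod>i<m. gauss_density n (norm (X i)))"
  unfolding gauss_measure_def
  by (rule PiM_density[OF sigma_finite_Leb]) (simp_all add: measurable_Lb_eq gauss_density_def)

lemma prob_space_PGauss: "prob_space (PGauss m n)"
  by (intro prob_space_PiM prob_space_gauss_measure)

lemma sets_PGauss: "sets (PGauss m n) = sets (PiM {..<m} (\<lambda>_. borel))"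
  by (rule sets_PiM_cong) simp_all

lemma measurable_PGauss_eq: "measurable (PGauss m n) N = measurable (PiM {..<m} (\<lambda>_. borel)) N"
  by (auto intro!: measurable_cong_sets sets_PGauss)

lemma borel_measurable_gauss_prod:
  "(\<lambda>X. \<Prod>i<m. gauss_density n (norm (X i))) \<in> borel_measurable (PiM {..<m} (\<lambda>_. borel :: fin_seq measure))"
  by measurable

lemma nn_integral_PGauss:
  assumes "g \<in> borel_measurable (PiM {..<m} (\<lambda>_. borel))"
  shows "(\<integral>\<^sup>+X. g X \<partial>PGauss m n) = (\<integral>\<^sup>+X. (\<Prod>i<m. gauss_density n (norm (X i))) * g X \<partial>PLeb {..<m} n)"
  unfolding PGauss_density using assms borel_measurable_gauss_prod[of n m]
  by (intro nn_integral_density) (simp_all add: measurable_PLeb_eq)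

lemma AE_PGauss:
  assumes "AE X in PLeb {..<m} n. P X"
  shows "AE X in PGauss m n. P X"
  unfolding PGauss_density using assms borel_measurable_gauss_prod[of n m]
  by (subst AE_density) (auto simp: measurable_PLeb_eq elim!: eventually_mono)

text \<open>The integral of \<open>f\<close> over the span of \<open>w\<^sub>0, \<dots>, w\<^bsub>m-1\<^esub>\<close>, if these vectors are independent.\<close>

definition span_integral :: "nat \<Rightarrow> (fin_seq \<Rightarrow> ennreal) \<Rightarrow> (nat \<Rightarrow> fin_seq) \<Rightarrow> ennreal" where
  "span_integral m f w = ennreal (gs_vol w m) * (\<integral>\<^sup>+x. f x \<partial>Lb w m)"

text \<open>In terms of coefficients c the integrand is jointly measurable in c and w over a fixed
  measure, whereas \<open>Lb w m\<close> itself varies with w.\<close>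

lemma borel_measurable_span_integral:
  assumes [measurable]: "f \<in> borel_measurable borel"
  shows "span_integral m f \<in> borel_measurable (PiM {..<m} (\<lambda>_. borel))"
proof -
  interpret L: sigma_finite_measure "PiM {..<m} (\<lambda>_. lborel :: real measure)" by (rule lborel_prod.sigma_finite) simp
  have [measurable]: "(\<lambda>w. gs_vol w m) \<in> borel_measurable (PiM {..<m} (\<lambda>_. borel :: fin_seq measure))"
    by (rule borel_measurable_gs_vol) simp
  have "(\<lambda>w. \<integral>\<^sup>+c. f (\<Sum>i<m. c i *\<^sub>R w i) \<partial>(PiM {..<m} (\<lambda>_. lborel))) \<in> borel_measurable (PiM {..<m} (\<lambda>_. borel))"
    by measurable
  then show ?thesis unfolding span_integral_def nn_integral_Lb[OF assms] by measurable
qed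

lemma span_integral_eq:
  assumes "gs_vol w m \<noteq> 0" "f \<in> borel_measurable borel"
  shows "span_integral m f w = (\<integral>\<^sup>+x. f x \<partial>Lb (gs w) m)"
  unfolding span_integral_def by (rule nn_integral_Lb_gs[OF assms])

lemma span_integral_cong: "(\<And>i. i < m \<Longrightarrow> w i = w' i) \<Longrightarrow> span_integral m f w = span_integral m f w'"
  unfolding span_integral_def Lb_def by (simp add: gs_vol_cong[of m w w'])

text \<open>The volume of B cancels, so the value depends on the map T alone and not on the vectors
  chosen in its image.\<close>

lemma span_integral_image:
  assumes T: "linear T" and inj: "\<And>x. x \<in> Rn m \<Longrightarrow> T x = 0 \<Longrightarrow> x = 0" and Tm [measurable]: "T \<in> borel_measurable borel"
    and B: "\<And>i. i < m \<Longrightarrow> B i \<in> Rn m" "gs_vol B m \<noteq> 0" and f [measurable]: "f \<in> borel_measurable borel"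
  shows "span_integral m f (\<lambda>j. T (B j)) = ennreal (gs_vol (\<lambda>l. T (unit_vec l)) m) * (\<integral>\<^sup>+x. f (T x) \<partial>Leb m)"
proof -
  have Lb: "Lb (gs B) m = Leb m"
    using orthonormal_gs[OF B(2)] gs_vol_neq_0_imp_span[OF B(2,1)] by (intro Lb_eq_Leb) auto
  have "ennreal (gs_vol B m) * (\<integral>\<^sup>+x. f (T x) \<partial>Lb B m) = (\<integral>\<^sup>+x. f (T x) \<partial>Leb m)"
    using nn_integral_Lb_gs[OF B(2), of "\<lambda>x. f (T x)"] Lb by simp
  moreover have "gs_vol (\<lambda>j. T (B j)) m = gs_vol B m * gs_vol (\<lambda>l. T (unit_vec l)) m"
    by (rule gs_vol_mult[OF T inj Tm B])
  ultimately show ?thesis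
    unfolding span_integral_def nn_integral_Lb_linear[OF T Tm f]
    by (simp add: ennreal_mult) (metis mult.assoc mult.commute)
qed

section \<open>Gaussian moments of volumes and the total constant\<close>

text \<open>For k = 1 this is x <= exp(x - 1) at x = r^2 / n, with equality at r^2 = n; the general
  case is the k-th power.\<close>

lemma radial_power_le:
  assumes "n > 0" "r \<ge> 0"
  shows "r ^ k * exp (- (real k / real n / 2) * r\<^sup>2) \<le> sqrt (real n / exp 1) ^ k"
proof -
  have "(r * exp (- r\<^sup>2 / (2 * real n)))\<^sup>2 = r\<^sup>2 * exp (- r\<^sup>2 / real n)"
    by (simp add: power_mult_distrib exp_double[symmetric])
  also have "\<dots> = real n * (r\<^sup>2 / real n) * exp (- r\<^sup>2 / real n)" using assms by simp
  also have "\<dots> \<le> real n * exp (r\<^sup>2 / real n - 1) * exp (- r\<^sup>2 / real n)"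
    using exp_ge_add_one_self[of "r\<^sup>2 / real n - 1"] by (intro mult_right_mono mult_left_mono) auto
  also have "\<dots> = real n / exp 1" by (simp add: exp_diff exp_minus field_simps)
  finally have "r * exp (- r\<^sup>2 / (2 * real n)) \<le> sqrt (real n / exp 1)" by (rule real_le_rsqrt)
  then have "(r * exp (- r\<^sup>2 / (2 * real n))) ^ k \<le> sqrt (real n / exp 1) ^ k"
    using assms by (intro power_mono) auto
  moreover have "exp (- r\<^sup>2 / (2 * real n)) ^ k = exp (- (real k / real n / 2) * r\<^sup>2)"
    by (simp add: exp_of_nat_mult[symmetric])
  ultimately show ?thesis by (simp add: power_mult_distrib)
qed

lemma ratio_power_le:
  assumes "m \<ge> 1"
  shows "((real m + real k) / real m) ^ m \<le> exp (real k)"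
proof -
  have "(real m + real k) / real m \<le> exp (real k / real m)"
    using exp_ge_add_one_self[of "real k / real m"] assms by (simp add: field_simps)
  then have "((real m + real k) / real m) ^ m \<le> exp (real k / real m) ^ m" by (intro power_mono) auto
  also have "\<dots> = exp (real k)" using assms by (simp add: exp_of_nat_mult[symmetric])
  finally show ?thesis .
qed

text \<open>The Gaussian exponent is split in the proportion k : m. One part absorbs
  \<open>norm x ^ k\<close> at the price (n / e)^(k/2), where n = m + k; the other is integrated
  over R^m and gives (2 pi n / m)^(m/2). Since (n / m)^m <= exp(k), the powers of e cancel.\<close>

lemma gauss_moment_le:
  assumes m: "m \<ge> 1"
  shows "(\<integral>\<^sup>+x. ennreal (norm x ^ k) * gauss_density (m + k) (norm x) \<partial>Leb m) \<le> ennreal (sqrt (real (m + k)) ^ k)"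
proof -
  define n where "n = m + k"
  have n: "n > 0" using m by (simp add: n_def)
  define \<theta> where "\<theta> = real m / real n"
  have \<theta>: "\<theta> > 0" using m n by (simp add: \<theta>_def)
  have k\<theta>: "real k / real n = 1 - \<theta>" 
  proof -
    have "real k / real n + real m / real n = 1"
      unfolding add_divide_distrib[symmetric] using m by (simp add: n_def add.commute add_nonneg_eq_0_iff)
    then show ?thesis by (simp add: \<theta>_def)
  qed
  define A where "A = (1 / sqrt (2 * pi)) ^ n * sqrt (real n / exp 1) ^ k"
  have A: "A \<ge> 0" by (simp add: A_def)
  have "(\<integral>\<^sup>+x. ennreal (norm x ^ k) * gauss_density n (norm x) \<partial>Leb m)
      \<le> (\<integral>\<^sup>+x. ennreal A * ennreal (exp (- (\<theta> / 2) * (norm x)\<^sup>2)) \<partial>Leb m)"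
  proof (rule nn_integral_mono)
    fix x :: fin_seq
    have "norm x ^ k * ((1 / sqrt (2 * pi)) ^ n * exp (- (1 / 2) * (norm x)\<^sup>2))
        = (1 / sqrt (2 * pi)) ^ n * (norm x ^ k * exp (- (real k / real n / 2) * (norm x)\<^sup>2)) * exp (- (\<theta> / 2) * (norm x)\<^sup>2)"
    proof -
      have "exp (- (1 / 2) * (norm x)\<^sup>2) = exp (- (real k / real n / 2) * (norm x)\<^sup>2) * exp (- (\<theta> / 2) * (norm x)\<^sup>2)"
        unfolding k\<theta> exp_add[symmetric] by (simp add: field_simps)
      then show ?thesis by (simp add: mult_ac)
    qed
    also have "\<dots> \<le> A * exp (- (\<theta> / 2) * (norm x)\<^sup>2)"
      unfolding A_def by (intro mult_right_mono mult_left_mono radial_power_le n) auto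
    finally have "ennreal (norm x ^ k * ((1 / sqrt (2 * pi)) ^ n * exp (- (1 / 2) * (norm x)\<^sup>2))) \<le> ennreal (A * exp (- (\<theta> / 2) * (norm x)\<^sup>2))"
      by (rule ennreal_leI)
    then show "ennreal (norm x ^ k) * gauss_density n (norm x) \<le> ennreal A * ennreal (exp (- (\<theta> / 2) * (norm x)\<^sup>2))"
      unfolding gauss_density_def using A by (subst (asm) (1 2) ennreal_mult) auto
  qed
  also have "\<dots> = ennreal A * ennreal (sqrt (2 * pi / \<theta>) ^ m)"
    using nn_integral_Lb_gaussian[OF orthonormal_unit_vec \<theta>, of m] by (subst nn_integral_cmult) (auto simp: measurable_Lb_eq)
  also have "\<dots> = ennreal (A * sqrt (2 * pi / \<theta>) ^ m)"
    using A \<theta> by (intro ennreal_mult[symmetric] zero_le_power real_sqrt_ge_zero) auto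
  also have "\<dots> \<le> ennreal (sqrt n ^ k)"
  proof (rule ennreal_leI)
    have "2 * pi / \<theta> = 2 * pi * ((real m + real k) / real m)" using m by (simp add: \<theta>_def n_def)
    then have "sqrt (2 * pi / \<theta>) ^ m = sqrt (2 * pi) ^ m * sqrt (((real m + real k) / real m) ^ m)"
      by (simp only: real_sqrt_mult power_mult_distrib real_sqrt_power)
    also have "\<dots> \<le> sqrt (2 * pi) ^ m * sqrt (exp (real k))"
      by (intro mult_left_mono real_sqrt_le_mono ratio_power_le m) auto
    also have "sqrt (exp (real k)) = sqrt (exp 1) ^ k"
      using exp_of_nat_mult[of k "1::real"] by (simp only: real_sqrt_power mult_1_right)
    finally have "A * sqrt (2 * pi / \<theta>) ^ m \<le> A * (sqrt (2 * pi) ^ m * sqrt (exp 1) ^ k)" using A by (rule mult_left_mono)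
    also have "\<dots> = (1 / sqrt (2 * pi) * sqrt (2 * pi)) ^ m * ((1 / sqrt (2 * pi)) ^ k * (sqrt (real n / exp 1) * sqrt (exp 1)) ^ k)"
      unfolding A_def n_def power_add power_mult_distrib by (simp only: mult_ac)
    also have "1 / sqrt (2 * pi) * sqrt (2 * pi) = 1" by simp
    also have "sqrt (real n / exp 1) * sqrt (exp 1) = sqrt n" by (simp add: real_sqrt_mult[symmetric])
    also have "1 ^ m * ((1 / sqrt (2 * pi)) ^ k * sqrt n ^ k) = (1 / sqrt (2 * pi)) ^ k * sqrt n ^ k" by simp
    also have "\<dots> \<le> 1 * sqrt n ^ k"
      using pi_gt3 by (intro mult_right_mono power_le_one) auto
    finally show "A * sqrt (2 * pi / \<theta>) ^ m \<le> sqrt n ^ k" by simp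
  qed
  finally show ?thesis by (simp add: n_def)
qed

text \<open>Hadamard's inequality bounds the volume by the product of the norms, so the moment
  factors over the vectors.\<close>

lemma gauss_det_moment_le:
  assumes m: "m \<ge> 1"
  shows "(\<integral>\<^sup>+B. ennreal (gs_vol B m ^ k) * (\<Prod>j<m. gauss_density (m + k) (norm (B j))) \<partial>PLeb {..<m} m)
    \<le> ennreal (sqrt (real (m + k)) ^ (k * m))"
proof -
  have "(\<integral>\<^sup>+B. ennreal (gs_vol B m ^ k) * (\<Prod>j<m. gauss_density (m + k) (norm (B j))) \<partial>PLeb {..<m} m)
      \<le> (\<integral>\<^sup>+B. (\<Prod>j<m. ennreal (norm (B j) ^ k) * gauss_density (m + k) (norm (B j))) \<partial>PLeb {..<m} m)"
  proof (rule nn_integral_mono)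
    fix B :: "nat \<Rightarrow> fin_seq"
    have "gs_vol B m ^ k \<le> (\<Prod>j<m. norm (B j)) ^ k" by (intro power_mono gs_vol_le) auto
    then have "ennreal (gs_vol B m ^ k) \<le> (\<Prod>j<m. ennreal (norm (B j) ^ k))"
      by (simp add: prod_ennreal prod_power_distrib ennreal_leI)
    then show "ennreal (gs_vol B m ^ k) * (\<Prod>j<m. gauss_density (m + k) (norm (B j)))
        \<le> (\<Prod>j<m. ennreal (norm (B j) ^ k) * gauss_density (m + k) (norm (B j)))"
      by (simp add: prod.distrib mult_right_mono)
  qed
  also have "\<dots> = (\<Prod>j<m. \<integral>\<^sup>+x. ennreal (norm x ^ k) * gauss_density (m + k) (norm x) \<partial>Leb m)"
    by (rule Leb_prod.product_nn_integral_prod) (auto simp: measurable_Lb_eq)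
  also have "\<dots> \<le> (\<Prod>j<m. ennreal (sqrt (real (m + k)) ^ k))"
    by (intro prod_mono_ennreal gauss_moment_le m)
  also have "\<dots> = ennreal (sqrt (real (m + k)) ^ (k * m))"
    by (simp add: ennreal_power power_mult)
  finally show ?thesis .
qed

text \<open>With n = m + k, the powers of n and m combine to (n / m)^(mk/2), which is at most
  2^(k^2) because (n / m)^m <= exp(k) <= 4^k. Only factors exponential in k(m + k) remain, and 1152
  is 2 times 576.\<close>

lemma total_constant_le:
  assumes m: "m \<ge> 1" and M: "M > 0"
  shows "sqrt (real (m + k)) ^ (k * m) * (M * (576 / sqrt m) ^ m) ^ k \<le> M ^ k * 1152 ^ (k * (m + k))"
proof -
  have "sqrt (real (m + k)) ^ (k * m) * (M * (576 / sqrt m) ^ m) ^ k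
      = M ^ k * ((576 ^ m) ^ k * ((sqrt (real (m + k)) / sqrt m) ^ m) ^ k)"
    by (simp add: power_mult_distrib power_divide power_mult mult.commute[of k m])
  also have "(576 ^ m) ^ k = (576::real) ^ (k * m)" by (simp only: power_mult[symmetric] mult.commute)
  also have "(sqrt (real (m + k)) / sqrt m) ^ m = sqrt (((real m + real k) / real m) ^ m)"
    by (simp add: real_sqrt_divide real_sqrt_power)
  also have "M ^ k * (576 ^ (k * m) * sqrt (((real m + real k) / real m) ^ m) ^ k) \<le> M ^ k * (576 ^ (k * m) * (2 ^ k) ^ k)"
  proof (intro mult_left_mono power_mono)
    have "((real m + real k) / real m) ^ m \<le> exp (real k)" by (rule ratio_power_le[OF m])
    also have "\<dots> = exp 1 ^ k" by (simp add: exp_of_nat_mult[symmetric])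
    also have "\<dots> \<le> (2 ^ 2) ^ k" using exp_le by (intro power_mono) auto
    also have "\<dots> = (2 ^ k)\<^sup>2" by (simp only: power_mult[symmetric] mult.commute)
    finally show "sqrt (((real m + real k) / real m) ^ m) \<le> 2 ^ k" by (intro real_le_lsqrt) auto
  qed (use M m in auto)
  also have "\<dots> \<le> M ^ k * (576 ^ (k * (m + k)) * 2 ^ (k * (m + k)))"
    using M by (intro mult_left_mono mult_mono) (auto simp: power_mult[symmetric] intro!: power_increasing)
  also have "\<dots> = M ^ k * 1152 ^ (k * (m + k))" by (simp add: power_mult_distrib[symmetric])
  finally show ?thesis .
qed

text \<open>In the chart the map C enters through its volume factor \<open>D C\<close>: integrating
  out the frame gives its power -(m + k), and the (m + k)-th power of the span integral gives the
  inverse of that. What is left is bounded by determinant moments of f on each graph, and the chart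
  formula read backwards turns these into the m-th power of the integral of f.\<close>

lemma nn_integral_span_integral_le_aux:
  assumes f [measurable]: "f \<in> borel_measurable borel" and fM: "\<And>x. f x \<le> ennreal M" and M: "M > 0"
    and m: "m \<ge> 1" and k: "k \<ge> 1"
  shows "(\<integral>\<^sup>+W. span_integral m f W ^ (m + k) \<partial>PGauss m (m + k))
    \<le> ennreal (M ^ k * 1152 ^ (k * (m + k))) * (\<integral>\<^sup>+x. f x \<partial>Leb (m + k)) ^ m"
proof -
  let ?n = "m + k"
  interpret C: sigma_finite_measure "PLeb {..<k} m" by (rule sigma_finite_PLeb) simp
  interpret Y: sigma_finite_measure "PLeb {..<m} m" by (rule sigma_finite_PLeb) simp
  define \<kappa> where "\<kappa> = (\<integral>\<^sup>+B. ennreal (gs_vol B m ^ k) * (\<Prod>j<m. gauss_density ?n (norm (B j))) \<partial>PLeb {..<m} m)"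
  define L where "L = ennreal ((M * (576 / sqrt m) ^ m) ^ k)"
  define D where "D C = gs_vol (\<lambda>l. graph m k C (unit_vec l)) m" for C
  define a where "a C = (\<integral>\<^sup>+x. f (graph m k C x) \<partial>Leb m)" for C
  have gm: "graph m k C \<in> borel_measurable borel" for C by measurable
  have Dpos: "D C > 0" for C
  proof -
    have "D C \<noteq> 0"
      unfolding D_def using graph_eq_0 orthonormal_gs_vol[OF orthonormal_unit_vec, of m]
      by (intro gs_vol_inj_image[OF linear_graph]) (auto simp: unit_vec_in_Rn)
    then show ?thesis using gs_vol_nonneg[of "\<lambda>l. graph m k C (unit_vec l)" m] by (simp add: D_def less_le)
  qed
  have Dm [measurable]: "D \<in> borel_measurable (PLeb {..<k} m)"
    unfolding D_def by (intro borel_measurable_gs_vol borel_measurable_graph borel_measurable_PLeb_component) auto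
  have am [measurable]: "a \<in> borel_measurable (PLeb {..<k} m)"
  proof -
    have "(\<lambda>z. graph m k (fst z) (snd z)) \<in> borel_measurable (PLeb {..<k} m \<Otimes>\<^sub>M Leb m)"
    proof (rule borel_measurable_graph)
      show "(\<lambda>z. fst z i) \<in> borel_measurable (PLeb {..<k} m \<Otimes>\<^sub>M Leb m)" if "i < k" for i
        using that by (intro measurable_compose[OF measurable_fst] borel_measurable_PLeb_component) auto
      show "snd \<in> borel_measurable (PLeb {..<k} m \<Otimes>\<^sub>M Leb m)"
        using measurable_snd[of "PLeb {..<k} m" "Leb m"] by (simp add: measurable_Lb_eq)
    qed
    from measurable_compose[OF this f] show ?thesis
      unfolding a_def by (intro sigma_finite_measure.borel_measurable_nn_integral[OF sigma_finite_Leb]) (simp add: case_prod_beta)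
  qed
  have sm: "span_integral m f \<in> borel_measurable (PiM {..<m} (\<lambda>_. borel))" by (rule borel_measurable_span_integral[OF f])
  have G1m: "(\<lambda>X. (\<Prod>i<m. gauss_density ?n (norm (X i))) * span_integral m f X ^ ?n) \<in> borel_measurable (PiM {..<m} (\<lambda>_. borel))"
    using sm borel_measurable_gauss_prod[of ?n m] by measurable
  have gr_meas: "(\<lambda>z. \<lambda>j\<in>{..<m}. graph m k (snd z) (fst z j)) \<in> PLeb {..<m} m \<Otimes>\<^sub>M PLeb {..<k} m \<rightarrow>\<^sub>M PiM {..<m} (\<lambda>_. borel)"
  proof (intro measurable_restrict borel_measurable_graph)
    show "(\<lambda>z. snd z i) \<in> borel_measurable (PLeb {..<m} m \<Otimes>\<^sub>M PLeb {..<k} m)" if "i < k" for i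
      using that by (intro measurable_compose[OF measurable_snd] borel_measurable_PLeb_component) auto
    show "(\<lambda>z. fst z j) \<in> borel_measurable (PLeb {..<m} m \<Otimes>\<^sub>M PLeb {..<k} m)" if "j \<in> {..<m}" for j
      using that by (intro measurable_compose[OF measurable_fst] borel_measurable_PLeb_component) auto
  qed
  have gv: "(\<lambda>z. ennreal (gs_vol (fst z) m ^ k)) \<in> borel_measurable (PLeb {..<m} m \<Otimes>\<^sub>M PLeb {..<k} m)"
    using measurable_compose[OF measurable_fst borel_measurable_gs_vol_PLeb] by measurable
  \<comment> \<open>Exchanges frame and map in the chart formula; used once to integrate out the
    frame and once in the opposite direction.\<close>
  have swap: "(\<integral>\<^sup>+B. ennreal (gs_vol B m ^ k) * (\<integral>\<^sup>+C. h (\<lambda>j\<in>{..<m}. graph m k C (B j)) * h' C \<partial>PLeb {..<k} m) \<partial>PLeb {..<m} m)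
      = (\<integral>\<^sup>+C. (\<integral>\<^sup>+B. ennreal (gs_vol B m ^ k) * h (\<lambda>j\<in>{..<m}. graph m k C (B j)) \<partial>PLeb {..<m} m) * h' C \<partial>PLeb {..<k} m)"
    if h: "h \<in> borel_measurable (PiM {..<m} (\<lambda>_. borel))" and h' [measurable]: "h' \<in> borel_measurable (PLeb {..<k} m)" for h h'
  proof -
    have hm [measurable]: "(\<lambda>z. h (\<lambda>j\<in>{..<m}. graph m k (snd z) (fst z j))) \<in> borel_measurable (PLeb {..<m} m \<Otimes>\<^sub>M PLeb {..<k} m)"
      by (rule measurable_compose[OF gr_meas h])
    have h2 [measurable]: "(\<lambda>z. h' (snd z)) \<in> borel_measurable (PLeb {..<m} m \<Otimes>\<^sub>M PLeb {..<k} m)"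
      by (rule measurable_compose[OF measurable_snd h'])
    note gv [measurable]
    have hB: "(\<lambda>C. h (\<lambda>j\<in>{..<m}. graph m k C (B j)) * h' C) \<in> borel_measurable (PLeb {..<k} m)" if "B \<in> space (PLeb {..<m} m)" for B
      using measurable_compose[OF measurable_Pair1'[OF that, of "PLeb {..<k} m"] hm] h' by simp
    have hC: "(\<lambda>B. ennreal (gs_vol B m ^ k) * h (\<lambda>j\<in>{..<m}. graph m k C (B j))) \<in> borel_measurable (PLeb {..<m} m)" if "C \<in> space (PLeb {..<k} m)" for C
      using measurable_compose[OF measurable_Pair2'[OF that, of "PLeb {..<m} m"] hm] by simp
    have "(\<integral>\<^sup>+B. ennreal (gs_vol B m ^ k) * (\<integral>\<^sup>+C. h (\<lambda>j\<in>{..<m}. graph m k C (B j)) * h' C \<partial>PLeb {..<k} m) \<partial>PLeb {..<m} m)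
        = (\<integral>\<^sup>+B. \<integral>\<^sup>+C. ennreal (gs_vol B m ^ k) * (h (\<lambda>j\<in>{..<m}. graph m k C (B j)) * h' C) \<partial>PLeb {..<k} m \<partial>PLeb {..<m} m)"
      by (intro nn_integral_cong nn_integral_cmult[symmetric] hB)
    also have "\<dots> = (\<integral>\<^sup>+C. \<integral>\<^sup>+B. ennreal (gs_vol B m ^ k) * (h (\<lambda>j\<in>{..<m}. graph m k C (B j)) * h' C) \<partial>PLeb {..<m} m \<partial>PLeb {..<k} m)"
    proof (rule nn_swap[OF Y.sigma_finite_measure_axioms C.sigma_finite_measure_axioms])
      show "(\<lambda>(B, C). ennreal (gs_vol B m ^ k) * (h (\<lambda>j\<in>{..<m}. graph m k C (B j)) * h' C)) \<in> borel_measurable (PLeb {..<m} m \<Otimes>\<^sub>M PLeb {..<k} m)"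
        unfolding case_prod_beta by (intro borel_measurable_times_ennreal gv hm h2)
    qed
    also have "\<dots> = (\<integral>\<^sup>+C. (\<integral>\<^sup>+B. ennreal (gs_vol B m ^ k) * h (\<lambda>j\<in>{..<m}. graph m k C (B j)) \<partial>PLeb {..<m} m) * h' C \<partial>PLeb {..<k} m)"
      unfolding mult.assoc[symmetric] by (intro nn_integral_cong nn_integral_multc hC)
    finally show ?thesis .
  qed
  have "(\<integral>\<^sup>+W. span_integral m f W ^ ?n \<partial>PGauss m ?n)
      = (\<integral>\<^sup>+X. (\<Prod>i<m. gauss_density ?n (norm (X i))) * span_integral m f X ^ ?n \<partial>PLeb {..<m} ?n)"
    using sm by (intro nn_integral_PGauss) measurable
  also have "\<dots> = (\<integral>\<^sup>+B. ennreal (gs_vol B m ^ k) * (\<integral>\<^sup>+C. (\<Prod>i<m. gauss_density ?n (norm ((\<lambda>j\<in>{..<m}. graph m k C (B j)) i)))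
        * span_integral m f (\<lambda>j\<in>{..<m}. graph m k C (B j)) ^ ?n \<partial>PLeb {..<k} m) \<partial>PLeb {..<m} m)"
    by (rule nn_integral_PLeb_graph[OF G1m])
  also have "\<dots> = (\<integral>\<^sup>+B. ennreal (gs_vol B m ^ k) * (\<integral>\<^sup>+C. (\<Prod>i<m. gauss_density ?n (norm ((\<lambda>j\<in>{..<m}. graph m k C (B j)) i)))
        * (ennreal (D C) * a C) ^ ?n \<partial>PLeb {..<k} m) \<partial>PLeb {..<m} m)"
  proof (rule nn_integral_cong_AE)
    show "AE B in PLeb {..<m} m. ennreal (gs_vol B m ^ k) * (\<integral>\<^sup>+C. (\<Prod>i<m. gauss_density ?n (norm ((\<lambda>j\<in>{..<m}. graph m k C (B j)) i)))
        * span_integral m f (\<lambda>j\<in>{..<m}. graph m k C (B j)) ^ ?n \<partial>PLeb {..<k} m)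
      = ennreal (gs_vol B m ^ k) * (\<integral>\<^sup>+C. (\<Prod>i<m. gauss_density ?n (norm ((\<lambda>j\<in>{..<m}. graph m k C (B j)) i)))
        * (ennreal (D C) * a C) ^ ?n \<partial>PLeb {..<k} m)"
      using AE_PLeb_gs_vol[OF order_refl, of m] AE_PLeb_Rn[of "{..<m}" m, simplified]
    proof eventually_elim
      case (elim B)
      have "span_integral m f (\<lambda>j\<in>{..<m}. graph m k C (B j)) = ennreal (D C) * a C" for C
      proof -
        have "span_integral m f (\<lambda>j\<in>{..<m}. graph m k C (B j)) = span_integral m f (\<lambda>j. graph m k C (B j))"
          by (rule span_integral_cong) simp
        also have "\<dots> = ennreal (D C) * a C"
          unfolding D_def a_def using elim graph_eq_0 gm by (intro span_integral_image linear_graph f) auto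
        finally show ?thesis .
      qed
      then show ?case by simp
    qed
  qed
  also have "\<dots> = (\<integral>\<^sup>+C. (\<integral>\<^sup>+B. ennreal (gs_vol B m ^ k) * (\<Prod>i<m. gauss_density ?n (norm ((\<lambda>j\<in>{..<m}. graph m k C (B j)) i))) \<partial>PLeb {..<m} m)
      * (ennreal (D C) * a C) ^ ?n \<partial>PLeb {..<k} m)"
    by (rule swap[OF borel_measurable_gauss_prod]) measurable
  also have "\<dots> = (\<integral>\<^sup>+C. \<kappa> * a C ^ ?n \<partial>PLeb {..<k} m)"
  proof (rule nn_integral_cong)
    fix C
    have "(\<integral>\<^sup>+B. ennreal (gs_vol B m ^ k) * (\<Prod>i<m. gauss_density ?n (norm ((\<lambda>j\<in>{..<m}. graph m k C (B j)) i))) \<partial>PLeb {..<m} m)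
        = ennreal ((1 / D C) ^ ?n) * \<kappa>"
      unfolding D_def \<kappa>_def
      using nn_integral_radial_matrix[OF linear_graph[of m k C] graph_eq_0[of _ m k C] gm[of C] borel_measurable_gauss_density[of ?n], where k=k] by simp
    then have "(\<integral>\<^sup>+B. ennreal (gs_vol B m ^ k) * (\<Prod>i<m. gauss_density ?n (norm ((\<lambda>j\<in>{..<m}. graph m k C (B j)) i))) \<partial>PLeb {..<m} m)
        * (ennreal (D C) * a C) ^ ?n = (ennreal ((1 / D C) ^ ?n) * ennreal (D C) ^ ?n) * (\<kappa> * a C ^ ?n)"
      by (simp only: power_mult_distrib mult_ac)
    \<comment> \<open>The cancellation that fixes the exponent at m + k.\<close>
    also have "ennreal ((1 / D C) ^ ?n) * ennreal (D C) ^ ?n = 1"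
      using Dpos[of C] by (simp add: ennreal_power ennreal_mult[symmetric] power_mult_distrib[symmetric] del: power_one_over)
    finally show "(\<integral>\<^sup>+B. ennreal (gs_vol B m ^ k) * (\<Prod>i<m. gauss_density ?n (norm ((\<lambda>j\<in>{..<m}. graph m k C (B j)) i))) \<partial>PLeb {..<m} m)
        * (ennreal (D C) * a C) ^ ?n = \<kappa> * a C ^ ?n" by simp
  qed
  also have "\<dots> \<le> (\<integral>\<^sup>+C. (\<kappa> * L) * (\<integral>\<^sup>+B. ennreal (gs_vol B m ^ k) * (\<Prod>j<m. f ((\<lambda>j\<in>{..<m}. graph m k C (B j)) j)) \<partial>PLeb {..<m} m) \<partial>PLeb {..<k} m)"
  proof (rule nn_integral_mono)
    fix C
    have "a C ^ ?n \<le> L * (\<integral>\<^sup>+B. ennreal (gs_vol B m ^ k) * (\<Prod>j<m. f (graph m k C (B j))) \<partial>PLeb {..<m} m)"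
      unfolding a_def L_def using fM M m k measurable_compose[OF gm f] by (intro random_det_moment) auto
    then have "\<kappa> * a C ^ ?n \<le> \<kappa> * (L * (\<integral>\<^sup>+B. ennreal (gs_vol B m ^ k) * (\<Prod>j<m. f (graph m k C (B j))) \<partial>PLeb {..<m} m))"
      by (rule mult_left_mono) simp
    then show "\<kappa> * a C ^ ?n \<le> (\<kappa> * L) * (\<integral>\<^sup>+B. ennreal (gs_vol B m ^ k) * (\<Prod>j<m. f ((\<lambda>j\<in>{..<m}. graph m k C (B j)) j)) \<partial>PLeb {..<m} m)"
      by (simp add: mult.assoc)
  qed
  also have "\<dots> = (\<integral>\<^sup>+C. (\<integral>\<^sup>+B. ennreal (gs_vol B m ^ k) * (\<Prod>j<m. f ((\<lambda>j\<in>{..<m}. graph m k C (B j)) j)) \<partial>PLeb {..<m} m) * (\<kappa> * L) \<partial>PLeb {..<k} m)"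
    by (simp only: mult.commute)
  also have "\<dots> = (\<integral>\<^sup>+B. ennreal (gs_vol B m ^ k) * (\<integral>\<^sup>+C. (\<Prod>j<m. f ((\<lambda>j\<in>{..<m}. graph m k C (B j)) j)) * (\<kappa> * L) \<partial>PLeb {..<k} m) \<partial>PLeb {..<m} m)"
    by (rule swap[symmetric]) measurable
  \<comment> \<open>The chart formula in the reverse direction: m vectors on a common graph become m
    unconstrained vectors of R^(m + k).\<close>
  also have "\<dots> = (\<integral>\<^sup>+X. (\<Prod>j<m. f (X j)) * (\<kappa> * L) \<partial>PLeb {..<m} ?n)"
    by (rule nn_integral_PLeb_graph[symmetric]) measurable
  also have "\<dots> = (\<integral>\<^sup>+X. (\<Prod>j<m. f (X j)) \<partial>PLeb {..<m} ?n) * (\<kappa> * L)"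
    by (rule nn_integral_multc) measurable
  also have "(\<integral>\<^sup>+X. (\<Prod>j<m. f (X j)) \<partial>PLeb {..<m} ?n) = (\<integral>\<^sup>+x. f x \<partial>Leb ?n) ^ m"
    by (subst Leb_prod.product_nn_integral_prod) (auto simp: measurable_Lb_eq)
  also have "(\<integral>\<^sup>+x. f x \<partial>Leb ?n) ^ m * (\<kappa> * L) \<le> (\<integral>\<^sup>+x. f x \<partial>Leb ?n) ^ m * ennreal (M ^ k * 1152 ^ (k * (m + k)))"
  proof (rule mult_left_mono)
    have "\<kappa> * L \<le> ennreal (sqrt ?n ^ (k * m)) * ennreal ((M * (576 / sqrt m) ^ m) ^ k)"
      unfolding L_def \<kappa>_def by (intro mult_right_mono gauss_det_moment_le m) simp
    also have "\<dots> = ennreal (sqrt ?n ^ (k * m) * (M * (576 / sqrt m) ^ m) ^ k)"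
      using M by (intro ennreal_mult[symmetric]) auto
    also have "\<dots> \<le> ennreal (M ^ k * 1152 ^ (k * (m + k)))"
      by (intro ennreal_leI total_constant_le m M)
    finally show "\<kappa> * L \<le> ennreal (M ^ k * 1152 ^ (k * (m + k)))" .
  qed simp
  finally show ?thesis by (simp only: mult.commute)
qed

text \<open>Almost every random subspace meets the null set where f exceeds M in a null set, by the
  previous bound applied to the indicator of that set; so f may be replaced by its minimum with
  M.\<close>

lemma nn_integral_span_integral_le:
  assumes f [measurable]: "f \<in> borel_measurable borel" and fM: "AE x in Leb (m + k). f x \<le> ennreal M" and M: "M > 0"
    and mass: "(\<integral>\<^sup>+x. f x \<partial>Leb (m + k)) \<le> 1" and m: "m \<ge> 1" and k: "k \<ge> 1"
  shows "(\<integral>\<^sup>+W. span_integral m f W ^ (m + k) \<partial>PGauss m (m + k)) \<le> ennreal (M ^ k * 1152 ^ (k * (m + k)))"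
proof -
  let ?n = "m + k"
  define N where "N = {x. \<not> f x \<le> ennreal M}"
  have N: "N = {x \<in> space borel. \<not> f x \<le> ennreal M}" by (simp add: N_def)
  have Nm [measurable]: "N \<in> sets borel" unfolding N by measurable
  define i :: "fin_seq \<Rightarrow> ennreal" where "i = indicator N"
  have im [measurable]: "i \<in> borel_measurable borel" by (simp add: i_def)
  have "(\<integral>\<^sup>+x. i x \<partial>Leb ?n) = (\<integral>\<^sup>+x. 0 \<partial>Leb ?n)"
    using fM by (intro nn_integral_cong_AE) (auto simp: i_def N_def elim!: eventually_mono)
  then have "(\<integral>\<^sup>+W. span_integral m i W ^ ?n \<partial>PGauss m ?n) \<le> 0"
    using nn_integral_span_integral_le_aux[OF im _ zero_less_one m k] m
    by (simp add: i_def indicator_def power_0_left)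
  moreover have sm: "(\<lambda>W. span_integral m i W ^ ?n) \<in> borel_measurable (PGauss m ?n)"
    unfolding measurable_PGauss_eq using borel_measurable_span_integral[OF im, of m] by measurable
  ultimately have "AE W in PGauss m ?n. span_integral m i W ^ ?n = 0"
    by (subst (asm) le_zero_eq, subst (asm) nn_integral_0_iff_AE) auto
  then have ae: "AE W in PGauss m ?n. span_integral m i W = 0"
    using m by (auto elim!: eventually_mono)
  define f' where "f' x = min (f x) (ennreal M)" for x
  have f'm [measurable]: "f' \<in> borel_measurable borel" unfolding f'_def by measurable
  have "(\<integral>\<^sup>+W. span_integral m f W ^ ?n \<partial>PGauss m ?n) = (\<integral>\<^sup>+W. span_integral m f' W ^ ?n \<partial>PGauss m ?n)"
  proof (rule nn_integral_cong_AE)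
    show "AE W in PGauss m ?n. span_integral m f W ^ ?n = span_integral m f' W ^ ?n"
      using ae
    proof eventually_elim
      case (elim W)
      then consider "gs_vol W m = 0" | "(\<integral>\<^sup>+x. i x \<partial>Lb W m) = 0" by (auto simp: span_integral_def)
      then have "span_integral m f W = span_integral m f' W"
      proof cases
        case 2
        then have "AE x in Lb W m. i x = 0"
          by (subst (asm) nn_integral_0_iff_AE) (auto simp: measurable_Lb_eq)
        then have "AE x in Lb W m. f x = f' x"
          by eventually_elim (auto simp: i_def N_def f'_def min_def indicator_def split: if_splits)
        then show ?thesis unfolding span_integral_def by (simp cong: nn_integral_cong_AE)
      qed (simp add: span_integral_def)
      then show ?case by simp
    qed
  qed
  also have "\<dots> \<le> ennreal (M ^ k * 1152 ^ (k * (m + k))) * (\<integral>\<^sup>+x. f' x \<partial>Leb ?n) ^ m"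
    by (rule nn_integral_span_integral_le_aux[OF f'm _ M m k]) (simp add: f'_def)
  also have "\<dots> \<le> ennreal (M ^ k * 1152 ^ (k * (m + k))) * 1 ^ m"
  proof (intro mult_left_mono power_mono)
    have "(\<integral>\<^sup>+x. f' x \<partial>Leb ?n) \<le> (\<integral>\<^sup>+x. f x \<partial>Leb ?n)" by (intro nn_integral_mono) (simp add: f'_def)
    then show "(\<integral>\<^sup>+x. f' x \<partial>Leb ?n) \<le> 1" using mass by simp
  qed auto
  finally show ?thesis by simp
qed

subsection \<open>The Haar measure on the Grassmannian\<close>

lemma orth_proj_eqI:
  assumes "subspace E" "y \<in> E" "\<And>v. v \<in> E \<Longrightarrow> (x - y) \<bullet> v = 0"
  shows "orth_proj E x = y"
  unfolding orth_proj_def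
proof (rule the_equality)
  show "y \<in> E \<and> (\<forall>v\<in>E. orthogonal (x - y) v)" using assms by (simp add: orthogonal_def)
  fix z assume z: "z \<in> E \<and> (\<forall>v\<in>E. orthogonal (x - z) v)"
  then have "y - z \<in> E" using assms by (intro subspace_diff) auto
  then have "(x - z) \<bullet> (y - z) = 0" "(x - y) \<bullet> (y - z) = 0" using z assms by (auto simp: orthogonal_def)
  then have "(y - z) \<bullet> (y - z) = 0" by (simp add: inner_diff_left)
  then show "z = y" by simp
qed

lemma orth_proj_orthonormal:
  assumes b: "orthonormal b k"
  shows "orth_proj (span (b ` {..<k})) x = (\<Sum>i<k. (x \<bullet> b i) *\<^sub>R b i)"
proof (rule orth_proj_eqI)
  fix v assume "v \<in> span (b ` {..<k})"
  then show "(x - (\<Sum>i<k. (x \<bullet> b i) *\<^sub>R b i)) \<bullet> v = 0"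
    by (rule span_orth[rotated, where A="{..<k}" and w=b])
       (simp add: inner_diff_left orthonormal_inner_sum[OF b])
qed (simp_all add: sum_in_span)

lemma grassmannian_basis:
  assumes "E \<in> grassmannian n k"
  obtains b where "orthonormal b n" "span (b ` {..<k}) = E" "span (b ` {..<n}) = Rn n" "k \<le> n"
proof -
  have E: "subspace E" "E \<subseteq> Rn n" "dim E = k" using assms by (auto simp: grassmannian_def)
  obtain b where b: "orthonormal b k" "span (b ` {..<k}) = E" "k \<le> n"
    using ex_orthonormal_subspace[OF E(1,2)] E(3) by metis
  have "b i \<in> Rn n" if "i < k" for i using b(2) E(2) that span_base[of "b i" "b ` {..<k}"] by auto
  then obtain b' where b': "orthonormal b' n" "\<And>i. i < k \<Longrightarrow> b' i = b i" "span (b' ` {..<n}) = Rn n"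
    using ex_orthonormal_extend[OF b(1) _ b(3)] by metis
  have "b' ` {..<k} = b ` {..<k}" using b'(2) by auto
  then show ?thesis using b b' by (intro that[of b']) auto
qed

lemma span_in_grassmannian:
  assumes "orthonormal b n" "k \<le> n" "span (b ` {..<n}) = Rn n"
  shows "span (b ` {..<k}) \<in> grassmannian n k"
proof -
  have "orthonormal b k" using assms by (auto simp: orthonormal_def)
  moreover have "span (b ` {..<k}) \<subseteq> Rn n" using assms by (metis image_mono lessThan_subset_iff span_mono)
  ultimately show ?thesis using dim_orthonormal[of b k] by (simp add: grassmannian_def)
qed

lemma orthonormal_shift: "orthonormal b (k + m) \<Longrightarrow> orthonormal (\<lambda>i. b (k + i)) m"
  by (auto simp: orthonormal_def)

lemma orthonormal_in_Rn: "span (b ` {..<n::nat}) = Rn n \<Longrightarrow> i < n \<Longrightarrow> b i \<in> Rn n"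
  by (metis imageI lessThan_iff span_base)

lemma orthogonal_comp_span:
  assumes b: "orthonormal b (k + m)" "span (b ` {..<k + m}) = Rn (k + m)"
  shows "(span (b ` {..<k}))\<^sup>\<bottom> \<inter> Rn (k + m) = span ((\<lambda>i. b (k + i)) ` {..<m})"
proof
  show "(span (b ` {..<k}))\<^sup>\<bottom> \<inter> Rn (k + m) \<subseteq> span ((\<lambda>i. b (k + i)) ` {..<m})"
  proof
    fix x assume x: "x \<in> (span (b ` {..<k}))\<^sup>\<bottom> \<inter> Rn (k + m)"
    then have z: "x \<bullet> b i = 0" if "i < k" for i
      using that span_base[of "b i" "b ` {..<k}"] by (auto simp: orthogonal_comp_def orthogonal_def inner_commute)
    have "x = (\<Sum>i<k + m. (x \<bullet> b i) *\<^sub>R b i)" using x b by (intro orthonormal_expand) auto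
    also have "\<dots> = (\<Sum>i<k. (x \<bullet> b i) *\<^sub>R b i) + (\<Sum>i<m. (x \<bullet> b (k + i)) *\<^sub>R b (k + i))"
      by (induction m) (simp_all add: add.assoc)
    also have "(\<Sum>i<k. (x \<bullet> b i) *\<^sub>R b i) = 0" using z by simp
    finally have eq: "x = (\<Sum>i<m. (x \<bullet> b (k + i)) *\<^sub>R b (k + i))" by simp
    show "x \<in> span ((\<lambda>i. b (k + i)) ` {..<m})" by (subst eq) (rule sum_in_span)
  qed
  have *: "b (k + i) \<in> (span (b ` {..<k}))\<^sup>\<bottom> \<inter> Rn (k + m)" if "i < m" for i
  proof -
    have "b (k + i) \<bullet> y = 0" if "y \<in> span (b ` {..<k})" for y
      using that by (rule span_orth[rotated, where A="{..<k}" and w=b]) (use b(1) \<open>i < m\<close> in \<open>auto simp: orthonormal_def\<close>)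
    then show ?thesis using orthonormal_in_Rn[OF b(2), of "k + i"] that
      by (auto simp: orthogonal_comp_def orthogonal_def inner_commute)
  qed
  show "span ((\<lambda>i. b (k + i)) ` {..<m}) \<subseteq> (span (b ` {..<k}))\<^sup>\<bottom> \<inter> Rn (k + m)"
    using * by (intro span_minimal subspace_inter subspace_orthogonal_comp) auto
qed

section \<open>Projection matrices and measurability on the Grassmannian\<close>

definition gmat :: "fin_seq set \<Rightarrow> nat \<Rightarrow> nat \<Rightarrow> real" where
  "gmat E i j = coord (orth_proj E (unit_vec j)) i"

text \<open>A polynomial in finitely many matrix entries and coordinates, hence visibly measurable
  in E and x jointly, while \<open>orth_proj\<close> is given by a definite description.\<close>

definition proj_mat :: "nat \<Rightarrow> fin_seq set \<Rightarrow> fin_seq \<Rightarrow> fin_seq" where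
  "proj_mat n E x = (\<Sum>i<n. \<Sum>j<n. (coord x j * gmat E i j) *\<^sub>R unit_vec i)"

lemma linear_orth_proj:
  assumes "E \<in> grassmannian n k"
  shows "linear (orth_proj E)"
proof -
  obtain b where b: "orthonormal b n" "span (b ` {..<k}) = E" "k \<le> n" using grassmannian_basis[OF assms] by metis
  then have "orthonormal b k" by (auto simp: orthonormal_def)
  then have "orth_proj E = (\<lambda>x. \<Sum>i<k. (x \<bullet> b i) *\<^sub>R b i)" using orth_proj_orthonormal b(2) by blast
  then show ?thesis
    by (auto intro!: linearI simp: inner_add_left scaleR_add_left sum.distrib scaleR_sum_right)
qed

lemma orth_proj_in: "E \<in> grassmannian n k \<Longrightarrow> orth_proj E x \<in> E"
proof -
  assume E: "E \<in> grassmannian n k"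
  obtain b where b: "orthonormal b n" "span (b ` {..<k}) = E" "k \<le> n" using grassmannian_basis[OF E] by metis
  then have "orthonormal b k" by (auto simp: orthonormal_def)
  then show "orth_proj E x \<in> E" using orth_proj_orthonormal[of b k x] sum_in_span[of _ b k] b(2) by simp
qed

lemma orth_proj_orth: "E \<in> grassmannian n k \<Longrightarrow> v \<in> E \<Longrightarrow> (x - orth_proj E x) \<bullet> v = 0"
proof -
  assume E: "E \<in> grassmannian n k" and v: "v \<in> E"
  obtain b where b: "orthonormal b n" "span (b ` {..<k}) = E" "k \<le> n" using grassmannian_basis[OF E] by metis
  then have bk: "orthonormal b k" by (auto simp: orthonormal_def)
  have op: "orth_proj E x = (\<Sum>i<k. (x \<bullet> b i) *\<^sub>R b i)" using orth_proj_orthonormal[OF bk] b(2) by simp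
  have v': "v \<in> span (b ` {..<k})" using v b(2) by simp
  show "(x - orth_proj E x) \<bullet> v = 0"
    unfolding op by (rule span_orth[OF _ v']) (simp add: inner_diff_left orthonormal_inner_sum[OF bk])
qed

lemma grassmannian_subspace: "E \<in> grassmannian n k \<Longrightarrow> subspace E"
  by (simp add: grassmannian_def)

lemma grassmannian_subset: "E \<in> grassmannian n k \<Longrightarrow> E \<subseteq> Rn n"
  by (simp add: grassmannian_def)

lemma gmat_eq_0:
  assumes E: "E \<in> grassmannian n k" and "i \<ge> n \<or> j \<ge> n"
  shows "gmat E i j = 0"
  using assms(2)
proof
  assume "i \<ge> n"
  then show ?thesis using orth_proj_in[OF E, of "unit_vec j"] grassmannian_subset[OF E] by (auto simp: gmat_def Rn_def)
next
  assume j: "j \<ge> n"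
  have "orth_proj E (unit_vec j) = 0"
  proof (rule orth_proj_eqI[OF grassmannian_subspace[OF E]])
    show "(unit_vec j - 0) \<bullet> v = 0" if "v \<in> E" for v
      using that grassmannian_subset[OF E] j by (auto simp: Rn_def)
  qed (simp add: subspace_0 grassmannian_subspace[OF E])
  then show ?thesis by (simp add: gmat_def)
qed

lemma proj_mat_eq:
  assumes E: "E \<in> grassmannian n k" and x: "x \<in> Rn n"
  shows "proj_mat n E x = orth_proj E x"
proof -
  have "orth_proj E x \<in> Rn n" using orth_proj_in[OF E] grassmannian_subset[OF E] by blast
  then have "orth_proj E x = (\<Sum>i<n. coord (orth_proj E x) i *\<^sub>R unit_vec i)" by (rule Rn_expand)
  also have "\<dots> = (\<Sum>i<n. (\<Sum>j<n. coord x j * gmat E i j) *\<^sub>R unit_vec i)"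
  proof (intro sum.cong refl arg_cong2[of _ _ _ _ scaleR])
    fix i
    have "orth_proj E x = orth_proj E (\<Sum>j<n. coord x j *\<^sub>R unit_vec j)" using Rn_expand[OF x] by simp
    also have "\<dots> = (\<Sum>j<n. coord x j *\<^sub>R orth_proj E (unit_vec j))"
      using linear_orth_proj[OF E] by (simp add: linear_sum linear_scale)
    finally show "coord (orth_proj E x) i = (\<Sum>j<n. coord x j * gmat E i j)" by (simp add: gmat_def)
  qed
  finally show ?thesis by (simp add: proj_mat_def scaleR_sum_left)
qed

lemma space_grassmannian_borel [simp]: "space (grassmannian_borel n k) = grassmannian n k"
  by (simp add: grassmannian_borel_def)

lemma measurable_gmat [measurable]: "(\<lambda>E. gmat E i j) \<in> borel_measurable (grassmannian_borel n k)"
proof -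
  have 1: "(\<lambda>E i j. gmat E i j) \<in> grassmannian_borel n k \<rightarrow>\<^sub>M (borel :: (nat \<Rightarrow> nat \<Rightarrow> real) measure)"
    unfolding grassmannian_borel_def gmat_def by (rule measurable_vimage_algebra1) simp
  have 2: "(\<lambda>g. g i j) \<in> borel_measurable (borel :: (nat \<Rightarrow> nat \<Rightarrow> real) measure)"
    by (intro borel_measurable_continuous_onI
        continuous_on_compose2[OF continuous_on_product_coordinates[of j] continuous_on_product_coordinates[of i]]) simp
  show ?thesis using measurable_compose[OF 1 2] by simp
qed

text \<open>Only the n by n block has to be checked, since all other entries vanish on the
  Grassmannian.\<close>

lemma measurable_into_grassmannian:
  assumes "\<And>z. z \<in> space M \<Longrightarrow> h z \<in> grassmannian n k"
    and "\<And>i j. i < n \<Longrightarrow> j < n \<Longrightarrow> (\<lambda>z. gmat (h z) i j) \<in> borel_measurable M"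
  shows "h \<in> M \<rightarrow>\<^sub>M grassmannian_borel n k"
  unfolding grassmannian_borel_def
proof (rule measurable_vimage_algebra2)
  show "h \<in> space M \<rightarrow> grassmannian n k" using assms by auto
  have "(\<lambda>z. gmat (h z) i j) \<in> borel_measurable M" for i j
  proof (cases "i < n \<and> j < n")
    case False
    have "(\<lambda>z. 0) \<in> borel_measurable M" by simp
    then show ?thesis
      by (rule measurable_cong[THEN iffD1, rotated]) (use False gmat_eq_0[OF assms(1)] in \<open>auto simp: not_less\<close>)
  qed (use assms in auto)
  then show "(\<lambda>z i j. coord (orth_proj (h z) (unit_vec j)) i) \<in> M \<rightarrow>\<^sub>M borel"
    unfolding gmat_def by (intro measurable_coordinatewise_then_product)
qed

lemma measurable_proj_mat [measurable (raw)]: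
  assumes "h \<in> M \<rightarrow>\<^sub>M grassmannian_borel n k" "x \<in> borel_measurable M"
  shows "(\<lambda>z. proj_mat n (h z) (x z)) \<in> borel_measurable M"
proof -
  have [measurable]: "(\<lambda>z. gmat (h z) i j) \<in> borel_measurable M" for i j
    by (rule measurable_compose[OF assms(1) measurable_gmat])
  note assms(2) [measurable]
  show ?thesis unfolding proj_mat_def by measurable
qed

lemma orthogonal_transformation_borel:
  fixes T :: "fin_seq \<Rightarrow> fin_seq"
  assumes "orthogonal_transformation T"
  shows "T \<in> borel_measurable borel"
proof -
  have T: "linear T" "\<And>x. norm (T x) = norm x"
    using assms by (auto simp: orthogonal_transformation_def norm_eq_sqrt_inner)
  then have "bounded_linear T" by (intro bounded_linear_intro[of T 1]) (auto simp: linear_add linear_scale)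
  then show ?thesis by (intro borel_measurable_continuous_onI) (simp add: linear_continuous_on)
qed

lemma orthogonal_transformation_orthonormal:
  "orthogonal_transformation T \<Longrightarrow> orthonormal b d \<Longrightarrow> orthonormal (\<lambda>i. T (b i)) d"
  by (simp add: orthogonal_transformation_def orthonormal_def)

lemma span_linear_image: "linear T \<Longrightarrow> span ((\<lambda>i. T (b i)) ` A) = T ` span (b ` A)"
  using linear_span_image[of T "b ` A"] by (simp add: image_image)

lemma orthogonal_transformation_grassmannian:
  assumes T: "orthogonal_transformation T" "T ` Rn n = Rn n" and E: "E \<in> grassmannian n k"
  shows "T ` E \<in> grassmannian n k"
proof -
  obtain b where b: "orthonormal b n" "span (b ` {..<k}) = E" "span (b ` {..<n}) = Rn n" "k \<le> n"
    using grassmannian_basis[OF E] by metis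
  have lin: "linear T" using T by (simp add: orthogonal_transformation_def)
  have "span ((\<lambda>i. T (b i)) ` {..<k}) \<in> grassmannian n k"
    using b T orthogonal_transformation_orthonormal[OF T(1) b(1)]
    by (intro span_in_grassmannian) (simp_all add: span_linear_image[OF lin])
  then show ?thesis by (simp add: span_linear_image[OF lin] b)
qed

lemma nn_integral_Leb_orthogonal:
  assumes T: "orthogonal_transformation T" "T ` Rn n = Rn n" and g: "g \<in> borel_measurable borel"
  shows "(\<integral>\<^sup>+x. g (T x) \<partial>Leb n) = (\<integral>\<^sup>+x. g x \<partial>Leb n)"
proof -
  have lin: "linear T" using T by (simp add: orthogonal_transformation_def)
  have "Lb (\<lambda>i. T (unit_vec i)) n = Leb n"
    using T orthogonal_transformation_orthonormal[OF T(1) orthonormal_unit_vec]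
    by (intro Lb_eq_Leb) (simp_all add: span_linear_image[OF lin] span_unit_vec)
  then show ?thesis using nn_integral_Lb_linear[OF lin orthogonal_transformation_borel[OF T(1)] g, of unit_vec n] by simp
qed

text \<open>The Gaussian density depends on the norm only and Lebesgue measure on R^n is invariant,
  so each factor of the product is invariant.\<close>

lemma nn_integral_PGauss_orthogonal:
  assumes T: "orthogonal_transformation T" "T ` Rn n = Rn n" and G: "G \<in> borel_measurable (PiM {..<m} (\<lambda>_. borel))"
  shows "(\<integral>\<^sup>+X. G (\<lambda>i\<in>{..<m}. T (X i)) \<partial>PGauss m n) = (\<integral>\<^sup>+X. G X \<partial>PGauss m n)"
proof -
  have Tm [measurable]: "T \<in> borel_measurable borel" by (rule orthogonal_transformation_borel[OF T(1)])
  have norm: "norm (T x) = norm x" for x using T(1) by (simp add: orthogonal_transformation_def norm_eq_sqrt_inner)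
  interpret g: prob_space "gauss_measure n" by (rule prob_space_gauss_measure)
  have eq: "(\<integral>\<^sup>+x. g (T x) \<partial>gauss_measure n) = 1 * (\<integral>\<^sup>+x. g x \<partial>gauss_measure n)"
    if "g \<in> borel_measurable (gauss_measure n)" for g
  proof -
    have g [measurable]: "g \<in> borel_measurable borel" using that by (simp add: gauss_measure_def measurable_Lb_eq)
    have "(\<integral>\<^sup>+x. g (T x) \<partial>gauss_measure n) = (\<integral>\<^sup>+x. gauss_density n (norm (T x)) * g (T x) \<partial>Leb n)"
      unfolding gauss_measure_def norm by (subst nn_integral_density) (auto simp: measurable_Lb_eq)
    also have "\<dots> = (\<integral>\<^sup>+x. gauss_density n (norm x) * g x \<partial>Leb n)"
      by (rule nn_integral_Leb_orthogonal[OF T]) measurable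
    also have "\<dots> = (\<integral>\<^sup>+x. g x \<partial>gauss_measure n)"
      unfolding gauss_measure_def by (subst nn_integral_density) (auto simp: measurable_Lb_eq)
    finally show ?thesis by simp
  qed
  have "(\<integral>\<^sup>+X. G (\<lambda>i\<in>{..<m}. T (X i)) \<partial>PGauss m n) = 1 ^ card {..<m} * (\<integral>\<^sup>+X. G X \<partial>PGauss m n)"
  proof (rule nn_integral_PiM_map[OF g.sigma_finite_measure_axioms g.sigma_finite_measure_axioms _ _ eq])
    show "T \<in> gauss_measure n \<rightarrow>\<^sub>M gauss_measure n" by measurable
    show "G \<in> borel_measurable (PGauss m n)" using G by (simp add: measurable_PGauss_eq)
  qed auto
  then show ?thesis by simp
qed

section \<open>Random subspaces and their invariance\<close>

text \<open>Frames that are dependent or leave R^(m + k) form a null set under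
  \<open>PGauss m (m + k)\<close>; they are sent to \<open>Rn k\<close> so that the value always
  lies in the Grassmannian.\<close>

definition rand_sub :: "nat \<Rightarrow> nat \<Rightarrow> (nat \<Rightarrow> fin_seq) \<Rightarrow> fin_seq set" where
  "rand_sub m k W = (if gs_vol W m \<noteq> 0 \<and> (\<forall>i<m. W i \<in> Rn (m + k))
     then {x \<in> Rn (m + k). \<forall>i<m. x \<bullet> W i = 0} else Rn k)"

lemma Rn_in_grassmannian: "k \<le> n \<Longrightarrow> Rn k \<in> grassmannian n k"
  using span_in_grassmannian[OF orthonormal_unit_vec, of k n] by (simp add: span_unit_vec)

text \<open>Orthonormalise W, extend to the whole space and move the k new vectors to the front, so
  that the random subspace occupies the first k places and the span of W the last m.\<close>

lemma rand_sub_basis: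
  assumes "gs_vol W m \<noteq> 0" "\<And>i. i < m \<Longrightarrow> W i \<in> Rn (m + k)"
  obtains b where "orthonormal b (k + m)" "span (b ` {..<k + m}) = Rn (k + m)" "span (b ` {..<k}) = rand_sub m k W"
    "span ((\<lambda>i. b (k + i)) ` {..<m}) = span (W ` {..<m})"
proof -
  note gs = orthonormal_gs[OF assms(1)]
  have "span (gs W ` {..<m}) \<subseteq> Rn (m + k)" unfolding gs(2) using assms by (intro span_minimal) auto
  then have gR: "gs W i \<in> Rn (m + k)" if "i < m" for i using that span_base[of "gs W i" "gs W ` {..<m}"] by auto
  obtain b' where b': "orthonormal b' (m + k)" "\<And>i. i < m \<Longrightarrow> b' i = gs W i" "span (b' ` {..<m + k}) = Rn (m + k)"
    using ex_orthonormal_extend[OF gs(1) gR] by auto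
  have b'm: "b' ` {..<m} = gs W ` {..<m}" using b'(2) by auto
  have "rand_sub m k W = (span (b' ` {..<m}))\<^sup>\<bottom> \<inter> Rn (m + k)"
  proof -
    have "(\<forall>i<m. x \<bullet> W i = 0) \<longleftrightarrow> (\<forall>y\<in>span (W ` {..<m}). orthogonal y x)" for x
    proof
      assume "\<forall>i<m. x \<bullet> W i = 0"
      then show "\<forall>y\<in>span (W ` {..<m}). orthogonal y x"
        using span_orth[where A="{..<m}" and w=W and x=x] by (auto simp: orthogonal_def inner_commute)
    next
      assume *: "\<forall>y\<in>span (W ` {..<m}). orthogonal y x"
      have "x \<bullet> W i = 0" if "i < m" for i
      proof -
        have "W i \<in> span (W ` {..<m})" using that by (intro span_base) auto
        with * have "orthogonal (W i) x" ..
        then show ?thesis by (simp add: orthogonal_def inner_commute)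
      qed
      then show "\<forall>i<m. x \<bullet> W i = 0" by blast
    qed
    then show ?thesis using assms unfolding b'm gs(2) by (auto simp: rand_sub_def orthogonal_comp_def)
  qed
  also have "\<dots> = span ((\<lambda>i. b' (m + i)) ` {..<k})" by (rule orthogonal_comp_span[OF b'(1,3)])
  finally have rs: "rand_sub m k W = span ((\<lambda>i. b' (m + i)) ` {..<k})" .
  define b where "b i = (if i < k then b' (m + i) else b' (i - k))" for i
  have "orthonormal b (k + m)" using b'(1) by (auto simp: orthonormal_def b_def)
  moreover have "b ` {..<k} = (\<lambda>i. b' (m + i)) ` {..<k}" by (auto simp: b_def)
  moreover have "(\<lambda>i. b (k + i)) ` {..<m} = b' ` {..<m}" by (auto simp: b_def)
  moreover have "b ` {..<k + m} = b' ` {..<m + k}"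
  proof
    show "b ` {..<k + m} \<subseteq> b' ` {..<m + k}" by (auto simp: b_def)
    show "b' ` {..<m + k} \<subseteq> b ` {..<k + m}"
    proof
      fix x assume "x \<in> b' ` {..<m + k}"
      then obtain i where i: "i < m + k" "x = b' i" by auto
      then have "x = b (if i < m then k + i else i - m)" "(if i < m then k + i else i - m) < k + m" by (auto simp: b_def)
      then show "x \<in> b ` {..<k + m}" by blast
    qed
  qed
  ultimately show ?thesis using b'(3) rs b'm gs(2) by (intro that[of b]) (auto simp: add.commute)
qed

lemma rand_sub_in_grassmannian: "rand_sub m k W \<in> grassmannian (m + k) k"
proof (cases "gs_vol W m \<noteq> 0 \<and> (\<forall>i<m. W i \<in> Rn (m + k))")
  case True
  then obtain b where "orthonormal b (k + m)" "span (b ` {..<k + m}) = Rn (k + m)" "span (b ` {..<k}) = rand_sub m k W"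
    using rand_sub_basis[of W m k] by metis
  then show ?thesis using span_in_grassmannian[of b "k + m" k] by (simp add: add.commute)
next
  case False
  then show ?thesis using Rn_in_grassmannian[of k "m + k"] by (auto simp: rand_sub_def)
qed

text \<open>Removing from x its part in the span of W leaves a vector of the complement. The
  projection matrix of the random subspace is thus expressed through residuals, which are measurable
  in W.\<close>

lemma orth_proj_rand_sub:
  assumes W: "gs_vol W m \<noteq> 0" "\<And>i. i < m \<Longrightarrow> W i \<in> Rn (m + k)" and x: "x \<in> Rn (m + k)"
  shows "orth_proj (rand_sub m k W) x = res W m x"
proof (rule orth_proj_eqI)
  show "subspace (rand_sub m k W)" using rand_sub_in_grassmannian by (rule grassmannian_subspace)
  have "res W m x \<in> Rn (m + k)" using W x by (intro res_in_subspace) auto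
  then show "res W m x \<in> rand_sub m k W" using W by (auto simp: rand_sub_def res_orth)
  fix v assume "v \<in> rand_sub m k W"
  then have "\<forall>i<m. v \<bullet> W i = 0" using W by (auto simp: rand_sub_def split: if_splits)
  then have "v \<bullet> (x - res W m x) = 0"
    by (intro span_orth[OF _ diff_res_in_span[of x W m]]) auto
  then show "(x - res W m x) \<bullet> v = 0" by (simp add: inner_commute)
qed

lemma measurable_good_frame:
  "Measurable.pred (PiM {..<m} (\<lambda>_. borel)) (\<lambda>W. gs_vol W m \<noteq> 0 \<and> (\<forall>i<m. W i \<in> Rn n))"
proof -
  have [measurable]: "(\<lambda>w. gs_vol w m) \<in> borel_measurable (PiM {..<m} (\<lambda>_. borel :: fin_seq measure))"
    by (rule borel_measurable_gs_vol) simp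
  have "Measurable.pred (PiM {..<m} (\<lambda>_. borel)) (\<lambda>W. \<forall>i\<in>{..<m}. W i \<in> Rn n)" by measurable
  then show ?thesis by simp
qed

lemma AE_good_frame:
  assumes "m \<le> n"
  shows "AE W in PGauss m n. gs_vol W m \<noteq> 0 \<and> (\<forall>i<m. W i \<in> Rn n)"
  using AE_PGauss[OF AE_PLeb_gs_vol[OF assms]] AE_PGauss[OF AE_PLeb_Rn[of "{..<m}" n, simplified]]
  by eventually_elim auto

lemma measurable_rand_sub: "rand_sub m k \<in> PiM {..<m} (\<lambda>_. borel) \<rightarrow>\<^sub>M grassmannian_borel (m + k) k"
proof (rule measurable_into_grassmannian)
  fix i j assume j: "j < m + k"
  note measurable_good_frame [measurable]
  have [measurable]: "(\<lambda>W. res W m (unit_vec j)) \<in> borel_measurable (PiM {..<m} (\<lambda>_. borel :: fin_seq measure))"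
    by (rule borel_measurable_res) simp_all
  have "(\<lambda>W. gmat (rand_sub m k W) i j) = (\<lambda>W. if gs_vol W m \<noteq> 0 \<and> (\<forall>i<m. W i \<in> Rn (m + k))
      then coord (res W m (unit_vec j)) i else gmat (Rn k) i j)"
  proof (rule ext)
    fix W
    show "gmat (rand_sub m k W) i j = (if gs_vol W m \<noteq> 0 \<and> (\<forall>i<m. W i \<in> Rn (m + k))
      then coord (res W m (unit_vec j)) i else gmat (Rn k) i j)"
    proof (cases "gs_vol W m \<noteq> 0 \<and> (\<forall>i<m. W i \<in> Rn (m + k))")
      case True
      then show ?thesis using j by (simp add: gmat_def orth_proj_rand_sub unit_vec_in_Rn)
    next
      case False
      then have "rand_sub m k W = Rn k" by (simp only: rand_sub_def if_False)
      then show ?thesis using False by (simp only: if_False)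
    qed
  qed
  then show "(\<lambda>W. gmat (rand_sub m k W) i j) \<in> borel_measurable (PiM {..<m} (\<lambda>_. borel))" by simp
qed (rule rand_sub_in_grassmannian)

lemma rand_sub_orthogonal:
  assumes T: "orthogonal_transformation T" "T ` Rn (m + k) = Rn (m + k)"
    and W: "gs_vol W m \<noteq> 0 \<and> (\<forall>i<m. W i \<in> Rn (m + k))"
  shows "rand_sub m k (\<lambda>i\<in>{..<m}. T (W i)) = T ` rand_sub m k W"
proof -
  have lin: "linear T" and iso: "\<And>x y. T x \<bullet> T y = x \<bullet> y" using T by (auto simp: orthogonal_transformation_def)
  have "gs_vol (\<lambda>i\<in>{..<m}. T (W i)) m = gs_vol (\<lambda>i. T (W i)) m" by (rule gs_vol_cong) simp
  also have "\<dots> = gs_vol W m" by (rule gs_vol_isometry[OF lin iso])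
  finally have "gs_vol (\<lambda>i\<in>{..<m}. T (W i)) m \<noteq> 0" using W by simp
  moreover have "T (W i) \<in> Rn (m + k)" if "i < m" for i using W T(2) that by blast
  ultimately have "rand_sub m k (\<lambda>i\<in>{..<m}. T (W i)) = {x \<in> Rn (m + k). \<forall>i<m. x \<bullet> T (W i) = 0}"
    by (simp add: rand_sub_def)
  also have "\<dots> = T ` {x \<in> Rn (m + k). \<forall>i<m. x \<bullet> W i = 0}"
  proof
    show "{x \<in> Rn (m + k). \<forall>i<m. x \<bullet> T (W i) = 0} \<subseteq> T ` {x \<in> Rn (m + k). \<forall>i<m. x \<bullet> W i = 0}"
    proof
      fix x assume x: "x \<in> {x \<in> Rn (m + k). \<forall>i<m. x \<bullet> T (W i) = 0}"
      then obtain y where "y \<in> Rn (m + k)" "x = T y" using T(2) by blast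
      then show "x \<in> T ` {x \<in> Rn (m + k). \<forall>i<m. x \<bullet> W i = 0}" using x by (auto simp: iso)
    qed
  qed (use T(2) in \<open>auto simp: iso\<close>)
  finally show ?thesis using W by (simp add: rand_sub_def)
qed

definition gauss_haar :: "nat \<Rightarrow> nat \<Rightarrow> fin_seq set measure" where
  "gauss_haar m k = distr (PGauss m (m + k)) (grassmannian_borel (m + k) k) (rand_sub m k)"

lemma measurable_rand_sub_PGauss: "rand_sub m k \<in> PGauss m (m + k) \<rightarrow>\<^sub>M grassmannian_borel (m + k) k"
  unfolding measurable_PGauss_eq by (rule measurable_rand_sub)

lemma prob_space_gauss_haar: "prob_space (gauss_haar m k)"
  unfolding gauss_haar_def by (intro prob_space.prob_space_distr prob_space_PGauss measurable_rand_sub_PGauss)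

text \<open>If T maps p and q to the unit vectors i and j, the entry (i, j) for the image of E is
  the inner product of p with the projection of q onto E, a measurable function of E.\<close>

lemma measurable_orthogonal_image:
  assumes T: "orthogonal_transformation T" "T ` Rn n = Rn n"
  shows "(\<lambda>E. T ` E) \<in> grassmannian_borel n k \<rightarrow>\<^sub>M grassmannian_borel n k"
proof (rule measurable_into_grassmannian)
  show "T ` E \<in> grassmannian n k" if "E \<in> space (grassmannian_borel n k)" for E
    using that by (intro orthogonal_transformation_grassmannian[OF T]) simp
  fix i j assume ij: "i < n" "j < n"
  have iso: "\<And>x y. T x \<bullet> T y = x \<bullet> y" and lin: "linear T" using T by (auto simp: orthogonal_transformation_def)
  have "unit_vec i \<in> T ` Rn n" "unit_vec j \<in> T ` Rn n" using ij T(2) by (auto simp: unit_vec_in_Rn)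
  then obtain p q where p: "p \<in> Rn n" "unit_vec i = T p" and q: "q \<in> Rn n" "unit_vec j = T q" by blast
  have "gmat (T ` E) i j = proj_mat n E q \<bullet> p" if E: "E \<in> grassmannian n k" for E
  proof -
    have "orth_proj (T ` E) (T q) = T (orth_proj E q)"
    proof (rule orth_proj_eqI)
      show "subspace (T ` E)" using orthogonal_transformation_grassmannian[OF T E] by (rule grassmannian_subspace)
      show "T (orth_proj E q) \<in> T ` E" using orth_proj_in[OF E] by blast
      fix v assume "v \<in> T ` E"
      then obtain w where w: "w \<in> E" "v = T w" by blast
      then have "(T q - T (orth_proj E q)) \<bullet> v = (q - orth_proj E q) \<bullet> w"
        using iso lin by (simp add: linear_diff[symmetric])
      then show "(T q - T (orth_proj E q)) \<bullet> v = 0" using orth_proj_orth[OF E w(1)] by simp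
    qed
    then have "gmat (T ` E) i j = T (orth_proj E q) \<bullet> T p"
      unfolding gmat_def q(2) inner_unit_vec(2)[symmetric] p(2) by simp
    then show ?thesis using proj_mat_eq[OF E q(1)] iso by simp
  qed
  moreover have "(\<lambda>E. proj_mat n E q \<bullet> p) \<in> borel_measurable (grassmannian_borel n k)"
    using measurable_proj_mat[of "\<lambda>E. E" "grassmannian_borel n k" n k "\<lambda>_. q"] by simp
  ultimately show "(\<lambda>E. gmat (T ` E) i j) \<in> borel_measurable (grassmannian_borel n k)"
    by (subst measurable_cong) auto
qed

text \<open>Rotating the frame rotates its complement, except on the null set of bad frames, and the
  Gaussian law of the frame is invariant under T.\<close>

lemma gauss_haar_invariant:
  assumes T: "orthogonal_transformation T" "T ` Rn (m + k) = Rn (m + k)"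
  shows "distr (gauss_haar m k) (gauss_haar m k) (\<lambda>E. T ` E) = gauss_haar m k"
proof (rule measure_eqI)
  let ?G = "grassmannian_borel (m + k) k"
  fix A assume "A \<in> sets (distr (gauss_haar m k) (gauss_haar m k) (\<lambda>E. T ` E))"
  then have A [measurable]: "A \<in> sets ?G" by (simp add: gauss_haar_def)
  note Tm [measurable] = measurable_orthogonal_image[OF T, of k]
  note Rm [measurable] = measurable_rand_sub_PGauss[of m k]
  have "emeasure (distr (gauss_haar m k) (gauss_haar m k) (\<lambda>E. T ` E)) A
      = (\<integral>\<^sup>+E. indicator A E \<partial>distr (gauss_haar m k) ?G (\<lambda>E. T ` E))"
    by (subst nn_integral_indicator) (auto simp: gauss_haar_def cong: distr_cong)
  also have "\<dots> = (\<integral>\<^sup>+E. indicator A (T ` E) \<partial>gauss_haar m k)"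
    by (rule nn_integral_distr) (auto simp: gauss_haar_def)
  also have "\<dots> = (\<integral>\<^sup>+W. indicator A (T ` rand_sub m k W) \<partial>PGauss m (m + k))"
    unfolding gauss_haar_def by (rule nn_integral_distr) auto
  also have "\<dots> = (\<integral>\<^sup>+W. indicator A (rand_sub m k (\<lambda>i\<in>{..<m}. T (W i))) \<partial>PGauss m (m + k))"
  proof (rule nn_integral_cong_AE)
    show "AE W in PGauss m (m + k). (indicator A (T ` rand_sub m k W) :: ennreal) = indicator A (rand_sub m k (\<lambda>i\<in>{..<m}. T (W i)))"
      using AE_good_frame[OF le_add1]
    proof eventually_elim
      case (elim W)
      then show ?case using rand_sub_orthogonal[OF T, of W] by simp
    qed
  qed
  also have "\<dots> = (\<integral>\<^sup>+W. indicator A (rand_sub m k W) \<partial>PGauss m (m + k))"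
  proof (rule nn_integral_PGauss_orthogonal[OF T])
    have "indicator A \<in> borel_measurable ?G" by simp
    from measurable_compose[OF measurable_rand_sub this]
    show "(\<lambda>W. indicator A (rand_sub m k W) :: ennreal) \<in> borel_measurable (PiM {..<m} (\<lambda>_. borel))" by simp
  qed
  also have "\<dots> = (\<integral>\<^sup>+E. indicator A E \<partial>gauss_haar m k)"
    unfolding gauss_haar_def by (rule nn_integral_distr[symmetric]) auto
  also have "\<dots> = emeasure (gauss_haar m k) A"
    by (rule nn_integral_indicator) (simp add: gauss_haar_def)
  finally show "emeasure (distr (gauss_haar m k) (gauss_haar m k) (\<lambda>E. T ` E)) A = emeasure (gauss_haar m k) A" .
qed (simp add: gauss_haar_def)

text \<open>The orthogonal transformation that maps an orthonormal basis \<open>b\<close> of \<open>\<real>\<^sup>n\<close> to the standard one.\<close>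

definition basis_change :: "nat \<Rightarrow> (nat \<Rightarrow> fin_seq) \<Rightarrow> fin_seq \<Rightarrow> fin_seq" where
  "basis_change n b x = (\<Sum>j<n. (x \<bullet> b j - coord x j) *\<^sub>R unit_vec j) + x"

lemma coord_basis_change:
  "coord (basis_change n b x) i = (if i < n then x \<bullet> b i else coord x i)"
proof -
  have "coord (\<Sum>j<n. (x \<bullet> b j - coord x j) *\<^sub>R unit_vec j) i = (\<Sum>j<n. if j = i then x \<bullet> b i - coord x i else 0)"
    unfolding coord_sum by (intro sum.cong) (auto simp: coord_unit_vec)
  then show ?thesis by (simp add: basis_change_def)
qed

text \<open>The coordinates from n on are left alone, so the map is orthogonal on the whole ambient
  space, as the definition of the Haar measure demands. On the first n coordinates, preservation of
  the inner product is Parseval for b.\<close>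

lemma basis_change:
  assumes b: "orthonormal b n" "span (b ` {..<n}) = Rn n"
  shows "orthogonal_transformation (basis_change n b)" "basis_change n b ` Rn n = Rn n"
    "\<And>j. j < n \<Longrightarrow> basis_change n b (b j) = unit_vec j"
proof -
  let ?S = "basis_change n b"
  have bR: "b j \<in> Rn n" if "j < n" for j using orthonormal_in_Rn[OF b(2) that] .
  have lin: "linear ?S"
    by (rule linearI) (auto simp: fin_seq_eq_iff coord_basis_change inner_add_left)
  have norm: "?S x \<bullet> ?S y = x \<bullet> y" for x y
  proof -
    obtain N where N: "x \<in> Rn N" using ex_Rn by blast
    define K where "K = max n N"
    have xK: "x \<in> Rn K" using N by (auto simp: Rn_def K_def)
    have SK: "?S x \<in> Rn K" using xK by (auto simp: Rn_def coord_basis_change K_def)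
    have split: "(\<Sum>i<K. h i) = (\<Sum>i<n. h i) + (\<Sum>i\<in>{n..<K}. h i)" for h :: "nat \<Rightarrow> real"
    proof -
      have un: "{..<n} \<union> {n..<K} = {..<K}" by (auto simp: K_def)
      have "(\<Sum>i\<in>{..<n} \<union> {n..<K}. h i) = (\<Sum>i<n. h i) + (\<Sum>i\<in>{n..<K}. h i)"
        by (rule sum.union_disjoint) auto
      then show ?thesis unfolding un .
    qed
    define p where "p z = (\<Sum>i<n. coord z i *\<^sub>R unit_vec i)" for z
    have pR: "p z \<in> Rn n" for z unfolding p_def span_unit_vec[symmetric] by (rule sum_in_span)
    have cp: "coord (p z) i = (if i < n then coord z i else 0)" for z i
    proof -
      have "coord (p z) i = (\<Sum>j<n. if j = i then coord z i else 0)"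
        unfolding p_def coord_sum by (intro sum.cong) (auto simp: coord_unit_vec)
      then show ?thesis by simp
    qed
    have pb: "p z \<bullet> b j = z \<bullet> b j" if "j < n" for z j
      using inner_Rn[OF bR[OF that], of "p z"] inner_Rn[OF bR[OF that], of z] by (simp add: inner_commute cp)
    have "(\<Sum>i<n. (x \<bullet> b i) * (y \<bullet> b i)) = (\<Sum>i<n. (p x \<bullet> b i) * (p y \<bullet> b i))" by (simp add: pb)
    also have "\<dots> = p x \<bullet> (\<Sum>i<n. (p y \<bullet> b i) *\<^sub>R b i)" by (simp add: inner_sum_right mult.commute)
    also have "\<dots> = p x \<bullet> p y" using orthonormal_expand[OF b(1), of "p y"] pR b(2) by simp
    also have "\<dots> = (\<Sum>i<n. coord x i * coord y i)" using inner_Rn[OF pR, of x "p y"] by (simp add: cp)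
    finally have eq: "(\<Sum>i<n. (x \<bullet> b i) * (y \<bullet> b i)) = (\<Sum>i<n. coord x i * coord y i)" .
    have "?S x \<bullet> ?S y = (\<Sum>i<K. coord (?S x) i * coord (?S y) i)" by (rule inner_Rn[OF SK])
    also have "\<dots> = (\<Sum>i<n. (x \<bullet> b i) * (y \<bullet> b i)) + (\<Sum>i\<in>{n..<K}. coord x i * coord y i)"
      unfolding split by (simp add: coord_basis_change)
    also have "\<dots> = (\<Sum>i<K. coord x i * coord y i)" unfolding split eq ..
    also have "\<dots> = x \<bullet> y" by (rule inner_Rn[OF xK, symmetric])
    finally show ?thesis .
  qed
  show T: "orthogonal_transformation ?S" using lin norm by (simp add: orthogonal_transformation_def)
  show bj: "?S (b j) = unit_vec j" if "j < n" for j
    unfolding fin_seq_eq_iff coord_basis_change coord_unit_vec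
    using b(1) bR[OF that] that by (auto simp: orthonormal_def Rn_def)
  have "?S ` Rn n = span ((\<lambda>j. ?S (b j)) ` {..<n})"
    unfolding b(2)[symmetric] by (rule span_linear_image[OF lin, symmetric])
  also have "(\<lambda>j. ?S (b j)) ` {..<n} = unit_vec ` {..<n}" using bj by auto
  finally show "?S ` Rn n = Rn n" by (simp add: span_unit_vec)
qed

lemma gs_isometry:
  assumes "linear T" "\<And>x y. T x \<bullet> T y = x \<bullet> y"
  shows "gs (\<lambda>i. T (w i)) j = T (gs w j)"
  unfolding gs_def using assms by (simp add: res_isometry norm_eq_sqrt_inner linear_scale)

text \<open>
  By invariance, \<open>M\<close> is its own average over the random orthogonal maps obtained from a Gaussian matrix. For each
  fixed \<open>E\<close> the image of \<open>E\<close> under such a map is distributed like that of \<open>\<real>\<^sup>k\<close>.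
\<close>

lemma haar_unique:
  assumes M: "prob_space M" "sets M = sets (grassmannian_borel n k)"
    and inv: "\<And>T. orthogonal_transformation T \<Longrightarrow> T ` Rn n = Rn n \<Longrightarrow> distr M M (\<lambda>E. T ` E) = M"
    and k: "k \<le> n" and A: "A \<in> sets (grassmannian_borel n k)"
  shows "emeasure M A = (\<integral>\<^sup>+X. indicator A (if gs_vol X n \<noteq> 0 \<and> (\<forall>i<n. X i \<in> Rn n) then basis_change n (gs X) ` Rn k else Rn k) \<partial>PGauss n n)"
proof -
  interpret M: prob_space M by (rule M(1))
  interpret P: prob_space "PGauss n n" by (rule prob_space_PGauss)
  let ?G = "grassmannian_borel n k"
  have spM: "space M = grassmannian n k" using sets_eq_imp_space_eq[OF M(2)] by simp
  define good where "good X \<longleftrightarrow> gs_vol X n \<noteq> 0 \<and> (\<forall>i<n. X i \<in> Rn n)" for X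
  have good_basis: "orthonormal (gs X) n" "span (gs X ` {..<n}) = Rn n" if "good X" for X
    using that orthonormal_gs[of X n] gs_vol_neq_0_imp_span[of X n] by (auto simp: good_def)
  \<comment> \<open>E moved by the rotation that takes the orthonormalised Gaussian vectors to the
    standard basis; degenerate X give the default \<open>Rn k\<close>.\<close>
  define U where "U X E = (if good X then basis_change n (gs X) ` E else Rn k)" for X E
  have goodm [measurable]: "Measurable.pred (PGauss n n) good"
    unfolding good_def[abs_def] measurable_PGauss_eq by (rule measurable_good_frame)
  have UG: "U X E \<in> grassmannian n k" if "E \<in> grassmannian n k" for X E
  proof (cases "good X")
    case True
    show ?thesis
      using orthogonal_transformation_grassmannian[OF basis_change(1,2)[OF good_basis[OF True]] that] True
      by (simp add: U_def)
  qed (simp add: U_def Rn_in_grassmannian[OF k])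
  have Um: "(\<lambda>(X, E). U X E) \<in> PGauss n n \<Otimes>\<^sub>M ?G \<rightarrow>\<^sub>M ?G"
  proof (rule measurable_into_grassmannian)
    show "(case z of (X, E) \<Rightarrow> U X E) \<in> grassmannian n k" if "z \<in> space (PGauss n n \<Otimes>\<^sub>M ?G)" for z
      using that UG by (auto simp: space_pair_measure)
    fix i j assume ij: "i < n" "j < n"
    have gsm [measurable]: "(\<lambda>z. gs (fst z) l) \<in> borel_measurable (PGauss n n \<Otimes>\<^sub>M ?G)" if "l < n" for l
    proof (rule borel_measurable_gs)
      fix j assume "j \<le> l"
      then have "(\<lambda>X. X j) \<in> borel_measurable (PGauss n n)"
        unfolding measurable_PGauss_eq using that by (intro measurable_component_singleton) auto
      then show "(\<lambda>z. fst z j) \<in> borel_measurable (PGauss n n \<Otimes>\<^sub>M ?G)" by (rule measurable_compose[OF measurable_fst])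
    qed
    have pm [measurable]: "(\<lambda>z. proj_mat n (snd z) (gs (fst z) j) \<bullet> gs (fst z) i) \<in> borel_measurable (PGauss n n \<Otimes>\<^sub>M ?G)"
      using gsm ij by (intro borel_measurable_inner measurable_proj_mat measurable_snd) auto
    have "gmat (U X E) i j = (if good X then proj_mat n E (gs X j) \<bullet> gs X i else gmat (Rn k) i j)"
      if E: "E \<in> grassmannian n k" for X E
    proof (cases "good X")
      case True
      note bc = basis_change[OF good_basis[OF True]]
      have gR: "gs X j \<in> Rn n" using orthonormal_in_Rn[OF good_basis(2)[OF True] ij(2)] .
      let ?S = "basis_change n (gs X)"
      have iso: "\<And>x y. ?S x \<bullet> ?S y = x \<bullet> y" and lin: "linear ?S" using bc(1) by (auto simp: orthogonal_transformation_def)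
      have "orth_proj (?S ` E) (?S (gs X j)) = ?S (orth_proj E (gs X j))"
      proof (rule orth_proj_eqI)
        show "subspace (?S ` E)" using orthogonal_transformation_grassmannian[OF bc(1,2) E] by (rule grassmannian_subspace)
        show "?S (orth_proj E (gs X j)) \<in> ?S ` E" using orth_proj_in[OF E] by blast
        fix v assume "v \<in> ?S ` E"
        then obtain w where w: "w \<in> E" "v = ?S w" by blast
        then have "(?S (gs X j) - ?S (orth_proj E (gs X j))) \<bullet> v = (gs X j - orth_proj E (gs X j)) \<bullet> w"
          using iso lin by (simp add: linear_diff[symmetric])
        then show "(?S (gs X j) - ?S (orth_proj E (gs X j))) \<bullet> v = 0" using orth_proj_orth[OF E w(1)] by simp
      qed
      then have "gmat (U X E) i j = coord (?S (orth_proj E (gs X j))) i"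
        using bc(3)[OF ij(2)] True by (simp add: gmat_def U_def)
      then show ?thesis using True ij(1) proj_mat_eq[OF E gR] by (simp add: coord_basis_change)
    qed (simp add: U_def)
    then have eq: "gmat (case z of (X, E) \<Rightarrow> U X E) i j = (if good (fst z) then proj_mat n (snd z) (gs (fst z) j) \<bullet> gs (fst z) i else gmat (Rn k) i j)"
      if "z \<in> space (PGauss n n \<Otimes>\<^sub>M ?G)" for z
      using that by (auto simp: space_pair_measure)
    have "Measurable.pred (PGauss n n \<Otimes>\<^sub>M ?G) (\<lambda>z. good (fst z))"
      by (rule measurable_compose[OF measurable_fst goodm])
    then have "(\<lambda>z. if good (fst z) then proj_mat n (snd z) (gs (fst z) j) \<bullet> gs (fst z) i else gmat (Rn k) i j) \<in> borel_measurable (PGauss n n \<Otimes>\<^sub>M ?G)"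
      by measurable
    then show "(\<lambda>z. gmat (case z of (X, E) \<Rightarrow> U X E) i j) \<in> borel_measurable (PGauss n n \<Otimes>\<^sub>M ?G)"
      using eq by (subst measurable_cong) auto
  qed
  have iA: "indicator A \<in> borel_measurable ?G" using A by simp
  have UAm: "(\<lambda>(X, E). indicator A (U X E) :: ennreal) \<in> borel_measurable (PGauss n n \<Otimes>\<^sub>M M)"
  proof -
    have "(\<lambda>z. indicator A (case z of (X, E) \<Rightarrow> U X E) :: ennreal) \<in> borel_measurable (PGauss n n \<Otimes>\<^sub>M ?G)"
      by (rule measurable_compose[OF Um iA])
    moreover have "sets (PGauss n n \<Otimes>\<^sub>M ?G) = sets (PGauss n n \<Otimes>\<^sub>M M)" using M(2) by (intro sets_pair_measure_cong) auto
    ultimately show ?thesis by (simp add: case_prod_beta cong: measurable_cong_sets)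
  qed
  define \<psi> where "\<psi> E = (\<integral>\<^sup>+X. indicator A (U X E) \<partial>PGauss n n)" for E
  \<comment> \<open>The law of \<open>U X E\<close> in X does not depend on E: choose T that maps E
    onto R^k and apply it to all vectors of X, which leaves the Gaussian law unchanged.\<close>
  have \<psi>: "\<psi> E = \<psi> (Rn k)" if E: "E \<in> grassmannian n k" for E
  proof -
    obtain b where b: "orthonormal b n" "span (b ` {..<k}) = E" "span (b ` {..<n}) = Rn n"
      using grassmannian_basis[OF E] by metis
    define T where "T = basis_change n b"
    note T = basis_change[OF b(1,3), folded T_def]
    have lin: "linear T" and iso: "\<And>x y. T x \<bullet> T y = x \<bullet> y" using T(1) by (auto simp: orthogonal_transformation_def)
    have "T ` E = span ((\<lambda>j. T (b j)) ` {..<k})"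
      unfolding b(2)[symmetric] by (rule span_linear_image[OF lin, symmetric])
    also have "(\<lambda>j. T (b j)) ` {..<k} = unit_vec ` {..<k}" using T(3) k by auto
    finally have TE: "T ` E = Rn k" by (simp add: span_unit_vec)
    have m1: "(\<lambda>X. indicator A (U X (Rn k)) :: ennreal) \<in> borel_measurable (PiM {..<n} (\<lambda>_. borel))"
    proof -
      have "Rn k \<in> space M" using Rn_in_grassmannian[OF k] spM by simp
      from measurable_compose[OF measurable_Pair2'[OF this] UAm] show ?thesis
        by (simp add: measurable_PGauss_eq)
    qed
    have "\<psi> (Rn k) = (\<integral>\<^sup>+X. indicator A (U (\<lambda>i\<in>{..<n}. T (X i)) (Rn k)) \<partial>PGauss n n)"
      unfolding \<psi>_def by (rule nn_integral_PGauss_orthogonal[OF T(1,2) m1, symmetric])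
    also have "\<dots> = \<psi> E"
      unfolding \<psi>_def
    proof (rule nn_integral_cong_AE)
      show "AE X in PGauss n n. (indicator A (U (\<lambda>i\<in>{..<n}. T (X i)) (Rn k)) :: ennreal) = indicator A (U X E)"
        using AE_good_frame[OF order_refl]
      proof eventually_elim
        case (elim X)
        then have gX: "good X" by (simp add: good_def)
        have "gs_vol (\<lambda>i\<in>{..<n}. T (X i)) n = gs_vol (\<lambda>i. T (X i)) n" by (rule gs_vol_cong) simp
        then have "gs_vol (\<lambda>i\<in>{..<n}. T (X i)) n = gs_vol X n" using gs_vol_isometry[OF lin iso] by simp
        moreover have "T (X i) \<in> Rn n" if "i < n" for i using elim T(2) that by blast
        ultimately have gT: "good (\<lambda>i\<in>{..<n}. T (X i))" using elim by (simp add: good_def)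
        have gsT: "gs (\<lambda>i\<in>{..<n}. T (X i)) j = T (gs X j)" if "j < n" for j
        proof -
          have "res (\<lambda>i\<in>{..<n}. T (X i)) j y = res (\<lambda>i. T (X i)) j y" for y using that by (intro res_cong) auto
          then have "gs (\<lambda>i\<in>{..<n}. T (X i)) j = gs (\<lambda>i. T (X i)) j" using that by (simp add: gs_def)
          then show ?thesis using gs_isometry[OF lin iso] by simp
        qed
        \<comment> \<open>Orthonormalisation commutes with T, so the coordinates of
          \<open>T x\<close> in the rotated frame are those of x in the original one.\<close>
        have "basis_change n (gs (\<lambda>i\<in>{..<n}. T (X i))) (T x) = basis_change n (gs X) x" if "x \<in> E" for x
        proof -
          have x: "x \<in> Rn n" "T x \<in> Rn n" using that grassmannian_subset[OF E] T(2) by auto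
          show ?thesis
            unfolding fin_seq_eq_iff coord_basis_change using gsT x iso by (auto simp: Rn_def)
        qed
        then have "basis_change n (gs (\<lambda>i\<in>{..<n}. T (X i))) ` (T ` E) = basis_change n (gs X) ` E"
          by (force simp: image_image intro!: image_cong)
        then show ?case using gX gT by (simp add: U_def TE)
      qed
    qed
    finally show ?thesis by simp
  qed
  have inner: "(\<integral>\<^sup>+E. indicator A (U X E) \<partial>M) = emeasure M A" if "good X" for X
  proof -
    note bc = basis_change[OF good_basis[OF that]]
    have m: "(\<lambda>E. basis_change n (gs X) ` E) \<in> M \<rightarrow>\<^sub>M M"
      using measurable_orthogonal_image[OF bc(1,2), of k] M(2) by (simp cong: measurable_cong_sets)
    have "emeasure M A = (\<integral>\<^sup>+E. indicator A E \<partial>distr M M (\<lambda>E. basis_change n (gs X) ` E))"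
      using A M(2) by (simp add: inv[OF bc(1,2)])
    also have "\<dots> = (\<integral>\<^sup>+E. indicator A (basis_change n (gs X) ` E) \<partial>M)"
      using m A M(2) by (intro nn_integral_distr) auto
    finally show ?thesis using that by (simp add: U_def)
  qed
  have "emeasure M A = (\<integral>\<^sup>+X. emeasure M A \<partial>PGauss n n)" using P.emeasure_space_1 by simp
  also have "\<dots> = (\<integral>\<^sup>+X. \<integral>\<^sup>+E. indicator A (U X E) \<partial>M \<partial>PGauss n n)"
  proof (rule nn_integral_cong_AE)
    show "AE X in PGauss n n. emeasure M A = (\<integral>\<^sup>+E. indicator A (U X E) \<partial>M)"
      using AE_good_frame[OF order_refl] by eventually_elim (simp add: inner good_def)
  qed
  also have "\<dots> = (\<integral>\<^sup>+E. \<psi> E \<partial>M)"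
    unfolding \<psi>_def by (rule nn_swap[OF P.sigma_finite_measure_axioms M.sigma_finite_measure_axioms UAm])
  also have "\<dots> = (\<integral>\<^sup>+E. \<psi> (Rn k) \<partial>M)" by (intro nn_integral_cong \<psi>) (simp add: spM)
  also have "\<dots> = \<psi> (Rn k)" using M.emeasure_space_1 by simp
  finally show ?thesis unfolding \<psi>_def U_def good_def .
qed

text \<open>The formula of \<open>haar_unique\<close> does not mention M on its right side, so every
  invariant probability measure coincides with the Gaussian one, which is invariant itself. This
  gives both existence and uniqueness for the definite description.\<close>

lemma grassmannian_haar_eq: "grassmannian_haar (m + k) k = gauss_haar m k"
  unfolding grassmannian_haar_def
proof (rule the_equality)
  have g: "sets (gauss_haar m k) = sets (grassmannian_borel (m + k) k)" by (simp add: gauss_haar_def)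
  show *: "prob_space (gauss_haar m k) \<and> sets (gauss_haar m k) = sets (grassmannian_borel (m + k) k) \<and>
      (\<forall>T. orthogonal_transformation T \<and> T ` Rn (m + k) = Rn (m + k) \<longrightarrow> distr (gauss_haar m k) (gauss_haar m k) (\<lambda>E. T ` E) = gauss_haar m k)"
    using g prob_space_gauss_haar gauss_haar_invariant by blast
  fix M assume M: "prob_space M \<and> sets M = sets (grassmannian_borel (m + k) k) \<and>
      (\<forall>T. orthogonal_transformation T \<and> T ` Rn (m + k) = Rn (m + k) \<longrightarrow> distr M M (\<lambda>E. T ` E) = M)"
  show "M = gauss_haar m k"
  proof (rule measure_eqI)
    show "sets M = sets (gauss_haar m k)" using M g by simp
    fix A assume "A \<in> sets M"
    then have A: "A \<in> sets (grassmannian_borel (m + k) k)" using M by simp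
    show "emeasure M A = emeasure (gauss_haar m k) A"
      using haar_unique[of M "m + k" k A] haar_unique[of "gauss_haar m k" "m + k" k A] M * A by simp
  qed
qed

section \<open>Moments of the marginal density\<close>

text \<open>Stated for the strict superlevel set, so that its complement is the non-strict bound
  that holds on good subspaces and outside the exceptional set.\<close>

lemma markov_strict:
  assumes u [measurable]: "u \<in> borel_measurable H" and le: "(\<integral>\<^sup>+x. u x \<partial>H) \<le> ennreal C" and C: "C > 0" and p: "p > 0"
  shows "emeasure H {x \<in> space H. u x > ennreal (C * p)} \<le> ennreal (1 / p)"
proof -
  let ?S = "{x \<in> space H. u x > ennreal (C * p)}"
  have S [measurable]: "?S \<in> sets H" by measurable
  have "ennreal (C * p) * emeasure H ?S = (\<integral>\<^sup>+x. ennreal (C * p) * indicator ?S x \<partial>H)"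
    by (rule nn_integral_cmult_indicator[symmetric]) simp
  also have "\<dots> \<le> (\<integral>\<^sup>+x. u x \<partial>H)" by (intro nn_integral_mono) (auto simp: indicator_def)
  also have "\<dots> \<le> ennreal C" by (rule le)
  finally have "ennreal (1 / (C * p)) * (ennreal (C * p) * emeasure H ?S) \<le> ennreal (1 / (C * p)) * ennreal C"
    by (rule mult_left_mono) simp
  moreover have "ennreal (1 / (C * p)) * (ennreal (C * p) * emeasure H ?S) = emeasure H ?S"
    using C p by (simp add: mult.assoc[symmetric] ennreal_mult[symmetric])
  moreover have "ennreal (1 / (C * p)) * ennreal C = ennreal (1 / p)"
    using C p by (simp add: ennreal_mult[symmetric])
  ultimately show ?thesis by simp
qed

lemma ennreal_power_le_imp_le:
  assumes le: "x ^ n \<le> ennreal (\<tau> ^ n)" and \<tau>: "\<tau> \<ge> 0" and n: "n > 0"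
  shows "x \<le> ennreal \<tau>"
proof (cases x)
  case (real r)
  then have "r ^ n \<le> \<tau> ^ n" using le \<tau> by (simp add: ennreal_power ennreal_le_iff)
  then have "r \<le> \<tau>" using n \<tau> real by (metis power_mono_iff)
  then show ?thesis using real by (simp add: ennreal_leI)
next
  case top
  then have "x ^ n = \<infinity>" using n by (simp add: power_eq_top_ennreal)
  then show ?thesis using le by (simp add: top_unique)
qed

lemma powr_inverse_power: "(M :: real) > 0 \<Longrightarrow> n > 0 \<Longrightarrow> (M powr (1 / real n)) ^ n = M"
  by (simp add: powr_realpow[symmetric] powr_powr)

text \<open>The codimension m is the parameter and n abbreviates m + k, which avoids truncated
  subtraction. The density takes extended values and is defined on the whole ambient space.\<close>

locale bounded_density =
  fixes m k :: nat and f :: "fin_seq \<Rightarrow> ennreal" and M :: real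
  assumes f_meas [measurable]: "f \<in> borel_measurable borel"
    and f_le: "AE x in Leb (m + k). f x \<le> ennreal M"
    and M_pos: "M > 0"
    and mass: "(\<integral>\<^sup>+x. f x \<partial>Leb (m + k)) = 1"
    and m_ge: "m \<ge> 1" and k_ge: "k \<ge> 1"
begin

abbreviation "n \<equiv> m + k"
abbreviation "Gr \<equiv> grassmannian_borel n k"

text \<open>
  The integral of \<open>f\<close> over \<open>E\<^sup>\<bottom> + z\<close>. Integrating a Gaussian density over \<open>E\<close> at the same time turns it
  into an integral over \<open>\<real>\<^sup>n\<close>, which is visibly measurable in \<open>E\<close>.
\<close>

definition psi :: "fin_seq set \<Rightarrow> fin_seq \<Rightarrow> ennreal" where
  "psi E z = (\<integral>\<^sup>+x. f (x - proj_mat n E x + z) * gauss_density k (norm (proj_mat n E x)) \<partial>Leb n)"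

definition C :: real where "C = M ^ k * 1152 ^ (k * n)"

lemma C_pos: "C > 0"
  using M_pos by (simp add: C_def)

text \<open>Split R^n by Fubini into E and its complement. The projection of x + y is x, so the
  Gaussian factor depends on x alone and integrates to one over E.\<close>

lemma psi_basis:
  assumes b: "orthonormal b (k + m)" "span (b ` {..<k + m}) = Rn n" and E: "span (b ` {..<k}) = E"
  shows "psi E z = (\<integral>\<^sup>+y. f (y + z) \<partial>Lb (\<lambda>i. b (k + i)) m)"
proof -
  let ?c = "\<lambda>i. b (k + i)"
  have bk: "orthonormal b k" using b(1) by (auto simp: orthonormal_def)
  have c: "orthonormal ?c m" by (rule orthonormal_shift[OF b(1)])
  have EG: "E \<in> grassmannian n k"
    using span_in_grassmannian[of b n k] b E by (simp add: add.commute)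
  have pm [measurable]: "proj_mat n E \<in> borel_measurable borel"
    unfolding proj_mat_def by measurable
  have "psi E z = (\<integral>\<^sup>+x. f (x - proj_mat n E x + z) * gauss_density k (norm (proj_mat n E x)) \<partial>Lb b (k + m))"
    using Lb_eq_Leb[of b n] b by (simp add: psi_def add.commute)
  also have "\<dots> = (\<integral>\<^sup>+x. \<integral>\<^sup>+y. f (x + y - proj_mat n E (x + y) + z) * gauss_density k (norm (proj_mat n E (x + y))) \<partial>Lb ?c m \<partial>Lb b k)"
    by (rule nn_integral_Lb_append[OF _ c]) measurable
  also have "\<dots> = (\<integral>\<^sup>+x. \<integral>\<^sup>+y. gauss_density k (norm x) * f (y + z) \<partial>Lb ?c m \<partial>Lb b k)"
  proof (intro nn_integral_Lb_cong[OF bk] nn_integral_Lb_cong[OF c])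
    fix x y assume x: "x \<in> span (b ` {..<k})" and y: "y \<in> span (?c ` {..<m})"
    have y': "y \<in> (span (b ` {..<k}))\<^sup>\<bottom> \<inter> Rn (k + m)"
      using y orthogonal_comp_span[of b k m] b by (simp add: add.commute)
    have xR: "x \<in> Rn n" using x E grassmannian_subset[OF EG] by auto
    have yR: "y \<in> Rn n" using y' by (simp add: add.commute)
    have "orth_proj E (x + y) = x"
    proof (rule orth_proj_eqI[OF grassmannian_subspace[OF EG]])
      fix v assume "v \<in> E"
      then show "(x + y - x) \<bullet> v = 0" using y' E by (auto simp: orthogonal_comp_def orthogonal_def inner_commute)
    qed (use x E in simp)
    then have "proj_mat n E (x + y) = x" using proj_mat_eq[OF EG, of "x + y"] xR yR by (simp add: subspace_add)
    then show "f (x + y - proj_mat n E (x + y) + z) * gauss_density k (norm (proj_mat n E (x + y))) = gauss_density k (norm x) * f (y + z)"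
      by (simp add: mult.commute)
  qed
  also have "\<dots> = (\<integral>\<^sup>+x. gauss_density k (norm x) * (\<integral>\<^sup>+y. f (y + z) \<partial>Lb ?c m) \<partial>Lb b k)"
    by (intro nn_integral_cong nn_integral_cmult) (simp add: measurable_Lb_eq)
  also have "\<dots> = (\<integral>\<^sup>+x. gauss_density k (norm x) \<partial>Lb b k) * (\<integral>\<^sup>+y. f (y + z) \<partial>Lb ?c m)"
    by (rule nn_integral_multc) (simp add: measurable_Lb_eq)
  finally show ?thesis by (simp add: nn_integral_gauss_density[OF bk])
qed

lemma Gr_basis:
  assumes "E \<in> grassmannian n k"
  obtains b where "orthonormal b (k + m)" "span (b ` {..<k + m}) = Rn n" "span (b ` {..<k}) = E"
  using grassmannian_basis[OF assms] by (metis add.commute)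

lemma psi_translate:
  assumes b: "orthonormal b (k + m)" "span (b ` {..<k + m}) = Rn n" "span (b ` {..<k}) = E"
    and v: "v \<in> span ((\<lambda>i. b (k + i)) ` {..<m})"
  shows "psi E (x + v) = psi E x"
proof -
  have "(\<integral>\<^sup>+y. f (y + v + x) \<partial>Lb (\<lambda>i. b (k + i)) m) = (\<integral>\<^sup>+y. f (y + x) \<partial>Lb (\<lambda>i. b (k + i)) m)"
    using v by (intro nn_integral_Lb_translate[where g="\<lambda>y. f (y + x)"]) auto
  then show ?thesis by (simp add: psi_basis[OF b] add_ac)
qed

text \<open>The difference of z and its projection lies in the complement of E, along which
  \<open>psi E\<close> is constant. Events about the density on E can therefore be pulled back to
  R^n.\<close>

lemma psi_proj:
  assumes E: "E \<in> grassmannian n k" and z: "z \<in> Rn n"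
  shows "psi E (proj_mat n E z) = psi E z"
proof -
  obtain b where b: "orthonormal b (k + m)" "span (b ` {..<k + m}) = Rn n" "span (b ` {..<k}) = E"
    using Gr_basis[OF E] by blast
  have p: "proj_mat n E z \<in> E" using proj_mat_eq[OF E z] orth_proj_in[OF E] by simp
  have "z - proj_mat n E z \<in> E\<^sup>\<bottom>"
    using proj_mat_eq[OF E z] orth_proj_orth[OF E, of _ z] by (auto simp: orthogonal_comp_def orthogonal_def inner_commute)
  moreover have "z - proj_mat n E z \<in> Rn n" using p grassmannian_subset[OF E] z by (intro subspace_diff) auto
  ultimately have "z - proj_mat n E z \<in> span ((\<lambda>i. b (k + i)) ` {..<m})"
    using orthogonal_comp_span[of b k m] b by (auto simp: add.commute)
  then have "psi E (proj_mat n E z + (z - proj_mat n E z)) = psi E (proj_mat n E z)" by (rule psi_translate[OF b])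
  then show ?thesis by simp
qed

lemma psi_eq_marginal_density:
  assumes E: "E \<in> grassmannian n k" and z: "z \<in> Rn n" and fg: "\<And>x. x \<in> Rn n \<Longrightarrow> f x = ennreal (g x)"
  shows "marginal_density n g E z = psi E z"
proof -
  obtain b where b: "orthonormal b (k + m)" "span (b ` {..<k + m}) = Rn n" "span (b ` {..<k}) = E"
    using Gr_basis[OF E] by blast
  have F: "E\<^sup>\<bottom> \<inter> Rn n = span ((\<lambda>i. b (k + i)) ` {..<m})"
    using orthogonal_comp_span[of b k m] b by (simp add: add.commute)
  have "marginal_density n g E z = (\<integral>\<^sup>+y. f (y + z) \<partial>lebesgue_on_subspace (E\<^sup>\<bottom> \<inter> Rn n))"
    unfolding marginal_density_def using z by (intro nn_integral_cong) (auto simp: fg subspace_add)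
  also have "\<dots> = (\<integral>\<^sup>+y. f (y + z) \<partial>Lb (\<lambda>i. b (k + i)) m)"
    unfolding F by (intro nn_integral_lebesgue_on_subspace orthonormal_shift b) auto
  finally show ?thesis by (simp add: psi_basis[OF b])
qed

text \<open>Ties the marginal density at z to the span integral of a translate of f, to which the
  moment bound applies.\<close>

lemma psi_rand_sub:
  assumes W: "gs_vol W m \<noteq> 0 \<and> (\<forall>i<m. W i \<in> Rn n)"
  shows "psi (rand_sub m k W) z = span_integral m (\<lambda>x. f (x + z)) W"
proof -
  obtain b where b: "orthonormal b (k + m)" "span (b ` {..<k + m}) = Rn (k + m)" "span (b ` {..<k}) = rand_sub m k W"
    "span ((\<lambda>i. b (k + i)) ` {..<m}) = span (W ` {..<m})"
    using rand_sub_basis[of W m k] W by metis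
  have "psi (rand_sub m k W) z = (\<integral>\<^sup>+y. f (y + z) \<partial>Lb (\<lambda>i. b (k + i)) m)"
    using b by (intro psi_basis) (simp_all add: add.commute)
  also have "Lb (\<lambda>i. b (k + i)) m = Lb (gs W) m"
    using orthonormal_gs[of W m] W b(4) by (intro Lb_unique orthonormal_shift b(1)) auto
  also have "(\<integral>\<^sup>+y. f (y + z) \<partial>Lb (gs W) m) = span_integral m (\<lambda>x. f (x + z)) W"
    using W by (intro span_integral_eq[symmetric]) auto
  finally show ?thesis .
qed

lemma measurable_psi: "(\<lambda>(E, z). psi E z) \<in> borel_measurable (Gr \<Otimes>\<^sub>M borel)"
proof -
  have p: "(\<lambda>w. proj_mat n (fst (fst w)) (snd w)) \<in> borel_measurable ((Gr \<Otimes>\<^sub>M (borel :: fin_seq measure)) \<Otimes>\<^sub>M Leb n)"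
  proof (rule measurable_proj_mat)
    show "(\<lambda>w. fst (fst w)) \<in> (Gr \<Otimes>\<^sub>M (borel :: fin_seq measure)) \<Otimes>\<^sub>M Leb n \<rightarrow>\<^sub>M Gr"
      by (rule measurable_compose[OF measurable_fst measurable_fst])
    show "snd \<in> borel_measurable ((Gr \<Otimes>\<^sub>M (borel :: fin_seq measure)) \<Otimes>\<^sub>M Leb n)"
      using measurable_snd[of "Gr \<Otimes>\<^sub>M (borel :: fin_seq measure)" "Leb n"] by (simp add: measurable_Lb_eq)
  qed
  have x: "snd \<in> borel_measurable ((Gr \<Otimes>\<^sub>M (borel :: fin_seq measure)) \<Otimes>\<^sub>M Leb n)"
    using measurable_snd[of "Gr \<Otimes>\<^sub>M (borel :: fin_seq measure)" "Leb n"] by (simp add: measurable_Lb_eq)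
  have z: "(\<lambda>w. snd (fst w)) \<in> borel_measurable ((Gr \<Otimes>\<^sub>M (borel :: fin_seq measure)) \<Otimes>\<^sub>M Leb n)"
    by (rule measurable_compose[OF measurable_fst measurable_snd])
  have "(\<lambda>w. f (snd w - proj_mat n (fst (fst w)) (snd w) + snd (fst w)) * gauss_density k (norm (proj_mat n (fst (fst w)) (snd w))))
      \<in> borel_measurable ((Gr \<Otimes>\<^sub>M (borel :: fin_seq measure)) \<Otimes>\<^sub>M Leb n)"
    by (intro borel_measurable_times_ennreal measurable_compose[OF _ f_meas] measurable_compose[OF _ borel_measurable_gauss_density]
        borel_measurable_add borel_measurable_diff borel_measurable_norm p x z measurable_compose[OF p borel_measurable_norm])
  then show ?thesis
    unfolding psi_def case_prod_beta
    by (intro sigma_finite_measure.borel_measurable_nn_integral[OF sigma_finite_Leb]) (simp add: case_prod_beta)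
qed

lemma measurable_psi1: "(\<lambda>E. psi E z) \<in> borel_measurable Gr"
  using measurable_compose[OF measurable_Pair2'[of z borel Gr] measurable_psi] by simp

lemma measurable_psi2: "E \<in> grassmannian n k \<Longrightarrow> psi E \<in> borel_measurable borel"
  using measurable_compose[OF measurable_Pair1'[of E Gr borel] measurable_psi] by simp

text \<open>Since \<open>psi E\<close> is constant along the complement of E, this is the n-th
  moment of the marginal density under the marginal itself, that is, the integral over E of its (n +
  1)-st power. Writing it over R^n avoids a measure that varies with E.\<close>

definition Q :: "fin_seq set \<Rightarrow> ennreal" where
  "Q E = (\<integral>\<^sup>+y. f y * psi E y ^ n \<partial>Leb n)"

lemma measurable_fpsi: "(\<lambda>(E, y). f y * psi E y ^ n) \<in> borel_measurable (Gr \<Otimes>\<^sub>M Leb n)"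
proof -
  have "sets (Gr \<Otimes>\<^sub>M Leb n) = sets (Gr \<Otimes>\<^sub>M (borel :: fin_seq measure))" by (intro sets_pair_measure_cong) auto
  moreover have "(\<lambda>w. f (snd w) * psi (fst w) (snd w) ^ n) \<in> borel_measurable (Gr \<Otimes>\<^sub>M (borel :: fin_seq measure))"
    using measurable_psi by (intro borel_measurable_times_ennreal measurable_compose[OF measurable_snd f_meas] borel_measurable_power_ennreal)
      (simp add: case_prod_beta)
  ultimately show ?thesis by (simp add: case_prod_beta cong: measurable_cong_sets)
qed

lemma measurable_Q: "Q \<in> borel_measurable Gr"
  unfolding Q_def by (intro sigma_finite_measure.borel_measurable_nn_integral[OF sigma_finite_Leb] measurable_fpsi)

text \<open>Translates of f by vectors of R^n have the same bound and the same mass, so the moment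
  bound is uniform in z.\<close>

lemma nn_integral_psi_le:
  assumes z: "z \<in> Rn n"
  shows "(\<integral>\<^sup>+E. psi E z ^ n \<partial>gauss_haar m k) \<le> ennreal C"
proof -
  have zs: "z \<in> span (unit_vec ` {..<n})" using z by (simp add: span_unit_vec)
  have m1 [measurable]: "(\<lambda>E. psi E z ^ n) \<in> borel_measurable Gr" using measurable_psi1 by measurable
  have "(\<integral>\<^sup>+E. psi E z ^ n \<partial>gauss_haar m k) = (\<integral>\<^sup>+W. psi (rand_sub m k W) z ^ n \<partial>PGauss m n)"
    unfolding gauss_haar_def by (rule nn_integral_distr[OF measurable_rand_sub_PGauss]) simp
  also have "\<dots> = (\<integral>\<^sup>+W. span_integral m (\<lambda>x. f (x + z)) W ^ n \<partial>PGauss m n)"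
  proof (rule nn_integral_cong_AE)
    show "AE W in PGauss m n. psi (rand_sub m k W) z ^ n = span_integral m (\<lambda>x. f (x + z)) W ^ n"
      using AE_good_frame[OF le_add1] by eventually_elim (simp add: psi_rand_sub)
  qed
  also have "\<dots> \<le> ennreal C"
    unfolding C_def
  proof (rule nn_integral_span_integral_le[OF _ _ M_pos _ m_ge k_ge])
    show "(\<lambda>x. f (x + z)) \<in> borel_measurable borel" by measurable
    define i :: "fin_seq \<Rightarrow> ennreal" where "i x = (if f x \<le> ennreal M then 0 else 1)" for x
    have [measurable]: "i \<in> borel_measurable borel" unfolding i_def by measurable
    have "AE x in Leb n. i x = 0" using f_le by eventually_elim (simp add: i_def)
    then have "(\<integral>\<^sup>+x. i x \<partial>Leb n) = 0" by (subst nn_integral_0_iff_AE) (auto simp: measurable_Lb_eq)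
    then have "(\<integral>\<^sup>+x. i (x + z) \<partial>Leb n) = 0" using nn_integral_Lb_translate[OF _ zs, of i] by simp
    then have "AE x in Leb n. i (x + z) = 0" by (subst (asm) nn_integral_0_iff_AE) (auto simp: measurable_Lb_eq)
    then show "AE x in Leb n. f (x + z) \<le> ennreal M" by eventually_elim (auto simp: i_def split: if_splits)
    show "(\<integral>\<^sup>+x. f (x + z) \<partial>Leb n) \<le> 1" using nn_integral_Lb_translate[OF f_meas zs] mass by simp
  qed
  finally show ?thesis .
qed

text \<open>After exchanging the integrals the inner one is at most C for each fixed y, and f has
  mass one.\<close>

lemma nn_integral_Q_le: "(\<integral>\<^sup>+E. Q E \<partial>gauss_haar m k) \<le> ennreal C"
proof -
  interpret H: prob_space "gauss_haar m k" by (rule prob_space_gauss_haar)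
  have sH: "sets (gauss_haar m k) = sets Gr" by (simp add: gauss_haar_def)
  have meas: "(\<lambda>(E, y). f y * psi E y ^ n) \<in> borel_measurable (gauss_haar m k \<Otimes>\<^sub>M Leb n)"
  proof -
    have "sets (gauss_haar m k \<Otimes>\<^sub>M Leb n) = sets (Gr \<Otimes>\<^sub>M Leb n)" using sH by (intro sets_pair_measure_cong) auto
    then show ?thesis using measurable_fpsi by (simp cong: measurable_cong_sets)
  qed
  have m1: "(\<lambda>E. psi E y ^ n) \<in> borel_measurable (gauss_haar m k)" for y
    using measurable_psi1[of y] sH by (simp cong: measurable_cong_sets)
  have "(\<integral>\<^sup>+E. Q E \<partial>gauss_haar m k) = (\<integral>\<^sup>+y. \<integral>\<^sup>+E. f y * psi E y ^ n \<partial>gauss_haar m k \<partial>Leb n)"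
    unfolding Q_def by (rule nn_swap[OF H.sigma_finite_measure_axioms sigma_finite_Leb meas])
  also have "\<dots> = (\<integral>\<^sup>+y. f y * (\<integral>\<^sup>+E. psi E y ^ n \<partial>gauss_haar m k) \<partial>Leb n)"
    by (intro nn_integral_cong nn_integral_cmult m1)
  also have "\<dots> \<le> (\<integral>\<^sup>+y. f y * ennreal C \<partial>Leb n)"
  proof (rule nn_integral_mono_AE)
    show "AE y in Leb n. f y * (\<integral>\<^sup>+E. psi E y ^ n \<partial>gauss_haar m k) \<le> f y * ennreal C"
      using AE_Leb_Rn by eventually_elim (intro mult_left_mono nn_integral_psi_le, auto)
  qed
  also have "\<dots> = ennreal C" using mass by (subst nn_integral_multc) (auto simp: measurable_Lb_eq)
  finally show ?thesis .
qed

text \<open>For p = s^(kn) each condition fails with probability at most s^(-kn), which accounts for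
  the factor 2 in the theorem. The first condition concerns the origin; the second serves the
  exceptional sets and the small balls.\<close>

definition good_subspaces :: "real \<Rightarrow> fin_seq set set" where
  "good_subspaces p = {E \<in> grassmannian n k. psi E 0 ^ n \<le> ennreal (C * p) \<and> Q E \<le> ennreal (C * p)}"

lemma good_subspaces_sets: "good_subspaces p \<in> sets (gauss_haar m k)"
proof -
  have [measurable]: "(\<lambda>E. psi E 0) \<in> borel_measurable Gr" "Q \<in> borel_measurable Gr"
    by (rule measurable_psi1 measurable_Q)+
  have "{E \<in> space Gr. psi E 0 ^ n \<le> ennreal (C * p) \<and> Q E \<le> ennreal (C * p)} \<in> sets Gr" by measurable
  then show ?thesis by (simp add: good_subspaces_def gauss_haar_def)
qed

lemma measure_good_subspaces:
  assumes p: "p > 0"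
  shows "measure (gauss_haar m k) (good_subspaces p) \<ge> 1 - 2 * (1 / p)"
proof -
  let ?H = "gauss_haar m k"
  interpret H: prob_space ?H by (rule prob_space_gauss_haar)
  have sH: "sets ?H = sets Gr" and spH: "space ?H = grassmannian n k" by (simp_all add: gauss_haar_def)
  have m1 [measurable]: "(\<lambda>E. psi E 0 ^ n) \<in> borel_measurable ?H"
    using measurable_psi1[of 0] sH by (simp cong: measurable_cong_sets)
  have m2 [measurable]: "Q \<in> borel_measurable ?H" using measurable_Q sH by (simp cong: measurable_cong_sets)
  define S1 where "S1 = {E \<in> space ?H. psi E 0 ^ n > ennreal (C * p)}"
  define S2 where "S2 = {E \<in> space ?H. Q E > ennreal (C * p)}"
  have [measurable]: "S1 \<in> sets ?H" "S2 \<in> sets ?H" unfolding S1_def S2_def by measurable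
  have "0 \<in> Rn n" by (simp add: subspace_0)
  then have "emeasure ?H S1 \<le> ennreal (1 / p)" "emeasure ?H S2 \<le> ennreal (1 / p)"
    unfolding S1_def S2_def using nn_integral_psi_le[of 0] nn_integral_Q_le C_pos p by (intro markov_strict; simp)+
  then have le: "measure ?H S1 \<le> 1 / p" "measure ?H S2 \<le> 1 / p"
    using p by (simp_all add: H.emeasure_eq_measure)
  have "space ?H - (S1 \<union> S2) = good_subspaces p"
    unfolding S1_def S2_def good_subspaces_def spH by (auto simp: not_less)
  moreover have "measure ?H (space ?H - (S1 \<union> S2)) = 1 - measure ?H (S1 \<union> S2)"
    by (rule H.prob_compl) measurable
  moreover have "measure ?H (S1 \<union> S2) \<le> measure ?H S1 + measure ?H S2" by (rule measure_Un_le) measurable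
  ultimately show ?thesis using le by simp
qed

abbreviation "\<nu> \<equiv> density (Leb n) f"

lemma nn_integral_nu:
  assumes "g \<in> borel_measurable borel"
  shows "(\<integral>\<^sup>+y. g y \<partial>\<nu>) = (\<integral>\<^sup>+y. f y * g y \<partial>Leb n)"
  using assms by (intro nn_integral_density) (simp_all add: measurable_Lb_eq)

lemma nu_large_psi:
  assumes E: "E \<in> good_subspaces p" and p: "p > 0" and q: "q > 0"
  shows "emeasure \<nu> {y. psi E y ^ n > ennreal (C * p * q)} \<le> ennreal (1 / q)"
proof -
  have EG: "E \<in> grassmannian n k" and QE: "Q E \<le> ennreal (C * p)" using E by (auto simp: good_subspaces_def)
  note measurable_psi2[OF EG, measurable]
  have "(\<integral>\<^sup>+y. psi E y ^ n \<partial>\<nu>) \<le> ennreal (C * p)"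
    using QE by (subst nn_integral_nu) (auto simp: Q_def)
  then have "emeasure \<nu> {y \<in> space \<nu>. psi E y ^ n > ennreal (C * p * q)} \<le> ennreal (1 / q)"
    using C_pos p q by (intro markov_strict) (auto simp: measurable_Lb_eq)
  then show ?thesis by simp
qed

section \<open>Small ball estimates\<close>

text \<open>On the ball around the origin, exp(k / 2) times the Gaussian with variance
  \<open>\<epsilon>\<^sup>2\<close> per coordinate is at least one, and its integral is the stated
  power; translation moves the centre to z.\<close>

lemma ball_volume_le:
  assumes b: "orthonormal b k" and z: "z \<in> span (b ` {..<k})" and \<epsilon>: "\<epsilon> > 0"
  shows "(\<integral>\<^sup>+x. indicator {x. norm (x - z) \<le> \<epsilon> * sqrt k} x \<partial>Lb b k) \<le> ennreal ((sqrt (2 * pi * exp 1) * \<epsilon>) ^ k)"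
proof -
  have "(\<integral>\<^sup>+x. indicator {x. norm (x - z) \<le> \<epsilon> * sqrt k} x \<partial>Lb b k)
      = (\<integral>\<^sup>+x. indicator {x. norm (x - z) \<le> \<epsilon> * sqrt k} (x + z) \<partial>Lb b k)"
    by (rule nn_integral_Lb_translate[symmetric, OF _ z]) measurable
  also have "\<dots> \<le> (\<integral>\<^sup>+x. ennreal (exp (1 / 2) ^ k) * ennreal (exp (- (1 / \<epsilon>\<^sup>2 / 2) * (norm x)\<^sup>2)) \<partial>Lb b k)"
  proof (rule nn_integral_mono)
    fix x :: fin_seq
    show "indicator {x. norm (x - z) \<le> \<epsilon> * sqrt k} (x + z) \<le> ennreal (exp (1 / 2) ^ k) * ennreal (exp (- (1 / \<epsilon>\<^sup>2 / 2) * (norm x)\<^sup>2))"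
    proof (cases "norm x \<le> \<epsilon> * sqrt k")
      case True
      then have "(norm x)\<^sup>2 \<le> (\<epsilon> * sqrt k)\<^sup>2" by (intro power_mono) auto
      then have "(norm x)\<^sup>2 \<le> \<epsilon>\<^sup>2 * real k" by (simp add: power_mult_distrib)
      then have "(norm x)\<^sup>2 / \<epsilon>\<^sup>2 \<le> real k" using \<epsilon> by (simp add: divide_le_eq mult.commute)
      then have "1 \<le> exp (real k * (1 / 2) + - (1 / \<epsilon>\<^sup>2 / 2) * (norm x)\<^sup>2)" by simp
      also have "\<dots> = exp (1 / 2) ^ k * exp (- (1 / \<epsilon>\<^sup>2 / 2) * (norm x)\<^sup>2)"
        unfolding exp_add exp_of_nat_mult ..
      finally have "ennreal 1 \<le> ennreal (exp (1 / 2) ^ k) * ennreal (exp (- (1 / \<epsilon>\<^sup>2 / 2) * (norm x)\<^sup>2))"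
        by (subst ennreal_mult[symmetric]) (auto intro: ennreal_leI simp del: ennreal_1)
      then show ?thesis by (simp add: indicator_def)
    qed simp
  qed
  also have "\<dots> = ennreal (exp (1 / 2) ^ k) * ennreal (sqrt (2 * pi / (1 / \<epsilon>\<^sup>2)) ^ k)"
    using nn_integral_Lb_gaussian[OF b, of "1 / \<epsilon>\<^sup>2"] \<epsilon> by (subst nn_integral_cmult) (auto simp: measurable_Lb_eq)
  also have "\<dots> = ennreal ((exp (1 / 2) * sqrt (2 * pi / (1 / \<epsilon>\<^sup>2))) ^ k)"
    by (subst ennreal_mult[symmetric]) (auto simp: power_mult_distrib)
  also have "exp (1 / 2) * sqrt (2 * pi / (1 / \<epsilon>\<^sup>2)) = sqrt (2 * pi * exp 1) * \<epsilon>"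
  proof -
    have "sqrt (exp (1::real)) = exp (1 / 2)" by (rule real_sqrt_unique) (simp_all add: exp_double[symmetric])
    then show ?thesis using \<epsilon> by (simp add: real_sqrt_mult)
  qed
  finally show ?thesis .
qed

text \<open>Cut at the level \<tau> of the marginal density: where the density is at most \<tau>,
  the ball has mass at most \<tau> times its volume; where it exceeds \<tau>, Markov's inequality
  for its n-th moment applies.\<close>

lemma nu_small_ball_aux:
  assumes E: "E \<in> good_subspaces p" and p: "p > 0" and z: "z \<in> E" and \<epsilon>: "\<epsilon> > 0" and \<tau>: "\<tau> > 0"
  shows "emeasure \<nu> {y. norm (proj_mat n E y - z) \<le> \<epsilon> * sqrt k}
    \<le> ennreal (\<tau> * (sqrt (2 * pi * exp 1) * \<epsilon>) ^ k + C * p / \<tau> ^ n)"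
proof -
  have EG: "E \<in> grassmannian n k" using E by (auto simp: good_subspaces_def)
  note measurable_psi2[OF EG, measurable]
  obtain b where b: "orthonormal b (k + m)" "span (b ` {..<k + m}) = Rn n" "span (b ` {..<k}) = E"
    using Gr_basis[OF EG] by blast
  let ?c = "\<lambda>i. b (k + i)"
  have bk: "orthonormal b k" using b(1) by (auto simp: orthonormal_def)
  have c: "orthonormal ?c m" by (rule orthonormal_shift[OF b(1)])
  have pm [measurable]: "proj_mat n E \<in> borel_measurable borel"
    unfolding proj_mat_def by measurable
  define V where "V = (sqrt (2 * pi * exp 1) * \<epsilon>) ^ k"
  have V: "V \<ge> 0" using \<epsilon> by (simp add: V_def)
  define S where "S = {x. norm (x - z) \<le> \<epsilon> * sqrt k}"
  have [measurable]: "S \<in> sets borel"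
  proof -
    have "S = {x \<in> space borel. norm (x - z) \<le> \<epsilon> * sqrt k}" by (simp add: S_def)
    also have "\<dots> \<in> sets borel" by measurable
    finally show ?thesis .
  qed
  have pS: "proj_mat n E -` S \<in> sets borel" using measurable_sets[OF pm, of S] by simp
  define L where "L = {y. psi E y > ennreal \<tau>}"
  have Lm [measurable]: "L \<in> sets borel"
  proof -
    have "L = {y \<in> space borel. psi E y > ennreal \<tau>}" by (simp add: L_def)
    also have "\<dots> \<in> sets borel" by measurable
    finally show ?thesis .
  qed
  have large: "emeasure \<nu> L \<le> ennreal (C * p / \<tau> ^ n)"
  proof -
    \<comment> \<open>Chosen so that the Markov threshold \<open>C * p * q\<close> is exactly
      \<open>\<tau> ^ n\<close>.\<close>
    define q where "q = \<tau> ^ n / (C * p)"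
    have q: "q > 0" "C * p * q = \<tau> ^ n" "1 / q = C * p / \<tau> ^ n" using C_pos p \<tau> by (auto simp: q_def)
    have "L \<subseteq> {y. psi E y ^ n > ennreal (C * p * q)}"
    proof
      fix y assume "y \<in> L"
      then have "ennreal \<tau> < psi E y" by (simp add: L_def)
      have "\<not> psi E y ^ n \<le> ennreal (\<tau> ^ n)"
      proof
        assume "psi E y ^ n \<le> ennreal (\<tau> ^ n)"
        then have "psi E y \<le> ennreal \<tau>" by (rule ennreal_power_le_imp_le) (use \<tau> m_ge in auto)
        then show False using \<open>ennreal \<tau> < psi E y\<close> by simp
      qed
      then show "y \<in> {y. psi E y ^ n > ennreal (C * p * q)}" by (simp add: q(2) not_le)
    qed
    moreover have "{y. psi E y ^ n > ennreal (C * p * q)} \<in> sets borel"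
    proof -
      have "{y \<in> space borel. psi E y ^ n > ennreal (C * p * q)} \<in> sets borel" by measurable
      then show ?thesis by simp
    qed
    ultimately have "emeasure \<nu> L \<le> emeasure \<nu> {y. psi E y ^ n > ennreal (C * p * q)}"
      by (intro emeasure_mono) simp_all
    then show ?thesis using nu_large_psi[OF E p q(1)] q(3) by simp
  qed
  have small: "emeasure \<nu> (proj_mat n E -` S - L) \<le> ennreal (\<tau> * V)"
  proof -
    have D: "proj_mat n E -` S - L \<in> sets borel" using pS by measurable
    have gm: "(\<lambda>y. f y * indicator (proj_mat n E -` S - L) y) \<in> borel_measurable borel"
      using D by measurable
    have "emeasure \<nu> (proj_mat n E -` S - L) = (\<integral>\<^sup>+y. f y * indicator (proj_mat n E -` S - L) y \<partial>Leb n)"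
      using D by (intro emeasure_density) (simp_all add: measurable_Lb_eq)
    also have "\<dots> = (\<integral>\<^sup>+y. f y * indicator (proj_mat n E -` S - L) y \<partial>Lb b (k + m))"
      using Lb_eq_Leb[of b n] b by (simp add: add.commute)
    also have "\<dots> = (\<integral>\<^sup>+x. \<integral>\<^sup>+y. f (x + y) * indicator (proj_mat n E -` S - L) (x + y) \<partial>Lb ?c m \<partial>Lb b k)"
      by (rule nn_integral_Lb_append[OF gm c])
    also have "\<dots> = (\<integral>\<^sup>+x. indicator (S - L) x * (\<integral>\<^sup>+y. f (y + x) \<partial>Lb ?c m) \<partial>Lb b k)"
    proof (rule nn_integral_Lb_cong[OF bk])
      fix x assume x: "x \<in> span (b ` {..<k})"
      have xR: "x \<in> Rn n" using x b(3) grassmannian_subset[OF EG] by auto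
      have "(\<integral>\<^sup>+y. f (x + y) * indicator (proj_mat n E -` S - L) (x + y) \<partial>Lb ?c m)
          = (\<integral>\<^sup>+y. indicator (S - L) x * f (y + x) \<partial>Lb ?c m)"
      proof (rule nn_integral_Lb_cong[OF c])
        fix y assume y: "y \<in> span (?c ` {..<m})"
        have y': "y \<in> (span (b ` {..<k}))\<^sup>\<bottom> \<inter> Rn (k + m)"
          using y orthogonal_comp_span[of b k m] b by (simp add: add.commute)
        have yR: "y \<in> Rn n" using y' by (simp add: add.commute)
        have "orth_proj E (x + y) = x"
        proof (rule orth_proj_eqI[OF grassmannian_subspace[OF EG]])
          fix v assume "v \<in> E"
          then show "(x + y - x) \<bullet> v = 0" using y' b(3) by (auto simp: orthogonal_comp_def orthogonal_def inner_commute)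
        qed (use x b(3) in simp)
        then have pxy: "proj_mat n E (x + y) = x" using proj_mat_eq[OF EG, of "x + y"] xR yR by (simp add: subspace_add)
        have "psi E (x + y) = psi E x" by (rule psi_translate[OF b y])
        then have "(x + y \<in> proj_mat n E -` S - L) = (x \<in> S - L)" using pxy by (simp add: L_def)
        then show "f (x + y) * indicator (proj_mat n E -` S - L) (x + y) = indicator (S - L) x * f (y + x)"
          by (simp add: indicator_def add.commute)
      qed
      also have "\<dots> = indicator (S - L) x * (\<integral>\<^sup>+y. f (y + x) \<partial>Lb ?c m)"
        by (rule nn_integral_cmult) (simp add: measurable_Lb_eq)
      finally show "(\<integral>\<^sup>+y. f (x + y) * indicator (proj_mat n E -` S - L) (x + y) \<partial>Lb ?c m)
          = indicator (S - L) x * (\<integral>\<^sup>+y. f (y + x) \<partial>Lb ?c m)" .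
    qed
    also have "\<dots> \<le> (\<integral>\<^sup>+x. ennreal \<tau> * indicator S x \<partial>Lb b k)"
      unfolding psi_basis[OF b, symmetric]
      by (intro nn_integral_mono) (auto simp: indicator_def L_def not_less)
    also have "\<dots> = ennreal \<tau> * (\<integral>\<^sup>+x. indicator S x \<partial>Lb b k)"
      by (rule nn_integral_cmult) (simp add: measurable_Lb_eq)
    also have "\<dots> \<le> ennreal \<tau> * ennreal V"
      unfolding S_def V_def using z b(3) by (intro mult_left_mono ball_volume_le[OF bk _ \<epsilon>]) auto
    also have "\<dots> = ennreal (\<tau> * V)" using \<tau> V by (simp add: ennreal_mult)
    finally show ?thesis .
  qed
  have "emeasure \<nu> (proj_mat n E -` S) \<le> emeasure \<nu> ((proj_mat n E -` S - L) \<union> L)"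
    using pS Lm by (intro emeasure_mono) auto
  also have "\<dots> \<le> emeasure \<nu> (proj_mat n E -` S - L) + emeasure \<nu> L"
    using pS Lm by (intro emeasure_subadditive) auto
  also have "\<dots> \<le> ennreal (\<tau> * V) + ennreal (C * p / \<tau> ^ n)" using small large by (rule add_mono)
  also have "\<dots> = ennreal (\<tau> * V + C * p / \<tau> ^ n)" using \<tau> V C_pos p by (intro ennreal_plus[symmetric]) auto
  finally show ?thesis unfolding S_def V_def vimage_def by simp
qed

end

text \<open>The value of \<open>\<tau>\<close> balances the two terms of the small ball estimate.\<close>

lemma balance_powr:
  fixes a v :: real and k n :: nat
  assumes a: "a > 0" and v: "v > 0"
  defines "\<beta> \<equiv> real k * real n / (real n + 1)"
    and "\<tau> \<equiv> a powr (real k * real n / (real n + 1)) * v powr (- real k / (real n + 1))"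
  shows "\<tau> > 0" "k \<ge> 1 \<Longrightarrow> n \<ge> 1 \<Longrightarrow> \<beta> \<ge> 1 / 2" "\<tau> * v ^ k = (a * v) powr \<beta>" "a powr (real (k * n)) / \<tau> ^ n = (a * v) powr \<beta>"
proof -
  show \<tau>: "\<tau> > 0" using a v by (simp add: \<tau>_def)
  have N: "real n + 1 > 0" by simp
  show "\<beta> \<ge> 1 / 2" if "k \<ge> 1" "n \<ge> 1"
  proof -
    have "1 * real n \<le> real k * real n" using that by (intro mult_right_mono) auto
    moreover have "real n \<ge> 1" using that by simp
    ultimately have "1 / 2 * (real n + 1) \<le> real k * real n" by argo
    then show ?thesis using N by (simp only: \<beta>_def pos_le_divide_eq)
  qed
  have "v powr (- real k / (real n + 1)) * v ^ k = v powr (- real k / (real n + 1) + real k)"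
    using v by (simp only: powr_realpow[symmetric] powr_add)
  also have "- real k / (real n + 1) + real k = \<beta>" using N by (simp add: \<beta>_def field_simps)
  finally show "\<tau> * v ^ k = (a * v) powr \<beta>"
    using a v by (simp add: \<tau>_def powr_mult mult.assoc flip: \<beta>_def)
  have "\<tau> ^ n = a powr (\<beta> * real n) * v powr (- real k / (real n + 1) * real n)"
    using a v by (simp add: \<tau>_def \<beta>_def power_mult_distrib powr_power mult.commute)
  also have "- real k / (real n + 1) * real n = - \<beta>" by (simp add: \<beta>_def)
  finally have "a powr (real (k * n)) / \<tau> ^ n = (a powr (real (k * n)) / a powr (\<beta> * real n)) * v powr \<beta>"
    using v by (simp add: powr_minus divide_inverse)
  also have "a powr (real (k * n)) / a powr (\<beta> * real n) = a powr (real (k * n) - \<beta> * real n)"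
    by (rule powr_diff[symmetric])
  also have "real (k * n) - \<beta> * real n = \<beta>" using N by (simp add: \<beta>_def field_simps)
  finally show "a powr (real (k * n)) / \<tau> ^ n = (a * v) powr \<beta>" using a v by (simp add: powr_mult)
qed

context bounded_density
begin

lemma C_power:
  assumes s: "s > 0"
  shows "C * s powr (real (k * n)) = (1152 * s * M powr (1 / real n)) ^ (k * n)"
proof -
  have n: "n > 0" using m_ge by simp
  have "(M powr (1 / real n)) ^ n = M" by (rule powr_inverse_power[OF M_pos n])
  then have "(M powr (1 / real n)) ^ (k * n) = M ^ k" by (metis mult.commute power_mult)
  moreover have "s powr (real (k * n)) = s ^ (k * n)" using s by (rule powr_realpow)
  ultimately show ?thesis by (simp add: C_def power_mult_distrib mult_ac)
qed

text \<open>The kn-th root is taken in two stages: the n-th root in the extended reals, which also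
  yields finiteness, and then the k-th root of a real number.\<close>

lemma psi_bound:
  assumes le: "psi E x ^ n \<le> ennreal (z ^ (k * n))" and z: "z > 0"
  shows "psi E x < \<infinity> \<and> enn2real (psi E x) powr (1 / real k) \<le> z"
proof -
  have n: "n > 0" using m_ge by simp
  have "psi E x ^ n \<le> ennreal ((z ^ k) ^ n)" using le by (simp only: power_mult)
  then have "psi E x \<le> ennreal (z ^ k)" by (rule ennreal_power_le_imp_le[OF _ _ n]) (use z in simp)
  then obtain r where r: "psi E x = ennreal r" "r \<ge> 0" "r \<le> z ^ k"
    using z by (cases "psi E x") (simp_all add: ennreal_le_iff top_unique)
  have "r powr (1 / real k) \<le> (z ^ k) powr (1 / real k)" using r by (intro powr_mono2) auto
  also have "\<dots> = z" using z k_ge by (simp add: powr_realpow[symmetric] powr_powr)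
  finally show ?thesis using r by simp
qed

lemma nu_small_ball:
  assumes E: "E \<in> good_subspaces (s powr (real (k * n)))" and s: "s > 1" and z: "z \<in> E" and \<epsilon>: "\<epsilon> > 0"
  shows "emeasure \<nu> {y. norm (proj_mat n E y - z) \<le> \<epsilon> * sqrt k}
    \<le> ennreal ((4608 * sqrt (2 * pi * exp 1) * s * \<epsilon> * M powr (1 / real n)) powr (real (k * n) / real (n + 1)))"
proof -
  define N where "N = n"
  \<comment> \<open>The two quantities to be balanced: \<open>a ^ (k * N)\<close> is the Markov
    threshold C p for p = s^(kn), and \<open>v ^ k\<close> is the bound for the volume of the
    ball.\<close>
  define a where "a = 1152 * s * M powr (1 / real N)"
  define v where "v = sqrt (2 * pi * exp 1) * \<epsilon>"
  have a: "a > 0" and v: "v > 0" using s M_pos \<epsilon> by (simp_all add: a_def v_def)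
  have "C * s powr (real (k * N)) = a ^ (k * N)"
    unfolding a_def N_def using C_power[of s] s by auto
  then have Cp: "C * s powr (real (k * N)) = a powr (real (k * N))"
    using a by (simp only: powr_realpow)
  define \<beta> where "\<beta> = real k * real N / (real N + 1)"
  define \<tau> where "\<tau> = a powr (real k * real N / (real N + 1)) * v powr (- real k / (real N + 1))"
  note \<tau> = balance_powr[OF a v, of k N, folded \<tau>_def \<beta>_def]
  have "N \<ge> 1" using m_ge by (simp add: N_def)
  then have \<beta>: "\<beta> \<ge> 1 / 2" using \<tau>(2) k_ge by blast
  have "s powr (real (k * N)) > 0" using s by simp
  then have "emeasure \<nu> {y. norm (proj_mat n E y - z) \<le> \<epsilon> * sqrt k}
      \<le> ennreal (\<tau> * v ^ k + C * s powr (real (k * N)) / \<tau> ^ N)"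
    using nu_small_ball_aux[OF E _ z \<epsilon> \<tau>(1)] unfolding N_def v_def by blast
  also have "\<tau> * v ^ k + C * s powr (real (k * N)) / \<tau> ^ N = 2 * (a * v) powr \<beta>"
    unfolding Cp \<tau>(3,4) by (rule mult_2[symmetric])
  \<comment> \<open>The two equal terms give the factor 2 = 4^(1/2), which 4^\<beta> dominates
    because \<beta> is at least 1/2. This brings it inside the power, where 4 times 1152 is
    4608.\<close>
  also have "\<dots> \<le> 4 powr \<beta> * (a * v) powr \<beta>"
  proof (rule mult_right_mono)
    have "(2::real) = 4 powr (1 / 2)" by (simp add: powr_half_sqrt)
    also have "\<dots> \<le> 4 powr \<beta>" using \<beta> by (intro powr_mono) auto
    finally show "2 \<le> (4::real) powr \<beta>" .
  qed simp
  also have "\<dots> = (4 * (a * v)) powr \<beta>" using a v by (simp add: powr_mult)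
  also have "4 * (a * v) = 4608 * sqrt (2 * pi * exp 1) * s * \<epsilon> * M powr (1 / real N)" by (simp add: a_def v_def)
  also have "\<beta> = real (k * N) / real (N + 1)" by (simp add: \<beta>_def add.commute)
  finally show ?thesis unfolding N_def by (simp add: ennreal_leI)
qed

end

section \<open>Transfer to the marginals of the given measure\<close>

text \<open>Excluding the zero measure rules out the essential supremum minus infinity, which the
  conversion to a real number would send to 0.\<close>

lemma AE_abs_le_Linf_norm:
  assumes f: "ess_bounded N f" and N: "\<not> (AE x in N. False)"
  shows "AE x in N. \<bar>f x\<bar> \<le> Linf_norm N f"
proof -
  define e where "e = esssup N (\<lambda>x. ereal \<bar>f x\<bar>)"
  have ae: "AE x in N. ereal \<bar>f x\<bar> \<le> e" unfolding e_def by (rule esssup_AE)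
  have "e \<noteq> \<infinity>" using f by (auto simp: ess_bounded_def e_def)
  moreover have "e \<noteq> - \<infinity>"
  proof
    assume "e = - \<infinity>"
    then have "AE x in N. False" using ae by (auto elim!: eventually_mono)
    then show False using N by simp
  qed
  ultimately have "e = ereal (Linf_norm N f)" by (cases e) (auto simp: Linf_norm_def e_def)
  then show ?thesis using ae by simp
qed

text \<open>With p = s^(kn) and q = t^(kn), the two applications of Markov's inequality lead to the
  threshold C p q = (1152 s t M^(1/n))^(kn) for the n-th power of the marginal density; its kn-th
  root is the pointwise bound.\<close>

lemma marginal_bounds:
  fixes n k :: nat and \<mu> :: "fin_seq measure" and f :: "fin_seq \<Rightarrow> real" and s :: real
  defines "M \<equiv> Linf_norm (lebesgue_on_subspace (Rn n)) f"
  assumes prob: "prob_space \<mu>" and ess: "ess_bounded (lebesgue_on_subspace (Rn n)) f"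
    and nonneg: "\<forall>x\<in>Rn n. 0 \<le> f x" and \<mu>: "\<mu> = density (lebesgue_on_subspace (Rn n)) (\<lambda>x. ennreal (f x))"
    and k: "1 \<le> k" "k \<le> n - 1" and s: "1 < s"
  shows "\<exists>A \<subseteq> grassmannian n k.
          A \<in> sets (grassmannian_haar n k) \<and>
          measure (grassmannian_haar n k) A \<ge> 1 - 2 * s powr (- real (k * n)) \<and>
          (\<forall>E\<in>A. \<forall>t :: real. 1 < t \<longrightarrow>
            (\<exists>B \<subseteq> E. B \<in> sets (marginal \<mu> E) \<and> measure (marginal \<mu> E) B \<le> t powr (- real (k * n)) \<and>
              (\<forall>x \<in> (E - B) \<union> {0}. marginal_density n f E x < \<infinity> \<and>
                enn2real (marginal_density n f E x) powr (1 / real k) \<le> 1152 * s * t * M powr (1 / real n)))) \<and>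
          (\<forall>E\<in>A. \<forall>\<epsilon> :: real. 0 < \<epsilon> \<longrightarrow> (\<forall>z\<in>E.
            measure (marginal \<mu> E) {x\<in>E. norm (x - z) \<le> \<epsilon> * sqrt (real k)}
              \<le> (4608 * sqrt (2 * pi * exp 1) * s * \<epsilon> * M powr (1 / real n)) powr (real (k * n) / real (n + 1))))"
proof -
  define m where "m = n - k"
  have n: "n = m + k" and m: "m \<ge> 1" using k by (auto simp: m_def)
  let ?\<Lambda> = "lebesgue_on_subspace (Rn n)"
  \<comment> \<open>The hypotheses describe f on R^n only; extension by zero makes it a Borel
    function on the ambient space.\<close>
  define f0 where "f0 x = (if x \<in> Rn n then ennreal (f x) else 0)" for x
  have f_meas: "f \<in> borel_measurable (restrict_space borel (Rn n))"
    using ess by (simp add: ess_bounded_def cong: measurable_cong_sets)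
  have "(\<lambda>x. if x \<in> Rn n then f x else 0) \<in> borel_measurable borel"
    using measurable_restrict_space_iff[of "Rn n" borel 0 borel f] f_meas by simp
  then have "(\<lambda>x. ennreal (if x \<in> Rn n then f x else 0)) \<in> borel_measurable borel" by measurable
  moreover have "(\<lambda>x. ennreal (if x \<in> Rn n then f x else 0)) = f0" by (auto simp: f0_def)
  ultimately have f0 [measurable]: "f0 \<in> borel_measurable borel" by simp
  have fm\<Lambda>: "(\<lambda>x. ennreal (f x)) \<in> borel_measurable ?\<Lambda>"
    using ess unfolding ess_bounded_def by (intro measurable_compose[OF _ measurable_ennreal]) auto
  have dens: "emeasure \<mu> S = (\<integral>\<^sup>+x. f0 x * indicator S' x \<partial>Leb n)"
    if "S \<in> sets ?\<Lambda>" "S' \<in> sets borel" "\<And>x. x \<in> Rn n \<Longrightarrow> x \<in> S \<longleftrightarrow> x \<in> S'" for S S'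
  proof -
    note that(2) [measurable]
    have "emeasure \<mu> S = (\<integral>\<^sup>+x. ennreal (f x) * indicator S x \<partial>?\<Lambda>)"
      unfolding \<mu> using that by (intro emeasure_density fm\<Lambda>) auto
    also have "\<dots> = (\<integral>\<^sup>+x. f0 x * indicator S' x \<partial>?\<Lambda>)"
      using that(3) by (intro nn_integral_cong) (auto simp: f0_def indicator_def)
    also have "\<dots> = (\<integral>\<^sup>+x. f0 x * indicator S' x \<partial>Leb n)"
      by (intro nn_integral_lebesgue_Rn) measurable
    finally show ?thesis .
  qed
  have sp\<mu>: "space \<mu> = Rn n" by (simp add: \<mu>)
  have top: "Rn n \<in> sets ?\<Lambda>" using sets.top[of ?\<Lambda>] by simp
  have mass: "(\<integral>\<^sup>+x. f0 x \<partial>Leb n) = 1"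
    using dens[OF top, of UNIV] prob_space.emeasure_space_1[OF prob] by (simp add: sp\<mu>)
  have mass\<Lambda>: "(\<integral>\<^sup>+x. f0 x \<partial>?\<Lambda>) = 1" using nn_integral_lebesgue_Rn[OF f0, of n] mass by simp
  have "\<not> (AE x in ?\<Lambda>. False)"
  proof
    assume "AE x in ?\<Lambda>. False"
    then have "(\<integral>\<^sup>+x. f0 x \<partial>?\<Lambda>) = (\<integral>\<^sup>+x. 0 \<partial>?\<Lambda>)" by (intro nn_integral_cong_AE) (auto elim!: eventually_mono)
    then show False using mass\<Lambda> by simp
  qed
  then have "AE x in ?\<Lambda>. \<bar>f x\<bar> \<le> M" unfolding M_def by (rule AE_abs_le_Linf_norm[OF ess])
  then have le\<Lambda>: "AE x in ?\<Lambda>. f0 x \<le> ennreal M"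
    by eventually_elim (auto simp: f0_def intro!: ennreal_leI)
  \<comment> \<open>Otherwise the density would vanish almost everywhere, against total mass
    one.\<close>
  have M: "M > 0"
  proof (rule ccontr)
    assume "\<not> M > 0"
    then have "ennreal M = 0" by (simp add: ennreal_neg)
    then have "AE x in ?\<Lambda>. f0 x = 0" using le\<Lambda> by simp
    then have "(\<integral>\<^sup>+x. f0 x \<partial>?\<Lambda>) = (\<integral>\<^sup>+x. 0 \<partial>?\<Lambda>)" by (rule nn_integral_cong_AE)
    then show False using mass\<Lambda> by simp
  qed
  have le: "AE x in Leb n. f0 x \<le> ennreal M"
  proof -
    \<comment> \<open>The two measures are compared through integrals of Borel functions on the
      ambient space, so the null set is carried over as the integral of its indicator.\<close>
    define i :: "fin_seq \<Rightarrow> ennreal" where "i x = (if f0 x \<le> ennreal M then 0 else 1)" for x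
    have i [measurable]: "i \<in> borel_measurable borel" unfolding i_def by measurable
    have "AE x in ?\<Lambda>. i x = 0" using le\<Lambda> by eventually_elim (simp add: i_def)
    then have "(\<integral>\<^sup>+x. i x \<partial>?\<Lambda>) = (\<integral>\<^sup>+x. 0 \<partial>?\<Lambda>)" by (rule nn_integral_cong_AE)
    then have "(\<integral>\<^sup>+x. i x \<partial>Leb n) = 0" using nn_integral_lebesgue_Rn[OF i, of n] by simp
    then have "AE x in Leb n. i x = 0" by (subst (asm) nn_integral_0_iff_AE) (auto simp: measurable_Lb_eq)
    then show ?thesis by eventually_elim (auto simp: i_def split: if_splits)
  qed
  interpret bounded_density m k f0 M
    by unfold_locales (fact f0 le[unfolded n] M mass[unfolded n] m k(1))+
  \<comment> \<open>Events of the marginal on E are pulled back to R^n, where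
    \<open>proj_mat\<close> stands in for \<open>orth_proj\<close>.\<close>
  have marg: "emeasure (marginal \<mu> E) {x \<in> E. P x} = emeasure (density (Leb n) f0) {y. P (proj_mat n E y)}"
    "{x \<in> E. P x} \<in> sets (marginal \<mu> E)"
    if E: "E \<in> grassmannian n k" and P: "{x. P x} \<in> sets borel" for E P
  proof -
    have pm: "proj_mat n E \<in> borel_measurable borel" unfolding proj_mat_def by measurable
    have "orth_proj E \<in> borel_measurable (restrict_space borel (Rn n))"
    proof (rule measurable_cong[THEN iffD1])
      show "proj_mat n E \<in> borel_measurable (restrict_space borel (Rn n))" by (rule measurable_restrict_space1[OF pm])
    qed (auto simp: space_restrict_space proj_mat_eq[OF E])
    then have "orth_proj E \<in> borel_measurable \<mu>" by (simp add: \<mu> cong: measurable_cong_sets)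
    then have om: "orth_proj E \<in> \<mu> \<rightarrow>\<^sub>M restrict_space borel E"
      using orth_proj_in[OF E] by (intro measurable_restrict_space2) auto
    have S: "{x \<in> E. P x} \<in> sets (restrict_space borel E)"
      using P by (auto simp: sets_restrict_space intro!: image_eqI[of _ _ "{x. P x}"])
    then show "{x \<in> E. P x} \<in> sets (marginal \<mu> E)" by (simp add: marginal_def)
    have pS: "{y. P (proj_mat n E y)} \<in> sets borel"
      using measurable_sets[OF pm P] by (simp add: vimage_def)
    have "emeasure (marginal \<mu> E) {x \<in> E. P x} = emeasure \<mu> (orth_proj E -` {x \<in> E. P x} \<inter> space \<mu>)"
      unfolding marginal_def by (rule emeasure_distr[OF om S])
    also have "\<dots> = (\<integral>\<^sup>+y. f0 y * indicator {y. P (proj_mat n E y)} y \<partial>Leb n)"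
    proof (rule dens[OF _ pS])
      show "orth_proj E -` {x \<in> E. P x} \<inter> space \<mu> \<in> sets ?\<Lambda>" using measurable_sets[OF om S] by (simp add: \<mu>)
      show "x \<in> orth_proj E -` {x \<in> E. P x} \<inter> space \<mu> \<longleftrightarrow> x \<in> {y. P (proj_mat n E y)}" if "x \<in> Rn n" for x
        using that orth_proj_in[OF E, of x] by (simp add: sp\<mu> proj_mat_eq[OF E that])
    qed
    also have "\<dots> = emeasure (density (Leb n) f0) {y. P (proj_mat n E y)}"
      using pS by (intro emeasure_density[symmetric]) (simp_all add: measurable_Lb_eq)
    finally show "emeasure (marginal \<mu> E) {x \<in> E. P x} = emeasure (density (Leb n) f0) {y. P (proj_mat n E y)}" .
  qed
  have psi: "marginal_density n f E x = psi E x" if "E \<in> grassmannian n k" "x \<in> Rn n" for E x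
    using that psi_eq_marginal_density[of E x f] by (simp add: f0_def n[symmetric])
  define p where "p = s powr (real (k * n))"
  have p: "p \<ge> 1" using s by (simp add: p_def ge_one_powr_ge_zero)
  define A where "A = good_subspaces p"
  have H: "grassmannian_haar n k = gauss_haar m k" unfolding n by (rule grassmannian_haar_eq)
  have AG: "A \<subseteq> grassmannian n k" by (auto simp: A_def good_subspaces_def n[symmetric])
  show ?thesis
  proof (intro exI[of _ A] conjI ballI allI impI)
    show "A \<subseteq> grassmannian n k" by (rule AG)
    show "A \<in> sets (grassmannian_haar n k)" unfolding H A_def by (rule good_subspaces_sets)
    have "1 / p = s powr (- real (k * n))" unfolding p_def powr_minus_divide ..
    then show "1 - 2 * s powr (- real (k * n)) \<le> measure (grassmannian_haar n k) A"
      using measure_good_subspaces[of p] p unfolding H A_def by simp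
  next
    fix E and t :: real assume E: "E \<in> A" and t: "1 < t"
    then have EG: "E \<in> grassmannian n k" using AG by blast
    note psi_meas [measurable] = measurable_psi2[of E, unfolded n[symmetric], OF EG]
    define q where "q = t powr (real (k * n))"
    have q: "q \<ge> 1" using t by (simp add: q_def ge_one_powr_ge_zero)
    define z where "z = 1152 * s * t * M powr (1 / real n)"
    have z: "z > 0" using s t M by (simp add: z_def)
    have zq: "C * p * q = z ^ (k * n)"
    proof -
      have "q = t ^ (k * n)" unfolding q_def using t by (intro powr_realpow) auto
      moreover have "C * p = (1152 * s * M powr (1 / real n)) ^ (k * n)"
        unfolding p_def using C_power[of s] s by (simp only: n[symmetric])
      ultimately show ?thesis by (simp add: z_def power_mult_distrib mult_ac)
    qed
    define B where "B = {x \<in> E. psi E x ^ n > ennreal (C * p * q)}"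
    have Bm: "{x. psi E x ^ n > ennreal (C * p * q)} \<in> sets borel"
    proof -
      have "{x \<in> space borel. psi E x ^ n > ennreal (C * p * q)} \<in> sets borel" by measurable
      then show ?thesis by simp
    qed
    have "emeasure (marginal \<mu> E) B = emeasure (density (Leb n) f0) {y. psi E (proj_mat n E y) ^ n > ennreal (C * p * q)}"
      unfolding B_def by (rule marg(1)[OF EG Bm])
    \<comment> \<open>\<open>psi E\<close> takes the same value at a point of R^n and at its
      projection, so the Markov bound on R^n applies.\<close>
    also have "\<dots> = emeasure (density (Leb n) f0) {y. psi E y ^ n > ennreal (C * p * q)}"
    proof (rule emeasure_eq_AE)
      have "AE y in Leb n. y \<in> Rn n" by (rule AE_Leb_Rn)
      then have "AE y in Leb n. psi E (proj_mat n E y) = psi E y"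
        by eventually_elim (use psi_proj[of E] EG in \<open>simp add: n[symmetric]\<close>)
      then have "AE y in density (Leb n) f0. psi E (proj_mat n E y) = psi E y"
        by (subst AE_density) (auto simp: measurable_Lb_eq elim!: eventually_mono)
      then show "AE y in density (Leb n) f0. (y \<in> {y. psi E (proj_mat n E y) ^ n > ennreal (C * p * q)}) = (y \<in> {y. psi E y ^ n > ennreal (C * p * q)})"
        by eventually_elim simp
      have pm: "proj_mat n E \<in> borel_measurable borel" unfolding proj_mat_def by measurable
      show "{y. psi E (proj_mat n E y) ^ n > ennreal (C * p * q)} \<in> sets (density (Leb n) f0)"
        using measurable_sets[OF pm Bm] by (simp add: vimage_def)
    qed (use Bm in simp)
    also have "\<dots> \<le> ennreal (1 / q)"
      using nu_large_psi[of E p q] E p q by (simp add: A_def n[symmetric])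
    finally have "measure (marginal \<mu> E) B \<le> 1 / q"
      unfolding measure_def using q by (intro enn2real_leI) auto
    moreover have "1 / q = t powr (- real (k * n))" unfolding q_def powr_minus_divide ..
    moreover have "marginal_density n f E x < \<infinity> \<and> enn2real (marginal_density n f E x) powr (1 / real k) \<le> z"
      if x: "x \<in> (E - B) \<union> {0}" for x
    proof -
      have "psi E x ^ n \<le> ennreal (C * p * q)"
      \<comment> \<open>The origin may belong to \<open>B\<close>; there the first condition on good
        subspaces gives the bound, even without the factor q.\<close>
      proof (cases "x = 0")
        case True
        have "psi E 0 ^ n \<le> ennreal (C * p)" using E by (simp add: A_def good_subspaces_def n[symmetric])
        also have "\<dots> \<le> ennreal (C * p * q)"
        proof (rule ennreal_leI)
          have "C * p * 1 \<le> C * p * q" using C_pos p q by (intro mult_left_mono) auto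
          then show "C * p \<le> C * p * q" by simp
        qed
        finally show ?thesis using True by simp
      next
        case False
        then show ?thesis using x by (auto simp: B_def not_less)
      qed
      then have "psi E x ^ n \<le> ennreal (z ^ (k * n))" by (simp only: zq)
      then have "psi E x < \<infinity> \<and> enn2real (psi E x) powr (1 / real k) \<le> z"
        using psi_bound[of E x z, unfolded n[symmetric]] z by blast
      moreover have "x \<in> Rn n" using x grassmannian_subset[OF EG] subspace_0[OF subspace_Rn[of n]] by auto
      ultimately show ?thesis by (simp only: psi[OF EG])
    qed
    ultimately show "\<exists>B\<subseteq>E. B \<in> sets (marginal \<mu> E) \<and> measure (marginal \<mu> E) B \<le> t powr (- real (k * n)) \<and>
        (\<forall>x\<in>E - B \<union> {0}. marginal_density n f E x < \<infinity> \<and>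
          enn2real (marginal_density n f E x) powr (1 / real k) \<le> 1152 * s * t * M powr (1 / real n))"
      unfolding z_def using marg(2)[OF EG Bm] by (intro exI[of _ B]) (auto simp: B_def)
  next
    fix E and \<epsilon> :: real and z assume E: "E \<in> A" and \<epsilon>: "0 < \<epsilon>" and z: "z \<in> E"
    then have EG: "E \<in> grassmannian n k" using AG by blast
    have Pm: "{x. norm (x - z) \<le> \<epsilon> * sqrt (real k)} \<in> sets borel"
    proof -
      have "{x \<in> space borel. norm (x - z) \<le> \<epsilon> * sqrt (real k)} \<in> sets borel" by measurable
      then show ?thesis by simp
    qed
    have "emeasure (marginal \<mu> E) {x \<in> E. norm (x - z) \<le> \<epsilon> * sqrt (real k)}
        = emeasure (density (Leb n) f0) {y. norm (proj_mat n E y - z) \<le> \<epsilon> * sqrt (real k)}"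
      by (rule marg(1)[OF EG Pm])
    also have "\<dots> \<le> ennreal ((4608 * sqrt (2 * pi * exp 1) * s * \<epsilon> * M powr (1 / real n)) powr (real (k * n) / real (n + 1)))"
      using nu_small_ball[of E s z \<epsilon>, unfolded n[symmetric]] E s z \<epsilon> unfolding A_def p_def by blast
    finally show "measure (marginal \<mu> E) {x \<in> E. norm (x - z) \<le> \<epsilon> * sqrt (real k)}
        \<le> (4608 * sqrt (2 * pi * exp 1) * s * \<epsilon> * M powr (1 / real n)) powr (real (k * n) / real (n + 1))"
      unfolding measure_def by (intro enn2real_leI) auto
  qed
qed

theorem theorem6p1:
  shows "\<exists>c1 c2 :: real. 0 < c1 \<and> 0 < c2 \<and>
    (\<forall>(n :: nat) (\<mu> :: fin_seq measure) (f :: fin_seq \<Rightarrow> real).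
      prob_space \<mu> \<and>
      ess_bounded (lebesgue_on_subspace (Rn n)) f \<and>
      (\<forall>x\<in>Rn n. 0 \<le> f x) \<and>
      \<mu> = density (lebesgue_on_subspace (Rn n)) (\<lambda>x. ennreal (f x)) \<longrightarrow>
      (\<forall>(k :: nat) (s :: real). 1 \<le> k \<and> k \<le> n - 1 \<and> 1 < s \<longrightarrow>
        (\<exists>A \<subseteq> grassmannian n k.
          A \<in> sets (grassmannian_haar n k) \<and>
          measure (grassmannian_haar n k) A \<ge> 1 - 2 * s powr (- real (k * n)) \<and>
          (\<forall>E\<in>A. \<forall>t :: real. 1 < t \<longrightarrow>
            (\<exists>B \<subseteq> E.
              B \<in> sets (marginal \<mu> E) \<and>
              measure (marginal \<mu> E) B \<le> t powr (- real (k * n)) \<and>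
              (\<forall>x \<in> (E - B) \<union> {0}.
                marginal_density n f E x < \<infinity> \<and>
                enn2real (marginal_density n f E x) powr (1 / real k)
                  \<le> c1 * s * t * Linf_norm (lebesgue_on_subspace (Rn n)) f powr (1 / real n)))) \<and>
          (\<forall>E\<in>A. \<forall>\<epsilon> :: real. 0 < \<epsilon> \<longrightarrow> (\<forall>z\<in>E.
            measure (marginal \<mu> E) {x\<in>E. norm (x - z) \<le> \<epsilon> * sqrt (real k)}
              \<le> (c2 * s * \<epsilon> * Linf_norm (lebesgue_on_subspace (Rn n)) f powr (1 / real n))
                   powr (real (k * n) / real (n + 1)))))))"
\<comment> \<open>1152 is the base of the moment bound; the second constant also carries the volume
  factor sqrt(2 pi e) of small balls and the 4 from balancing.\<close>
proof (rule exI[of _ 1152], rule exI[of _ "4608 * sqrt (2 * pi * exp 1)"], intro conjI allI impI)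
  fix n :: nat and \<mu> :: "fin_seq measure" and f :: "fin_seq \<Rightarrow> real" and k :: nat and s :: real
  assume \<mu>: "prob_space \<mu> \<and> ess_bounded (lebesgue_on_subspace (Rn n)) f \<and> (\<forall>x\<in>Rn n. 0 \<le> f x) \<and>
      \<mu> = density (lebesgue_on_subspace (Rn n)) (\<lambda>x. ennreal (f x))"
    and k: "1 \<le> k \<and> k \<le> n - 1 \<and> 1 < s"
  show "\<exists>A \<subseteq> grassmannian n k.
          A \<in> sets (grassmannian_haar n k) \<and>
          measure (grassmannian_haar n k) A \<ge> 1 - 2 * s powr (- real (k * n)) \<and>
          (\<forall>E\<in>A. \<forall>t :: real. 1 < t \<longrightarrow>
            (\<exists>B \<subseteq> E.
              B \<in> sets (marginal \<mu> E) \<and>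
              measure (marginal \<mu> E) B \<le> t powr (- real (k * n)) \<and>
              (\<forall>x \<in> (E - B) \<union> {0}.
                marginal_density n f E x < \<infinity> \<and>
                enn2real (marginal_density n f E x) powr (1 / real k)
                  \<le> 1152 * s * t * Linf_norm (lebesgue_on_subspace (Rn n)) f powr (1 / real n)))) \<and>
          (\<forall>E\<in>A. \<forall>\<epsilon> :: real. 0 < \<epsilon> \<longrightarrow> (\<forall>z\<in>E.
            measure (marginal \<mu> E) {x\<in>E. norm (x - z) \<le> \<epsilon> * sqrt (real k)}
              \<le> (4608 * sqrt (2 * pi * exp 1) * s * \<epsilon> *
                  Linf_norm (lebesgue_on_subspace (Rn n)) f powr (1 / real n))
                   powr (real (k * n) / real (n + 1))))"
    by (rule marginal_bounds) (use \<mu> k in blast)+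
qed simp_all

end
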